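(* Let $H$ be a Hopf algebra with bijective antipode over a field $k$, and let $G=\mathrm{Aut}_{Hopf}(H)\times \mathrm{Aut}_{Hopf}(H)$ with multiplication $(\alpha,\beta)*(\gamma,\delta)=(\alpha\gamma,\ \delta\gamma^{-1}\beta\gamma)$. Let $\mathcal{YD}(H)$ be the disjoint union of the categories ${}_H\mathcal{YD}^H(\alpha,\beta)$, $(\alpha,\beta)\in G$, endowed with the tensor product, unit object, functors $\varphi_{(\alpha,\beta)}$ and maps $c_{M,N}$ described in the context. Then $\mathcal{YD}(H)$ is a braided T-category over $G$, with component of index $(\alpha,\beta)$ equal to ${}_H\mathcal{YD}^H(\alpha,\beta)$, group homomorphism $\varphi:(\alpha,\beta)\mapsto\varphi_{(\alpha,\beta)}$ and braiding $\{c_{M,N}\}$.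
   Context: $k$ is a field, $\otimes=\otimes_k$, $H$ is a Hopf algebra over $k$ with bijective antipode $S$; Sweedler notation $\Delta(h)=h_1\otimes h_2$. $\mathrm{Aut}_{Hopf}(H)$ is the group of Hopf algebra automorphisms of $H$. For $\alpha,\beta\in \mathrm{Aut}_{Hopf}(H)$, an $(\alpha,\beta)$-Yetter-Drinfeld module over $H$ is a vector space $M$ that is a left $H$-module ($h\otimes m\mapsto h\cdot m$) and a right $H$-comodule ($m\mapsto m_{(0)}\otimes m_{(1)}\in M\otimes H$) such that for all $h\in H$, $m\in M$: $$(h\cdot m)_{(0)}\otimes (h\cdot m)_{(1)}=h_2\cdot m_{(0)}\otimes \beta(h_3)\,m_{(1)}\,\alpha(S^{-1}(h_1)).$$ ${}_H\mathcal{YD}^H(\alpha,\beta)$ is the category of these, with $H$-linear $H$-colinear maps as morphisms; ${}_H\mathcal{YD}^H={}_H\mathcal{YD}^H(\mathrm{id},\mathrm{id})$. $(G,* )$ is a group with unit $(\mathrm{id},\mathrm{id})$ and $(\alpha,\beta)^{-1}=(\alpha^{-1},\alpha\beta^{-1}\alpha^{-1})$. Structure of $\mathcal{YD}(H)$: - Objects of the disjoint union carry their index $(\alpha,\beta)$; there are no morphisms between different components. - Tensor product: for $M\in{}_H\mathcal{YD}^H(\alpha,\beta)$, $N\in{}_H\mathcal{YD}^H(\gamma,\delta)$, $M\otimes N\in{}_H\mathcal{YD}^H((\alpha,\beta)*(\gamma,\delta))$ is the vector space $M\otimes N$ with $h\cdot(m\otimes n)=\gamma(h_1)\cdot m\otimes\gamma^{-1}\beta\gamma(h_2)\cdot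 n$ and $m\otimes n\mapsto (m_{(0)}\otimes n_{(0)})\otimes n_{(1)}m_{(1)}$; on morphisms it is the tensor product of linear maps. - Unit: $k$ with trivial structures ($h\cdot 1=\varepsilon(h)1$, $1\mapsto 1\otimes 1$), in ${}_H\mathcal{YD}^H$. - For $(\alpha,\beta)\in G$ and $N\in{}_H\mathcal{YD}^H(\gamma,\delta)$, $\varphi_{(\alpha,\beta)}(N)={}^{(\alpha,\beta)}N\in{}_H\mathcal{YD}^H((\alpha,\beta)*(\gamma,\delta)*(\alpha,\beta)^{-1})$ is $N$ as a vector space, with action $h\rightharpoonup n=\gamma^{-1}\beta\gamma\alpha^{-1}(h)\cdot n$ and coaction $n\mapsto n_{(0)}\otimes\alpha\beta^{-1}(n_{(1)})$; $\varphi_{(\alpha,\beta)}$ is the identity on morphisms. - For $M\in{}_H\mathcal{YD}^H(\alpha,\beta)$ and $N\in{}_H\mathcal{YD}^H(\gamma,\delta)$, ${}^MN:={}^{(\alpha,\beta)}N$ and $c_{M,N}:M\otimes N\to{}^MN\otimes M$, $c_{M,N}(m\otimes n)=n_{(0)}\otimes\beta^{-1}(n_{(1)})\cdot m$. Braided T-category (braided crossed group-category) over a group $G$: a (strict, up to the usual identifications of vector spaces) monoidal category $\mathcal T$ that is a disjoint union of subcategories $\mathcal T_a$ ($a\in G$), with $U\otimes V\in\mathcal T_{ab}$ for $U\in\mathcal T_a$, $V\in\mathcal T_b$ and unit object in $\mathcal T_1$; together with a group homomorphism $\varphi:G\to \mathrm{aut}(\mathcal T)$, $a\mapsto\varphi_a$,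 into the group of invertible strict monoidal endofunctors of $\mathcal T$, with $\varphi_b(\mathcal T_a)=\mathcal T_{bab^{-1}}$; and a braiding, i.e. a family of isomorphisms $c_{U,V}:U\otimes V\to{}^UV\otimes U$ (where ${}^UV=\varphi_a(V)$ for $U\in\mathcal T_a$) such that (i) $(\varphi_a(g)\otimes f)\circ c_{U,V}=c_{U',V'}\circ(f\otimes g)$ for all morphisms $f:U\to U'$ in $\mathcal T_a$ and $g:V\to V'$ in $\mathcal T$; (ii) $c_{U\otimes V,W}=(c_{U,{}^VW}\otimes\mathrm{id}_V)\circ(\mathrm{id}_U\otimes c_{V,W})$; (iii) $c_{U,V\otimes W}=(\mathrm{id}_{{}^UV}\otimes c_{U,W})\circ(c_{U,V}\otimes\mathrm{id}_W)$; (iv) $\varphi_b(c_{U,V})=c_{\varphi_b(U),\varphi_b(V)}$ for all $b\in G$. *)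

theory Defs
  imports "HOL-Algebra.Module" "HOL-Algebra.Bij"
begin

section \<open>Tensor products over a field\<close>

text \<open>
  A vector space over \<open>k\<close> is a \<^locale>\<open>module\<close> over the field \<open>k\<close>. Its record inherits the fields
  \<open>mult\<close> and \<open>one\<close> from rings; they carry no information unless the vector space is an algebra.

  The tensor product of \<open>M\<close> and \<open>N\<close> is the free commutative monoid on \<open>carrier M \<times> carrier N\<close>, with
  words written as lists, divided by the congruence that makes the pairing bilinear; scalars are
  absorbed into the left factor.
\<close>

inductive tensor_eq ::
  "('k, 'x) ring_scheme \<Rightarrow> ('k, 'm, 'y) module_scheme \<Rightarrow> ('k, 'n, 'z) module_scheme
    \<Rightarrow> ('m \<times> 'n) list \<Rightarrow> ('m \<times> 'n) list \<Rightarrow> bool"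
  for k M N where
    refl: "xs \<in> lists (carrier M \<times> carrier N) \<Longrightarrow> tensor_eq k M N xs xs"
  | sym: "tensor_eq k M N xs ys \<Longrightarrow> tensor_eq k M N ys xs"
  | trans: "tensor_eq k M N xs ys \<Longrightarrow> tensor_eq k M N ys zs \<Longrightarrow> tensor_eq k M N xs zs"
  | append: "tensor_eq k M N xs xs' \<Longrightarrow> tensor_eq k M N ys ys'
      \<Longrightarrow> tensor_eq k M N (xs @ ys) (xs' @ ys')"
  | swap: "p \<in> carrier M \<times> carrier N \<Longrightarrow> q \<in> carrier M \<times> carrier N
      \<Longrightarrow> tensor_eq k M N [p, q] [q, p]"
  | add_left: "m \<in> carrier M \<Longrightarrow> m' \<in> carrier M \<Longrightarrow> n \<in> carrier N
      \<Longrightarrow> tensor_eq k M N [(m \<oplus>\<^bsub>M\<^esub> m', n)] [(m, n), (m', n)]"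
  | add_right: "m \<in> carrier M \<Longrightarrow> n \<in> carrier N \<Longrightarrow> n' \<in> carrier N
      \<Longrightarrow> tensor_eq k M N [(m, n \<oplus>\<^bsub>N\<^esub> n')] [(m, n), (m, n')]"
  | smult: "c \<in> carrier k \<Longrightarrow> m \<in> carrier M \<Longrightarrow> n \<in> carrier N
      \<Longrightarrow> tensor_eq k M N [(c \<odot>\<^bsub>M\<^esub> m, n)] [(m, c \<odot>\<^bsub>N\<^esub> n)]"
  | zero: "n \<in> carrier N \<Longrightarrow> tensor_eq k M N [(\<zero>\<^bsub>M\<^esub>, n)] []"

type_synonym ('m, 'n) tensor = "('m \<times> 'n) list set"

definition tensor_class ::
  "('k, 'x) ring_scheme \<Rightarrow> ('k, 'm, 'y) module_scheme \<Rightarrow> ('k, 'n, 'z) module_scheme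
    \<Rightarrow> ('m \<times> 'n) list \<Rightarrow> ('m, 'n) tensor" where
  "tensor_class k M N xs = {ys. tensor_eq k M N xs ys}"

text \<open>
  The fields \<open>mult\<close> and \<open>one\<close> below are those of the tensor product of algebras; they are meaningful
  only if \<open>M\<close> and \<open>N\<close> are algebras.
\<close>

definition tensor_module ::
  "('k, 'x) ring_scheme \<Rightarrow> ('k, 'm, 'y) module_scheme \<Rightarrow> ('k, 'n, 'z) module_scheme
    \<Rightarrow> ('k, ('m, 'n) tensor) module" where
  "tensor_module k M N =
    \<lparr>carrier = tensor_class k M N ` lists (carrier M \<times> carrier N),
     mult = \<lambda>X Y. \<Union>xs\<in>X. \<Union>ys\<in>Y.
       tensor_class k M N [(m \<otimes>\<^bsub>M\<^esub> m', n \<otimes>\<^bsub>N\<^esub> n'). (m, n) \<leftarrow> xs, (m', n') \<leftarrow> ys],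
     one = tensor_class k M N [(\<one>\<^bsub>M\<^esub>, \<one>\<^bsub>N\<^esub>)],
     zero = tensor_class k M N [],
     add = \<lambda>X Y. \<Union>xs\<in>X. \<Union>ys\<in>Y. tensor_class k M N (xs @ ys),
     smult = \<lambda>c X. \<Union>xs\<in>X. tensor_class k M N [(c \<odot>\<^bsub>M\<^esub> m, n). (m, n) \<leftarrow> xs]\<rparr>"

definition pure_tensor ::
  "('k, 'x) ring_scheme \<Rightarrow> ('k, 'm, 'y) module_scheme \<Rightarrow> ('k, 'n, 'z) module_scheme
    \<Rightarrow> 'm \<Rightarrow> 'n \<Rightarrow> ('m, 'n) tensor" where
  "pure_tensor k M N m n = tensor_class k M N [(m, n)]"

text \<open>
  The linear map out of a tensor product induced by a bilinear map \<open>f\<close> with values in \<open>P\<close>, applied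
  to \<open>t\<close>. With \<open>t = \<Delta>(h)\<close> or \<open>t\<close> a coaction this is Sweedler notation:
  \<open>tensor_lift P (\<lambda>x y. f x y) (\<Delta> h)\<close> is \<open>f(h\<^sub>1, h\<^sub>2)\<close>, summation understood.
\<close>

definition tensor_lift ::
  "('k, 'p, 'y) module_scheme \<Rightarrow> ('m \<Rightarrow> 'n \<Rightarrow> 'p) \<Rightarrow> ('m, 'n) tensor \<Rightarrow> 'p" where
  "tensor_lift P f t =
    (THE p. \<exists>xs\<in>t. p = foldr (\<lambda>(m, n) s. f m n \<oplus>\<^bsub>P\<^esub> s) xs \<zero>\<^bsub>P\<^esub>)"

definition linear_maps ::
  "('k, 'x) ring_scheme \<Rightarrow> ('k, 'm, 'y) module_scheme \<Rightarrow> ('k, 'n, 'z) module_scheme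
    \<Rightarrow> ('m \<Rightarrow> 'n) set" where
  "linear_maps k M N = {f \<in> carrier M \<rightarrow> carrier N.
    (\<forall>x\<in>carrier M. \<forall>y\<in>carrier M. f (x \<oplus>\<^bsub>M\<^esub> y) = f x \<oplus>\<^bsub>N\<^esub> f y) \<and>
    (\<forall>c\<in>carrier k. \<forall>x\<in>carrier M. f (c \<odot>\<^bsub>M\<^esub> x) = c \<odot>\<^bsub>N\<^esub> f x)}"

text \<open>
  \<open>tensor_map k M' N' f g\<close> is \<open>f \<otimes> g\<close> for linear maps \<open>f\<close> into \<open>M'\<close> and \<open>g\<close> into \<open>N'\<close>.
\<close>

definition tensor_map ::
  "('k, 'x) ring_scheme \<Rightarrow> ('k, 'm2, 'y) module_scheme \<Rightarrow> ('k, 'n2, 'z) module_scheme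
    \<Rightarrow> ('m \<Rightarrow> 'm2) \<Rightarrow> ('n \<Rightarrow> 'n2) \<Rightarrow> ('m, 'n) tensor \<Rightarrow> ('m2, 'n2) tensor" where
  "tensor_map k M' N' f g =
    tensor_lift (tensor_module k M' N') (\<lambda>m n. pure_tensor k M' N' (f m) (g n))"

definition base_module :: "('k, 'x) ring_scheme \<Rightarrow> ('k, 'k) module" where
  "base_module k = \<lparr>carrier = carrier k, mult = mult k, one = one k, zero = zero k, add = add k,
     smult = mult k\<rparr>"


section \<open>Hopf algebras\<close>

record ('k, 'h) hopf = "('k, 'h) module" +
  comult :: "'h \<Rightarrow> ('h, 'h) tensor"
  counit :: "'h \<Rightarrow> 'k"
  antipode :: "'h \<Rightarrow> 'h"

locale hopf_algebra = field k + ring H + module k H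
  for k :: "('k, 'x) ring_scheme" and H :: "('k, 'h, 'y) hopf_scheme" +
  assumes smult_mult_left:
      "\<lbrakk>c \<in> carrier k; x \<in> carrier H; y \<in> carrier H\<rbrakk>
        \<Longrightarrow> (c \<odot>\<^bsub>H\<^esub> x) \<otimes>\<^bsub>H\<^esub> y = c \<odot>\<^bsub>H\<^esub> (x \<otimes>\<^bsub>H\<^esub> y)"
    and smult_mult_right:
      "\<lbrakk>c \<in> carrier k; x \<in> carrier H; y \<in> carrier H\<rbrakk>
        \<Longrightarrow> x \<otimes>\<^bsub>H\<^esub> (c \<odot>\<^bsub>H\<^esub> y) = c \<odot>\<^bsub>H\<^esub> (x \<otimes>\<^bsub>H\<^esub> y)"
    and comult_linear: "comult H \<in> linear_maps k H (tensor_module k H H)"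
    and comult_ring_hom: "comult H \<in> ring_hom H (tensor_module k H H)"
    and counit_linear: "counit H \<in> linear_maps k H (base_module k)"
    and counit_ring_hom: "counit H \<in> ring_hom H k"
    and coassoc: "h \<in> carrier H \<Longrightarrow>
      tensor_lift (tensor_module k H (tensor_module k H H))
        (\<lambda>x z. tensor_lift (tensor_module k H (tensor_module k H H))
          (\<lambda>x1 x2. pure_tensor k H (tensor_module k H H) x1 (pure_tensor k H H x2 z))
          (comult H x)) (comult H h) =
      tensor_map k H (tensor_module k H H) (\<lambda>x. x) (comult H) (comult H h)"
    and counit_left: "h \<in> carrier H \<Longrightarrow>
      tensor_lift H (\<lambda>x y. counit H x \<odot>\<^bsub>H\<^esub> y) (comult H h) = h"
    and counit_right: "h \<in> carrier H \<Longrightarrow>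
      tensor_lift H (\<lambda>x y. counit H y \<odot>\<^bsub>H\<^esub> x) (comult H h) = h"
    and antipode_linear: "antipode H \<in> linear_maps k H H"
    and antipode_left: "h \<in> carrier H \<Longrightarrow>
      tensor_lift H (\<lambda>x y. antipode H x \<otimes>\<^bsub>H\<^esub> y) (comult H h) = counit H h \<odot>\<^bsub>H\<^esub> \<one>\<^bsub>H\<^esub>"
    and antipode_right: "h \<in> carrier H \<Longrightarrow>
      tensor_lift H (\<lambda>x y. x \<otimes>\<^bsub>H\<^esub> antipode H y) (comult H h) = counit H h \<odot>\<^bsub>H\<^esub> \<one>\<^bsub>H\<^esub>"

text \<open>
  Automorphisms are extensional functions, so that they form a group under composition
  (cf. \<^const>\<open>BijGroup\<close>). Their compatibility with the antipode is implied by the other conditions.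
\<close>

definition hopf_auto :: "('k, 'x) ring_scheme \<Rightarrow> ('k, 'h, 'y) hopf_scheme \<Rightarrow> ('h \<Rightarrow> 'h) set" where
  "hopf_auto k H = {\<alpha> \<in> Bij (carrier H).
     \<alpha> \<in> linear_maps k H H \<and> \<alpha> \<in> ring_hom H H \<and>
     (\<forall>h\<in>carrier H. comult H (\<alpha> h) = tensor_map k H H \<alpha> \<alpha> (comult H h) \<and>
       counit H (\<alpha> h) = counit H h \<and> antipode H (\<alpha> h) = \<alpha> (antipode H h))}"

definition Aut_Hopf :: "('k, 'x) ring_scheme \<Rightarrow> ('k, 'h, 'y) hopf_scheme \<Rightarrow> ('h \<Rightarrow> 'h) monoid" where
  "Aut_Hopf k H = BijGroup (carrier H)\<lparr>carrier := hopf_auto k H\<rparr>"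

definition yd_group ::
  "('k, 'x) ring_scheme \<Rightarrow> ('k, 'h, 'y) hopf_scheme \<Rightarrow> (('h \<Rightarrow> 'h) \<times> ('h \<Rightarrow> 'h)) monoid" where
  "yd_group k H = (let A = Aut_Hopf k H in
    \<lparr>carrier = carrier A \<times> carrier A,
     mult = \<lambda>(\<alpha>, \<beta>) (\<gamma>, \<delta>). (\<alpha> \<otimes>\<^bsub>A\<^esub> \<gamma>, \<delta> \<otimes>\<^bsub>A\<^esub> inv\<^bsub>A\<^esub> \<gamma> \<otimes>\<^bsub>A\<^esub> \<beta> \<otimes>\<^bsub>A\<^esub> \<gamma>),
     one = (\<one>\<^bsub>A\<^esub>, \<one>\<^bsub>A\<^esub>)\<rparr>)"


section \<open>Yetter--Drinfeld modules\<close>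

record ('k, 'h, 'v) yd_module = "('k, 'v) module" +
  action :: "'h \<Rightarrow> 'v \<Rightarrow> 'v"
  coaction :: "'v \<Rightarrow> ('v, 'h) tensor"

text \<open>
  Actions and coactions are required to be extensional, so that structures which agree on the
  carriers are equal.
\<close>

locale left_action = field k + module k M
  for k :: "('k, 'x) ring_scheme" and H :: "('k, 'h, 'y) hopf_scheme"
    and M :: "('k, 'h, 'v) yd_module" +
  assumes action_ext: "action M \<in> carrier H \<rightarrow>\<^sub>E (carrier M \<rightarrow>\<^sub>E carrier M)"
    and action_linear: "h \<in> carrier H \<Longrightarrow> action M h \<in> linear_maps k M M"
    and action_add: "\<lbrakk>g \<in> carrier H; h \<in> carrier H; m \<in> carrier M\<rbrakk>
      \<Longrightarrow> action M (g \<oplus>\<^bsub>H\<^esub> h) m = action M g m \<oplus>\<^bsub>M\<^esub> action M h m"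
    and action_smult: "\<lbrakk>c \<in> carrier k; h \<in> carrier H; m \<in> carrier M\<rbrakk>
      \<Longrightarrow> action M (c \<odot>\<^bsub>H\<^esub> h) m = c \<odot>\<^bsub>M\<^esub> action M h m"
    and action_mult: "\<lbrakk>g \<in> carrier H; h \<in> carrier H; m \<in> carrier M\<rbrakk>
      \<Longrightarrow> action M (g \<otimes>\<^bsub>H\<^esub> h) m = action M g (action M h m)"
    and action_one: "m \<in> carrier M \<Longrightarrow> action M \<one>\<^bsub>H\<^esub> m = m"

locale right_coaction = field k + module k M
  for k :: "('k, 'x) ring_scheme" and H :: "('k, 'h, 'y) hopf_scheme"
    and M :: "('k, 'h, 'v) yd_module" +
  assumes coaction_ext: "coaction M \<in> extensional (carrier M)"
    and coaction_linear: "coaction M \<in> linear_maps k M (tensor_module k M H)"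
    and coaction_coassoc: "m \<in> carrier M \<Longrightarrow>
      tensor_lift (tensor_module k M (tensor_module k H H))
        (\<lambda>m0 m1. tensor_lift (tensor_module k M (tensor_module k H H))
          (\<lambda>m00 m01. pure_tensor k M (tensor_module k H H) m00 (pure_tensor k H H m01 m1))
          (coaction M m0)) (coaction M m) =
      tensor_map k M (tensor_module k H H) (\<lambda>x. x) (comult H) (coaction M m)"
    and coaction_counit: "m \<in> carrier M \<Longrightarrow>
      tensor_lift M (\<lambda>m0 m1. counit H m1 \<odot>\<^bsub>M\<^esub> m0) (coaction M m) = m"

locale yetter_drinfeld = left_action k H M + right_coaction k H M
  for k :: "('k, 'x) ring_scheme" and H :: "('k, 'h, 'y) hopf_scheme"
    and \<alpha> \<beta> :: "'h \<Rightarrow> 'h" and M :: "('k, 'h, 'v) yd_module" +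
  assumes compatibility: "\<lbrakk>h \<in> carrier H; m \<in> carrier M\<rbrakk> \<Longrightarrow>
    coaction M (action M h m) =
      tensor_lift (tensor_module k M H)
        (\<lambda>h12 h3. tensor_lift (tensor_module k M H)
          (\<lambda>h1 h2. tensor_lift (tensor_module k M H)
            (\<lambda>m0 m1. pure_tensor k M H (action M h2 m0)
              (\<beta> h3 \<otimes>\<^bsub>H\<^esub> m1 \<otimes>\<^bsub>H\<^esub> \<alpha> (inv_into (carrier H) (antipode H) h1)))
            (coaction M m))
          (comult H h12))
        (comult H h)"


section \<open>A universe of vectors closed under tensor products\<close>

text \<open>
  To form a category of vector spaces that is closed under tensor products inside one type, the
  carriers of its objects range over all subsets of the following type: it contains an arbitrary
  type \<open>'a\<close> of atoms, the scalars, and codes for the elements of tensor products. A class of lists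
  is coded by one of its members, chosen once and for all.
\<close>

datatype ('k, 'a) vec = Atom 'a | Scalar 'k | Tensor "(('k, 'a) vec \<times> ('k, 'a) vec) list"

definition tensor_code :: "(('k, 'a) vec, ('k, 'a) vec) tensor \<Rightarrow> ('k, 'a) vec" where
  "tensor_code t = Tensor (SOME xs. xs \<in> t)"

text \<open>Transport of the vector space structure of \<open>M\<close> along a map \<open>f\<close> injective on \<open>carrier M\<close>.\<close>

definition transport :: "('m \<Rightarrow> 'n) \<Rightarrow> ('k, 'm, 'y) module_scheme \<Rightarrow> ('k, 'n) module" where
  "transport f M = (let d = inv_into (carrier M) f in
    \<lparr>carrier = f ` carrier M, mult = undefined, one = undefined, zero = f \<zero>\<^bsub>M\<^esub>,
     add = \<lambda>x y. f (d x \<oplus>\<^bsub>M\<^esub> d y), smult = \<lambda>c x. f (c \<odot>\<^bsub>M\<^esub> d x)\<rparr>)"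

text \<open>The tensor product inside the universe, its pure tensors, and its universal property.\<close>

definition vtensor ::
  "('k, 'x) ring_scheme \<Rightarrow> ('k, ('k, 'a) vec, 'y) module_scheme
    \<Rightarrow> ('k, ('k, 'a) vec, 'z) module_scheme \<Rightarrow> ('k, ('k, 'a) vec) module" where
  "vtensor k M N = transport tensor_code (tensor_module k M N)"

definition vpure ::
  "('k, 'x) ring_scheme \<Rightarrow> ('k, ('k, 'a) vec, 'y) module_scheme
    \<Rightarrow> ('k, ('k, 'a) vec, 'z) module_scheme \<Rightarrow> ('k, 'a) vec \<Rightarrow> ('k, 'a) vec \<Rightarrow> ('k, 'a) vec" where
  "vpure k M N m n = tensor_code (pure_tensor k M N m n)"

definition vlift ::
  "('k, 'x) ring_scheme \<Rightarrow> ('k, ('k, 'a) vec, 'y) module_scheme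
    \<Rightarrow> ('k, ('k, 'a) vec, 'z) module_scheme \<Rightarrow> ('k, 'p, 'w) module_scheme
    \<Rightarrow> (('k, 'a) vec \<Rightarrow> ('k, 'a) vec \<Rightarrow> 'p) \<Rightarrow> ('k, 'a) vec \<Rightarrow> 'p" where
  "vlift k M N P f = (\<lambda>t\<in>carrier (vtensor k M N).
    tensor_lift P f (inv_into (carrier (tensor_module k M N)) tensor_code t))"


section \<open>Braided T-categories\<close>

record ('o, 'm) cat =
  Ob :: "'o set"
  Arr :: "'m set"
  Dom :: "'m \<Rightarrow> 'o"
  Cod :: "'m \<Rightarrow> 'o"
  Ident :: "'o \<Rightarrow> 'm"
  Comp :: "'m \<Rightarrow> 'm \<Rightarrow> 'm"  (infixr \<open>\<cdot>\<index>\<close> 55)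

definition Hom :: "('o, 'm, 'z) cat_scheme \<Rightarrow> 'o \<Rightarrow> 'o \<Rightarrow> 'm set" where
  "Hom C U V = {f \<in> Arr C. Dom C f = U \<and> Cod C f = V}"

locale category =
  fixes C :: "('o, 'm, 'z) cat_scheme" (structure)
  assumes Dom_Ob: "f \<in> Arr C \<Longrightarrow> Dom C f \<in> Ob C"
    and Cod_Ob: "f \<in> Arr C \<Longrightarrow> Cod C f \<in> Ob C"
    and Ident_Hom: "U \<in> Ob C \<Longrightarrow> Ident C U \<in> Hom C U U"
    and Comp_Hom: "\<lbrakk>f \<in> Hom C U V; g \<in> Hom C V W\<rbrakk> \<Longrightarrow> g \<cdot> f \<in> Hom C U W"
    and Comp_Ident: "f \<in> Hom C U V \<Longrightarrow> f \<cdot> Ident C U = f"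
    and Ident_Comp: "f \<in> Hom C U V \<Longrightarrow> Ident C V \<cdot> f = f"
    and Comp_assoc: "\<lbrakk>f \<in> Hom C U V; g \<in> Hom C V W; h \<in> Hom C W X\<rbrakk>
      \<Longrightarrow> (h \<cdot> g) \<cdot> f = h \<cdot> (g \<cdot> f)"

definition inverse_arrows :: "('o, 'm, 'z) cat_scheme \<Rightarrow> 'm \<Rightarrow> 'm \<Rightarrow> bool" where
  "inverse_arrows C f g \<longleftrightarrow> f \<in> Arr C \<and> g \<in> Hom C (Cod C f) (Dom C f) \<and>
     g \<cdot>\<^bsub>C\<^esub> f = Ident C (Dom C f) \<and> f \<cdot>\<^bsub>C\<^esub> g = Ident C (Cod C f)"

definition isos :: "('o, 'm, 'z) cat_scheme \<Rightarrow> 'o \<Rightarrow> 'o \<Rightarrow> 'm set" where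
  "isos C U V = {f \<in> Hom C U V. \<exists>g. inverse_arrows C f g}"

definition arr_inv :: "('o, 'm, 'z) cat_scheme \<Rightarrow> 'm \<Rightarrow> 'm" where
  "arr_inv C f = (THE g. inverse_arrows C f g)"

record ('o, 'm) moncat = "('o, 'm) cat" +
  tens_ob :: "'o \<Rightarrow> 'o \<Rightarrow> 'o"  (infixr \<open>\<otimes>o\<index>\<close> 70)
  tens_arr :: "'m \<Rightarrow> 'm \<Rightarrow> 'm"  (infixr \<open>\<otimes>a\<index>\<close> 70)
  unit_ob :: 'o
  assoc :: "'o \<Rightarrow> 'o \<Rightarrow> 'o \<Rightarrow> 'm"
  lunit :: "'o \<Rightarrow> 'm"
  runit :: "'o \<Rightarrow> 'm"

locale monoidal_category = category T
  for T :: "('o, 'm, 'z) moncat_scheme" (structure) +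
  assumes tens_Ob: "\<lbrakk>U \<in> Ob T; V \<in> Ob T\<rbrakk> \<Longrightarrow> U \<otimes>o V \<in> Ob T"
    and tens_Hom: "\<lbrakk>f \<in> Hom T U U'; g \<in> Hom T V V'\<rbrakk> \<Longrightarrow> f \<otimes>a g \<in> Hom T (U \<otimes>o V) (U' \<otimes>o V')"
    and tens_Ident: "\<lbrakk>U \<in> Ob T; V \<in> Ob T\<rbrakk> \<Longrightarrow> Ident T U \<otimes>a Ident T V = Ident T (U \<otimes>o V)"
    and tens_Comp:
      "\<lbrakk>f \<in> Hom T U U'; f' \<in> Hom T U' U''; g \<in> Hom T V V'; g' \<in> Hom T V' V''\<rbrakk>
        \<Longrightarrow> (f' \<cdot> f) \<otimes>a (g' \<cdot> g) = (f' \<otimes>a g') \<cdot> (f \<otimes>a g)"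
    and unit_Ob: "unit_ob T \<in> Ob T"
    and assoc_iso: "\<lbrakk>U \<in> Ob T; V \<in> Ob T; W \<in> Ob T\<rbrakk>
      \<Longrightarrow> assoc T U V W \<in> isos T ((U \<otimes>o V) \<otimes>o W) (U \<otimes>o (V \<otimes>o W))"
    and assoc_natural: "\<lbrakk>f \<in> Hom T U U'; g \<in> Hom T V V'; h \<in> Hom T W W'\<rbrakk>
      \<Longrightarrow> assoc T U' V' W' \<cdot> ((f \<otimes>a g) \<otimes>a h) = (f \<otimes>a (g \<otimes>a h)) \<cdot> assoc T U V W"
    and lunit_iso: "U \<in> Ob T \<Longrightarrow> lunit T U \<in> isos T (unit_ob T \<otimes>o U) U"
    and lunit_natural: "f \<in> Hom T U V
      \<Longrightarrow> lunit T V \<cdot> (Ident T (unit_ob T) \<otimes>a f) = f \<cdot> lunit T U"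
    and runit_iso: "U \<in> Ob T \<Longrightarrow> runit T U \<in> isos T (U \<otimes>o unit_ob T) U"
    and runit_natural: "f \<in> Hom T U V
      \<Longrightarrow> runit T V \<cdot> (f \<otimes>a Ident T (unit_ob T)) = f \<cdot> runit T U"
    and pentagon: "\<lbrakk>U \<in> Ob T; V \<in> Ob T; W \<in> Ob T; X \<in> Ob T\<rbrakk> \<Longrightarrow>
      assoc T U V (W \<otimes>o X) \<cdot> assoc T (U \<otimes>o V) W X =
      (Ident T U \<otimes>a assoc T V W X) \<cdot> assoc T U (V \<otimes>o W) X \<cdot> (assoc T U V W \<otimes>a Ident T X)"
    and triangle: "\<lbrakk>U \<in> Ob T; V \<in> Ob T\<rbrakk> \<Longrightarrow>
      (Ident T U \<otimes>a lunit T V) \<cdot> assoc T U (unit_ob T) V = runit T U \<otimes>a Ident T V"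

text \<open>
  Endofunctors are pairs of an object map and an arrow map; strictness means that the tensor
  product, the unit object and the constraints are preserved on the nose.
\<close>

definition strict_endofunctors ::
  "('o, 'm, 'z) moncat_scheme \<Rightarrow> (('o \<Rightarrow> 'o) \<times> ('m \<Rightarrow> 'm)) set" where
  "strict_endofunctors T = {(F, F').
     F \<in> Ob T \<rightarrow>\<^sub>E Ob T \<and> F' \<in> Arr T \<rightarrow>\<^sub>E Arr T \<and>
     (\<forall>f\<in>Arr T. Dom T (F' f) = F (Dom T f) \<and> Cod T (F' f) = F (Cod T f)) \<and>
     (\<forall>U\<in>Ob T. F' (Ident T U) = Ident T (F U)) \<and>
     (\<forall>f\<in>Arr T. \<forall>g\<in>Arr T. Dom T g = Cod T f \<longrightarrow> F' (g \<cdot>\<^bsub>T\<^esub> f) = F' g \<cdot>\<^bsub>T\<^esub> F' f) \<and>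
     (\<forall>U\<in>Ob T. \<forall>V\<in>Ob T. F (U \<otimes>o\<^bsub>T\<^esub> V) = F U \<otimes>o\<^bsub>T\<^esub> F V) \<and>
     (\<forall>f\<in>Arr T. \<forall>g\<in>Arr T. F' (f \<otimes>a\<^bsub>T\<^esub> g) = F' f \<otimes>a\<^bsub>T\<^esub> F' g) \<and>
     F (unit_ob T) = unit_ob T \<and>
     (\<forall>U\<in>Ob T. \<forall>V\<in>Ob T. \<forall>W\<in>Ob T. F' (assoc T U V W) = assoc T (F U) (F V) (F W)) \<and>
     (\<forall>U\<in>Ob T. F' (lunit T U) = lunit T (F U) \<and> F' (runit T U) = runit T (F U))}"

definition strict_End ::
  "('o, 'm, 'z) moncat_scheme \<Rightarrow> (('o \<Rightarrow> 'o) \<times> ('m \<Rightarrow> 'm)) monoid" where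
  "strict_End T =
    \<lparr>carrier = strict_endofunctors T,
     mult = \<lambda>(F, F') (E, E'). (compose (Ob T) F E, compose (Arr T) F' E'),
     one = (\<lambda>U\<in>Ob T. U, \<lambda>f\<in>Arr T. f)\<rparr>"

abbreviation strict_Aut ::
  "('o, 'm, 'z) moncat_scheme \<Rightarrow> (('o \<Rightarrow> 'o) \<times> ('m \<Rightarrow> 'm)) monoid" where
  "strict_Aut T \<equiv> units_of (strict_End T)"

text \<open>
  \<open>S a\<close> is the set of objects of the component of index \<open>a\<close>. As \<open>T\<close> is the disjoint union of its
  components, these are full subcategories without arrows between them, hence determined by \<open>S\<close>.
\<close>

locale T_category = G?: group G + monoidal_category T
  for G :: "('g, 'y) monoid_scheme" (structure) and T :: "('o, 'm, 'z) moncat_scheme" (structure) +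
  fixes S :: "'g \<Rightarrow> 'o set" and \<phi> :: "'g \<Rightarrow> ('o \<Rightarrow> 'o) \<times> ('m \<Rightarrow> 'm)"
  assumes components_cover: "(\<Union>a\<in>carrier G. S a) = Ob T"
    and components_disjoint: "\<lbrakk>a \<in> carrier G; b \<in> carrier G; a \<noteq> b\<rbrakk> \<Longrightarrow> S a \<inter> S b = {}"
    and components_separated: "\<lbrakk>f \<in> Arr T; a \<in> carrier G; Dom T f \<in> S a\<rbrakk> \<Longrightarrow> Cod T f \<in> S a"
    and components_tens: "\<lbrakk>a \<in> carrier G; b \<in> carrier G; U \<in> S a; V \<in> S b\<rbrakk>
      \<Longrightarrow> U \<otimes>o\<^bsub>T\<^esub> V \<in> S (a \<otimes>\<^bsub>G\<^esub> b)"
    and components_unit: "unit_ob T \<in> S \<one>\<^bsub>G\<^esub>"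
    and \<phi>_hom: "\<phi> \<in> hom G (strict_Aut T)"
    and \<phi>_component: "\<lbrakk>a \<in> carrier G; b \<in> carrier G\<rbrakk>
      \<Longrightarrow> fst (\<phi> b) ` S a = S (b \<otimes>\<^bsub>G\<^esub> a \<otimes>\<^bsub>G\<^esub> inv\<^bsub>G\<^esub> b)"

text \<open>
  The identities are stated with the associativity constraints that are suppressed when \<open>T\<close> is
  treated as strict. In them \<open>fst (\<phi> a) V\<close> is the object written \<open>\<^sup>UV\<close> for \<open>U\<close> of index \<open>a\<close>.
\<close>

locale braided_T_category = T_category G T S \<phi>
  for G :: "('g, 'y) monoid_scheme" (structure) and T :: "('o, 'm, 'z) moncat_scheme" (structure)
    and S :: "'g \<Rightarrow> 'o set" and \<phi> :: "'g \<Rightarrow> ('o \<Rightarrow> 'o) \<times> ('m \<Rightarrow> 'm)" +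
  fixes c :: "'o \<Rightarrow> 'o \<Rightarrow> 'm"
  assumes braiding_iso: "\<lbrakk>a \<in> carrier G; U \<in> S a; V \<in> Ob T\<rbrakk>
      \<Longrightarrow> c U V \<in> isos T (U \<otimes>o\<^bsub>T\<^esub> V) (fst (\<phi> a) V \<otimes>o\<^bsub>T\<^esub> U)"
    and braiding_natural:
      "\<lbrakk>a \<in> carrier G; U \<in> S a; U' \<in> S a; f \<in> Hom T U U'; g \<in> Hom T V V'\<rbrakk>
        \<Longrightarrow> (snd (\<phi> a) g \<otimes>a\<^bsub>T\<^esub> f) \<cdot>\<^bsub>T\<^esub> c U V = c U' V' \<cdot>\<^bsub>T\<^esub> (f \<otimes>a\<^bsub>T\<^esub> g)"
    and braiding_tens_left:
      "\<lbrakk>a \<in> carrier G; b \<in> carrier G; U \<in> S a; V \<in> S b; W \<in> Ob T\<rbrakk> \<Longrightarrow>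
        c (U \<otimes>o\<^bsub>T\<^esub> V) W =
          assoc T (fst (\<phi> a) (fst (\<phi> b) W)) U V \<cdot>\<^bsub>T\<^esub>
          (c U (fst (\<phi> b) W) \<otimes>a\<^bsub>T\<^esub> Ident T V) \<cdot>\<^bsub>T\<^esub>
          arr_inv T (assoc T U (fst (\<phi> b) W) V) \<cdot>\<^bsub>T\<^esub>
          (Ident T U \<otimes>a\<^bsub>T\<^esub> c V W) \<cdot>\<^bsub>T\<^esub>
          assoc T U V W"
    and braiding_tens_right:
      "\<lbrakk>a \<in> carrier G; U \<in> S a; V \<in> Ob T; W \<in> Ob T\<rbrakk> \<Longrightarrow>
        c U (V \<otimes>o\<^bsub>T\<^esub> W) =
          arr_inv T (assoc T (fst (\<phi> a) V) (fst (\<phi> a) W) U) \<cdot>\<^bsub>T\<^esub>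
          (Ident T (fst (\<phi> a) V) \<otimes>a\<^bsub>T\<^esub> c U W) \<cdot>\<^bsub>T\<^esub>
          assoc T (fst (\<phi> a) V) U W \<cdot>\<^bsub>T\<^esub>
          (c U V \<otimes>a\<^bsub>T\<^esub> Ident T W) \<cdot>\<^bsub>T\<^esub>
          arr_inv T (assoc T U V W)"
    and braiding_\<phi>: "\<lbrakk>b \<in> carrier G; U \<in> Ob T; V \<in> Ob T\<rbrakk>
        \<Longrightarrow> snd (\<phi> b) (c U V) = c (fst (\<phi> b) U) (fst (\<phi> b) V)"


section \<open>The category of all Yetter--Drinfeld modules\<close>

type_synonym ('k, 'h, 'a) yd_ob =
  "(('h \<Rightarrow> 'h) \<times> ('h \<Rightarrow> 'h)) \<times> ('k, 'h, ('k, 'a) vec) yd_module"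

text \<open>An arrow consists of its domain, its codomain and an extensional map.\<close>

type_synonym ('k, 'h, 'a) yd_arr =
  "('k, 'h, 'a) yd_ob \<times> ('k, 'h, 'a) yd_ob \<times> (('k, 'a) vec \<Rightarrow> ('k, 'a) vec)"

definition yd_component ::
  "('k, 'x) ring_scheme \<Rightarrow> ('k, 'h, 'y) hopf_scheme \<Rightarrow> ('h \<Rightarrow> 'h) \<times> ('h \<Rightarrow> 'h)
    \<Rightarrow> ('k, 'h, 'a) yd_ob set" where
  "yd_component k H = (\<lambda>(\<alpha>, \<beta>). {((\<alpha>, \<beta>), M) | M. yetter_drinfeld k H \<alpha> \<beta> M})"

definition yd_obs ::
  "('k, 'x) ring_scheme \<Rightarrow> ('k, 'h, 'y) hopf_scheme \<Rightarrow> ('k, 'h, 'a) yd_ob set" where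
  "yd_obs k H = (\<Union>a\<in>carrier (yd_group k H). yd_component k H a)"

definition yd_maps ::
  "('k, 'x) ring_scheme \<Rightarrow> ('k, 'h, 'y) hopf_scheme
    \<Rightarrow> ('k, 'h, 'v) yd_module \<Rightarrow> ('k, 'h, 'w) yd_module \<Rightarrow> ('v \<Rightarrow> 'w) set" where
  "yd_maps k H M N = {f \<in> linear_maps k M N. f \<in> extensional (carrier M) \<and>
     (\<forall>h\<in>carrier H. \<forall>m\<in>carrier M. f (action M h m) = action N h (f m)) \<and>
     (\<forall>m\<in>carrier M. coaction N (f m) = tensor_map k N H f (\<lambda>x. x) (coaction M m))}"

definition yd_arrs ::
  "('k, 'x) ring_scheme \<Rightarrow> ('k, 'h, 'y) hopf_scheme \<Rightarrow> ('k, 'h, 'a) yd_arr set" where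
  "yd_arrs k H = {((a, M), (b, N), f) | a M b N f.
     (a, M) \<in> yd_obs k H \<and> (b, N) \<in> yd_obs k H \<and> a = b \<and> f \<in> yd_maps k H M N}"

definition yd_tensor ::
  "('k, 'x) ring_scheme \<Rightarrow> ('k, 'h, 'y) hopf_scheme
    \<Rightarrow> ('k, 'h, 'a) yd_ob \<Rightarrow> ('k, 'h, 'a) yd_ob \<Rightarrow> ('k, 'h, 'a) yd_ob" where
  "yd_tensor k H = (\<lambda>((\<alpha>, \<beta>), M) ((\<gamma>, \<delta>), N).
    let A = Aut_Hopf k H; V = vtensor k M N in
    ((\<alpha>, \<beta>) \<otimes>\<^bsub>yd_group k H\<^esub> (\<gamma>, \<delta>),
     \<lparr>carrier = carrier V, mult = mult V, one = one V, zero = zero V, add = add V,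
      smult = smult V,
      action = (\<lambda>h\<in>carrier H. \<lambda>t\<in>carrier V.
        tensor_lift V
          (\<lambda>h1 h2. vlift k M N V
            (\<lambda>m n. vpure k M N (action M (\<gamma> h1) m)
              (action N ((inv\<^bsub>A\<^esub> \<gamma> \<otimes>\<^bsub>A\<^esub> \<beta> \<otimes>\<^bsub>A\<^esub> \<gamma>) h2) n)) t)
          (comult H h)),
      coaction = vlift k M N (tensor_module k V H)
        (\<lambda>m n. tensor_lift (tensor_module k V H)
          (\<lambda>m0 m1. tensor_lift (tensor_module k V H)
            (\<lambda>n0 n1. pure_tensor k V H (vpure k M N m0 n0) (n1 \<otimes>\<^bsub>H\<^esub> m1))
            (coaction N n))
          (coaction M m))\<rparr>))"

definition yd_tensor_arr ::
  "('k, 'x) ring_scheme \<Rightarrow> ('k, 'h, 'y) hopf_scheme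
    \<Rightarrow> ('k, 'h, 'a) yd_arr \<Rightarrow> ('k, 'h, 'a) yd_arr \<Rightarrow> ('k, 'h, 'a) yd_arr" where
  "yd_tensor_arr k H = (\<lambda>(X, X', f) (Y, Y', g).
    (yd_tensor k H X Y, yd_tensor k H X' Y',
     vlift k (snd X) (snd Y) (vtensor k (snd X') (snd Y'))
       (\<lambda>m n. vpure k (snd X') (snd Y') (f m) (g n))))"

definition yd_unit ::
  "('k, 'x) ring_scheme \<Rightarrow> ('k, 'h, 'y) hopf_scheme \<Rightarrow> ('k, 'h, 'a) yd_ob" where
  "yd_unit k H = (let I = transport Scalar (base_module k) in
    (\<one>\<^bsub>yd_group k H\<^esub>,
     \<lparr>carrier = carrier I, mult = mult I, one = one I, zero = zero I, add = add I,
      smult = smult I,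
      action = (\<lambda>h\<in>carrier H. \<lambda>x\<in>carrier I. counit H h \<odot>\<^bsub>I\<^esub> x),
      coaction = (\<lambda>x\<in>carrier I. pure_tensor k I H x \<one>\<^bsub>H\<^esub>)\<rparr>))"

text \<open>The constraints are the usual identifications of vector spaces.\<close>

definition yd_assoc ::
  "('k, 'x) ring_scheme \<Rightarrow> ('k, 'h, 'y) hopf_scheme
    \<Rightarrow> ('k, 'h, 'a) yd_ob \<Rightarrow> ('k, 'h, 'a) yd_ob \<Rightarrow> ('k, 'h, 'a) yd_ob \<Rightarrow> ('k, 'h, 'a) yd_arr" where
  "yd_assoc k H X Y Z =
    (let L = snd X; M = snd Y; N = snd Z; P = vtensor k L (vtensor k M N) in
    (yd_tensor k H (yd_tensor k H X Y) Z, yd_tensor k H X (yd_tensor k H Y Z),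
     vlift k (vtensor k L M) N P
       (\<lambda>t n. vlift k L M P (\<lambda>l m. vpure k L (vtensor k M N) l (vpure k M N m n)) t)))"

definition yd_lunit ::
  "('k, 'x) ring_scheme \<Rightarrow> ('k, 'h, 'y) hopf_scheme \<Rightarrow> ('k, 'h, 'a) yd_ob \<Rightarrow> ('k, 'h, 'a) yd_arr" where
  "yd_lunit k H X = (yd_tensor k H (yd_unit k H) X, X,
     vlift k (snd (yd_unit k H :: ('k, 'h, 'a) yd_ob)) (snd X) (snd X)
       (\<lambda>r m. inv_into (carrier k) Scalar r \<odot>\<^bsub>snd X\<^esub> m))"

definition yd_runit ::
  "('k, 'x) ring_scheme \<Rightarrow> ('k, 'h, 'y) hopf_scheme \<Rightarrow> ('k, 'h, 'a) yd_ob \<Rightarrow> ('k, 'h, 'a) yd_arr" where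
  "yd_runit k H X = (yd_tensor k H X (yd_unit k H), X,
     vlift k (snd X) (snd (yd_unit k H :: ('k, 'h, 'a) yd_ob)) (snd X)
       (\<lambda>m r. inv_into (carrier k) Scalar r \<odot>\<^bsub>snd X\<^esub> m))"

definition YD ::
  "('k, 'x) ring_scheme \<Rightarrow> ('k, 'h, 'y) hopf_scheme
    \<Rightarrow> (('k, 'h, 'a) yd_ob, ('k, 'h, 'a) yd_arr) moncat" where
  "YD k H =
    \<lparr>Ob = yd_obs k H, Arr = yd_arrs k H,
     Dom = (\<lambda>(X, Y, f). X), Cod = (\<lambda>(X, Y, f). Y),
     Ident = (\<lambda>X. (X, X, \<lambda>m\<in>carrier (snd X). m)),
     Comp = (\<lambda>(Y, Z, g) (X, Y', f). (X, Z, compose (carrier (snd X)) g f)),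
     tens_ob = yd_tensor k H, tens_arr = yd_tensor_arr k H, unit_ob = yd_unit k H,
     assoc = yd_assoc k H, lunit = yd_lunit k H, runit = yd_runit k H\<rparr>"

definition yd_conj_ob ::
  "('k, 'x) ring_scheme \<Rightarrow> ('k, 'h, 'y) hopf_scheme \<Rightarrow> ('h \<Rightarrow> 'h) \<times> ('h \<Rightarrow> 'h)
    \<Rightarrow> ('k, 'h, 'a) yd_ob \<Rightarrow> ('k, 'h, 'a) yd_ob" where
  "yd_conj_ob k H = (\<lambda>(\<alpha>, \<beta>) ((\<gamma>, \<delta>), N).
    let A = Aut_Hopf k H; G = yd_group k H in
    ((\<alpha>, \<beta>) \<otimes>\<^bsub>G\<^esub> (\<gamma>, \<delta>) \<otimes>\<^bsub>G\<^esub> inv\<^bsub>G\<^esub> (\<alpha>, \<beta>),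
     N\<lparr>action := (\<lambda>h\<in>carrier H. \<lambda>n\<in>carrier N.
         action N ((inv\<^bsub>A\<^esub> \<gamma> \<otimes>\<^bsub>A\<^esub> \<beta> \<otimes>\<^bsub>A\<^esub> \<gamma> \<otimes>\<^bsub>A\<^esub> inv\<^bsub>A\<^esub> \<alpha>) h) n),
       coaction := (\<lambda>n\<in>carrier N.
         tensor_map k N H (\<lambda>x. x) (\<alpha> \<otimes>\<^bsub>A\<^esub> inv\<^bsub>A\<^esub> \<beta>) (coaction N n))\<rparr>))"

definition yd_conj ::
  "('k, 'x) ring_scheme \<Rightarrow> ('k, 'h, 'y) hopf_scheme \<Rightarrow> ('h \<Rightarrow> 'h) \<times> ('h \<Rightarrow> 'h)
    \<Rightarrow> (('k, 'h, 'a) yd_ob \<Rightarrow> ('k, 'h, 'a) yd_ob) \<times> (('k, 'h, 'a) yd_arr \<Rightarrow> ('k, 'h, 'a) yd_arr)" where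
  "yd_conj k H a =
    (\<lambda>X\<in>yd_obs k H. yd_conj_ob k H a X,
     \<lambda>(X, Y, f)\<in>yd_arrs k H. (yd_conj_ob k H a X, yd_conj_ob k H a Y, f))"

definition yd_braiding ::
  "('k, 'x) ring_scheme \<Rightarrow> ('k, 'h, 'y) hopf_scheme
    \<Rightarrow> ('k, 'h, 'a) yd_ob \<Rightarrow> ('k, 'h, 'a) yd_ob \<Rightarrow> ('k, 'h, 'a) yd_arr" where
  "yd_braiding k H = (\<lambda>((\<alpha>, \<beta>), M) Y.
    let A = Aut_Hopf k H; N = snd Y; Y' = yd_conj_ob k H (\<alpha>, \<beta>) Y; N' = snd Y' in
    (yd_tensor k H ((\<alpha>, \<beta>), M) Y, yd_tensor k H Y' ((\<alpha>, \<beta>), M),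
     vlift k M N (vtensor k N' M)
       (\<lambda>m n. tensor_lift (vtensor k N' M)
         (\<lambda>n0 n1. vpure k N' M n0 (action M ((inv\<^bsub>A\<^esub> \<beta>) n1) m))
         (coaction N n))))"

end

theory Submission
  imports Defs
begin

text \<open>
  Each identity is an equality of linear maps, hence may be checked on pure tensors, where it is a
  computation in Sweedler notation. All tensor products and conjugates are instances of two general
  constructions: \<open>M \<otimes> N\<close> with action \<open>\<gamma>(h\<^sub>1)\<cdot>m \<otimes> \<theta>(h\<^sub>2)\<cdot>n\<close>, and \<open>N\<close> with action \<open>\<theta>(h)\<cdot>n\<close> and
  coaction \<open>n\<^sub>0 \<otimes> \<eta>(n\<^sub>1)\<close>, for automorphisms \<open>\<gamma>, \<theta>, \<eta>\<close>. Strictness of the conjugation functors and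
  the compatibilities of the braiding then reduce to identities between words in the automorphisms.
  That \<open>c\<close> is a morphism follows by cancelling \<open>S\<^sup>-\<^sup>1(h\<^sub>2) h\<^sub>1\<close> in the compatibility condition, and its
  inverse is \<open>n \<otimes> m \<mapsto> \<beta>\<^sup>-\<^sup>1(S(n\<^sub>1))\<cdot>m \<otimes> n\<^sub>0\<close>.
\<close>

section \<open>Linear and bilinear maps\<close>

text \<open>The action on \<open>M \<otimes> N\<close> has its shape because of the compatibility
  condition. For \<open>\<Delta>(h) = x \<otimes> y\<close> the coefficient in \<open>H\<close>
  contains \<open>\<gamma>(\<theta>(S\<^sup>-\<^sup>1(y\<^sub>1)))\<close> next to
  \<open>\<beta>(\<gamma>(x\<^sub>3))\<close>; if \<open>\<gamma>\<theta> = \<beta>\<gamma>\<close>,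
  that is \<open>\<theta> = \<gamma>\<^sup>-\<^sup>1\<beta>\<gamma>\<close>, the two merge and
  cancel. The automorphisms that survive are \<open>\<alpha>\<gamma>\<close> and
  \<open>\<delta>\<theta>\<close>, which is the product in \<open>G\<close>. The factor
  \<open>\<alpha>\<beta>\<^sup>-\<^sup>1\<close> in the conjugated coaction does the same for the
  colinearity of \<open>c\<close>. These cancellations need the inverse antipode to reverse
  products. The Hopf algebra axioms do not state this even for \<open>S\<close>, so it is derived.
  Strictness asks for equality of records. It is attainable because conjugation leaves the
  underlying vector space untouched, hence also the codes of tensors and the linear maps behind the
  constraints, and because actions and coactions are extensional. Equality of indices is a separate
  computation in \<open>G\<close>.\<close>

definition lin ::
  "('k, 'x) ring_scheme \<Rightarrow> ('k, 'm, 'y) module_scheme \<Rightarrow> ('k, 'n, 'z) module_scheme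
    \<Rightarrow> ('m \<Rightarrow> 'n) \<Rightarrow> bool" where
  "lin k M N f \<longleftrightarrow> f \<in> linear_maps k M N"

definition bilin ::
  "('k, 'x) ring_scheme \<Rightarrow> ('k, 'm, 'y) module_scheme \<Rightarrow> ('k, 'n, 'z) module_scheme
    \<Rightarrow> ('k, 'p, 'w) module_scheme \<Rightarrow> ('m \<Rightarrow> 'n \<Rightarrow> 'p) \<Rightarrow> bool" where
  "bilin k M N P f \<longleftrightarrow>
    (\<forall>n\<in>carrier N. lin k M P (\<lambda>m. f m n)) \<and> (\<forall>m\<in>carrier M. lin k N P (\<lambda>n. f m n))"

text \<open>
  Sweedler calculus is carried out by the simplifier. These weak congruence rules stop it from
  rewriting inside the functions whose (bi)linearity it has to establish.
\<close>

lemma lin_weak_cong [cong]: "k = k' \<Longrightarrow> M = M' \<Longrightarrow> N = N' \<Longrightarrow> lin k M N f = lin k' M' N' f"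
  by (simp add: lin_def)

lemma bilin_weak_cong [cong]:
  "k = k' \<Longrightarrow> M = M' \<Longrightarrow> N = N' \<Longrightarrow> P = P' \<Longrightarrow> bilin k M N P f = bilin k' M' N' P' f"
  by (simp add: bilin_def)

lemma linI:
  assumes "\<And>x. x \<in> carrier M \<Longrightarrow> f x \<in> carrier N"
    and "\<And>x y. \<lbrakk>x \<in> carrier M; y \<in> carrier M\<rbrakk> \<Longrightarrow> f (x \<oplus>\<^bsub>M\<^esub> y) = f x \<oplus>\<^bsub>N\<^esub> f y"
    and "\<And>c x. \<lbrakk>c \<in> carrier k; x \<in> carrier M\<rbrakk> \<Longrightarrow> f (c \<odot>\<^bsub>M\<^esub> x) = c \<odot>\<^bsub>N\<^esub> f x"
  shows "lin k M N f"
  using assms by (auto simp: lin_def linear_maps_def)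

lemma lin_closed: "lin k M N f \<Longrightarrow> x \<in> carrier M \<Longrightarrow> f x \<in> carrier N"
  and lin_add: "lin k M N f \<Longrightarrow> x \<in> carrier M \<Longrightarrow> y \<in> carrier M \<Longrightarrow> f (x \<oplus>\<^bsub>M\<^esub> y) = f x \<oplus>\<^bsub>N\<^esub> f y"
  and lin_smult: "lin k M N f \<Longrightarrow> c \<in> carrier k \<Longrightarrow> x \<in> carrier M \<Longrightarrow> f (c \<odot>\<^bsub>M\<^esub> x) = c \<odot>\<^bsub>N\<^esub> f x"
  by (auto simp: lin_def linear_maps_def)

lemma lin_zero:
  assumes "module k M" "module k N" "lin k M N f"
  shows "f \<zero>\<^bsub>M\<^esub> = \<zero>\<^bsub>N\<^esub>"
proof -
  interpret M: module k M by fact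
  interpret N: module k N by fact
  \<comment> \<open>\<open>lin\<close> asks for additivity and homogeneity; the value at zero comes
    from writing zero as a multiple by the scalar zero.\<close>
  have "f (\<zero>\<^bsub>k\<^esub> \<odot>\<^bsub>M\<^esub> \<zero>\<^bsub>M\<^esub>) = \<zero>\<^bsub>k\<^esub> \<odot>\<^bsub>N\<^esub> f \<zero>\<^bsub>M\<^esub>"
    using assms(3) by (simp only: lin_smult M.R.zero_closed M.M.zero_closed)
  then show ?thesis using lin_closed[OF assms(3)] by simp
qed

lemma lin_ident [simp]: "lin k M M (\<lambda>x. x)"
  by (auto intro: linI)

lemma lin_comp: "lin k M N g \<Longrightarrow> lin k L M f \<Longrightarrow> lin k L N (\<lambda>x. g (f x))"
  by (intro linI) (simp_all add: lin_closed[of k L M f] lin_closed[of k M N g]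
      lin_add[of k L M f] lin_add[of k M N g] lin_smult[of k L M f] lin_smult[of k M N g])

text \<open>\<open>lin\<close> inspects a function only on \<open>carrier M\<close>, and the
  operations of a module do not leave the carrier. This is how restricted functions are replaced by
  their bodies.\<close>

lemma lin_cong:
  assumes "\<And>x. x \<in> carrier M \<Longrightarrow> f x = g x" "module k M"
  shows "lin k M N f = lin k M N g"
proof -
  interpret module k M by fact
  show ?thesis
    using assms(1) by (auto simp: lin_def linear_maps_def Pi_def)
qed

lemma lin_smult_const [simp]:
  assumes "module k N" "c \<in> carrier k" "lin k M N f"
  shows "lin k M N (\<lambda>x. c \<odot>\<^bsub>N\<^esub> f x)"
proof -
  interpret N: module k N by fact
  show ?thesis
    using assms lin_closed[OF assms(3)]
    by (intro linI)
      (auto simp: lin_add lin_smult N.smult_r_distr N.smult_assoc1[symmetric] N.R.m_comm)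
qed

lemma bilinI:
  assumes "\<And>n. n \<in> carrier N \<Longrightarrow> lin k M P (\<lambda>m. f m n)"
    and "\<And>m. m \<in> carrier M \<Longrightarrow> lin k N P (\<lambda>n. f m n)"
  shows "bilin k M N P f"
  using assms by (simp add: bilin_def)

text \<open>As a rewrite rule this makes the simplifier split bilinearity into linearity in each
  slot, which the rules for \<open>lin\<close> then settle.\<close>

declare bilinI [simp]
declare in_lists_conv_set [simp del] in_listsD [rule del] in_listsI [rule del]

lemma bilinD1: "bilin k M N P f \<Longrightarrow> n \<in> carrier N \<Longrightarrow> lin k M P (\<lambda>m. f m n)"
  and bilinD2: "bilin k M N P f \<Longrightarrow> m \<in> carrier M \<Longrightarrow> lin k N P (\<lambda>n. f m n)"
  by (auto simp: bilin_def)

lemma bilin_closed: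
  "bilin k M N P f \<Longrightarrow> m \<in> carrier M \<Longrightarrow> n \<in> carrier N \<Longrightarrow> f m n \<in> carrier P"
  by (drule (1) bilinD2) (rule lin_closed)

section \<open>Tensor products\<close>

abbreviation tsum ::
  "('k, 'p, 'y) module_scheme \<Rightarrow> ('m \<Rightarrow> 'n \<Rightarrow> 'p) \<Rightarrow> ('m \<times> 'n) list \<Rightarrow> 'p" where
  "tsum P f xs \<equiv> foldr (\<lambda>(m, n) s. f m n \<oplus>\<^bsub>P\<^esub> s) xs \<zero>\<^bsub>P\<^esub>"

section \<open>The congruence of words and the vector space of its classes\<close>

context
  fixes k :: "('k, 'x) ring_scheme" and M :: "('k, 'm, 'y) module_scheme"
    and N :: "('k, 'n, 'z) module_scheme"
  assumes M: "module k M" and N: "module k N"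
begin

interpretation M: module k M by (rule M)
interpretation N: module k N by (rule N)

abbreviation (input) "T \<equiv> tensor_module k M N"
abbreviation (input) "L \<equiv> lists (carrier M \<times> carrier N)"
abbreviation (input) "cls \<equiv> tensor_class k M N"
abbreviation (input) "pt \<equiv> pure_tensor k M N"

lemma tensor_eq_in_lists:
  "tensor_eq k M N xs ys \<Longrightarrow> xs \<in> L \<and> ys \<in> L"
  by (induction rule: tensor_eq.induct) auto

lemma tensor_class_eqI: "tensor_eq k M N xs ys \<Longrightarrow> cls xs = cls ys"
  unfolding tensor_class_def using tensor_eq.sym tensor_eq.trans by blast

lemma tensor_class_self: "xs \<in> L \<Longrightarrow> xs \<in> cls xs"
  by (simp add: tensor_class_def tensor_eq.refl)

lemma tensor_classD: "ys \<in> cls xs \<Longrightarrow> tensor_eq k M N xs ys"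
  by (simp add: tensor_class_def)

lemma tensor_carrier: "carrier T = cls ` L"
  by (simp add: tensor_module_def)

text \<open>Classes of an equivalence relation: every word in a class represents it. This is what
  later makes the choice of a representative harmless.\<close>

lemma tensor_memD: "t \<in> carrier T \<Longrightarrow> xs \<in> t \<Longrightarrow> xs \<in> L \<and> t = cls xs"
  unfolding tensor_carrier using tensor_classD tensor_eq_in_lists tensor_class_eqI by blast

lemma tensor_zero: "\<zero>\<^bsub>T\<^esub> = cls []"
  by (simp add: tensor_module_def)

text \<open>The sum is a union over all pairs of representatives. By the rule \<open>append\<close>
  every member of that union is the same class, and reflexivity provides at least one pair, so the
  union collapses.\<close>

lemma tensor_add:
  assumes "xs \<in> L" "ys \<in> L"
  shows "cls xs \<oplus>\<^bsub>T\<^esub> cls ys = cls (xs @ ys)"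
proof -
  have "cls (xs' @ ys') = cls (xs @ ys)" if "xs' \<in> cls xs" "ys' \<in> cls ys" for xs' ys'
    using that by (intro tensor_class_eqI tensor_eq.append tensor_classD[THEN tensor_eq.sym])
  then have "(\<Union>xs'\<in>cls xs. \<Union>ys'\<in>cls ys. cls (xs' @ ys')) = (\<Union>xs'\<in>cls xs. \<Union>ys'\<in>cls ys. cls (xs @
    ys))"
    by simp
  also have "\<dots> = cls (xs @ ys)"
    using tensor_class_self[OF assms(1)] tensor_class_self[OF assms(2)] by blast
  finally show ?thesis by (simp add: tensor_module_def)
qed

lemma tensor_eq_smult:
  assumes "tensor_eq k M N xs ys" "c \<in> carrier k"
  shows "tensor_eq k M N (map (\<lambda>(m, n). (c \<odot>\<^bsub>M\<^esub> m, n)) xs) (map (\<lambda>(m, n). (c \<odot>\<^bsub>M\<^esub> m, n)) ys)"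
  using assms
proof (induction rule: tensor_eq.induct)
  case (refl xs)
  then show ?case by (intro tensor_eq.refl) (auto simp: in_lists_conv_set)
next
  \<comment> \<open>Scaling the relation by \<open>c\<close> produces \<open>c d m\<close>, while
    the relation for \<open>c m\<close> produces \<open>d c m\<close>; commutativity of
    \<open>k\<close> identifies them.\<close>
  case (smult d m n)
  then show ?case
    using tensor_eq.smult[of d k "c \<odot>\<^bsub>M\<^esub> m" M n N]
    by (simp add: M.smult_assoc1[symmetric] M.R.m_comm)
next
  case (zero n)
  then show ?case by (simp add: tensor_eq.zero)
next
  case (swap p q)
  then show ?case by (cases p; cases q) (auto intro!: tensor_eq.swap)
next
  case (sym xs ys)
  then show ?case by (simp add: tensor_eq.sym)
next
  case (trans xs ys zs)
  then show ?case using tensor_eq.trans by blast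
qed (auto intro: tensor_eq.append tensor_eq.add_left tensor_eq.add_right simp: M.smult_r_distr)

lemma tensor_smult:
  assumes "xs \<in> L" "c \<in> carrier k"
  shows "c \<odot>\<^bsub>T\<^esub> cls xs = cls (map (\<lambda>(m, n). (c \<odot>\<^bsub>M\<^esub> m, n)) xs)"
proof -
  have "cls (map (\<lambda>(m, n). (c \<odot>\<^bsub>M\<^esub> m, n)) xs') = cls (map (\<lambda>(m, n). (c \<odot>\<^bsub>M\<^esub> m, n)) xs)"
    if "xs' \<in> cls xs" for xs'
    using that assms by (intro tensor_class_eqI tensor_eq_smult tensor_classD[THEN tensor_eq.sym])
  then have "(\<Union>xs'\<in>cls xs. cls (map (\<lambda>(m, n). (c \<odot>\<^bsub>M\<^esub> m, n)) xs'))
      = (\<Union>xs'\<in>cls xs. cls (map (\<lambda>(m, n). (c \<odot>\<^bsub>M\<^esub> m, n)) xs))"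
    by simp
  also have "\<dots> = cls (map (\<lambda>(m, n). (c \<odot>\<^bsub>M\<^esub> m, n)) xs)"
    using tensor_class_self[OF assms(1)] by blast
  finally show ?thesis by (simp add: tensor_module_def)
qed

lemma pure_tensor_closed [simp]: "m \<in> carrier M \<Longrightarrow> n \<in> carrier N \<Longrightarrow> pt m n \<in> carrier T"
  by (auto simp: tensor_carrier pure_tensor_def)

lemma tensor_Cons:
  "m \<in> carrier M \<Longrightarrow> n \<in> carrier N \<Longrightarrow> xs \<in> L \<Longrightarrow> cls ((m, n) # xs) = pt m n \<oplus>\<^bsub>T\<^esub> cls xs"
  by (simp add: pure_tensor_def tensor_add)

text \<open>A class comes from a word, and putting a pair in front of the word adds a pure tensor;
  so this is list induction on a representative.\<close>

lemma tensor_induct [consumes 1, case_names zero add]: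
  assumes "t \<in> carrier T" "Q \<zero>\<^bsub>T\<^esub>"
    and "\<And>m n t. \<lbrakk>m \<in> carrier M; n \<in> carrier N; t \<in> carrier T; Q t\<rbrakk> \<Longrightarrow> Q (pt m n \<oplus>\<^bsub>T\<^esub> t)"
  shows "Q t"
proof -
  obtain xs where xs: "xs \<in> L" "t = cls xs"
    using assms(1) by (auto simp: tensor_carrier)
  from xs(1) have "Q (cls xs)"
  proof (induction xs)
    case Nil
    then show ?case using assms(2) by (simp add: tensor_zero)
  next
    case (Cons p xs)
    then show ?case
      using assms(3)[of "fst p" "snd p" "cls xs"] by (cases p) (auto simp: tensor_Cons
        tensor_carrier)
  qed
  with xs show ?thesis by simp
qed

lemma tensor_add_closed: "s \<in> carrier T \<Longrightarrow> t \<in> carrier T \<Longrightarrow> s \<oplus>\<^bsub>T\<^esub> t \<in> carrier T"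
  by (auto simp: tensor_carrier tensor_add intro!: imageI)

lemma tensor_zero_closed: "\<zero>\<^bsub>T\<^esub> \<in> carrier T"
  by (auto simp: tensor_carrier tensor_zero)

text \<open>The relation \<open>swap\<close> exchanges two isolated letters. A letter travels
  through a word by one such swap at a time, each placed in its surroundings by
  \<open>append\<close>.\<close>

lemma tensor_eq_Cons_rotate:
  "p \<in> carrier M \<times> carrier N \<Longrightarrow> ys \<in> L \<Longrightarrow> tensor_eq k M N (p # ys) (ys @ [p])"
proof (induction ys)
  case Nil
  then show ?case by (auto intro: tensor_eq.refl)
next
  case (Cons q ys)
  have a: "tensor_eq k M N ([p, q] @ ys) ([q, p] @ ys)"
    using Cons.prems by (intro tensor_eq.append[OF tensor_eq.swap tensor_eq.refl]) simp_all
  have b: "tensor_eq k M N ([q] @ (p # ys)) ([q] @ (ys @ [p]))"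
    using Cons by (intro tensor_eq.append[OF tensor_eq.refl]) simp_all
  show ?case using tensor_eq.trans[OF a[simplified] b[simplified]] by simp
qed

lemma tensor_eq_commute:
  "xs \<in> L \<Longrightarrow> ys \<in> L \<Longrightarrow> tensor_eq k M N (xs @ ys) (ys @ xs)"
proof (induction xs arbitrary: ys)
  case Nil
  then show ?case by (auto intro: tensor_eq.refl)
next
  case (Cons p xs)
  have a: "tensor_eq k M N ([p] @ (xs @ ys)) ([p] @ (ys @ xs))"
    using Cons by (intro tensor_eq.append[OF tensor_eq.refl]) simp_all
  have b: "tensor_eq k M N ((p # ys) @ xs) ((ys @ [p]) @ xs)"
    using Cons.prems by (intro tensor_eq.append[OF tensor_eq_Cons_rotate tensor_eq.refl]) simp_all
  show ?case using tensor_eq.trans[OF a[simplified] b[simplified]] by simp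
qed

lemma tensor_a_assoc:
  "r \<in> carrier T \<Longrightarrow> s \<in> carrier T \<Longrightarrow> t \<in> carrier T \<Longrightarrow>
    (r \<oplus>\<^bsub>T\<^esub> s) \<oplus>\<^bsub>T\<^esub> t = r \<oplus>\<^bsub>T\<^esub> (s \<oplus>\<^bsub>T\<^esub> t)"
  by (auto simp: tensor_carrier tensor_add)

lemma tensor_a_comm: "s \<in> carrier T \<Longrightarrow> t \<in> carrier T \<Longrightarrow> s \<oplus>\<^bsub>T\<^esub> t = t \<oplus>\<^bsub>T\<^esub> s"
  unfolding tensor_carrier by (elim imageE) (simp add: tensor_add, rule tensor_class_eqI, rule
    tensor_eq_commute)

lemma tensor_l_zero: "t \<in> carrier T \<Longrightarrow> \<zero>\<^bsub>T\<^esub> \<oplus>\<^bsub>T\<^esub> t = t"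
  by (auto simp: tensor_carrier tensor_zero tensor_add)

lemma pure_tensor_add_left:
  assumes "m \<in> carrier M" "m' \<in> carrier M" "n \<in> carrier N"
  shows "pt (m \<oplus>\<^bsub>M\<^esub> m') n = pt m n \<oplus>\<^bsub>T\<^esub> pt m' n"
proof -
  have "pt m n \<oplus>\<^bsub>T\<^esub> pt m' n = cls ([(m, n)] @ [(m', n)])"
    using assms by (simp add: pure_tensor_def tensor_add)
  then show ?thesis
    using assms by (auto simp: pure_tensor_def intro!: tensor_class_eqI tensor_eq.add_left)
qed

lemma pure_tensor_add_right:
  assumes "m \<in> carrier M" "n \<in> carrier N" "n' \<in> carrier N"
  shows "pt m (n \<oplus>\<^bsub>N\<^esub> n') = pt m n \<oplus>\<^bsub>T\<^esub> pt m n'"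
proof -
  have "pt m n \<oplus>\<^bsub>T\<^esub> pt m n' = cls ([(m, n)] @ [(m, n')])"
    using assms by (simp add: pure_tensor_def tensor_add)
  then show ?thesis
    using assms by (auto simp: pure_tensor_def intro!: tensor_class_eqI tensor_eq.add_right)
qed

lemma pure_tensor_smult_left:
  "c \<in> carrier k \<Longrightarrow> m \<in> carrier M \<Longrightarrow> n \<in> carrier N \<Longrightarrow> pt (c \<odot>\<^bsub>M\<^esub> m) n = c \<odot>\<^bsub>T\<^esub> pt m n"
  by (simp add: pure_tensor_def tensor_smult)

lemma pure_tensor_smult_right:
  "c \<in> carrier k \<Longrightarrow> m \<in> carrier M \<Longrightarrow> n \<in> carrier N \<Longrightarrow> pt m (c \<odot>\<^bsub>N\<^esub> n) = c \<odot>\<^bsub>T\<^esub> pt m n"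
  by (simp add: pure_tensor_def tensor_smult tensor_class_eqI[OF tensor_eq.smult])

lemma pure_tensor_zero_left: "n \<in> carrier N \<Longrightarrow> pt \<zero>\<^bsub>M\<^esub> n = \<zero>\<^bsub>T\<^esub>"
  by (auto simp: pure_tensor_def tensor_zero intro!: tensor_class_eqI tensor_eq.zero)

text \<open>Words form only a monoid. Additivity on the left together with the relation
  \<open>zero\<close> makes \<open>(\<ominus>m) \<otimes> n\<close> inverse to
  \<open>m \<otimes> n\<close>, and induction over sums of pure tensors gives all other
  inverses.\<close>

lemma abelian_group_tensor: "abelian_group T"
proof (rule abelian_groupI)
  show "\<exists>y\<in>carrier T. y \<oplus>\<^bsub>T\<^esub> t = \<zero>\<^bsub>T\<^esub>" if "t \<in> carrier T" for t
    using that
  proof (induction rule: tensor_induct)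
    case zero
    then show ?case using tensor_zero_closed tensor_l_zero by blast
  next
    case (add m n t)
    then obtain y where y: "y \<in> carrier T" "y \<oplus>\<^bsub>T\<^esub> t = \<zero>\<^bsub>T\<^esub>" by blast
    have neg: "pt (\<ominus>\<^bsub>M\<^esub> m) n \<oplus>\<^bsub>T\<^esub> pt m n = \<zero>\<^bsub>T\<^esub>"
      using add by (simp add: pure_tensor_add_left[symmetric] M.M.l_neg pure_tensor_zero_left)
    have "(y \<oplus>\<^bsub>T\<^esub> pt (\<ominus>\<^bsub>M\<^esub> m) n) \<oplus>\<^bsub>T\<^esub> (pt m n \<oplus>\<^bsub>T\<^esub> t)
        = y \<oplus>\<^bsub>T\<^esub> ((pt (\<ominus>\<^bsub>M\<^esub> m) n \<oplus>\<^bsub>T\<^esub> pt m n) \<oplus>\<^bsub>T\<^esub> t)"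
      using add y by (simp add: tensor_a_assoc tensor_add_closed)
    also have "\<dots> = \<zero>\<^bsub>T\<^esub>"
      using neg y add by (simp add: tensor_l_zero)
    finally show ?case
      using add y by (meson M.M.a_inv_closed pure_tensor_closed tensor_add_closed)
  qed
qed (rule tensor_add_closed tensor_zero_closed tensor_a_assoc tensor_a_comm tensor_l_zero;
  assumption)+

lemma map_smult_in_lists:
  "c \<in> carrier k \<Longrightarrow> xs \<in> L \<Longrightarrow> map (\<lambda>(m, n). (c \<odot>\<^bsub>M\<^esub> m, n)) xs \<in> L"
  by (fastforce simp: in_lists_conv_set)

lemma tensor_smult_closed: "c \<in> carrier k \<Longrightarrow> t \<in> carrier T \<Longrightarrow> c \<odot>\<^bsub>T\<^esub> t \<in> carrier T"
  by (auto simp: tensor_carrier tensor_smult map_smult_in_lists intro!: imageI)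

lemma tensor_smult_r_distr:
  assumes "c \<in> carrier k" "s \<in> carrier T" "t \<in> carrier T"
  shows "c \<odot>\<^bsub>T\<^esub> (s \<oplus>\<^bsub>T\<^esub> t) = c \<odot>\<^bsub>T\<^esub> s \<oplus>\<^bsub>T\<^esub> c \<odot>\<^bsub>T\<^esub> t"
proof -
  obtain xs ys where "xs \<in> L" "s = cls xs" "ys \<in> L" "t = cls ys"
    using assms(2,3) by (auto simp: tensor_carrier)
  then show ?thesis
    using assms(1) by (simp add: tensor_smult tensor_add map_smult_in_lists)
qed

lemma tensor_smult_zero: "c \<in> carrier k \<Longrightarrow> c \<odot>\<^bsub>T\<^esub> \<zero>\<^bsub>T\<^esub> = \<zero>\<^bsub>T\<^esub>"
  by (simp add: tensor_zero tensor_smult)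

text \<open>Scalars act on the left entries, so each law is inherited from \<open>M\<close> on pure
  tensors and spreads to sums by induction.\<close>

lemma module_tensor [simp]: "module k T"
proof -
  interpret T: abelian_group T by (rule abelian_group_tensor)
  note [simp] = tensor_smult_closed tensor_smult_r_distr tensor_smult_zero
    pure_tensor_smult_left[symmetric]
  show ?thesis
  proof (rule moduleI)
    show "cring k" ..
    show "abelian_group T" by (rule abelian_group_tensor)
    show "(a \<oplus>\<^bsub>k\<^esub> b) \<odot>\<^bsub>T\<^esub> t = a \<odot>\<^bsub>T\<^esub> t \<oplus>\<^bsub>T\<^esub> b \<odot>\<^bsub>T\<^esub> t"
      if "a \<in> carrier k" "b \<in> carrier k" "t \<in> carrier T" for a b t
      using that(3)
    proof (induction rule: tensor_induct)
      case (add m n t)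
      with that show ?case
        by (simp add: M.smult_l_distr pure_tensor_add_left T.a_ac)
    qed (use that in auto)
    show "(a \<otimes>\<^bsub>k\<^esub> b) \<odot>\<^bsub>T\<^esub> t = a \<odot>\<^bsub>T\<^esub> (b \<odot>\<^bsub>T\<^esub> t)"
      if "a \<in> carrier k" "b \<in> carrier k" "t \<in> carrier T" for a b t
      using that(3)
    proof (induction rule: tensor_induct)
      case (add m n t)
      with that show ?case by (simp add: M.smult_assoc1)
    qed (use that in auto)
    show "\<one>\<^bsub>k\<^esub> \<odot>\<^bsub>T\<^esub> t = t" if "t \<in> carrier T" for t
      using that by (induction rule: tensor_induct) auto
  qed auto
qed

lemma bilin_pure_tensor: "bilin k M N T pt"
  by (intro bilinI linI)
    (auto simp: pure_tensor_add_left pure_tensor_add_right pure_tensor_smult_left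
      pure_tensor_smult_right)

lemma tensor_ext:
  assumes "module k P" "lin k T P f" "lin k T P g"
    and "\<And>m n. m \<in> carrier M \<Longrightarrow> n \<in> carrier N \<Longrightarrow> f (pt m n) = g (pt m n)"
    and "t \<in> carrier T"
  shows "f t = g t"
  using assms(5)
proof (induction rule: tensor_induct)
  case zero
  then show ?case using lin_zero[OF module_tensor] assms by metis
next
  case (add m n t)
  then show ?case using assms by (simp add: lin_add)
qed

section \<open>The universal property of the tensor product\<close>

context
  fixes P :: "('k, 'p, 'w) module_scheme" and f
  assumes P: "module k P" and f: "bilin k M N P f"
begin

interpretation P: module k P by (rule P)

lemma tsum_closed: "xs \<in> L \<Longrightarrow> tsum P f xs \<in> carrier P"
  by (induction xs) (auto simp: bilin_closed[OF f])

lemma tsum_append: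
  "xs \<in> L \<Longrightarrow> ys \<in> L \<Longrightarrow> tsum P f (xs @ ys) = tsum P f xs \<oplus>\<^bsub>P\<^esub> tsum P f ys"
proof (induction xs)
  case Nil
  then show ?case using tsum_closed by simp
next
  case (Cons p xs)
  then show ?case
    using tsum_closed[of xs] tsum_closed[of ys] by (cases p) (auto simp: bilin_closed[OF f]
      P.M.a_assoc)
qed

text \<open>The map induced by \<open>f\<close> is well defined: evaluation in \<open>P\<close>
  satisfies each generating relation, the additive and scalar ones by bilinearity of
  \<open>f\<close> and \<open>swap\<close> by commutativity of addition in \<open>P\<close>.\<close>

lemma tsum_tensor_eq: "tensor_eq k M N xs ys \<Longrightarrow> tsum P f xs = tsum P f ys"
proof (induction rule: tensor_eq.induct)
  case (append xs xs' ys ys')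
  then show ?case using tensor_eq_in_lists by (metis tsum_append)
next
  case (swap p q)
  then show ?case by (auto simp: bilin_closed[OF f] P.M.a_ac)
next
  case (add_left m m' n)
  then show ?case using lin_add[OF bilinD1[OF f]] by (auto simp: bilin_closed[OF f])
next
  case (add_right m n n')
  then show ?case using lin_add[OF bilinD2[OF f]] by (auto simp: bilin_closed[OF f])
next
  case (smult c m n)
  then show ?case using lin_smult[OF bilinD1[OF f]] lin_smult[OF bilinD2[OF f]]
    by (auto simp: bilin_closed[OF f])
next
  case (zero n)
  then show ?case using lin_zero[OF M P bilinD1[OF f]] by auto
qed auto

text \<open>All representatives have the same value, so the definite description denotes the value
  of any one of them.\<close>

lemma tensor_lift_class: "xs \<in> L \<Longrightarrow> tensor_lift P f (cls xs) = tsum P f xs"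
  unfolding tensor_lift_def
  by (rule the_equality) (auto intro: tensor_class_self dest: tensor_classD simp: tsum_tensor_eq)

lemma lin_tensor_lift_self: "lin k T P (tensor_lift P f)"
proof (rule linI)
  fix s t assume "s \<in> carrier T" "t \<in> carrier T"
  then obtain xs ys where "xs \<in> L" "s = cls xs" "ys \<in> L" "t = cls ys"
    by (auto simp: tensor_carrier)
  then show "tensor_lift P f (s \<oplus>\<^bsub>T\<^esub> t) = tensor_lift P f s \<oplus>\<^bsub>P\<^esub> tensor_lift P f t"
    by (simp add: tensor_add tensor_lift_class tsum_append del: foldr_append)
next
  fix c t assume c: "c \<in> carrier k" and "t \<in> carrier T"
  then obtain xs where xs: "xs \<in> L" "t = cls xs" by (auto simp: tensor_carrier)
  have "tsum P f (map (\<lambda>(m, n). (c \<odot>\<^bsub>M\<^esub> m, n)) xs) = c \<odot>\<^bsub>P\<^esub> tsum P f xs"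
    using xs(1)
  proof (induction xs)
    case (Cons p xs)
    then show ?case
      using c lin_smult[OF bilinD1[OF f]] tsum_closed[of xs]
      by (cases p) (auto simp: bilin_closed[OF f] P.smult_r_distr)
  qed (use c in auto)
  then show "tensor_lift P f (c \<odot>\<^bsub>T\<^esub> t) = c \<odot>\<^bsub>P\<^esub> tensor_lift P f t"
    using xs c by (simp add: tensor_smult tensor_lift_class map_smult_in_lists)
qed (auto simp: tensor_carrier tensor_lift_class tsum_closed)

lemma tensor_lift_pure [simp]:
  "m \<in> carrier M \<Longrightarrow> n \<in> carrier N \<Longrightarrow> tensor_lift P f (pt m n) = f m n"
  by (simp add: pure_tensor_def tensor_lift_class bilin_closed[OF f])

lemma tensor_lift_closed: "t \<in> carrier T \<Longrightarrow> tensor_lift P f t \<in> carrier P"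
  using lin_tensor_lift_self by (rule lin_closed)

lemma tensor_lift_zero: "tensor_lift P f \<zero>\<^bsub>T\<^esub> = \<zero>\<^bsub>P\<^esub>"
  by (rule lin_zero[OF module_tensor P lin_tensor_lift_self])

lemma tensor_lift_Cons:
  "m \<in> carrier M \<Longrightarrow> n \<in> carrier N \<Longrightarrow> t \<in> carrier T \<Longrightarrow>
    tensor_lift P f (pt m n \<oplus>\<^bsub>T\<^esub> t) = f m n \<oplus>\<^bsub>P\<^esub> tensor_lift P f t"
  using lin_add[OF lin_tensor_lift_self] by simp

end

end

hide_const (open) T L cls pt
declare in_lists_conv_set [simp] in_listsD [dest!] in_listsI [intro!]

text \<open>All representatives of \<open>t\<close> have their entries in the carriers, so the two
  definite descriptions range over the same values.\<close>

lemma tensor_lift_cong: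
  assumes "module k M" "module k N" "t \<in> carrier (tensor_module k M N)"
    and "\<And>m n. m \<in> carrier M \<Longrightarrow> n \<in> carrier N \<Longrightarrow> f m n = g m n"
  shows "tensor_lift P f t = tensor_lift P g t"
proof -
  have "tsum P f xs = tsum P g xs" if "xs \<in> t" for xs
  proof -
    have "xs \<in> lists (carrier M \<times> carrier N)"
      using tensor_memD[OF assms(1-3) that] by blast
    then show ?thesis by (induction xs) (auto simp: assms(4))
  qed
  then show ?thesis by (auto simp: tensor_lift_def intro!: arg_cong[where f = The])
qed

lemma tensor_lift_push:
  assumes "module k M" "module k N" "module k P" "module k Q"
    and "lin k P Q g" "bilin k M N P f" "t \<in> carrier (tensor_module k M N)"
  shows "g (tensor_lift P f t) = tensor_lift Q (\<lambda>m n. g (f m n)) t"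
proof -
  have gf: "bilin k M N Q (\<lambda>m n. g (f m n))"
    using assms by (intro bilinI lin_comp[OF assms(5)]) (auto dest: bilinD1 bilinD2)
  show ?thesis
    by (rule tensor_ext[OF assms(1,2,4) _ _ _ assms(7), where f = "\<lambda>t. g (tensor_lift P f t)"])
      (use assms gf in \<open>simp_all add: lin_comp[OF assms(5)] lin_tensor_lift_self\<close>)
qed

text \<open>The parameter \<open>x\<close> sits in the bilinear map and \<open>t\<close> is fixed.
  As \<open>t\<close> is a finite sum of pure tensors, the value is a finite sum of terms linear in
  \<open>x\<close>; hence the induction on \<open>t\<close>.\<close>

lemma lin_tensor_lift_body:
  assumes M: "module k M" and N: "module k N" and P: "module k P" and L: "module k L"
    and bi: "\<And>x. x \<in> carrier L \<Longrightarrow> bilin k M N P (F x)"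
    and li: "\<And>m n. m \<in> carrier M \<Longrightarrow> n \<in> carrier N \<Longrightarrow> lin k L P (\<lambda>x. F x m n)"
    and t: "t \<in> carrier (tensor_module k M N)"
  shows "lin k L P (\<lambda>x. tensor_lift P (F x) t)"
proof -
  interpret P: module k P by (rule P)
  interpret L: module k L by (rule L)
  note [simp] = M N P bi tensor_lift_closed[OF M N P] tensor_lift_zero[OF M N P] tensor_lift_Cons[OF
    M N P]
    bilin_closed[OF bi]
  show ?thesis
  proof (rule tensor_induct[OF M N t, where Q = "\<lambda>t. lin k L P (\<lambda>x. tensor_lift P (F x) t)"])
    show "lin k L P (\<lambda>x. tensor_lift P (F x) \<zero>\<^bsub>tensor_module k M N\<^esub>)"
      by (intro linI) simp_all
  next
    fix m n t
    assume mnt: "m \<in> carrier M" "n \<in> carrier N" "t \<in> carrier (tensor_module k M N)"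
      and IH: "lin k L P (\<lambda>x. tensor_lift P (F x) t)"
    have cl: "F x m n \<in> carrier P" if "x \<in> carrier L" for x
      using mnt that lin_closed[OF li] by simp
    show "lin k L P (\<lambda>x. tensor_lift P (F x) (pure_tensor k M N m n \<oplus>\<^bsub>tensor_module k M N\<^esub> t))"
      using mnt cl lin_add[OF li[of m n]] lin_smult[OF li[of m n]] lin_add[OF IH] lin_smult[OF IH]
      by (intro linI) (simp_all add: P.smult_r_distr P.M.a_ac)
  qed
qed

lemma lin_pure_left [simp]:
  "\<lbrakk>module k M; module k N; lin k L M f; n \<in> carrier N\<rbrakk>
    \<Longrightarrow> lin k L (tensor_module k M N) (\<lambda>x. pure_tensor k M N (f x) n)"
  by (rule lin_comp[OF bilinD1[OF bilin_pure_tensor]])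

lemma lin_pure_right [simp]:
  "\<lbrakk>module k M; module k N; lin k L N f; m \<in> carrier M\<rbrakk>
    \<Longrightarrow> lin k L (tensor_module k M N) (\<lambda>x. pure_tensor k M N m (f x))"
  by (rule lin_comp[OF bilinD2[OF bilin_pure_tensor]])

lemma bilin_pure_comp:
  assumes "module k M'" "module k N'" "lin k M M' f" "lin k N N' g"
  shows "bilin k M N (tensor_module k M' N') (\<lambda>m n. pure_tensor k M' N' (f m) (g n))"
  by (intro bilinI lin_pure_left lin_pure_right assms lin_closed[OF assms(3)] lin_closed[OF
    assms(4)])

lemma tensor_map_pure:
  assumes "module k M" "module k N" "module k M'" "module k N'" "lin k M M' f" "lin k N N' g"
    "m \<in> carrier M" "n \<in> carrier N"
  shows "tensor_map k M' N' f g (pure_tensor k M N m n) = pure_tensor k M' N' (f m) (g n)"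
  unfolding tensor_map_def
  by (intro tensor_lift_pure bilin_pure_comp module_tensor assms)

lemma lin_tensor_map:
  assumes "module k M" "module k N" "module k M'" "module k N'" "lin k M M' f" "lin k N N' g"
  shows "lin k (tensor_module k M N) (tensor_module k M' N') (tensor_map k M' N' f g)"
  unfolding tensor_map_def
  by (intro lin_tensor_lift_self bilin_pure_comp module_tensor assms)

lemma tensor_lift_tensor_map:
  assumes "module k M" "module k N" "module k M'" "module k N'" "lin k M M' f" "lin k N N' g"
    and "module k P" "bilin k M' N' P F" "t \<in> carrier (tensor_module k M N)"
  shows "tensor_lift P F (tensor_map k M' N' f g t) = tensor_lift P (\<lambda>x y. F (f x) (g y)) t"
proof -
  have "tensor_lift P F (tensor_map k M' N' f g t)
      = tensor_lift P (\<lambda>x y. tensor_lift P F (pure_tensor k M' N' (f x) (g y))) t"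
    unfolding tensor_map_def
    by (rule tensor_lift_push[where k = k and M = M and N = N and P = "tensor_module k M' N'"])
      (intro assms module_tensor lin_tensor_lift_self bilin_pure_comp)+
  also have "\<dots> = tensor_lift P (\<lambda>x y. F (f x) (g y)) t"
    by (intro tensor_lift_cong[OF assms(1,2,9)] tensor_lift_pure assms lin_closed[OF assms(5)]
        lin_closed[OF assms(6)])
  finally show ?thesis .
qed

section \<open>Tensor products inside the universe\<close>

text \<open>The code stores a chosen word of the class, and a class can be recovered from any of its
  words.\<close>

lemma inj_on_tensor_code:
  assumes "module k M" "module k N"
  shows "inj_on tensor_code (carrier (tensor_module k M N))"
proof (rule inj_onI)
  fix s t assume s: "s \<in> carrier (tensor_module k M N)" and t: "t \<in> carrier (tensor_module k M N)"
    and eq: "tensor_code s = tensor_code t"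
  have some: "(SOME xs. xs \<in> r) \<in> r" if r: "r \<in> carrier (tensor_module k M N)" for r
  proof -
    obtain xs where "xs \<in> lists (carrier M \<times> carrier N)" "r = tensor_class k M N xs"
      using r unfolding tensor_carrier[OF assms] by (rule imageE)
    then have "xs \<in> r" using tensor_class_self[OF assms] by simp
    then show ?thesis by (rule someI[where P = "\<lambda>xs. xs \<in> r"])
  qed
  have eq': "(SOME xs. xs \<in> s) = (SOME xs. xs \<in> t)"
    using eq by (simp add: tensor_code_def)
  have "s = tensor_class k M N (SOME xs. xs \<in> s)"
    using tensor_memD[OF assms s some[OF s]] by (rule conjunct2)
  moreover have "t = tensor_class k M N (SOME xs. xs \<in> t)"
    using tensor_memD[OF assms t some[OF t]] by (rule conjunct2)
  ultimately show "s = t" using eq' by metis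
qed

lemma transport_simps [simp]:
  "carrier (transport f M) = f ` carrier M"
  "\<zero>\<^bsub>transport f M\<^esub> = f \<zero>\<^bsub>M\<^esub>"
  "x \<oplus>\<^bsub>transport f M\<^esub> y = f (inv_into (carrier M) f x \<oplus>\<^bsub>M\<^esub> inv_into (carrier M) f y)"
  "c \<odot>\<^bsub>transport f M\<^esub> x = f (c \<odot>\<^bsub>M\<^esub> inv_into (carrier M) f x)"
  by (simp_all add: transport_def Let_def)

lemma module_transport:
  assumes "module k M" "inj_on f (carrier M)"
  shows "module k (transport f M)"
proof -
  interpret M: module k M by fact
  note [simp] = inv_into_f_f[OF assms(2)]
  show ?thesis
  proof (rule moduleI)
    show "cring k" ..
    show "abelian_group (transport f M)"
    proof (rule abelian_groupI)
      show "\<exists>y\<in>carrier (transport f M). y \<oplus>\<^bsub>transport f M\<^esub> x = \<zero>\<^bsub>transport f M\<^esub>"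
        if "x \<in> carrier (transport f M)" for x
      proof -
        from that obtain m where "m \<in> carrier M" "x = f m" by auto
        then show ?thesis by (auto intro!: bexI[of _ "\<ominus>\<^bsub>M\<^esub> m"] simp: M.M.l_neg)
      qed
    qed (auto simp: M.M.a_ac)
  qed (auto simp: M.smult_l_distr M.smult_r_distr M.smult_assoc1)
qed

lemma lin_transport: "inj_on f (carrier M) \<Longrightarrow> lin k M (transport f M) f"
  by (intro linI) (auto simp: inv_into_f_f)

lemma lin_inv_transport:
  assumes "module k M" "inj_on f (carrier M)"
  shows "lin k (transport f M) M (inv_into (carrier M) f)"
proof -
  interpret M: module k M by fact
  show ?thesis using assms by (intro linI) (auto simp: inv_into_f_f inv_into_into)
qed

context
  fixes k :: "('k, 'x) ring_scheme" and M :: "('k, ('k, 'a) vec, 'y) module_scheme"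
    and N :: "('k, ('k, 'a) vec, 'z) module_scheme"
  assumes M: "module k M" and N: "module k N"
begin

lemma module_vtensor [simp]: "module k (vtensor k M N)"
  unfolding vtensor_def by (intro module_transport module_tensor inj_on_tensor_code M N)

lemma bilin_vpure: "bilin k M N (vtensor k M N) (vpure k M N)"
  unfolding vpure_def vtensor_def
  by (intro bilinI lin_comp[OF lin_transport[OF inj_on_tensor_code[OF M N]]]
      lin_pure_left lin_pure_right M N lin_ident)

lemma lin_vpure_left [simp]:
  "lin k L M f \<Longrightarrow> n \<in> carrier N \<Longrightarrow> lin k L (vtensor k M N) (\<lambda>x. vpure k M N (f x) n)"
  by (rule lin_comp[OF bilinD1[OF bilin_vpure]])

lemma lin_vpure_right [simp]:
  "lin k L N f \<Longrightarrow> m \<in> carrier M \<Longrightarrow> lin k L (vtensor k M N) (\<lambda>x. vpure k M N m (f x))"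
  by (rule lin_comp[OF bilinD2[OF bilin_vpure]])

lemma vpure_closed [simp]:
  "m \<in> carrier M \<Longrightarrow> n \<in> carrier N \<Longrightarrow> vpure k M N m n \<in> carrier (vtensor k M N)"
  by (rule bilin_closed[OF bilin_vpure])

lemma vtensor_ext:
  assumes "module k P" "lin k (vtensor k M N) P f" "lin k (vtensor k M N) P g"
    and "\<And>m n. m \<in> carrier M \<Longrightarrow> n \<in> carrier N \<Longrightarrow> f (vpure k M N m n) = g (vpure k M N m n)"
    and "t \<in> carrier (vtensor k M N)"
  shows "f t = g t"
proof -
  from assms(5) obtain s where s: "s \<in> carrier (tensor_module k M N)" "t = tensor_code s"
    by (auto simp: vtensor_def)
  have l: "lin k (tensor_module k M N) (vtensor k M N) tensor_code"
    unfolding vtensor_def by (rule lin_transport[OF inj_on_tensor_code[OF M N]])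
  have "f (tensor_code s) = g (tensor_code s)"
    by (rule tensor_ext[OF M N assms(1) lin_comp[OF assms(2) l] lin_comp[OF assms(3) l] _ s(1)])
      (use assms(4) in \<open>auto simp: vpure_def\<close>)
  with s show ?thesis by simp
qed

context
  fixes P :: "('k, 'p, 'w) module_scheme" and f
  assumes P: "module k P" and f: "bilin k M N P f"
begin

lemma lin_vlift_self [simp]: "lin k (vtensor k M N) P (vlift k M N P f)"
proof -
  have "lin k (vtensor k M N) P
      (\<lambda>t. tensor_lift P f (inv_into (carrier (tensor_module k M N)) tensor_code t))"
    unfolding vtensor_def
    by (intro lin_comp[OF lin_tensor_lift_self[OF M N P f] lin_inv_transport] module_tensor
        inj_on_tensor_code M N)
  then show ?thesis
    by (subst lin_cong) (auto simp: vlift_def)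
qed

lemma vlift_pure [simp]:
  "m \<in> carrier M \<Longrightarrow> n \<in> carrier N \<Longrightarrow> vlift k M N P f (vpure k M N m n) = f m n"
  using vpure_closed[of m n] M N P f
  by (simp add: vlift_def) (simp add: vpure_def inv_into_f_f[OF inj_on_tensor_code[OF M N]])

lemma vlift_closed [simp]: "t \<in> carrier (vtensor k M N) \<Longrightarrow> vlift k M N P f t \<in> carrier P"
  by (rule lin_closed[OF lin_vlift_self])

lemma lin_vlift_arg [simp]:
  "lin k L (vtensor k M N) t \<Longrightarrow> lin k L P (\<lambda>x. vlift k M N P f (t x))"
  by (rule lin_comp[OF lin_vlift_self])

end

lemma vlift_extensional [simp]: "vlift k M N P f \<in> extensional (carrier (vtensor k M N))"
  by (simp add: vlift_def)

lemma lin_vlift_body [simp]: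
  assumes "module k P" "module k L"
    and "\<And>x. x \<in> carrier L \<Longrightarrow> bilin k M N P (F x)"
    and "\<And>m n. m \<in> carrier M \<Longrightarrow> n \<in> carrier N \<Longrightarrow> lin k L P (\<lambda>x. F x m n)"
    and "t \<in> carrier (vtensor k M N)"
  shows "lin k L P (\<lambda>x. vlift k M N P (F x) t)"
proof -
  have "inv_into (carrier (tensor_module k M N)) tensor_code t \<in> carrier (tensor_module k M N)"
    using assms(5) by (auto simp: vtensor_def intro: inv_into_into)
  \<comment> \<open>\<open>vlift\<close> has to be unfolded inside the very function whose linearity
    is claimed, so the weak congruence rule is switched off.\<close>
  from lin_tensor_lift_body[OF M N assms(1-4) this] show ?thesis
    using assms(5) by (simp add: vlift_def cong del: lin_weak_cong)
qed

lemma vlift_cong: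
  "(\<And>m n. m \<in> carrier M \<Longrightarrow> n \<in> carrier N \<Longrightarrow> f m n = g m n) \<Longrightarrow> vlift k M N P f = vlift k M N P g"
  unfolding vlift_def
  by (rule restrict_ext, rule tensor_lift_cong[OF M N])
    (auto simp: vtensor_def intro: inv_into_into)

end

section \<open>Sweedler sums\<close>

text \<open>
  Unlike \<^const>\<open>tensor_lift\<close>, which is meaningful only for bilinear \<open>f\<close>, this sum over a chosen
  representative can be interchanged with other sums and pushed through linear maps for arbitrary
  \<open>f\<close>; this removes most of the bilinearity conditions from calculations.
\<close>

definition sw :: "('k, 'p, 'y) module_scheme \<Rightarrow> ('m \<Rightarrow> 'n \<Rightarrow> 'p) \<Rightarrow> ('m, 'n) tensor \<Rightarrow> 'p" where
  "sw P f t = tsum P f (SOME xs. xs \<in> t)"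

definition occurs :: "('m, 'n) tensor \<Rightarrow> 'm \<Rightarrow> 'n \<Rightarrow> bool" where
  "occurs t m n \<longleftrightarrow> (m, n) \<in> set (SOME xs. xs \<in> t)"

text \<open>
  The intermediate predicate \<open>R\<close> lets the simplifier turn \<^const>\<open>occurs\<close> into facts on membership
  in carriers before it rewrites the summand.
\<close>

lemma sw_cong [cong]:
  assumes "P = P'" "t = t'" "\<And>m n. occurs t' m n = R m n" "\<And>m n. R m n \<Longrightarrow> f m n = g m n"
  shows "sw P f t = sw P' g t'"
proof -
  have "tsum P f xs = tsum P g xs" if "\<And>m n. (m, n) \<in> set xs \<Longrightarrow> f m n = g m n" for xs
    using that by (induction xs) auto
  note eq = this
  have "tsum P f (SOME xs. xs \<in> t') = tsum P g (SOME xs. xs \<in> t')"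
    using assms(3,4) by (intro eq) (auto simp: occurs_def)
  then show ?thesis using assms(1,2) by (simp add: sw_def)
qed

text \<open>Counterpart of \<open>occurs\<close> for \<open>tensor_lift\<close>: the definite
  description looks at all representatives, so a pair counts if it appears in any of them.\<close>

definition occurs_lift :: "('m, 'n) tensor \<Rightarrow> 'm \<Rightarrow> 'n \<Rightarrow> bool" where
  "occurs_lift t m n \<longleftrightarrow> (\<exists>xs\<in>t. (m, n) \<in> set xs)"

lemma tensor_lift_simp_cong [cong]:
  assumes "P = P'" "t = t'" "\<And>m n. occurs_lift t' m n = R m n" "\<And>m n. R m n \<Longrightarrow> f m n = g m n"
  shows "tensor_lift P f t = tensor_lift P' g t'"
proof -
  have "tsum P f xs = tsum P g xs" if "\<And>m n. (m, n) \<in> set xs \<Longrightarrow> f m n = g m n" for xs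
    using that by (induction xs) auto
  note eq = this
  have "tsum P f xs = tsum P g xs" if "xs \<in> t'" for xs
  proof (rule eq, rule assms(4))
    show "R m n" if "(m, n) \<in> set xs" for m n
      using assms(3)[of m n] that \<open>xs \<in> t'\<close> by (auto simp: occurs_lift_def)
  qed
  then have "(\<lambda>p. \<exists>xs\<in>t'. p = tsum P f xs) = (\<lambda>p. \<exists>xs\<in>t'. p = tsum P g xs)"
    by auto
  then show ?thesis by (simp only: tensor_lift_def assms(1,2))
qed

text \<open>The congruence rules require an equivalence between occurrence and \<open>R\<close>, so
  membership in the carriers alone is too weak a right-hand side. A synonym carries the remaining
  information; repeating the original constant there would make the rewriting loop.\<close>

definition occurring_lift :: "('m, 'n) tensor \<Rightarrow> 'm \<Rightarrow> 'n \<Rightarrow> bool" where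
  "occurring_lift = occurs_lift"

definition occurring :: "('m, 'n) tensor \<Rightarrow> 'm \<Rightarrow> 'n \<Rightarrow> bool" where
  "occurring = occurs"

lemma tsum_mem:
  assumes "abelian_group P" "xs \<in> lists (A \<times> B)"
    and "\<And>m n. m \<in> A \<Longrightarrow> n \<in> B \<Longrightarrow> f m n \<in> carrier P"
  shows "tsum P f xs \<in> carrier P"
proof -
  interpret P: abelian_group P by fact
  show ?thesis using assms(2,3) by (induction xs) auto
qed

lemma tsum_add:
  assumes "abelian_group P" "xs \<in> lists (A \<times> B)"
    and "\<And>m n. m \<in> A \<Longrightarrow> n \<in> B \<Longrightarrow> f m n \<in> carrier P"
    and "\<And>m n. m \<in> A \<Longrightarrow> n \<in> B \<Longrightarrow> g m n \<in> carrier P"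
  shows "tsum P (\<lambda>m n. f m n \<oplus>\<^bsub>P\<^esub> g m n) xs = tsum P f xs \<oplus>\<^bsub>P\<^esub> tsum P g xs"
proof -
  interpret P: abelian_group P by fact
  show ?thesis
    using assms(2-4) by (induction xs) (auto simp: P.a_ac tsum_mem[OF assms(1), of _ A B])
qed

context
  fixes k :: "('k, 'x) ring_scheme" and M :: "('k, 'm, 'y) module_scheme"
    and N :: "('k, 'n, 'z) module_scheme"
  assumes M: "module k M" and N: "module k N"
begin

lemma tensor_rep:
  assumes "t \<in> carrier (tensor_module k M N)"
  shows "(SOME xs. xs \<in> t) \<in> t" "(SOME xs. xs \<in> t) \<in> lists (carrier M \<times> carrier N)"
    "t = tensor_class k M N (SOME xs. xs \<in> t)"
proof -
  obtain xs where "xs \<in> lists (carrier M \<times> carrier N)" "t = tensor_class k M N xs"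
    using assms unfolding tensor_carrier[OF M N] by (rule imageE)
  then have "xs \<in> t" using tensor_class_self[OF M N] by simp
  then show 1: "(SOME xs. xs \<in> t) \<in> t" by (rule someI[where P = "\<lambda>xs. xs \<in> t"])
  show "(SOME xs. xs \<in> t) \<in> lists (carrier M \<times> carrier N)"
    "t = tensor_class k M N (SOME xs. xs \<in> t)"
    using tensor_memD[OF M N assms 1] by (rule conjunct1, rule conjunct2)
qed

lemma occurs_iff:
  assumes "t \<in> carrier (tensor_module k M N)"
  shows "occurs t m n \<longleftrightarrow> m \<in> carrier M \<and> n \<in> carrier N \<and> occurring t m n"
  using tensor_rep(2)[OF assms] by (auto simp: occurs_def occurring_def)

lemma occurs_lift_iff:
  assumes "t \<in> carrier (tensor_module k M N)"
  shows "occurs_lift t m n \<longleftrightarrow> m \<in> carrier M \<and> n \<in> carrier N \<and> occurring_lift t m n"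
  using tensor_memD[OF M N assms] by (fastforce simp: occurs_lift_def occurring_lift_def)

text \<open>For bilinear \<open>f\<close> all words of \<open>t\<close> have the same value, in
  particular the chosen one. This is the bridge from the definitions to the calculus with
  \<open>sw\<close>.\<close>

lemma tensor_lift_eq_sw:
  assumes "module k P" "bilin k M N P f" "t \<in> carrier (tensor_module k M N)"
  shows "tensor_lift P f t = sw P f t"
  using tensor_lift_class[OF M N assms(1,2) tensor_rep(2)[OF assms(3)]] tensor_rep(3)[OF assms(3)]
  by (simp add: sw_def)

lemma sw_pure [simp]:
  assumes "module k P" "bilin k M N P f" "m \<in> carrier M" "n \<in> carrier N"
  shows "sw P f (pure_tensor k M N m n) = f m n"
  using assms M N by (simp flip: tensor_lift_eq_sw)

text \<open>The chosen word is read back as a sum of pure tensors. At the end of a calculation this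
  turns a Sweedler expression into the tensor itself.\<close>

lemma sw_pures:
  assumes "t \<in> carrier (tensor_module k M N)"
  shows "sw (tensor_module k M N) (pure_tensor k M N) t = t"
proof -
  have "tsum (tensor_module k M N) (pure_tensor k M N) xs = tensor_class k M N xs"
    if "xs \<in> lists (carrier M \<times> carrier N)" for xs
    using that by (induction xs) (auto simp: tensor_zero[OF M N] tensor_Cons[OF M N])
  then show ?thesis
    using tensor_rep[OF assms] by (simp add: sw_def)
qed

lemma sw_closed:
  assumes "module k P" "t \<in> carrier (tensor_module k M N)"
    and "\<And>m n. m \<in> carrier M \<Longrightarrow> n \<in> carrier N \<Longrightarrow> f m n \<in> carrier P"
  shows "sw P f t \<in> carrier P"
proof -
  interpret P: module k P by fact
  show ?thesis
    unfolding sw_def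
    by (rule tsum_mem[OF P.abelian_group_axioms tensor_rep(2)[OF assms(2)] assms(3)])
qed

text \<open>Additivity of \<open>g\<close> along the single chosen word; \<open>f\<close> ranges
  over arbitrary functions into \<open>P\<close>.\<close>

lemma sw_push:
  assumes "module k P" "module k Q" "t \<in> carrier (tensor_module k M N)" "lin k P Q g"
    and "\<And>m n. m \<in> carrier M \<Longrightarrow> n \<in> carrier N \<Longrightarrow> f m n \<in> carrier P"
  shows "g (sw P f t) = sw Q (\<lambda>m n. g (f m n)) t"
proof -
  interpret P: module k P by fact
  have "g (tsum P f xs) = tsum Q (\<lambda>m n. g (f m n)) xs \<and> tsum P f xs \<in> carrier P"
    if "xs \<in> lists (carrier M \<times> carrier N)" for xs
    using that assms by (induction xs) (auto simp: lin_add[OF assms(4)] lin_zero[OF assms(1,2,4)])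
  then show ?thesis using tensor_rep(2)[OF assms(3)] by (simp add: sw_def)
qed

lemma lin_sw_body:
  assumes "module k P" "module k L" "t \<in> carrier (tensor_module k M N)"
    and li: "\<And>m n. m \<in> carrier M \<Longrightarrow> n \<in> carrier N \<Longrightarrow> lin k L P (\<lambda>x. F x m n)"
  shows "lin k L P (\<lambda>x. sw P (F x) t)"
proof -
  interpret P: module k P by fact
  interpret L: module k L by fact
  have "lin k L P (\<lambda>x. tsum P (F x) xs)" if "xs \<in> lists (carrier M \<times> carrier N)" for xs
    using that
  proof (induction xs)
    case Nil
    show ?case by (intro linI) simp_all
  next
    case (Cons p xs)
    obtain m n where p: "p = (m, n)" by (cases p)
    note li' = li[of m n] and IH = Cons.IH
    show ?case
      using Cons.hyps IH li' lin_closed[OF li'] lin_closed[OF IH] lin_add[OF li'] lin_add[OF IH]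
        lin_smult[OF li'] lin_smult[OF IH]
      by (intro linI) (simp_all add: p P.smult_r_distr P.M.a_ac)
  qed
  then show ?thesis using tensor_rep(2)[OF assms(3)] by (simp add: sw_def cong del: lin_weak_cong)
qed

lemma lin_sw_self:
  assumes "module k P" "bilin k M N P f"
  shows "lin k (tensor_module k M N) P (sw P f)"
  using lin_tensor_lift_self[OF M N assms]
  by (subst lin_cong[where g = "tensor_lift P f"]) (simp_all add: tensor_lift_eq_sw assms M N)

lemma tensor_map_eq_sw:
  assumes "module k M'" "module k N'" "lin k M M' f" "lin k N N' g"
    "t \<in> carrier (tensor_module k M N)"
  shows "tensor_map k M' N' f g t = sw (tensor_module k M' N') (\<lambda>x y. pure_tensor k M' N' (f x) (g
    y)) t"
  unfolding tensor_map_def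
  by (intro tensor_lift_eq_sw module_tensor assms bilin_pure_comp)

end

text \<open>Interchange of two finite sums over fixed words, so the summand may depend on its four
  arguments in any way.\<close>

lemma sw_swap:
  assumes M: "module k M" and N: "module k N" and "module k A" "module k B" "module k P"
    and "s \<in> carrier (tensor_module k M N)" "t \<in> carrier (tensor_module k A B)"
    and cl: "\<And>x y m n. x \<in> carrier A \<Longrightarrow> y \<in> carrier B \<Longrightarrow> m \<in> carrier M \<Longrightarrow> n \<in> carrier N
      \<Longrightarrow> F x y m n \<in> carrier P"
  shows "sw P (\<lambda>x y. sw P (F x y) s) t = sw P (\<lambda>m n. sw P (\<lambda>x y. F x y m n) t) s"
proof -
  interpret P: module k P by fact
  have zero: "foldr (\<lambda>a. (\<oplus>\<^bsub>P\<^esub>) \<zero>\<^bsub>P\<^esub>) xs \<zero>\<^bsub>P\<^esub> = \<zero>\<^bsub>P\<^esub>" for xs :: "('m \<times> 'n) list"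
    by (induction xs) auto
  have "tsum P (\<lambda>x y. tsum P (F x y) xs) ys = tsum P (\<lambda>m n. tsum P (\<lambda>x y. F x y m n) ys) xs"
    if xs: "xs \<in> lists (carrier M \<times> carrier N)" and "ys \<in> lists (carrier A \<times> carrier B)" for xs ys
    using that(2)
  proof (induction ys)
    case Nil
    then show ?case by (simp add: zero)
  next
    case (Cons p ys)
    then show ?case
      using cl by (cases p)
        (auto simp: tsum_add[OF P.abelian_group_axioms xs] tsum_mem[OF P.abelian_group_axioms, of _
          "carrier A" "carrier B"])
  qed
  then show ?thesis
    using tensor_rep(2)[OF M N assms(6)] tensor_rep(2)[OF assms(3,4,7)] by (simp add: sw_def)
qed

text \<open>The word chosen for the image of \<open>t\<close> has no relation to the image of the
  word chosen for \<open>t\<close>. Bilinearity of \<open>F\<close> bridges this, by a detour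
  through \<open>tensor_lift\<close>.\<close>

lemma sw_tensor_map:
  assumes "module k M" "module k N" "module k M'" "module k N'" "lin k M M' f" "lin k N N' g"
    and "module k P" "t \<in> carrier (tensor_module k M N)" "bilin k M' N' P F"
  shows "sw P F (tensor_map k M' N' f g t) = sw P (\<lambda>x y. F (f x) (g y)) t"
proof -
  have F: "bilin k M N P (\<lambda>x y. F (f x) (g y))"
    using lin_comp[OF bilinD1[OF assms(9)] assms(5)] lin_comp[OF bilinD2[OF assms(9)] assms(6)]
    by (intro bilinI) (simp_all add: lin_closed[OF assms(5)] lin_closed[OF assms(6)])
  have "sw P F (tensor_map k M' N' f g t) = tensor_lift P F (tensor_map k M' N' f g t)"
    by (rule tensor_lift_eq_sw[OF assms(3,4,7,9) lin_closed[OF lin_tensor_map[OF assms(1-6)]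
      assms(8)], symmetric])
  also have "\<dots> = tensor_lift P (\<lambda>x y. F (f x) (g y)) t"
    by (rule tensor_lift_tensor_map[OF assms(1-7,9,8)])
  also have "\<dots> = sw P (\<lambda>x y. F (f x) (g y)) t"
    by (rule tensor_lift_eq_sw[OF assms(1,2,7) F assms(8)])
  finally show ?thesis .
qed

section \<open>Sweedler calculus in a Hopf algebra\<close>

lemma module_base [simp]: "field k \<Longrightarrow> module k (base_module k)"
proof -
  assume "field k"
  then interpret field k .
  show ?thesis
    by (rule moduleI)
      (auto simp: base_module_def l_distr r_distr m_assoc is_cring intro!: abelian_groupI a_assoc
        a_comm
        intro: l_neg add.inv_closed)
qed

locale hopf_algebra_bij = hopf_algebra k H
  for k :: "('k, 'x) ring_scheme" and H :: "('k, 'h, 'y) hopf_scheme" +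
  assumes antipode_bij: "bij_betw (antipode H) (carrier H) (carrier H)"
begin

abbreviation HH where "HH \<equiv> tensor_module k H H"

lemma field_k [simp]: "field k" ..

lemma mod_H [simp]: "module k H" ..

lemma ring_H: "ring H" ..

lemma semiring_H: "semiring H" ..

lemma lin_mult_left [simp]:
  "lin k L H f \<Longrightarrow> y \<in> carrier H \<Longrightarrow> lin k L H (\<lambda>x. f x \<otimes>\<^bsub>H\<^esub> y)"
  by (rule lin_comp[where M = H and g = "\<lambda>x. x \<otimes>\<^bsub>H\<^esub> y"])
    (auto intro!: linI simp: semiring.l_distr[OF semiring_H] smult_mult_left)

lemma lin_mult_right [simp]:
  "lin k L H f \<Longrightarrow> y \<in> carrier H \<Longrightarrow> lin k L H (\<lambda>x. y \<otimes>\<^bsub>H\<^esub> f x)"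
  by (rule lin_comp[where M = H and g = "\<lambda>x. y \<otimes>\<^bsub>H\<^esub> x"])
    (auto intro!: linI simp: semiring.r_distr[OF semiring_H] smult_mult_right)

lemma lin_comult: "lin k H HH (comult H)"
  using comult_linear by (simp add: lin_def)

lemma comult_closed [simp]: "h \<in> carrier H \<Longrightarrow> comult H h \<in> carrier HH"
  by (rule lin_closed[OF lin_comult])

lemma lin_counit: "lin k H (base_module k) (counit H)"
  using counit_linear by (simp add: lin_def)

lemma counit_closed [simp]: "h \<in> carrier H \<Longrightarrow> counit H h \<in> carrier k"
  using lin_closed[OF lin_counit] by (simp add: base_module_def)

lemma counit_mult [simp]:
  "x \<in> carrier H \<Longrightarrow> y \<in> carrier H \<Longrightarrow> counit H (x \<otimes>\<^bsub>H\<^esub> y) = counit H x \<otimes>\<^bsub>k\<^esub> counit H y"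
  and counit_one [simp]: "counit H \<one>\<^bsub>H\<^esub> = \<one>\<^bsub>k\<^esub>"
  using counit_ring_hom by (auto simp: ring_hom_def)

lemma lin_counit_smult [simp]:
  assumes "module k P" "lin k L H f" "p \<in> carrier P"
  shows "lin k L P (\<lambda>x. counit H (f x) \<odot>\<^bsub>P\<^esub> p)"
proof -
  interpret P: module k P by fact
  have "lin k H P (\<lambda>x. counit H x \<odot>\<^bsub>P\<^esub> p)"
    using assms(3) lin_add[OF lin_counit] lin_smult[OF lin_counit]
    by (intro linI) (auto simp: base_module_def P.smult_l_distr P.smult_assoc1)
  then show ?thesis by (rule lin_comp) (rule assms)
qed

lemma lin_antipode_self: "lin k H H (antipode H)"
  using antipode_linear by (simp add: lin_def)

lemmas lin_antipode [simp] = lin_comp[OF lin_antipode_self]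

lemma antipode_closed [simp]: "h \<in> carrier H \<Longrightarrow> antipode H h \<in> carrier H"
  by (rule lin_closed[OF lin_antipode_self])

definition sinv :: "'h \<Rightarrow> 'h" where
  "sinv = inv_into (carrier H) (antipode H)"

lemma sinv_closed [simp]: "h \<in> carrier H \<Longrightarrow> sinv h \<in> carrier H"
  using antipode_bij unfolding sinv_def by (metis bij_betw_def inv_into_into)

lemma antipode_sinv [simp]: "h \<in> carrier H \<Longrightarrow> antipode H (sinv h) = h"
  using antipode_bij unfolding sinv_def by (metis bij_betw_def f_inv_into_f)

lemma sinv_antipode [simp]: "h \<in> carrier H \<Longrightarrow> sinv (antipode H h) = h"
  using antipode_bij unfolding sinv_def by (metis bij_betw_def inv_into_f_f)

lemma sinv_eqI: "x \<in> carrier H \<Longrightarrow> antipode H x = h \<Longrightarrow> sinv h = x"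
  by auto

lemma lin_sinv_self: "lin k H H sinv"
  by (intro linI sinv_eqI)
    (simp_all add: lin_add[OF lin_antipode_self] lin_smult[OF lin_antipode_self])

lemmas lin_sinv [simp] = lin_comp[OF lin_sinv_self]

section \<open>Rewriting rules for sums over a coproduct\<close>

context
  fixes P :: "('k, 'p, 'w) module_scheme"
  assumes P [simp]: "module k P"
begin

lemma lift_comult [simp]:
  "bilin k H H P f \<Longrightarrow> h \<in> carrier H \<Longrightarrow> tensor_lift P f (comult H h) = sw P f (comult H h)"
  by (rule tensor_lift_eq_sw[of k H H]) simp_all

lemma sw_comult_closed [simp]:
  "h \<in> carrier H \<Longrightarrow> (\<And>x y. x \<in> carrier H \<Longrightarrow> y \<in> carrier H \<Longrightarrow> f x y \<in> carrier P)
    \<Longrightarrow> sw P f (comult H h) \<in> carrier P"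
  by (rule sw_closed[of k H H]) simp_all

lemma lin_comult_body [simp]:
  "module k L \<Longrightarrow> h \<in> carrier H \<Longrightarrow>
    (\<And>m n. m \<in> carrier H \<Longrightarrow> n \<in> carrier H \<Longrightarrow> lin k L P (\<lambda>x. F x m n)) \<Longrightarrow>
    lin k L P (\<lambda>x. sw P (F x) (comult H h))"
  by (rule lin_sw_body[of k H H]) simp_all

lemma lin_comult_arg [simp]:
  "bilin k H H P f \<Longrightarrow> lin k L H t \<Longrightarrow> lin k L P (\<lambda>x. sw P f (comult H (t x)))"
  by (rule lin_comp[OF lin_comp[OF lin_sw_self lin_comult]]) simp_all

end

lemma occurs_comult [simp]:
  "h \<in> carrier H \<Longrightarrow> occurs (comult H h) x y \<longleftrightarrow> x \<in> carrier H \<and> y \<in> carrier H \<and> occurring (comult H h)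
    x y"
  by (rule occurs_iff[of k]) simp_all

lemma occurs_lift_comult [simp]:
  "h \<in> carrier H \<Longrightarrow>
    occurs_lift (comult H h) x y \<longleftrightarrow> x \<in> carrier H \<and> y \<in> carrier H \<and> occurring_lift (comult H h) x y"
  by (rule occurs_lift_iff[of k]) simp_all

lemma sw_comult_cong:
  "h \<in> carrier H \<Longrightarrow> (\<And>x y. x \<in> carrier H \<Longrightarrow> y \<in> carrier H \<Longrightarrow> f x y = g x y)
    \<Longrightarrow> sw P f (comult H h) = sw P g (comult H h)"
  by simp

lemma comult_push:
  assumes "module k P" "module k Q" "h \<in> carrier H" "lin k P Q g"
    and "\<And>x y. x \<in> carrier H \<Longrightarrow> y \<in> carrier H \<Longrightarrow> f x y \<in> carrier P"
  shows "g (sw P f (comult H h)) = sw Q (\<lambda>x y. g (f x y)) (comult H h)"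
  by (rule sw_push[of k H H]) (use assms in simp_all)

text \<open>The two hypotheses on \<open>F\<close> say that it is trilinear. The axiom equates two
  elements of \<open>H \<otimes> (H \<otimes> H)\<close>, and applying the linear map
  \<open>?\<Phi>\<close> induced by \<open>F\<close> yields the two ways of nesting the
  sums.\<close>

lemma sw_coassoc:
  assumes P [simp]: "module k P" and h: "h \<in> carrier H"
    and F: "\<And>z. z \<in> carrier H \<Longrightarrow> bilin k H H P (\<lambda>x y. F x y z)"
      "\<And>x. x \<in> carrier H \<Longrightarrow> bilin k H H P (\<lambda>y z. F x y z)"
  shows "sw P (\<lambda>x z. sw P (\<lambda>x1 x2. F x1 x2 z) (comult H x)) (comult H h)
    = sw P (\<lambda>x y. sw P (\<lambda>y z. F x y z) (comult H y)) (comult H h)"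
proof -
  note [simp] = bilinD1[OF F(1)] bilinD2[OF F(1)] bilinD1[OF F(2)] bilinD2[OF F(2)] h
  have cl [simp]: "F x y z \<in> carrier P" if "x \<in> carrier H" "y \<in> carrier H" "z \<in> carrier H" for x y z
    using bilin_closed[OF F(2)] that by simp
  let ?Q = "tensor_module k H HH"
  let ?\<Phi> = "sw P (\<lambda>x s. sw P (\<lambda>y z. F x y z) s)"
  have bi: "bilin k H HH P (\<lambda>x s. sw P (\<lambda>y z. F x y z) s)"
    by (intro bilinI lin_sw_body[of k H H] lin_sw_self) simp_all
  have \<Phi>: "lin k ?Q P ?\<Phi>"
    by (rule lin_sw_self[OF _ _ P bi]) simp_all
  have pure: "?\<Phi> (pure_tensor k H HH x (pure_tensor k H H y z)) = F x y z"
    if "x \<in> carrier H" "y \<in> carrier H" "z \<in> carrier H" for x y z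
    using that by (subst sw_pure[OF _ _ P bi]) simp_all
  have "?\<Phi> (sw ?Q (\<lambda>x z. sw ?Q (\<lambda>x1 x2. pure_tensor k H HH x1 (pure_tensor k H H x2 z)) (comult H
    x)) (comult H h))
    = sw P (\<lambda>x z. sw P (\<lambda>x1 x2. F x1 x2 z) (comult H x)) (comult H h)"
    by (simp add: comult_push[OF _ P _ \<Phi>] pure)
  moreover have "?\<Phi> (tensor_map k H HH (\<lambda>x. x) (comult H) (comult H h))
    = sw P (\<lambda>x y. sw P (\<lambda>y z. F x y z) (comult H y)) (comult H h)"
    by (rule sw_tensor_map[OF mod_H mod_H _ _ _ _ P _ bi]) (simp_all add: lin_comult)
  moreover have "sw ?Q (\<lambda>x z. sw ?Q (\<lambda>x1 x2. pure_tensor k H HH x1 (pure_tensor k H H x2 z)) (comult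
    H x)) (comult H h)
      = tensor_map k H HH (\<lambda>x. x) (comult H) (comult H h)"
    using coassoc[OF h] by simp
  ultimately show ?thesis by metis
qed

lemma sw_counit_left:
  assumes [simp]: "module k P" "h \<in> carrier H" and f: "lin k H P f"
  shows "sw P (\<lambda>x y. counit H x \<odot>\<^bsub>P\<^esub> f y) (comult H h) = f h"
proof -
  note [simp] = lin_closed[OF f] lin_smult[OF f]
  have "f (sw H (\<lambda>x y. counit H x \<odot>\<^bsub>H\<^esub> y) (comult H h)) = sw P (\<lambda>x y. counit H x \<odot>\<^bsub>P\<^esub> f y) (comult H
    h)"
    by (simp add: comult_push[OF _ _ _ f])
  then show ?thesis using counit_left[of h] by simp
qed

lemma sw_counit_right:
  assumes [simp]: "module k P" "h \<in> carrier H" and f: "lin k H P f"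
  shows "sw P (\<lambda>x y. counit H y \<odot>\<^bsub>P\<^esub> f x) (comult H h) = f h"
proof -
  note [simp] = lin_closed[OF f] lin_smult[OF f]
  have "f (sw H (\<lambda>x y. counit H y \<odot>\<^bsub>H\<^esub> x) (comult H h)) = sw P (\<lambda>x y. counit H y \<odot>\<^bsub>P\<^esub> f x) (comult H
    h)"
    by (simp add: comult_push[OF _ _ _ f])
  then show ?thesis using counit_right[of h] by simp
qed

lemma sw_antipode_left:
  assumes [simp]: "module k P" "h \<in> carrier H" and f: "lin k H P f"
  shows "sw P (\<lambda>x y. f (antipode H x \<otimes>\<^bsub>H\<^esub> y)) (comult H h) = counit H h \<odot>\<^bsub>P\<^esub> f \<one>\<^bsub>H\<^esub>"
  using antipode_left[of h] lin_smult[OF f, of "counit H h" "\<one>\<^bsub>H\<^esub>"]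
    comult_push[OF _ _ _ f, of h "\<lambda>x y. antipode H x \<otimes>\<^bsub>H\<^esub> y"] by simp

lemma sw_antipode_right:
  assumes [simp]: "module k P" "h \<in> carrier H" and f: "lin k H P f"
  shows "sw P (\<lambda>x y. f (x \<otimes>\<^bsub>H\<^esub> antipode H y)) (comult H h) = counit H h \<odot>\<^bsub>P\<^esub> f \<one>\<^bsub>H\<^esub>"
  using antipode_right[of h] lin_smult[OF f, of "counit H h" "\<one>\<^bsub>H\<^esub>"]
    comult_push[OF _ _ _ f, of h "\<lambda>x y. x \<otimes>\<^bsub>H\<^esub> antipode H y"] by simp

text \<open>The product is a union over all representatives of the classes of product words. Each of
  these classes equals the double Sweedler sum, which depends only on \<open>s\<close> and
  \<open>t\<close>, so the union is one class.\<close>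

lemma tensor_mult_eq_sw:
  assumes s: "s \<in> carrier HH" and t: "t \<in> carrier HH"
  shows "s \<otimes>\<^bsub>HH\<^esub> t = sw HH (\<lambda>m n. sw HH (\<lambda>m' n'. pure_tensor k H H (m \<otimes>\<^bsub>H\<^esub> m') (n \<otimes>\<^bsub>H\<^esub> n')) t) s"
proof -
  note in_lists_conv_set [simp del]
  let ?f = "\<lambda>m n m' n'. pure_tensor k H H (m \<otimes>\<^bsub>H\<^esub> m') (n \<otimes>\<^bsub>H\<^esub> n')"
  let ?L = "lists (carrier H \<times> carrier H)"
  let ?prod = "\<lambda>xs ys. [(m \<otimes>\<^bsub>H\<^esub> m', n \<otimes>\<^bsub>H\<^esub> n'). (m, n) \<leftarrow> xs, (m', n') \<leftarrow> ys]"
  have inner: "map (\<lambda>(m', n'). (m \<otimes>\<^bsub>H\<^esub> m', n \<otimes>\<^bsub>H\<^esub> n')) ys \<in> ?L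
      \<and> tsum HH (?f m n) ys = tensor_class k H H (map (\<lambda>(m', n'). (m \<otimes>\<^bsub>H\<^esub> m', n \<otimes>\<^bsub>H\<^esub> n')) ys)"
    if "ys \<in> ?L" "m \<in> carrier H" "n \<in> carrier H" for m n ys
    using that(1)
    by (induction ys) (simp_all add: tensor_zero[OF mod_H mod_H] tensor_Cons[OF mod_H mod_H] that
      split_beta mem_Times_iff)
  have outer: "?prod xs ys \<in> ?L \<and> tsum HH (\<lambda>m n. tsum HH (?f m n) ys) xs
    = tensor_class k H H (?prod xs ys)"
    if "xs \<in> ?L" "ys \<in> ?L" for xs ys
    using that(1)
  proof (induction xs)
    case Nil
    then show ?case by (simp add: tensor_zero)
  next
    case (Cons p xs)
    obtain m n where p: "p = (m, n)" by (cases p)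
    with Cons.hyps have mn: "m \<in> carrier H" "n \<in> carrier H" by auto
    show ?case
      using Cons.IH inner[OF that(2) mn] by (simp add: p tensor_add[of k H H] del: map_append)
  qed
  have bi': "bilin k H H HH (?f m n)" if "m \<in> carrier H" "n \<in> carrier H" for m n
    using that by simp
  have bi: "bilin k H H HH (\<lambda>m n. sw HH (?f m n) t)"
    using t by (intro bilinI lin_sw_body[of k H H]) simp_all
  have "tensor_class k H H (?prod xs ys) = sw HH (\<lambda>m n. sw HH (?f m n) t) s" if "xs \<in> s" "ys \<in> t"
    for xs ys
  proof -
    have xs: "xs \<in> ?L" "s = tensor_class k H H xs" and ys: "ys \<in> ?L" "t = tensor_class k H H ys"
      using tensor_memD[OF mod_H mod_H s that(1)] tensor_memD[OF mod_H mod_H t that(2)] by auto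
    have a: "sw HH (?f m n) t = tsum HH (?f m n) ys" if "m \<in> carrier H" "n \<in> carrier H" for m n
      using tensor_lift_class[OF _ _ _ bi'[OF that] ys(1)] tensor_lift_eq_sw[OF _ _ _ bi'[OF that]
        t] ys(2)
      by simp
    have "sw HH (\<lambda>m n. sw HH (?f m n) t) s = tsum HH (\<lambda>m n. sw HH (?f m n) t) xs"
      using tensor_lift_class[OF _ _ _ bi xs(1)] tensor_lift_eq_sw[OF _ _ _ bi s] xs(2) by simp
    also have "\<dots> = tsum HH (\<lambda>m n. tsum HH (?f m n) ys) xs"
      using xs(1) by (induction xs) (auto simp: a)
    finally show ?thesis using outer[OF xs(1) ys(1)] by simp
  qed
  then have "(\<Union>xs\<in>s. \<Union>ys\<in>t. tensor_class k H H (?prod xs ys)) = (\<Union>xs\<in>s. \<Union>ys\<in>t. sw HH (\<lambda>m n. sw HH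
    (?f m n) t) s)"
    by simp
  also have "\<dots> = sw HH (\<lambda>m n. sw HH (?f m n) t) s"
    using tensor_rep(1)[OF mod_H mod_H s] tensor_rep(1)[OF mod_H mod_H t] by auto
  finally show ?thesis by (simp add: tensor_module_def)
qed

lemma sw_comult_mult:
  assumes [simp]: "module k P" "g \<in> carrier H" "h \<in> carrier H" and F: "bilin k H H P F"
  shows "sw P F (comult H (g \<otimes>\<^bsub>H\<^esub> h))
    = sw P (\<lambda>g1 g2. sw P (\<lambda>h1 h2. F (g1 \<otimes>\<^bsub>H\<^esub> h1) (g2 \<otimes>\<^bsub>H\<^esub> h2)) (comult H h)) (comult H g)"
proof -
  have "comult H (g \<otimes>\<^bsub>H\<^esub> h) = comult H g \<otimes>\<^bsub>HH\<^esub> comult H h"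
    using comult_ring_hom by (simp add: ring_hom_def)
  also have "\<dots> = sw HH (\<lambda>g1 g2. sw HH (\<lambda>h1 h2. pure_tensor k H H (g1 \<otimes>\<^bsub>H\<^esub> h1) (g2 \<otimes>\<^bsub>H\<^esub> h2)) (comult
    H h)) (comult H g)"
    by (rule tensor_mult_eq_sw) simp_all
  finally show ?thesis
    by (simp add: comult_push[OF _ _ _ lin_sw_self[OF mod_H mod_H assms(1) F]] sw_pure[OF _ _ _ F])
qed

lemma sw_comult_one:
  assumes "module k P" "bilin k H H P F"
  shows "sw P F (comult H \<one>\<^bsub>H\<^esub>) = F \<one>\<^bsub>H\<^esub> \<one>\<^bsub>H\<^esub>"
proof -
  have "comult H \<one>\<^bsub>H\<^esub> = \<one>\<^bsub>HH\<^esub>"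
    using comult_ring_hom by (simp add: ring_hom_def)
  then have "comult H \<one>\<^bsub>H\<^esub> = pure_tensor k H H \<one>\<^bsub>H\<^esub> \<one>\<^bsub>H\<^esub>"
    by (simp add: tensor_module_def pure_tensor_def)
  then show ?thesis using assms by simp
qed

lemma assoc_H: "x \<in> carrier H \<Longrightarrow> y \<in> carrier H \<Longrightarrow> z \<in> carrier H
    \<Longrightarrow> x \<otimes>\<^bsub>H\<^esub> y \<otimes>\<^bsub>H\<^esub> z = x \<otimes>\<^bsub>H\<^esub> (y \<otimes>\<^bsub>H\<^esub> z)"
  using ring.is_monoid[OF ring_H] by (auto simp: monoid.m_assoc monoid.m_closed monoid.one_closed)

text \<open>
  Both sides arise from \<open>S(g\<^sub>1 h\<^sub>1) g\<^sub>2 h\<^sub>2 S(h\<^sub>3) S(g\<^sub>3)\<close>, by cancelling from the right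
    and from the left.
\<close>

lemma antipode_mult:
  assumes [simp]: "g \<in> carrier H" "h \<in> carrier H"
  shows "antipode H (g \<otimes>\<^bsub>H\<^esub> h) = antipode H h \<otimes>\<^bsub>H\<^esub> antipode H g"
proof -
  let ?S = "antipode H"
  let ?G = "\<lambda>g1 g2 g3 h1 h2 h3. ?S (g1 \<otimes>\<^bsub>H\<^esub> h1) \<otimes>\<^bsub>H\<^esub> (g2 \<otimes>\<^bsub>H\<^esub> ((h2 \<otimes>\<^bsub>H\<^esub> ?S h3) \<otimes>\<^bsub>H\<^esub> ?S g3))"
  let ?F = "\<lambda>g1 g2 g3. sw H (\<lambda>h1 h'. sw H (\<lambda>h2 h3. ?G g1 g2 g3 h1 h2 h3) (comult H h')) (comult H
    h)"
  let ?X = "sw H (\<lambda>g1 g'. sw H (\<lambda>g2 g3. ?F g1 g2 g3) (comult H g')) (comult H g)"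
  \<comment> \<open>Evaluation from the right: \<open>h\<^sub>2 S(h\<^sub>3)\<close> collapses, then
    the counit absorbs the leftover leg, and the same is repeated for
    \<open>g\<^sub>2 S(g\<^sub>3)\<close>.\<close>
  have r1: "sw H (\<lambda>h2 h3. ?G g1 g2 g3 h1 h2 h3) (comult H h')
      = counit H h' \<odot>\<^bsub>H\<^esub> (?S (g1 \<otimes>\<^bsub>H\<^esub> h1) \<otimes>\<^bsub>H\<^esub> (g2 \<otimes>\<^bsub>H\<^esub> ?S g3))"
    if [simp]: "g1 \<in> carrier H" "g2 \<in> carrier H" "g3 \<in> carrier H" "h1 \<in> carrier H" "h' \<in> carrier H"
    for g1 g2 g3 h1 h'
    using sw_antipode_right[of H h' "\<lambda>z. ?S (g1 \<otimes>\<^bsub>H\<^esub> h1) \<otimes>\<^bsub>H\<^esub> (g2 \<otimes>\<^bsub>H\<^esub> (z \<otimes>\<^bsub>H\<^esub> ?S g3))"] by simp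
  have r2: "?F g1 g2 g3 = ?S (g1 \<otimes>\<^bsub>H\<^esub> h) \<otimes>\<^bsub>H\<^esub> (g2 \<otimes>\<^bsub>H\<^esub> ?S g3)"
    if [simp]: "g1 \<in> carrier H" "g2 \<in> carrier H" "g3 \<in> carrier H" for g1 g2 g3
    using sw_counit_right[of H h "\<lambda>h1. ?S (g1 \<otimes>\<^bsub>H\<^esub> h1) \<otimes>\<^bsub>H\<^esub> (g2 \<otimes>\<^bsub>H\<^esub> ?S g3)"] by (simp add: r1)
  have r3: "sw H (\<lambda>g2 g3. ?S (g1 \<otimes>\<^bsub>H\<^esub> h) \<otimes>\<^bsub>H\<^esub> (g2 \<otimes>\<^bsub>H\<^esub> ?S g3)) (comult H g')
    = counit H g' \<odot>\<^bsub>H\<^esub> ?S (g1 \<otimes>\<^bsub>H\<^esub> h)"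
    if [simp]: "g1 \<in> carrier H" "g' \<in> carrier H" for g1 g'
    using sw_antipode_right[of H g' "\<lambda>z. ?S (g1 \<otimes>\<^bsub>H\<^esub> h) \<otimes>\<^bsub>H\<^esub> z"] by simp
  have right: "?X = ?S (g \<otimes>\<^bsub>H\<^esub> h)"
    using sw_counit_right[of H g "\<lambda>g1. ?S (g1 \<otimes>\<^bsub>H\<^esub> h)"] by (simp add: r2 r3)
  \<comment> \<open>Evaluation from the left: as \<open>\<Delta>\<close> is multiplicative,
    \<open>S(g\<^sub>1 h\<^sub>1) g\<^sub>2 h\<^sub>2\<close> is the left antipode expression for
    the single element \<open>g' h'\<close>.\<close>
  have l1: "sw H (\<lambda>g1 g2. sw H (\<lambda>h1 h2. ?G g1 g2 g3 h1 h2 h3) (comult H h')) (comult H g')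
      = counit H g' \<odot>\<^bsub>H\<^esub> (counit H h' \<odot>\<^bsub>H\<^esub> (?S h3 \<otimes>\<^bsub>H\<^esub> ?S g3))"
    if [simp]: "g' \<in> carrier H" "g3 \<in> carrier H" "h' \<in> carrier H" "h3 \<in> carrier H" for g' g3 h' h3
  proof -
    have "sw H (\<lambda>g1 g2. sw H (\<lambda>h1 h2. ?G g1 g2 g3 h1 h2 h3) (comult H h')) (comult H g')
      = sw H (\<lambda>x y. (?S x \<otimes>\<^bsub>H\<^esub> y) \<otimes>\<^bsub>H\<^esub> (?S h3 \<otimes>\<^bsub>H\<^esub> ?S g3)) (comult H (g' \<otimes>\<^bsub>H\<^esub> h'))"
      by (simp add: sw_comult_mult) (simp add: assoc_H)
    also have "\<dots> = counit H (g' \<otimes>\<^bsub>H\<^esub> h') \<odot>\<^bsub>H\<^esub> (?S h3 \<otimes>\<^bsub>H\<^esub> ?S g3)"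
      by (subst sw_antipode_left[where f = "\<lambda>z. z \<otimes>\<^bsub>H\<^esub> (?S h3 \<otimes>\<^bsub>H\<^esub> ?S g3)"]) simp_all
    finally show ?thesis by (simp add: smult_assoc1)
  qed
  have l2: "?F g1 g2 g3 = sw H (\<lambda>h' h3. sw H (\<lambda>h1 h2. ?G g1 g2 g3 h1 h2 h3) (comult H h')) (comult H
    h)"
    if [simp]: "g1 \<in> carrier H" "g2 \<in> carrier H" "g3 \<in> carrier H" for g1 g2 g3
    by (rule sw_coassoc[symmetric]) simp_all
  \<comment> \<open>Both threefold coproducts are regrouped so that the first two legs belong
    together, and the sums over \<open>g\<close> and \<open>h\<close> are interchanged to expose the
    pattern of \<open>l1\<close>.\<close>
  have "?X = sw H (\<lambda>g' g3. sw H (\<lambda>g1 g2. ?F g1 g2 g3) (comult H g')) (comult H g)"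
    by (rule sw_coassoc[symmetric]) simp_all
  also have "\<dots> = sw H (\<lambda>g' g3. sw H (\<lambda>g1 g2. sw H (\<lambda>h' h3. sw H (\<lambda>h1 h2. ?G g1 g2 g3 h1 h2 h3)
      (comult H h')) (comult H h)) (comult H g')) (comult H g)"
    by (simp add: l2)
  also have "\<dots> = sw H (\<lambda>g' g3. sw H (\<lambda>h' h3. sw H (\<lambda>g1 g2. sw H (\<lambda>h1 h2. ?G g1 g2 g3 h1 h2 h3)
      (comult H h')) (comult H g')) (comult H h)) (comult H g)"
    by (rule sw_comult_cong, simp, rule sw_swap[of k H H H H H]) simp_all
  also have "\<dots> = sw H (\<lambda>g' g3. sw H (\<lambda>h' h3. counit H g' \<odot>\<^bsub>H\<^esub> (counit H h' \<odot>\<^bsub>H\<^esub> (?S h3 \<otimes>\<^bsub>H\<^esub> ?S g3)))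
    (comult H h)) (comult H g)"
    by (simp add: l1)
  also have "\<dots> = sw H (\<lambda>g' g3. counit H g' \<odot>\<^bsub>H\<^esub> (?S h \<otimes>\<^bsub>H\<^esub> ?S g3)) (comult H g)"
  proof -
    have "sw H (\<lambda>h' h3. counit H g' \<odot>\<^bsub>H\<^esub> (counit H h' \<odot>\<^bsub>H\<^esub> (?S h3 \<otimes>\<^bsub>H\<^esub> ?S g3))) (comult H h)
      = counit H g' \<odot>\<^bsub>H\<^esub> (?S h \<otimes>\<^bsub>H\<^esub> ?S g3)" if [simp]: "g' \<in> carrier H" "g3 \<in> carrier H" for g' g3
      using sw_counit_left[of H h "\<lambda>h3. ?S h3 \<otimes>\<^bsub>H\<^esub> ?S g3"]
        comult_push[of H H h "\<lambda>z. counit H g' \<odot>\<^bsub>H\<^esub> z" "\<lambda>h' h3. counit H h' \<odot>\<^bsub>H\<^esub> (?S h3 \<otimes>\<^bsub>H\<^esub> ?S g3)"]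
          by simp
    then show ?thesis by simp
  qed
  also have "\<dots> = ?S h \<otimes>\<^bsub>H\<^esub> ?S g"
    using sw_counit_left[of H g "\<lambda>g3. ?S h \<otimes>\<^bsub>H\<^esub> ?S g3"] by simp
  finally show ?thesis using right by simp
qed

lemma antipode_one [simp]: "antipode H \<one>\<^bsub>H\<^esub> = \<one>\<^bsub>H\<^esub>"
  using antipode_left[of "\<one>\<^bsub>H\<^esub>"] sw_comult_one[of H "\<lambda>x y. antipode H x \<otimes>\<^bsub>H\<^esub> y"] by simp

lemma sinv_one [simp]: "sinv \<one>\<^bsub>H\<^esub> = \<one>\<^bsub>H\<^esub>"
  by (rule sinv_eqI) simp_all

lemma sinv_mult:
  "x \<in> carrier H \<Longrightarrow> y \<in> carrier H \<Longrightarrow> sinv (x \<otimes>\<^bsub>H\<^esub> y) = sinv y \<otimes>\<^bsub>H\<^esub> sinv x"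
  by (rule sinv_eqI) (simp_all add: antipode_mult)

text \<open>The inverse antipode reverses products, so applying it to
  \<open>S(h\<^sub>1) h\<^sub>2 = \<epsilon>(h) 1\<close> gives
  \<open>S\<^sup>-\<^sup>1(h\<^sub>2) h\<^sub>1 = \<epsilon>(h) 1\<close>; the linear map
  \<open>f\<close> is applied afterwards.\<close>

lemma sw_sinv:
  assumes [simp]: "module k P" "h \<in> carrier H" and f: "lin k H P f"
  shows "sw P (\<lambda>x y. f (sinv y \<otimes>\<^bsub>H\<^esub> x)) (comult H h) = counit H h \<odot>\<^bsub>P\<^esub> f \<one>\<^bsub>H\<^esub>"
proof -
  have "sinv (sw H (\<lambda>x y. antipode H x \<otimes>\<^bsub>H\<^esub> y) (comult H h)) = sw H (\<lambda>x y. sinv y \<otimes>\<^bsub>H\<^esub> x) (comult H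
    h)"
    by (simp add: comult_push[OF _ _ _ lin_sinv_self] sinv_mult)
  then have "sw H (\<lambda>x y. sinv y \<otimes>\<^bsub>H\<^esub> x) (comult H h) = counit H h \<odot>\<^bsub>H\<^esub> \<one>\<^bsub>H\<^esub>"
    using antipode_left[of h] by (simp add: lin_smult[OF lin_sinv_self])
  then show ?thesis
    using comult_push[OF _ _ _ f, of h "\<lambda>x y. sinv y \<otimes>\<^bsub>H\<^esub> x"] lin_smult[OF f, of "counit H h"
      "\<one>\<^bsub>H\<^esub>"] by simp
qed

text \<open>The contraction \<open>h\<^sub>1 \<otimes> S\<^sup>-\<^sup>1(h\<^sub>3) h\<^sub>2 \<otimes> h\<^sub>4 = h\<^sub>1 \<otimes> 1 \<otimes> h\<^sub>2\<close>.\<close>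

lemma sw_contract:
  assumes P [simp]: "module k P" and h [simp]: "h \<in> carrier H"
    and G1 [simp]: "\<And>y z. y \<in> carrier H \<Longrightarrow> z \<in> carrier H \<Longrightarrow> lin k H P (\<lambda>x. G x y z)"
    and G2 [simp]: "\<And>x z. x \<in> carrier H \<Longrightarrow> z \<in> carrier H \<Longrightarrow> lin k H P (\<lambda>y. G x y z)"
    and G3 [simp]: "\<And>x y. x \<in> carrier H \<Longrightarrow> y \<in> carrier H \<Longrightarrow> lin k H P (\<lambda>z. G x y z)"
  shows "sw P (\<lambda>x y. sw P (\<lambda>x1 x2. sw P (\<lambda>y1 y2. G x1 (sinv y1 \<otimes>\<^bsub>H\<^esub> x2) y2) (comult H y)) (comult H
    x)) (comult H h)
    = sw P (\<lambda>x y. G x \<one>\<^bsub>H\<^esub> y) (comult H h)"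
proof -
  have [simp]: "lin k L P (\<lambda>w. G (f w) y z)" if "lin k L H f" "y \<in> carrier H" "z \<in> carrier H"
    for L :: "('k, 'h, 'y) hopf_scheme" and f y z by (intro lin_comp[OF G1] that)
  have [simp]: "lin k L P (\<lambda>w. G x (f w) z)" if "lin k L H f" "x \<in> carrier H" "z \<in> carrier H"
    for L :: "('k, 'h, 'y) hopf_scheme" and f x z by (intro lin_comp[OF G2] that)
  have [simp]: "G x y z \<in> carrier P" if "x \<in> carrier H" "y \<in> carrier H" "z \<in> carrier H" for x y z
    using lin_closed[OF G1] that by simp
  have "sw P (\<lambda>x y. sw P (\<lambda>x1 x2. sw P (\<lambda>y1 y2. G x1 (sinv y1 \<otimes>\<^bsub>H\<^esub> x2) y2) (comult H y)) (comult H
    x)) (comult H h)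
    = sw P (\<lambda>x1 x. sw P (\<lambda>x2 y. sw P (\<lambda>y1 y2. G x1 (sinv y1 \<otimes>\<^bsub>H\<^esub> x2) y2) (comult H y)) (comult H x))
      (comult H h)"
    by (rule sw_coassoc) simp_all
  \<comment> \<open>The neighbouring legs \<open>x2\<close> and \<open>y1\<close> are now the two
    halves of one coproduct, which is the shape that \<open>sw_sinv\<close> evaluates.\<close>
  also have "\<dots> = sw P (\<lambda>x1 x. sw P (\<lambda>y y2. sw P (\<lambda>x2 y1. G x1 (sinv y1 \<otimes>\<^bsub>H\<^esub> x2) y2) (comult H y))
    (comult H x)) (comult H h)"
    by (rule sw_comult_cong, simp, rule sw_coassoc[symmetric]) simp_all
  also have "\<dots> = sw P (\<lambda>x1 x. sw P (\<lambda>y y2. counit H y \<odot>\<^bsub>P\<^esub> G x1 \<one>\<^bsub>H\<^esub> y2) (comult H x)) (comult H h)"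
    by (simp add: sw_sinv[where f = "\<lambda>z. G _ z _"])
  also have "\<dots> = sw P (\<lambda>x y. G x \<one>\<^bsub>H\<^esub> y) (comult H h)"
    by (simp add: sw_counit_left[where f = "\<lambda>z. G _ _ z"])
  finally show ?thesis .
qed

end

section \<open>The group of indices\<close>

lemma (in group) inv_cancel_left [simp]:
  assumes "x \<in> carrier G" "y \<in> carrier G"
  shows "inv x \<otimes> (x \<otimes> y) = y" "x \<otimes> (inv x \<otimes> y) = y"
  using assms by (simp_all flip: m_assoc)

context hopf_algebra_bij
begin

abbreviation A where "A \<equiv> Aut_Hopf k H"
abbreviation G where "G \<equiv> yd_group k H"

section \<open>Hopf automorphisms under composition and inversion\<close>

lemma hopf_autoI:
  assumes bij: "a \<in> Bij (carrier H)" and lin: "lin k H H a"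
    and "\<And>x y. x \<in> carrier H \<Longrightarrow> y \<in> carrier H \<Longrightarrow> a (x \<otimes>\<^bsub>H\<^esub> y) = a x \<otimes>\<^bsub>H\<^esub> a y" "a \<one>\<^bsub>H\<^esub> = \<one>\<^bsub>H\<^esub>"
    and comult: "\<And>h. h \<in> carrier H \<Longrightarrow> comult H (a h) = sw HH (\<lambda>x y. pure_tensor k H H (a x) (a y))
      (comult H h)"
    and "\<And>h. h \<in> carrier H \<Longrightarrow> counit H (a h) = counit H h"
    and "\<And>h. h \<in> carrier H \<Longrightarrow> antipode H (a h) = a (antipode H h)"
  shows "a \<in> hopf_auto k H"
  using assms
  by (auto simp: hopf_auto_def lin_def[symmetric] ring_hom_def lin_closed[OF lin] lin_add[OF lin]
      tensor_map_eq_sw[OF mod_H mod_H])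

context
  fixes a assumes a: "a \<in> hopf_auto k H"
begin

lemma auto_Bij: "a \<in> Bij (carrier H)"
  using a by (simp add: hopf_auto_def)

lemma lin_auto_self: "lin k H H a"
  using a by (simp add: hopf_auto_def lin_def)

lemma lin_auto: "lin k L H f \<Longrightarrow> lin k L H (\<lambda>x. a (f x))"
  by (rule lin_comp[OF lin_auto_self])

lemma auto_closed: "h \<in> carrier H \<Longrightarrow> a h \<in> carrier H"
  by (rule lin_closed[OF lin_auto_self])

lemma auto_mult: "x \<in> carrier H \<Longrightarrow> y \<in> carrier H \<Longrightarrow> a (x \<otimes>\<^bsub>H\<^esub> y) = a x \<otimes>\<^bsub>H\<^esub> a y"
  using a by (simp add: hopf_auto_def ring_hom_def)

lemma auto_one: "a \<one>\<^bsub>H\<^esub> = \<one>\<^bsub>H\<^esub>"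
  using a by (simp add: hopf_auto_def ring_hom_def)

lemma auto_counit: "h \<in> carrier H \<Longrightarrow> counit H (a h) = counit H h"
  using a by (simp add: hopf_auto_def)

lemma auto_antipode: "h \<in> carrier H \<Longrightarrow> antipode H (a h) = a (antipode H h)"
  using a by (simp add: hopf_auto_def)

lemma auto_sinv: "h \<in> carrier H \<Longrightarrow> sinv (a h) = a (sinv h)"
  by (rule sinv_eqI) (simp_all add: auto_closed auto_antipode)

lemma auto_comult: "h \<in> carrier H \<Longrightarrow> comult H (a h) = tensor_map k H H a a (comult H h)"
  using a by (simp add: hopf_auto_def)

lemma auto_sw:
  "module k P \<Longrightarrow> h \<in> carrier H \<Longrightarrow> bilin k H H P F
    \<Longrightarrow> sw P F (comult H (a h)) = sw P (\<lambda>x y. F (a x) (a y)) (comult H h)"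
  unfolding auto_comult by (rule sw_tensor_map[of k H H]) (simp_all add: lin_auto_self)

lemmas auto_rules = lin_auto auto_closed auto_mult auto_one auto_counit auto_sinv auto_sw

end

lemma auto_compose:
  assumes a: "a \<in> hopf_auto k H" and b: "b \<in> hopf_auto k H"
  shows "compose (carrier H) a b \<in> hopf_auto k H"
proof (rule hopf_autoI)
  note [simp] = auto_rules[OF a] auto_rules[OF b] compose_def
  show "compose (carrier H) a b \<in> Bij (carrier H)"
    by (rule compose_Bij) (use a b auto_Bij in auto)
  have "lin k H H (\<lambda>x. a (b x))" by simp
  then show "lin k H H (compose (carrier H) a b)"
    by (subst lin_cong[where g = "\<lambda>x. a (b x)"]) simp_all
  show "comult H (compose (carrier H) a b h)
      = sw HH (\<lambda>x y. pure_tensor k H H (compose (carrier H) a b x) (compose (carrier H) a b y))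
        (comult H h)"
    if [simp]: "h \<in> carrier H" for h
    using auto_comult[OF a, of "b h"] by (simp add: tensor_map_eq_sw[OF mod_H mod_H]
      lin_auto_self[OF a])
qed (simp_all add: compose_def auto_rules[OF a] auto_rules[OF b] auto_antipode[OF a]
  auto_antipode[OF b])

lemma auto_inv:
  assumes a: "a \<in> hopf_auto k H"
  shows "(\<lambda>x\<in>carrier H. inv_into (carrier H) a x) \<in> hopf_auto k H"
proof -
  define b where "b = (\<lambda>x\<in>carrier H. inv_into (carrier H) a x)"
  note [simp] = auto_rules[OF a]
  have bij: "bij_betw a (carrier H) (carrier H)"
    using auto_Bij[OF a] by (simp add: Bij_def)
  have b [simp]: "b h \<in> carrier H" "a (b h) = h" "b (a h) = h" if "h \<in> carrier H" for h
    using that bij unfolding b_def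
    by (simp_all add: bij_betw_def inv_into_into f_inv_into_f inv_into_f_f)
  have bI: "b h = h'" if "h' \<in> carrier H" "a h' = h" for h h'
    using that by auto
  have "b \<in> hopf_auto k H"
  proof (rule hopf_autoI)
    show "b \<in> Bij (carrier H)"
      unfolding b_def by (rule restrict_inv_into_Bij[OF auto_Bij[OF a]])
    show lb: "lin k H H b"
      by (intro linI bI) (simp_all add: lin_add[OF lin_auto_self[OF a]] lin_smult[OF
        lin_auto_self[OF a]])
    show "comult H (b h) = sw HH (\<lambda>x y. pure_tensor k H H (b x) (b y)) (comult H h)"
      if [simp]: "h \<in> carrier H" for h
    proof -
      \<comment> \<open>Apply \<open>b \<otimes> b\<close> to
        \<open>\<Delta>(a(b h)) = (a \<otimes> a) \<Delta>(b h)\<close>: on the right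
        \<open>b\<close> undoes \<open>a\<close> in both legs.\<close>
      have "sw HH (\<lambda>x y. pure_tensor k H H (b x) (b y)) (comult H (a (b h))) = comult H (b h)"
        by (subst auto_sw[OF a]) (simp_all add: sw_pures lin_comp[OF lb])
      then show ?thesis by simp
    qed
    show "b (x \<otimes>\<^bsub>H\<^esub> y) = b x \<otimes>\<^bsub>H\<^esub> b y" if "x \<in> carrier H" "y \<in> carrier H" for x y
      using that by (intro bI) simp_all
    show "b \<one>\<^bsub>H\<^esub> = \<one>\<^bsub>H\<^esub>" by (intro bI) simp_all
    show "counit H (b h) = counit H h" if "h \<in> carrier H" for h
      using that auto_counit[OF a, of "b h"] by simp
    show "antipode H (b h) = b (antipode H h)" if "h \<in> carrier H" for h
      using that auto_antipode[OF a, of "b h"] bI[of "antipode H (b h)" "antipode H h"] by simp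
  qed
  then show ?thesis by (simp add: b_def)
qed

lemma auto_ident: "(\<lambda>x\<in>carrier H. x) \<in> hopf_auto k H"
proof (rule hopf_autoI)
  show "lin k H H (\<lambda>x\<in>carrier H. x)"
    by (subst lin_cong[where g = "\<lambda>x. x"]) simp_all
  show "comult H ((\<lambda>x\<in>carrier H. x) h)
      = sw HH (\<lambda>x y. pure_tensor k H H ((\<lambda>x\<in>carrier H. x) x) ((\<lambda>x\<in>carrier H. x) y)) (comult H h)"
    if "h \<in> carrier H" for h
    using that by (simp add: sw_pures)
qed (simp_all add: id_Bij)

lemma group_A: "group A"
proof -
  have "subgroup (hopf_auto k H) (BijGroup (carrier H))"
  proof
    show "hopf_auto k H \<subseteq> carrier (BijGroup (carrier H))"
      by (auto simp: BijGroup_def auto_Bij)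
    show "x \<otimes>\<^bsub>BijGroup (carrier H)\<^esub> y \<in> hopf_auto k H" if "x \<in> hopf_auto k H" "y \<in> hopf_auto k H"
      for x y
      using that by (simp add: BijGroup_def auto_Bij auto_compose)
    show "\<one>\<^bsub>BijGroup (carrier H)\<^esub> \<in> hopf_auto k H"
      by (simp add: BijGroup_def auto_ident)
    show "inv\<^bsub>BijGroup (carrier H)\<^esub> x \<in> hopf_auto k H" if "x \<in> hopf_auto k H" for x
      using that by (simp add: inv_BijGroup auto_Bij auto_inv)
  qed
  then show ?thesis
    unfolding Aut_Hopf_def by (rule subgroup.subgroup_is_group[OF _ group_BijGroup])
qed

sublocale A: group A by (rule group_A)

lemma carrier_A [simp]: "carrier A = hopf_auto k H"
  by (simp add: Aut_Hopf_def)

lemma A_closed [simp]: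
  "a \<in> hopf_auto k H \<Longrightarrow> b \<in> hopf_auto k H \<Longrightarrow> a \<otimes>\<^bsub>A\<^esub> b \<in> hopf_auto k H"
  "a \<in> hopf_auto k H \<Longrightarrow> inv\<^bsub>A\<^esub> a \<in> hopf_auto k H"
  "\<one>\<^bsub>A\<^esub> \<in> hopf_auto k H"
  using A.m_closed A.inv_closed A.one_closed by simp_all

lemma A_mult_app [simp]:
  "a \<in> hopf_auto k H \<Longrightarrow> b \<in> hopf_auto k H \<Longrightarrow> h \<in> carrier H \<Longrightarrow> (a \<otimes>\<^bsub>A\<^esub> b) h = a (b h)"
  by (simp add: Aut_Hopf_def BijGroup_def auto_Bij compose_def)

lemma A_one_app [simp]: "h \<in> carrier H \<Longrightarrow> \<one>\<^bsub>A\<^esub> h = h"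
  by (simp add: Aut_Hopf_def BijGroup_def)

lemma A_inv_app [simp]:
  assumes "a \<in> hopf_auto k H" "h \<in> carrier H"
  shows "a ((inv\<^bsub>A\<^esub> a) h) = h" "(inv\<^bsub>A\<^esub> a) (a h) = h"
proof -
  have "(a \<otimes>\<^bsub>A\<^esub> inv\<^bsub>A\<^esub> a) h = h" "(inv\<^bsub>A\<^esub> a \<otimes>\<^bsub>A\<^esub> a) h = h"
    using assms A.r_inv[of a] A.l_inv[of a] by (simp_all del: A_mult_app A.r_inv A.l_inv)
  then show "a ((inv\<^bsub>A\<^esub> a) h) = h" "(inv\<^bsub>A\<^esub> a) (a h) = h"
    using assms A_mult_app A_closed(2) by metis+
qed

section \<open>The twisted product on pairs of automorphisms\<close>

lemma G_simps [simp]: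
  "carrier G = hopf_auto k H \<times> hopf_auto k H"
  "\<one>\<^bsub>G\<^esub> = (\<one>\<^bsub>A\<^esub>, \<one>\<^bsub>A\<^esub>)"
  "(\<alpha>, \<beta>) \<otimes>\<^bsub>G\<^esub> (\<gamma>, \<delta>) = (\<alpha> \<otimes>\<^bsub>A\<^esub> \<gamma>, \<delta> \<otimes>\<^bsub>A\<^esub> inv\<^bsub>A\<^esub> \<gamma> \<otimes>\<^bsub>A\<^esub> \<beta> \<otimes>\<^bsub>A\<^esub> \<gamma>)"
  by (simp_all add: yd_group_def Let_def)

lemma group_G: "group G"
proof (rule groupI)
  show "\<exists>y\<in>carrier G. y \<otimes>\<^bsub>G\<^esub> x = \<one>\<^bsub>G\<^esub>" if x: "x \<in> carrier G" for x
  proof -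
    obtain \<alpha> \<beta> where "x = (\<alpha>, \<beta>)" "\<alpha> \<in> hopf_auto k H" "\<beta> \<in> hopf_auto k H" using x by auto
    \<comment> \<open>The second entry \<open>x\<close> of the left inverse solves
      \<open>\<beta> \<alpha>\<^sup>-\<^sup>1 x \<alpha> = 1\<close>.\<close>
    then have "(inv\<^bsub>A\<^esub> \<alpha>, \<alpha> \<otimes>\<^bsub>A\<^esub> inv\<^bsub>A\<^esub> \<beta> \<otimes>\<^bsub>A\<^esub> inv\<^bsub>A\<^esub> \<alpha>) \<otimes>\<^bsub>G\<^esub> x = \<one>\<^bsub>G\<^esub>"
      by (simp add: A.m_assoc)
    then show ?thesis using \<open>x = _\<close> \<open>\<alpha> \<in> _\<close> \<open>\<beta> \<in> _\<close>
      by (intro bexI[of _ "(inv\<^bsub>A\<^esub> \<alpha>, \<alpha> \<otimes>\<^bsub>A\<^esub> inv\<^bsub>A\<^esub> \<beta> \<otimes>\<^bsub>A\<^esub> inv\<^bsub>A\<^esub> \<alpha>)"]) simp_all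
  qed
  show "x \<otimes>\<^bsub>G\<^esub> y \<otimes>\<^bsub>G\<^esub> z = x \<otimes>\<^bsub>G\<^esub> (y \<otimes>\<^bsub>G\<^esub> z)"
    if "x \<in> carrier G" "y \<in> carrier G" "z \<in> carrier G" for x y z
    using that by (auto simp: A.m_assoc A.inv_mult_group)
qed (auto simp: A.m_assoc)

sublocale G: group G by (rule group_G)

lemma G_inv [simp]:
  assumes "\<alpha> \<in> hopf_auto k H" "\<beta> \<in> hopf_auto k H"
  shows "inv\<^bsub>G\<^esub> (\<alpha>, \<beta>) = (inv\<^bsub>A\<^esub> \<alpha>, \<alpha> \<otimes>\<^bsub>A\<^esub> inv\<^bsub>A\<^esub> \<beta> \<otimes>\<^bsub>A\<^esub> inv\<^bsub>A\<^esub> \<alpha>)"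
  by (rule G.inv_equality) (use assms in \<open>simp_all add: A.m_assoc\<close>)

end

section \<open>Dependence on the underlying module\<close>

text \<open>Yetter-Drinfeld modules are records extending modules. Equal truncations say that two
  records, possibly of different types, have the same underlying vector space; the rules of this
  section then rewrite linear constructions on decorated modules to bare vector spaces.\<close>

lemma truncate_iff:
  "module.truncate R = module.truncate V \<longleftrightarrow>
    carrier R = carrier V \<and> mult R = mult V \<and> one R = one V \<and> zero R = zero V \<and> add R = add V \<and>
      smult R = smult V"
  by (simp add: module.defs)

text \<open>Each generating relation reads only the listed fields. Stated as an implication and used
  in both directions, it gives equality of the congruences.\<close>

lemma tensor_eq_mono:
  assumes "tensor_eq k M N xs ys"
    and "carrier M = carrier M'" "zero M = zero M'" "add M = add M'" "smult M = smult M'"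
    and "carrier N = carrier N'" "add N = add N'" "smult N = smult N'"
  shows "tensor_eq k M' N' xs ys"
  using assms(1)
proof (induction rule: tensor_eq.induct)
  case (trans xs ys zs)
  then show ?case using tensor_eq.trans by blast
next
  case (sym xs ys)
  show ?case using sym.IH by (rule tensor_eq.sym)
next
  case (swap p q)
  then show ?case using assms(2-) by (intro tensor_eq.swap) simp_all
next
  case (zero n)
  then show ?case using assms(2-) tensor_eq.zero[of n N' k M'] by simp
qed (use assms(2-) in \<open>auto intro: tensor_eq.refl tensor_eq.append tensor_eq.add_left
  tensor_eq.add_right tensor_eq.smult\<close>)

context
  fixes R :: "('k, 'm, 'y) module_scheme" and V :: "('k, 'm, 'v) module_scheme"
  assumes RV: "module.truncate R = module.truncate V"
begin

lemma trunc_fields: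
  "carrier R = carrier V" "mult R = mult V" "one R = one V" "zero R = zero V" "add R = add V"
    "smult R = smult V"
  using RV unfolding truncate_iff by simp_all

lemma trunc_tensor_class:
  "tensor_class k R N = tensor_class k V N" "tensor_class k N R = tensor_class k N V"
  using tensor_eq_mono[of k R N _ _ V N] tensor_eq_mono[of k V N _ _ R N]
    tensor_eq_mono[of k N R _ _ N V] tensor_eq_mono[of k N V _ _ N R]
  by (auto simp: fun_eq_iff tensor_class_def trunc_fields)

lemma trunc_tensor:
  "tensor_module k R N = tensor_module k V N" "tensor_module k N R = tensor_module k N V"
  by (simp_all add: tensor_module_def trunc_fields trunc_tensor_class)

lemma trunc_pure:
  "pure_tensor k R N = pure_tensor k V N" "pure_tensor k N R = pure_tensor k N V"
  by (simp_all add: fun_eq_iff pure_tensor_def trunc_tensor_class)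

lemma trunc_lin:
  "lin k R N = lin k V N" "lin k N R = lin k N V"
  by (simp_all add: fun_eq_iff lin_def linear_maps_def trunc_fields)

lemma trunc_tensor_lift: "tensor_lift R = tensor_lift V"
  by (simp add: fun_eq_iff tensor_lift_def trunc_fields)

lemma trunc_module: "module k R = module k V"
  by (simp add: module_def module_axioms_def abelian_group_def abelian_monoid_def
    abelian_group_axioms_def
      comm_group_def group_def group_axioms_def Units_def comm_monoid_def comm_monoid_axioms_def
      Group.monoid_def trunc_fields)

lemma trunc_tensor_map:
  "tensor_map k R N = tensor_map k V N" "tensor_map k N R = tensor_map k N V"
  by (simp_all add: fun_eq_iff tensor_map_def trunc_tensor trunc_pure)

end

context
  fixes R :: "('k, ('k, 'a) vec, 'y) module_scheme" and V :: "('k, ('k, 'a) vec, 'v) module_scheme"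
  assumes RV: "module.truncate R = module.truncate V"
begin

lemma trunc_vtensor:
  "vtensor k R N = vtensor k V N" "vtensor k N R = vtensor k N V"
  by (simp_all add: vtensor_def trunc_tensor[OF RV])

lemma trunc_vpure:
  "vpure k R N = vpure k V N" "vpure k N R = vpure k N V"
  by (simp_all add: fun_eq_iff vpure_def trunc_pure[OF RV])

lemma trunc_vlift:
  "vlift k R N P = vlift k V N P" "vlift k N R P = vlift k N V P" 
  by (simp_all add: fun_eq_iff vlift_def trunc_tensor[OF RV] trunc_vtensor)

lemma trunc_vlift_target: "vlift k M N R = vlift k M N V"
  by (simp add: fun_eq_iff vlift_def trunc_tensor_lift[OF RV])

end

lemmas trunc_rules = trunc_fields trunc_tensor trunc_pure trunc_lin trunc_tensor_lift
  trunc_module trunc_tensor_map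

lemmas vtrunc_rules = trunc_rules trunc_vtensor trunc_vpure trunc_vlift trunc_vlift_target

section \<open>Actions and coactions\<close>

context hopf_algebra_bij
begin

context
  fixes M :: "('k, 'h, 'v) yd_module"
  assumes M: "left_action k H M"
begin

interpretation M: left_action k H M by (rule M)

lemma act_module: "module k M" ..

lemma act_closed [simp]: "h \<in> carrier H \<Longrightarrow> m \<in> carrier M \<Longrightarrow> action M h m \<in> carrier M"
  using M.action_ext by blast

lemma lin_act_right [simp]: "h \<in> carrier H \<Longrightarrow> lin k L M f \<Longrightarrow> lin k L M (\<lambda>x. action M h (f x))"
  by (rule lin_comp[of k M M]) (simp add: lin_def M.action_linear)

lemma lin_act_left [simp]: "lin k L H f \<Longrightarrow> m \<in> carrier M \<Longrightarrow> lin k L M (\<lambda>x. action M (f x) m)"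
  by (rule lin_comp[of k H M "\<lambda>h. action M h m"]) (auto intro!: linI simp: M.action_add
    M.action_smult)

lemma act_mult: "g \<in> carrier H \<Longrightarrow> h \<in> carrier H \<Longrightarrow> m \<in> carrier M \<Longrightarrow>
    action M (g \<otimes>\<^bsub>H\<^esub> h) m = action M g (action M h m)"
  by (rule M.action_mult)

lemma act_one [simp]: "m \<in> carrier M \<Longrightarrow> action M \<one>\<^bsub>H\<^esub> m = m"
  by (rule M.action_one)

end

section \<open>Coactions in Sweedler form\<close>

context
  fixes M :: "('k, 'h, 'v) yd_module"
  assumes M: "right_coaction k H M"
begin

interpretation M: right_coaction k H M by (rule M)

lemma coact_module: "module k M" ..

lemma lin_coact_self: "lin k M (tensor_module k M H) (coaction M)"
  using M.coaction_linear by (simp add: lin_def)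

lemma coact_closed [simp]: "m \<in> carrier M \<Longrightarrow> coaction M m \<in> carrier (tensor_module k M H)"
  by (rule lin_closed[OF lin_coact_self])

lemma lin_coact [simp]: "lin k L M f \<Longrightarrow> lin k L (tensor_module k M H) (\<lambda>x. coaction M (f x))"
  by (rule lin_comp[OF lin_coact_self])

lemma occurs_coact [simp]:
  "m \<in> carrier M \<Longrightarrow> occurs (coaction M m) x y \<longleftrightarrow> x \<in> carrier M \<and> y \<in> carrier H \<and> occurring (coaction M
    m) x y"
  "m \<in> carrier M \<Longrightarrow> occurs_lift (coaction M m) x y \<longleftrightarrow> x \<in> carrier M \<and> y
    \<in> carrier H \<and> occurring_lift (coaction M m) x y"
  by (rule occurs_iff[of k], simp_all add: coact_module) (rule occurs_lift_iff[of k], simp_all add: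
    coact_module)

lemma sw_coact_cong:
  "m \<in> carrier M \<Longrightarrow> (\<And>x y. x \<in> carrier M \<Longrightarrow> y \<in> carrier H \<Longrightarrow> f x y = g x y)
    \<Longrightarrow> sw P f (coaction M m) = sw P g (coaction M m)"
  by simp

context
  fixes P :: "('k, 'p, 'w) module_scheme"
  assumes P [simp]: "module k P"
begin

lemma lift_coact [simp]:
  "bilin k M H P f \<Longrightarrow> m \<in> carrier M \<Longrightarrow> tensor_lift P f (coaction M m) = sw P f (coaction M m)"
  by (rule tensor_lift_eq_sw[of k M H]) (simp_all add: coact_module)

lemma sw_coact_closed [simp]:
  "m \<in> carrier M \<Longrightarrow> (\<And>x y. x \<in> carrier M \<Longrightarrow> y \<in> carrier H \<Longrightarrow> f x y \<in> carrier P)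
    \<Longrightarrow> sw P f (coaction M m) \<in> carrier P"
  by (rule sw_closed[of k M H]) (simp_all add: coact_module)

lemma lin_coact_body [simp]:
  "module k L \<Longrightarrow> m \<in> carrier M \<Longrightarrow>
    (\<And>x y. x \<in> carrier M \<Longrightarrow> y \<in> carrier H \<Longrightarrow> lin k L P (\<lambda>w. F w x y)) \<Longrightarrow>
    lin k L P (\<lambda>w. sw P (F w) (coaction M m))"
  by (rule lin_sw_body[of k M H]) (simp_all add: coact_module)

lemma lin_coact_arg [simp]:
  "bilin k M H P f \<Longrightarrow> lin k L M t \<Longrightarrow> lin k L P (\<lambda>x. sw P f (coaction M (t x)))"
  by (rule lin_comp[OF lin_comp[OF lin_sw_self lin_coact_self]]) (simp_all add: coact_module)

lemma coact_push:
  assumes "module k Q" "m \<in> carrier M" "lin k P Q g"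
    and "\<And>x y. x \<in> carrier M \<Longrightarrow> y \<in> carrier H \<Longrightarrow> f x y \<in> carrier P"
  shows "g (sw P f (coaction M m)) = sw Q (\<lambda>x y. g (f x y)) (coaction M m)"
  by (rule sw_push[of k M H]) (use assms in \<open>simp_all add: coact_module\<close>)

text \<open>The argument of \<open>sw_coassoc\<close> with
  \<open>M \<otimes> (H \<otimes> H)\<close> in place of \<open>H \<otimes> (H \<otimes> H)\<close>:
  the comodule axiom is pushed through the linear map induced by a trilinear
  \<open>F\<close>.\<close>

lemma coact_coassoc:
  assumes m: "m \<in> carrier M"
    and F: "\<And>z. z \<in> carrier H \<Longrightarrow> bilin k M H P (\<lambda>x y. F x y z)"
      "\<And>x. x \<in> carrier M \<Longrightarrow> bilin k H H P (\<lambda>y z. F x y z)"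
  shows "sw P (\<lambda>x z. sw P (\<lambda>x1 x2. F x1 x2 z) (coaction M x)) (coaction M m)
    = sw P (\<lambda>x y. sw P (\<lambda>y z. F x y z) (comult H y)) (coaction M m)"
proof -
  note [simp] = bilinD1[OF F(1)] bilinD2[OF F(1)] bilinD1[OF F(2)] bilinD2[OF F(2)] m coact_module
  have cl [simp]: "F x y z \<in> carrier P" if "x \<in> carrier M" "y \<in> carrier H" "z \<in> carrier H" for x y z
    using bilin_closed[OF F(2)] that by simp
  let ?Q = "tensor_module k M HH"
  let ?\<Phi> = "sw P (\<lambda>x s. sw P (\<lambda>y z. F x y z) s)"
  have bi: "bilin k M HH P (\<lambda>x s. sw P (\<lambda>y z. F x y z) s)"
    by (intro bilinI lin_sw_body[of k H H] lin_sw_self) simp_all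
  have \<Phi>: "lin k ?Q P ?\<Phi>"
    by (rule lin_sw_self[OF _ _ P bi]) simp_all
  have pure: "?\<Phi> (pure_tensor k M HH x (pure_tensor k H H y z)) = F x y z"
    if "x \<in> carrier M" "y \<in> carrier H" "z \<in> carrier H" for x y z
    using that by (subst sw_pure[OF _ _ P bi]) simp_all
  have push: "?\<Phi> (sw ?Q f (coaction M x)) = sw P (\<lambda>u v. ?\<Phi> (f u v)) (coaction M x)"
    if "x \<in> carrier M" "\<And>x y. x \<in> carrier M \<Longrightarrow> y \<in> carrier H \<Longrightarrow> f x y \<in> carrier ?Q" for x f
    by (rule sw_push[of k M H]) (use that \<Phi> in simp_all)
  have "?\<Phi> (sw ?Q (\<lambda>x z. sw ?Q (\<lambda>x1 x2. pure_tensor k M HH x1 (pure_tensor k H H x2 z)) (coaction M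
    x)) (coaction M m))
    = sw P (\<lambda>x z. sw P (\<lambda>x1 x2. F x1 x2 z) (coaction M x)) (coaction M m)"
    by (simp add: push pure sw_closed[of k M H])
  moreover have "?\<Phi> (tensor_map k M HH (\<lambda>x. x) (comult H) (coaction M m))
    = sw P (\<lambda>x y. sw P (\<lambda>y z. F x y z) (comult H y)) (coaction M m)"
    by (rule sw_tensor_map[OF coact_module mod_H _ _ _ _ P _ bi]) (simp_all add: lin_comult)
  moreover have "sw ?Q (\<lambda>x z. sw ?Q (\<lambda>x1 x2. pure_tensor k M HH x1 (pure_tensor k H H x2 z))
    (coaction M x)) (coaction M m)
      = tensor_map k M HH (\<lambda>x. x) (comult H) (coaction M m)"
  proof -
    \<comment> \<open>In this context the general rules speak about the fixed target
      \<open>P\<close>; these are the instances needed for \<open>?Q\<close>, in which the comodule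
      axiom is stated.\<close>
    have lift: "tensor_lift ?Q f (coaction M x) = sw ?Q f (coaction M x)" if "bilin k M H ?Q f"
      "x \<in> carrier M" for f x
      by (rule tensor_lift_eq_sw[of k M H]) (use that in simp_all)
    have body: "lin k L ?Q (\<lambda>w. sw ?Q (F w) (coaction M x))"
      if "module k L" "x \<in> carrier M" "\<And>u v. u \<in> carrier M \<Longrightarrow> v \<in> carrier H
        \<Longrightarrow> lin k L ?Q (\<lambda>w. F w u v)"
      for L :: "('k, 'h, 'y) hopf_scheme" and F x
      by (rule lin_sw_body[of k M H]) (use that in simp_all)
    have arg: "lin k M ?Q (\<lambda>x. sw ?Q f (coaction M x))" if "bilin k M H ?Q f" for f
      by (rule lin_comp[OF lin_sw_self lin_coact_self]) (use that in simp_all)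
    show ?thesis using M.coaction_coassoc[OF m] by (simp add: lift body arg)
  qed
  ultimately show ?thesis by metis
qed

end

lemma coact_counit:
  assumes P [simp]: "module k P" and m: "m \<in> carrier M" and f: "lin k M P f"
  shows "sw P (\<lambda>x y. counit H y \<odot>\<^bsub>P\<^esub> f x) (coaction M m) = f m"
proof -
  interpret M': module k M by (rule coact_module)
  note [simp] = lin_closed[OF f] lin_smult[OF f] coact_module m
  have "f (sw M (\<lambda>x y. counit H y \<odot>\<^bsub>M\<^esub> x) (coaction M m)) = sw P (\<lambda>x y. counit H y \<odot>\<^bsub>P\<^esub> f x)
    (coaction M m)"
    by (simp add: coact_push[OF _ _ _ f])
  then show ?thesis using M.coaction_counit[OF m] by simp
qed

end

section \<open>The compatibility condition in Sweedler form\<close>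

context
  fixes M :: "('k, 'h, 'v) yd_module" and \<alpha> \<beta>
  assumes M: "yetter_drinfeld k H \<alpha> \<beta> M" and \<alpha>: "\<alpha> \<in> hopf_auto k H" and \<beta>: "\<beta> \<in> hopf_auto k H"
begin

lemma yd_left_action: "left_action k H M"
  using M by (simp add: yetter_drinfeld_def)

lemma yd_right_coaction: "right_coaction k H M"
  using M by (simp add: yetter_drinfeld_def)

text \<open>Compatibility is an equation in \<open>M \<otimes> H\<close>. Applying the linear map
  induced by \<open>F\<close> makes it usable inside an arbitrary sum.\<close>

lemma coact_act_left_nested:
  assumes P [simp]: "module k P" and h: "h \<in> carrier H" and m: "m \<in> carrier M"
    and F: "bilin k M H P F"
  shows "sw P F (coaction M (action M h m)) =
    sw P (\<lambda>h12 h3. sw P (\<lambda>h1 h2. sw P (\<lambda>m0 m1. F (action M h2 m0) (\<beta> h3 \<otimes>\<^bsub>H\<^esub> m1 \<otimes>\<^bsub>H\<^esub> \<alpha> (sinv h1)))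
      (coaction M m)) (comult H h12)) (comult H h)"
proof -
  note [simp] = yd_left_action yd_right_coaction coact_module[OF yd_right_coaction] h m
    auto_rules[OF \<alpha>] auto_rules[OF \<beta>] sw_pure[OF _ _ _ F]
  let ?T = "tensor_module k M H"
  have \<Phi>: "lin k ?T P (sw P F)" by (rule lin_sw_self[OF _ _ P F]) simp_all
  have "coaction M (action M h m) =
    sw ?T (\<lambda>h12 h3. sw ?T (\<lambda>h1 h2. sw ?T (\<lambda>m0 m1. pure_tensor k M H (action M h2 m0) (\<beta> h3 \<otimes>\<^bsub>H\<^esub> m1
      \<otimes>\<^bsub>H\<^esub> \<alpha> (sinv h1)))
      (coaction M m)) (comult H h12)) (comult H h)"
    using yetter_drinfeld.compatibility[OF M h m] by (simp flip: sinv_def)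
  then show ?thesis
    by (simp add: comult_push[OF _ _ _ \<Phi>] coact_push[OF _ _ _ _ \<Phi>])
qed

text \<open>The other nesting of the threefold coproduct. Which one is wanted depends on the leg
  that has to stay accessible for a cancellation: this one exposes the first leg, the previous one
  the third.\<close>

lemma coact_act:
  assumes P [simp]: "module k P" and h: "h \<in> carrier H" and m: "m \<in> carrier M"
    and F: "bilin k M H P F"
  shows "sw P F (coaction M (action M h m)) =
    sw P (\<lambda>h1 h23. sw P (\<lambda>h2 h3. sw P (\<lambda>m0 m1. F (action M h2 m0) (\<beta> h3 \<otimes>\<^bsub>H\<^esub> m1 \<otimes>\<^bsub>H\<^esub> \<alpha> (sinv h1)))
      (coaction M m)) (comult H h23)) (comult H h)"
proof -
  note [simp] = yd_left_action yd_right_coaction coact_module[OF yd_right_coaction] h m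
    auto_rules[OF \<alpha>] auto_rules[OF \<beta>] lin_comp[OF bilinD1[OF F]] lin_comp[OF bilinD2[OF F]]
  show ?thesis
    by (subst coact_act_left_nested[OF P h m F], rule sw_coassoc) simp_all
qed

end

end

section \<open>Tensor products of Yetter--Drinfeld modules\<close>

text \<open>The module and comodule axioms hold for any two automorphisms \<open>\<gamma>\<close>
  and \<open>\<theta>\<close>; only the compatibility condition ties them to the indices. In
  \<open>yd_tensor\<close> the parameter \<open>\<theta>\<close> is
  \<open>\<gamma>\<^sup>-\<^sup>1\<beta>\<gamma>\<close>.\<close>

definition yd_tens ::
  "('k, 'x) ring_scheme \<Rightarrow> ('k, 'h, 'y) hopf_scheme \<Rightarrow> ('h \<Rightarrow> 'h) \<Rightarrow> ('h \<Rightarrow> 'h)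
    \<Rightarrow> ('k, 'h, ('k, 'a) vec) yd_module \<Rightarrow> ('k, 'h, ('k, 'a) vec) yd_module \<Rightarrow> ('k, 'h, ('k, 'a) vec)
      yd_module" where
  "yd_tens k H \<gamma> \<theta> M N = (let V = vtensor k M N in
     \<lparr>carrier = carrier V, mult = mult V, one = one V, zero = zero V, add = add V, smult = smult V,
      action = (\<lambda>h\<in>carrier H. \<lambda>t\<in>carrier V.
        tensor_lift V
          (\<lambda>h1 h2. vlift k M N V (\<lambda>m n. vpure k M N (action M (\<gamma> h1) m) (action N (\<theta> h2) n)) t)
          (comult H h)),
      coaction = vlift k M N (tensor_module k V H)
        (\<lambda>m n. tensor_lift (tensor_module k V H)
          (\<lambda>m0 m1. tensor_lift (tensor_module k V H)
            (\<lambda>n0 n1. pure_tensor k V H (vpure k M N m0 n0) (n1 \<otimes>\<^bsub>H\<^esub> m1))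
            (coaction N n))
          (coaction M m))\<rparr>)"

lemma truncate_yd_tens: "module.truncate (yd_tens k H \<gamma> \<theta> M N) = module.truncate (vtensor k M N)"
  by (simp add: yd_tens_def Let_def module.defs)

lemmas yd_tens_trunc [simp] = vtrunc_rules[OF truncate_yd_tens]

lemma yd_tensor_eq:
  "yd_tensor k H ((\<alpha>, \<beta>), M) ((\<gamma>, \<delta>), N) = ((\<alpha>, \<beta>) \<otimes>\<^bsub>yd_group k H\<^esub> (\<gamma>, \<delta>),
    yd_tens k H \<gamma> (inv\<^bsub>Aut_Hopf k H\<^esub> \<gamma> \<otimes>\<^bsub>Aut_Hopf k H\<^esub> \<beta> \<otimes>\<^bsub>Aut_Hopf k H\<^esub> \<gamma>) M N)"
  by (simp add: yd_tensor_def yd_tens_def Let_def)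

declare (in hopf_algebra_bij) act_module [simp] coact_module [simp] yd_left_action [simp]
  yd_right_coaction [simp]

locale action_coaction_pair = hopf_algebra_bij k H
  for k :: "('k, 'x) ring_scheme" and H :: "('k, 'h, 'y) hopf_scheme" +
  fixes M N :: "('k, 'h, ('k, 'a) vec) yd_module" and \<gamma> \<theta> :: "'h \<Rightarrow> 'h"
  assumes MA [simp]: "left_action k H M" and MC [simp]: "right_coaction k H M"
    and NA [simp]: "left_action k H N" and NC [simp]: "right_coaction k H N"
    and \<gamma> [simp]: "\<gamma> \<in> hopf_auto k H" and \<theta> [simp]: "\<theta> \<in> hopf_auto k H"
begin

lemmas \<gamma>_rules [simp] = auto_rules[OF \<gamma>]
lemmas \<theta>_rules [simp] = auto_rules[OF \<theta>]

lemma module_MN [simp]: "module k M" "module k N"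
  using act_module[OF MA] act_module[OF NA] by simp_all

abbreviation V where "V \<equiv> vtensor k M N"
abbreviation VH where "VH \<equiv> tensor_module k V H"
abbreviation W where "W \<equiv> yd_tens k H \<gamma> \<theta> M N"

lemma action_tens:
  assumes "h \<in> carrier H" "t \<in> carrier V"
  shows "action W h t = sw V (\<lambda>h1 h2. vlift k M N V
    (\<lambda>m n. vpure k M N (action M (\<gamma> h1) m) (action N (\<theta> h2) n)) t) (comult H h)"
  using assms by (simp add: yd_tens_def Let_def)

lemma action_tens_pure [simp]:
  assumes "h \<in> carrier H" "m \<in> carrier M" "n \<in> carrier N"
  shows "action W h (vpure k M N m n) =
    sw V (\<lambda>h1 h2. vpure k M N (action M (\<gamma> h1) m) (action N (\<theta> h2) n)) (comult H h)"
  using assms by (simp add: action_tens)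

lemma lin_action_tens: "h \<in> carrier H \<Longrightarrow> lin k V V (action W h)"
  by (subst lin_cong[OF action_tens]) simp_all

lemma lin_action_tens_left:
  assumes "t \<in> carrier V" shows "lin k H V (\<lambda>h. action W h t)"
  using assms by (subst lin_cong[OF action_tens]) simp_all

lemma left_action_tens [simp]: "left_action k H W"
proof (intro left_action.intro left_action_axioms.intro)
  show "field k" "module k W" by simp_all
  show "action W \<in> carrier H \<rightarrow>\<^sub>E carrier W \<rightarrow>\<^sub>E carrier W"
    using lin_closed[OF lin_action_tens]
    by (auto simp: PiE_def extensional_def Pi_def) (simp_all add: yd_tens_def Let_def)
  show "action W h \<in> linear_maps k W W" if "h \<in> carrier H" for h
    using lin_action_tens[OF that] by (simp flip: lin_def)
  show "action W (g \<oplus>\<^bsub>H\<^esub> h) t = action W g t \<oplus>\<^bsub>W\<^esub> action W h t"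
    if "g \<in> carrier H" "h \<in> carrier H" "t \<in> carrier W" for g h t
    using that lin_add[OF lin_action_tens_left] by simp
  show "action W (c \<odot>\<^bsub>H\<^esub> h) t = c \<odot>\<^bsub>W\<^esub> action W h t"
    if "c \<in> carrier k" "h \<in> carrier H" "t \<in> carrier W" for c h t
    using that lin_smult[OF lin_action_tens_left] by simp
  show "action W (g \<otimes>\<^bsub>H\<^esub> h) t = action W g (action W h t)"
    if gh [simp]: "g \<in> carrier H" "h \<in> carrier H" and t: "t \<in> carrier W" for g h t
  proof (rule vtensor_ext[where t = t and P = V and M = M and N = N and k = k])
    show "lin k V V (\<lambda>t. action W g (action W h t))"
      by (rule lin_comp[OF lin_action_tens lin_action_tens]) simp_all
    show "action W (g \<otimes>\<^bsub>H\<^esub> h) (vpure k M N m n) = action W g (action W h (vpure k M N m n))"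
      if [simp]: "m \<in> carrier M" "n \<in> carrier N" for m n
    proof -
      \<comment> \<open>Iterating the action puts the sum over \<open>\<Delta>(h)\<close> outside,
        whereas expanding \<open>\<Delta>(g h)\<close> puts the sum over \<open>\<Delta>(g)\<close>
        outside; the interchange reconciles them.\<close>
      have "action W g (action W h (vpure k M N m n)) =
        sw V (\<lambda>h1 h2. sw V (\<lambda>g1 g2. vpure k M N (action M (\<gamma> g1) (action M (\<gamma> h1) m)) (action N (\<theta>
          g2) (action N (\<theta> h2) n)))
          (comult H g)) (comult H h)"
        by (simp add: comult_push[OF _ _ _ lin_action_tens])
      also have "\<dots> = sw V (\<lambda>g1 g2. sw V (\<lambda>h1 h2. vpure k M N (action M (\<gamma> g1) (action M (\<gamma> h1) m))
        (action N (\<theta> g2) (action N (\<theta> h2) n)))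
          (comult H h)) (comult H g)"
        by (rule sw_swap[of k H H H H V]) simp_all
      also have "\<dots> = action W (g \<otimes>\<^bsub>H\<^esub> h) (vpure k M N m n)"
        by (simp add: sw_comult_mult act_mult)
      finally show ?thesis by simp
    qed
  qed (use t in \<open>simp_all add: lin_action_tens\<close>)
  show "action W \<one>\<^bsub>H\<^esub> t = t" if t: "t \<in> carrier W" for t
    by (rule vtensor_ext[where t = t and P = V and M = M and N = N and k = k])
      (use t in \<open>simp_all add: lin_action_tens sw_comult_one\<close>)
qed

section \<open>The coaction on a tensor product\<close>

lemma coaction_tens:
  "coaction W = vlift k M N VH (\<lambda>m n. sw VH (\<lambda>m0 m1. sw VH
      (\<lambda>n0 n1. pure_tensor k V H (vpure k M N m0 n0) (n1 \<otimes>\<^bsub>H\<^esub> m1)) (coaction N n)) (coaction M m))"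
  by (simp add: yd_tens_def Let_def) (rule vlift_cong, simp_all)

lemma coaction_tens_pure:
  "m \<in> carrier M \<Longrightarrow> n \<in> carrier N \<Longrightarrow> coaction W (vpure k M N m n) = sw VH (\<lambda>m0 m1. sw VH
      (\<lambda>n0 n1. pure_tensor k V H (vpure k M N m0 n0) (n1 \<otimes>\<^bsub>H\<^esub> m1)) (coaction N n)) (coaction M m)"
  by (simp add: coaction_tens)

lemma lin_coaction_tens: "lin k V VH (coaction W)"
  unfolding coaction_tens by simp

lemma sw_coaction_tens:
  assumes [simp]: "module k P" "m \<in> carrier M" "n \<in> carrier N" and F: "bilin k V H P F"
  shows "sw P F (coaction W (vpure k M N m n)) = sw P (\<lambda>m0 m1. sw P
      (\<lambda>n0 n1. F (vpure k M N m0 n0) (n1 \<otimes>\<^bsub>H\<^esub> m1)) (coaction N n)) (coaction M m)"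
proof -
  have \<Phi>: "lin k VH P (sw P F)" by (rule lin_sw_self[OF _ _ _ F]) simp_all
  show ?thesis
    by (simp add: coaction_tens_pure coact_push[OF _ _ _ _ \<Phi>] sw_pure[OF _ _ _ F])
qed

text \<open>The coefficient \<open>n\<^sub>1 m\<^sub>1\<close> is a product, so the counit law rests
  on multiplicativity of \<open>\<epsilon>\<close> and coassociativity on multiplicativity of
  \<open>\<Delta>\<close>.\<close>

lemma right_coaction_tens [simp]: "right_coaction k H W"
proof (intro right_coaction.intro right_coaction_axioms.intro)
  show "field k" "module k W" by simp_all
  show "coaction W \<in> extensional (carrier W)"
    by (simp add: coaction_tens)
  show "coaction W \<in> linear_maps k W (tensor_module k W H)"
    using lin_coaction_tens by (simp flip: lin_def)
  have cl [simp]: "coaction W t \<in> carrier VH" if "t \<in> carrier V" for t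
    using lin_closed[OF lin_coaction_tens that] .
  have occ [simp]: "occurs (coaction W t) x y \<longleftrightarrow> x \<in> carrier V \<and> y \<in> carrier H \<and> occurring (coaction
    W t) x y"
    "occurs_lift (coaction W t) x y \<longleftrightarrow> x \<in> carrier V \<and> y \<in> carrier H \<and> occurring_lift (coaction W t)
      x y"
    if "t \<in> carrier V" for t x y
    using that by (simp_all add: occurs_iff[of k V H] occurs_lift_iff[of k V H])
  show "tensor_lift W (\<lambda>m0 m1. counit H m1 \<odot>\<^bsub>W\<^esub> m0) (coaction W t) = t" if t: "t \<in> carrier W" for t
  proof -
    have bi: "bilin k V H V (\<lambda>m0 m1. counit H m1 \<odot>\<^bsub>V\<^esub> m0)" by simp
    have "sw V (\<lambda>m0 m1. counit H m1 \<odot>\<^bsub>V\<^esub> m0) (coaction W t) = t"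
    proof (rule vtensor_ext[where t = t and P = V and M = M and N = N and k = k])
      show "lin k V V (\<lambda>t. sw V (\<lambda>m0 m1. counit H m1 \<odot>\<^bsub>V\<^esub> m0) (coaction W t))"
        by (rule lin_comp[OF lin_sw_self lin_coaction_tens]) simp_all
      interpret V: module k V by simp
      show "sw V (\<lambda>m0 m1. counit H m1 \<odot>\<^bsub>V\<^esub> m0) (coaction W (vpure k M N m n)) = vpure k M N m n"
        if [simp]: "m \<in> carrier M" "n \<in> carrier N" for m n
      proof -
        have "sw V (\<lambda>m0 m1. counit H m1 \<odot>\<^bsub>V\<^esub> m0) (coaction W (vpure k M N m n))
          = sw V (\<lambda>m0 m1. sw V (\<lambda>n0 n1. counit H n1 \<odot>\<^bsub>V\<^esub> (counit H m1 \<odot>\<^bsub>V\<^esub> vpure k M N m0 n0))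
            (coaction N n)) (coaction M m)"
          by (simp add: sw_coaction_tens V.smult_assoc1)
        also have "\<dots> = sw V (\<lambda>m0 m1. counit H m1 \<odot>\<^bsub>V\<^esub> vpure k M N m0 n) (coaction M m)"
          by (rule sw_coact_cong[OF MC], simp, rule coact_counit[OF NC]) simp_all
        also have "\<dots> = vpure k M N m n"
          by (rule coact_counit[OF MC]) simp_all
        finally show ?thesis .
      qed
    qed (use t in simp_all)
    then show ?thesis
      using t by (simp add: tensor_lift_eq_sw[of k V H, OF _ _ _ bi])
  qed
  show "tensor_lift (tensor_module k W HH) (\<lambda>m0 m1. tensor_lift (tensor_module k W HH)
      (\<lambda>m00 m01. pure_tensor k W HH m00 (pure_tensor k H H m01 m1)) (coaction W m0)) (coaction W t)
        =
    tensor_map k W HH (\<lambda>x. x) (comult H) (coaction W t)" if t: "t \<in> carrier W" for t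
  proof -
    let ?Q = "tensor_module k V HH"
    have lift: "tensor_lift ?Q F (coaction W t) = sw ?Q F (coaction W t)" if "t \<in> carrier V"
      "bilin k V H ?Q F" for F t
      using that by (intro tensor_lift_eq_sw[of k V H]) simp_all
    have body: "lin k L ?Q (\<lambda>w. sw ?Q (F w) (coaction W t))"
      if "module k L" "t \<in> carrier V" "\<And>u v. u \<in> carrier V \<Longrightarrow> v \<in> carrier H
        \<Longrightarrow> lin k L ?Q (\<lambda>w. F w u v)"
      for L :: "('k, 'h, 'y) hopf_scheme" and F t
      by (rule lin_sw_body[of k V H]) (use that in simp_all)
    have arg: "lin k V ?Q (\<lambda>x. sw ?Q f (coaction W x))" if "bilin k V H ?Q f" for f
      by (rule lin_comp[OF lin_sw_self lin_coaction_tens]) (use that in simp_all)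
    have "sw ?Q (\<lambda>m0 m1. sw ?Q (\<lambda>m00 m01. pure_tensor k V HH m00 (pure_tensor k H H m01 m1))
      (coaction W m0)) (coaction W t)
        = sw ?Q (\<lambda>m0 m1. pure_tensor k V HH m0 (comult H m1)) (coaction W t)"
    proof (rule vtensor_ext[where t = t and P = ?Q and M = M and N = N and k = k])
      show "lin k V ?Q (\<lambda>t. sw ?Q (\<lambda>m0 m1. sw ?Q (\<lambda>m00 m01. pure_tensor k V HH m00 (pure_tensor k H
        H m01 m1)) (coaction W m0)) (coaction W t))"
        by (simp add: arg body)
      show "lin k V ?Q (\<lambda>t. sw ?Q (\<lambda>m0 m1. pure_tensor k V HH m0 (comult H m1)) (coaction W t))"
        by (simp add: arg lin_comult)
      fix m n assume [simp]: "m \<in> carrier M" "n \<in> carrier N"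
      let ?p = "\<lambda>m0 n0 a b. pure_tensor k V HH (vpure k M N m0 n0) (pure_tensor k H H a b)"
      have push: "pure_tensor k V HH v (sw HH f (comult H x)) = sw ?Q (\<lambda>a b. pure_tensor k V HH v (f
        a b)) (comult H x)"
        if "v \<in> carrier V" "x \<in> carrier H" "\<And>a b. a \<in> carrier H \<Longrightarrow> b \<in> carrier H
          \<Longrightarrow> f a b \<in> carrier HH" for v x f
        by (rule comult_push[where g = "pure_tensor k V HH v"]) (use that in simp_all)
      have \<Delta>: "pure_tensor k V HH v (comult H (x \<otimes>\<^bsub>H\<^esub> y)) = sw ?Q (\<lambda>x1 x2. sw ?Q (\<lambda>y1 y2.
          pure_tensor k V HH v (pure_tensor k H H (x1 \<otimes>\<^bsub>H\<^esub> y1) (x2 \<otimes>\<^bsub>H\<^esub> y2))) (comult H y)) (comult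
            H x)"
        if [simp]: "v \<in> carrier V" "x \<in> carrier H" "y \<in> carrier H" for v x y
      proof -
        have "comult H (x \<otimes>\<^bsub>H\<^esub> y) = sw HH (\<lambda>x1 x2. sw HH (\<lambda>y1 y2. pure_tensor k H H (x1 \<otimes>\<^bsub>H\<^esub> y1) (x2
          \<otimes>\<^bsub>H\<^esub> y2)) (comult H y)) (comult H x)"
          using sw_comult_mult[of HH x y "pure_tensor k H H"] sw_pures[of k H H
            "comult H (x \<otimes>\<^bsub>H\<^esub> y)"] by simp
        then show ?thesis by (simp add: push)
      qed
      \<comment> \<open>The iterated coactions of \<open>M\<close> and \<open>N\<close> are
        interleaved. Interchanging sums brings the pair for \<open>N\<close> together, and
        coassociativity applies to it and then to the pair for \<open>M\<close>; further
        interchanges recover \<open>\<Delta>(n\<^sub>1 m\<^sub>1)\<close>.\<close>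
      have "sw ?Q (\<lambda>m0 m1. sw ?Q (\<lambda>m00 m01. pure_tensor k V HH m00 (pure_tensor k H H m01 m1))
        (coaction W m0)) (coaction W (vpure k M N m n))
        = sw ?Q (\<lambda>m0 m1. sw ?Q (\<lambda>n0 n1. sw ?Q (\<lambda>m00 m01. sw ?Q (\<lambda>n00 n01. ?p m00 n00 (n01 \<otimes>\<^bsub>H\<^esub> m01)
          (n1 \<otimes>\<^bsub>H\<^esub> m1))
            (coaction N n0)) (coaction M m0)) (coaction N n)) (coaction M m)"
        by (simp add: sw_coaction_tens arg body)
      also have "\<dots> = sw ?Q (\<lambda>m0 m1. sw ?Q (\<lambda>m00 m01. sw ?Q (\<lambda>n0 n1. sw ?Q (\<lambda>n00 n01. ?p m00 n00 (n01
        \<otimes>\<^bsub>H\<^esub> m01) (n1 \<otimes>\<^bsub>H\<^esub> m1))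
            (coaction N n0)) (coaction N n)) (coaction M m0)) (coaction M m)"
        by (rule sw_coact_cong[OF MC], simp, rule sw_swap[of k M H N H ?Q]) simp_all
      also have "\<dots> = sw ?Q (\<lambda>m0 m1. sw ?Q (\<lambda>m00 m01. sw ?Q (\<lambda>n0 n1. sw ?Q (\<lambda>a b. ?p m00 n0 (a \<otimes>\<^bsub>H\<^esub>
        m01) (b \<otimes>\<^bsub>H\<^esub> m1))
            (comult H n1)) (coaction N n)) (coaction M m0)) (coaction M m)"
        by (rule sw_coact_cong[OF MC], simp, rule sw_coact_cong[OF MC], simp, rule coact_coassoc[OF
          NC]) simp_all
      also have "\<dots> = sw ?Q (\<lambda>m0 m1. sw ?Q (\<lambda>c d. sw ?Q (\<lambda>n0 n1. sw ?Q (\<lambda>a b. ?p m0 n0 (a \<otimes>\<^bsub>H\<^esub> c) (b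
        \<otimes>\<^bsub>H\<^esub> d))
            (comult H n1)) (coaction N n)) (comult H m1)) (coaction M m)"
        by (rule coact_coassoc[OF MC]) simp_all
      also have "\<dots> = sw ?Q (\<lambda>m0 m1. sw ?Q (\<lambda>n0 n1. sw ?Q (\<lambda>c d. sw ?Q (\<lambda>a b. ?p m0 n0 (a \<otimes>\<^bsub>H\<^esub> c) (b
        \<otimes>\<^bsub>H\<^esub> d))
            (comult H n1)) (comult H m1)) (coaction N n)) (coaction M m)"
        by (rule sw_coact_cong[OF MC], simp, rule sw_swap[of k N H H H ?Q]) simp_all
      also have "\<dots> = sw ?Q (\<lambda>m0 m1. sw ?Q (\<lambda>n0 n1. sw ?Q (\<lambda>a b. sw ?Q (\<lambda>c d. ?p m0 n0 (a \<otimes>\<^bsub>H\<^esub> c) (b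
        \<otimes>\<^bsub>H\<^esub> d))
            (comult H m1)) (comult H n1)) (coaction N n)) (coaction M m)"
        by (rule sw_coact_cong[OF MC], simp, rule sw_coact_cong[OF NC], simp, rule sw_swap[of k H H
          H H ?Q]) simp_all
      also have "\<dots> = sw ?Q (\<lambda>m0 m1. pure_tensor k V HH m0 (comult H m1)) (coaction W (vpure k M N m
        n))"
        by (simp add: sw_coaction_tens lin_comult \<Delta>)
      finally show "sw ?Q (\<lambda>m0 m1. sw ?Q (\<lambda>m00 m01. pure_tensor k V HH m00 (pure_tensor k H H m01
        m1)) (coaction W m0)) (coaction W (vpure k M N m n))
        = sw ?Q (\<lambda>m0 m1. pure_tensor k V HH m0 (comult H m1)) (coaction W (vpure k M N m n))" .
    qed (use t in simp_all)
    then show ?thesis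
      using t by (simp add: lift arg body tensor_map_eq_sw[of k V H] lin_comult)
  qed
qed

end

context hopf_algebra_bij
begin

text \<open>The inverse antipode applied to the right antipode axiom. The compatibility condition of
  the unit object reduces to this identity.\<close>

lemma sw_sinv_right:
  assumes [simp]: "module k P" "h \<in> carrier H" and f: "lin k H P f"
  shows "sw P (\<lambda>x y. f (y \<otimes>\<^bsub>H\<^esub> sinv x)) (comult H h) = counit H h \<odot>\<^bsub>P\<^esub> f \<one>\<^bsub>H\<^esub>"
proof -
  have "sinv (sw H (\<lambda>x y. x \<otimes>\<^bsub>H\<^esub> antipode H y) (comult H h)) = sw H (\<lambda>x y. y \<otimes>\<^bsub>H\<^esub> sinv x) (comult H
    h)"
    by (simp add: comult_push[OF _ _ _ lin_sinv_self] sinv_mult)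
  then have "sw H (\<lambda>x y. y \<otimes>\<^bsub>H\<^esub> sinv x) (comult H h) = counit H h \<odot>\<^bsub>H\<^esub> \<one>\<^bsub>H\<^esub>"
    using antipode_right[of h] by (simp add: lin_smult[OF lin_sinv_self])
  then show ?thesis
    using comult_push[OF _ _ _ f, of h "\<lambda>x y. y \<otimes>\<^bsub>H\<^esub> sinv x"] lin_smult[OF f, of "counit H h"
      "\<one>\<^bsub>H\<^esub>"] by simp
qed

text \<open>Regrouping of a fourfold coproduct from \<open>(12)(34)\<close> to
  \<open>(1(23))4\<close>. The first grouping is left behind by the cancellation in a tensor
  product; in the second the inner pair acts while the outer legs enter the coefficient.\<close>

lemma sw_coassoc4:
  assumes P [simp]: "module k P" and h [simp]: "h \<in> carrier H"
    and D1: "\<And>x y z. x \<in> carrier H \<Longrightarrow> y \<in> carrier H \<Longrightarrow> z \<in> carrier H \<Longrightarrow> lin k H P (\<lambda>w. D w x y z)"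
    and D2: "\<And>x y z. x \<in> carrier H \<Longrightarrow> y \<in> carrier H \<Longrightarrow> z \<in> carrier H \<Longrightarrow> lin k H P (\<lambda>w. D x w y z)"
    and D3: "\<And>x y z. x \<in> carrier H \<Longrightarrow> y \<in> carrier H \<Longrightarrow> z \<in> carrier H \<Longrightarrow> lin k H P (\<lambda>w. D x y w z)"
    and D4: "\<And>x y z. x \<in> carrier H \<Longrightarrow> y \<in> carrier H \<Longrightarrow> z \<in> carrier H \<Longrightarrow> lin k H P (\<lambda>w. D x y z w)"
  shows "sw P (\<lambda>x y. sw P (\<lambda>h1 h2. sw P (\<lambda>h3 h4. D h1 h2 h3 h4) (comult H y)) (comult H x)) (comult
    H h)
    = sw P (\<lambda>x h4. sw P (\<lambda>h1 y. sw P (\<lambda>h2 h3. D h1 h2 h3 h4) (comult H y)) (comult H x)) (comult H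
      h)"
proof -
  note [simp] = D1 D2 D3 D4 lin_closed[OF D1]
  have "sw P (\<lambda>x y. sw P (\<lambda>h1 h2. sw P (\<lambda>h3 h4. D h1 h2 h3 h4) (comult H y)) (comult H x)) (comult H
    h)
    = sw P (\<lambda>h1 w. sw P (\<lambda>h2 y. sw P (\<lambda>h3 h4. D h1 h2 h3 h4) (comult H y)) (comult H w)) (comult H
      h)"
    by (rule sw_coassoc) simp_all
  also have "\<dots> = sw P (\<lambda>h1 w. sw P (\<lambda>y h4. sw P (\<lambda>h2 h3. D h1 h2 h3 h4) (comult H y)) (comult H w))
    (comult H h)"
    by (rule sw_comult_cong, simp, rule sw_coassoc[symmetric]) simp_all
  also have "\<dots> = sw P (\<lambda>x h4. sw P (\<lambda>h1 y. sw P (\<lambda>h2 h3. D h1 h2 h3 h4) (comult H y)) (comult H x))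
    (comult H h)"
    by (rule sw_coassoc[symmetric]) simp_all
  finally show ?thesis .
qed

end

context action_coaction_pair
begin

text \<open>With \<open>\<Delta>(h) = x \<otimes> y\<close>, compatibility of the factors gives the
  coefficient \<open>\<delta>\<theta>(y\<^sub>3) n\<^sub>1
  \<gamma>\<theta>(S\<^sup>-\<^sup>1(y\<^sub>1)) \<beta>\<gamma>(x\<^sub>3) m\<^sub>1
  \<alpha>\<gamma>(S\<^sup>-\<^sup>1(x\<^sub>1))\<close>. By \<open>twist\<close> the middle is
  \<open>\<beta>\<gamma>(S\<^sup>-\<^sup>1(y\<^sub>1) x\<^sub>3)\<close>, which contracts to
  \<open>1\<close>. The outer automorphisms \<open>\<delta>\<theta>\<close> and
  \<open>\<alpha>\<gamma>\<close> are \<open>\<beta>'\<close> and \<open>\<alpha>'\<close>.\<close>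

lemma yetter_drinfeld_tens:
  assumes M: "yetter_drinfeld k H \<alpha> \<beta> M" and N: "yetter_drinfeld k H \<gamma> \<delta> N"
    and autos: "\<alpha> \<in> hopf_auto k H" "\<beta> \<in> hopf_auto k H" "\<delta> \<in> hopf_auto k H"
    and twist: "\<And>h. h \<in> carrier H \<Longrightarrow> \<gamma> (\<theta> h) = \<beta> (\<gamma> h)"
    and \<alpha>': "\<And>h. h \<in> carrier H \<Longrightarrow> \<alpha>' h = \<alpha> (\<gamma> h)"
    and \<beta>': "\<And>h. h \<in> carrier H \<Longrightarrow> \<beta>' h = \<delta> (\<theta> h)"
  shows "yetter_drinfeld k H \<alpha>' \<beta>' W"
proof (intro yetter_drinfeld.intro yetter_drinfeld_axioms.intro)
  show "left_action k H W" "right_coaction k H W" by simp_all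
  note [simp] = auto_rules[OF autos(1)] auto_rules[OF autos(2)] auto_rules[OF autos(3)] twist
  fix h t assume h [simp]: "h \<in> carrier H" and t: "t \<in> carrier W"
  let ?p = "\<lambda>a c z. pure_tensor k V H (vpure k M N a c) z"
  let ?R = "\<lambda>t. sw VH (\<lambda>h12 h3. sw VH (\<lambda>h1 h2. sw VH (\<lambda>m0 m1. pure_tensor k V H (action W h2 m0)
      (\<delta> (\<theta> h3) \<otimes>\<^bsub>H\<^esub> m1 \<otimes>\<^bsub>H\<^esub> \<alpha> (\<gamma> (sinv h1)))) (coaction W t)) (comult H h12)) (comult H h)"
  have lin_W [simp]: "lin k L V (\<lambda>x. action W h (f x))" if "h \<in> carrier H" "lin k L V f"
    for h f and L :: "('k, ('k, 'a) vec) module"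
    using lin_comp[OF lin_action_tens] that by blast
  have [simp]: "lin k H V (\<lambda>x. action W x t)" if "t \<in> carrier V" for t
    using lin_action_tens_left that by blast
  have [simp]: "action W h t \<in> carrier V" if "h \<in> carrier H" "t \<in> carrier V" for h t
    using lin_closed[OF lin_action_tens] that by blast
  have arg [simp]: "lin k V VH (\<lambda>x. sw VH f (coaction W x))" if "bilin k V H VH f" for f
    by (rule lin_comp[OF lin_sw_self lin_coaction_tens]) (use that in simp_all)
  have [simp]: "coaction W t \<in> carrier VH" if "t \<in> carrier V" for t
    using lin_closed[OF lin_coaction_tens that] .
  have occ [simp]: "occurs (coaction W t) x y \<longleftrightarrow> x \<in> carrier V \<and> y \<in> carrier H \<and> occurring (coaction
    W t) x y"
    "occurs_lift (coaction W t) x y \<longleftrightarrow> x \<in> carrier V \<and> y \<in> carrier H \<and> occurring_lift (coaction W t)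
      x y"
    if "t \<in> carrier V" for t x y
    using that by (simp_all add: occurs_iff[of k V H] occurs_lift_iff[of k V H])
  have lift [simp]: "tensor_lift VH F (coaction W t) = sw VH F (coaction W t)" if "t \<in> carrier V"
    "bilin k V H VH F" for F t
    using that by (intro tensor_lift_eq_sw[of k V H]) simp_all
  have body [simp]: "lin k L VH (\<lambda>w. sw VH (F w) (coaction W t))"
    if "module k L" "t \<in> carrier V" "\<And>u v. u \<in> carrier V \<Longrightarrow> v \<in> carrier H \<Longrightarrow> lin k L VH (\<lambda>w. F w u v)"
    for L :: "('k, 'h, 'y) hopf_scheme" and F t
    by (rule lin_sw_body[of k V H]) (use that in simp_all)
  have "coaction W (action W h t) = ?R t"
  proof (rule vtensor_ext[where t = t and P = VH and M = M and N = N and k = k])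
    show "lin k V VH (\<lambda>t. coaction W (action W h t))"
      by (rule lin_comp[OF lin_coaction_tens lin_action_tens]) simp
    show "lin k V VH ?R" by simp
    fix m n assume [simp]: "m \<in> carrier M" "n \<in> carrier N"
    \<comment> \<open>The variable \<open>z\<close> marks the place of the two middle factors: it is
      first \<open>S\<^sup>-\<^sup>1(y\<^sub>1) x\<^sub>3\<close> and becomes \<open>1\<close> after
      the contraction.\<close>
    let ?E = "\<lambda>x1 x2 z y2 y3 m0 m1 n0 n1. ?p (action M (\<gamma> x2) m0) (action N (\<theta> y2) n0)
      (\<delta> (\<theta> y3) \<otimes>\<^bsub>H\<^esub> (n1 \<otimes>\<^bsub>H\<^esub> (\<beta> (\<gamma> z) \<otimes>\<^bsub>H\<^esub> (m1 \<otimes>\<^bsub>H\<^esub> \<alpha> (\<gamma> (sinv x1))))))"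
    let ?G = "\<lambda>x12 z y23. sw VH (\<lambda>x1 x2. sw VH (\<lambda>y2 y3. sw VH (\<lambda>m0 m1. sw VH (\<lambda>n0 n1.
      ?E x1 x2 z y2 y3 m0 m1 n0 n1) (coaction N n)) (coaction M m)) (comult H y23)) (comult H x12)"
    have K: "sw VH (\<lambda>c d. ?p a c (d \<otimes>\<^bsub>H\<^esub> b)) (coaction N (action N (\<theta> y) n))
      = sw VH (\<lambda>y1 y23. sw VH (\<lambda>y2 y3. sw VH (\<lambda>n0 n1. ?p a (action N (\<theta> y2) n0)
        ((\<delta> (\<theta> y3) \<otimes>\<^bsub>H\<^esub> n1 \<otimes>\<^bsub>H\<^esub> \<gamma> (sinv (\<theta> y1))) \<otimes>\<^bsub>H\<^esub> b)) (coaction N n)) (comult H y23)) (comult H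
          y)"
      if [simp]: "a \<in> carrier M" "b \<in> carrier H" "y \<in> carrier H" for a b y
      by (subst coact_act[OF N \<gamma> autos(3)]) simp_all
    \<comment> \<open>\<open>M\<close> is expanded with its third leg outermost and \<open>N\<close>
      with its first leg outermost, since \<open>x3\<close> and \<open>y1\<close> are the legs that
      cancel. All other sums are moved into \<open>?G\<close>.\<close>
    have J: "sw VH (\<lambda>a b. sw VH (\<lambda>c d. ?p a c (d \<otimes>\<^bsub>H\<^esub> b)) (coaction N (action N (\<theta> y) n))) (coaction
      M (action M (\<gamma> x) m))
      = sw VH (\<lambda>x12 x3. sw VH (\<lambda>y1 y23. ?G x12 (sinv y1 \<otimes>\<^bsub>H\<^esub> x3) y23) (comult H y)) (comult H x)"
      if [simp]: "x \<in> carrier H" "y \<in> carrier H" for x y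
    proof -
      have "sw VH (\<lambda>a b. sw VH (\<lambda>c d. ?p a c (d \<otimes>\<^bsub>H\<^esub> b)) (coaction N (action N (\<theta> y) n))) (coaction
        M (action M (\<gamma> x) m))
        = sw VH (\<lambda>x12 x3. sw VH (\<lambda>x1 x2. sw VH (\<lambda>m0 m1. sw VH (\<lambda>c d. ?p (action M (\<gamma> x2) m0) c
            (d \<otimes>\<^bsub>H\<^esub> (\<beta> (\<gamma> x3) \<otimes>\<^bsub>H\<^esub> m1 \<otimes>\<^bsub>H\<^esub> \<alpha> (sinv (\<gamma> x1))))) (coaction N (action N (\<theta> y) n)))
            (coaction M m)) (comult H x12)) (comult H x)"
        by (subst coact_act_left_nested[OF M autos(1,2)]) simp_all
      also have "\<dots> = sw VH (\<lambda>x12 x3. sw VH (\<lambda>x1 x2. sw VH (\<lambda>m0 m1. sw VH (\<lambda>y1 y23. sw VH (\<lambda>y2 y3. sw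
        VH (\<lambda>n0 n1.
          ?E x1 x2 (sinv y1 \<otimes>\<^bsub>H\<^esub> x3) y2 y3 m0 m1 n0 n1) (coaction N n)) (comult H y23)) (comult H
            y))
            (coaction M m)) (comult H x12)) (comult H x)"
        by (simp add: K) (simp add: assoc_H)
      also have "\<dots> = sw VH (\<lambda>x12 x3. sw VH (\<lambda>x1 x2. sw VH (\<lambda>y1 y23. sw VH (\<lambda>m0 m1. sw VH (\<lambda>y2 y3. sw
        VH (\<lambda>n0 n1.
          ?E x1 x2 (sinv y1 \<otimes>\<^bsub>H\<^esub> x3) y2 y3 m0 m1 n0 n1) (coaction N n)) (comult H y23)) (coaction M
            m))
            (comult H y)) (comult H x12)) (comult H x)"
        by (rule sw_comult_cong, simp, rule sw_comult_cong, simp, rule sw_swap[of k H H M H VH])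
          simp_all
      also have "\<dots> = sw VH (\<lambda>x12 x3. sw VH (\<lambda>x1 x2. sw VH (\<lambda>y1 y23. sw VH (\<lambda>y2 y3. sw VH (\<lambda>m0 m1. sw
        VH (\<lambda>n0 n1.
          ?E x1 x2 (sinv y1 \<otimes>\<^bsub>H\<^esub> x3) y2 y3 m0 m1 n0 n1) (coaction N n)) (coaction M m)) (comult H
            y23))
            (comult H y)) (comult H x12)) (comult H x)"
        by (rule sw_comult_cong, simp, rule sw_comult_cong, simp, rule sw_comult_cong, simp,
            rule sw_swap[of k H H M H VH]) simp_all
      also have "\<dots> = sw VH (\<lambda>x12 x3. sw VH (\<lambda>y1 y23. ?G x12 (sinv y1 \<otimes>\<^bsub>H\<^esub> x3) y23) (comult H y))
        (comult H x)"
        by (rule sw_comult_cong, simp, rule sw_swap[of k H H H H VH]) simp_all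
      finally show ?thesis .
    qed
    have "coaction W (action W h (vpure k M N m n)) = sw VH (\<lambda>x y. sw VH (\<lambda>a b. sw VH (\<lambda>c d. ?p a c
      (d \<otimes>\<^bsub>H\<^esub> b))
        (coaction N (action N (\<theta> y) n))) (coaction M (action M (\<gamma> x) m))) (comult H h)"
      by (simp add: comult_push[OF _ _ _ lin_coaction_tens] coaction_tens_pure)
    also have "\<dots> = sw VH (\<lambda>x y. sw VH (\<lambda>x12 x3. sw VH (\<lambda>y1 y23. ?G x12 (sinv y1 \<otimes>\<^bsub>H\<^esub> x3) y23)
      (comult H y)) (comult H x)) (comult H h)"
      by (rule sw_comult_cong, simp, rule J)
    \<comment> \<open>As \<open>x\<close> and \<open>y\<close> come from one coproduct, the last leg
      of \<open>x\<close> and the first leg of \<open>y\<close> are consecutive legs of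
      \<open>h\<close>, so \<open>sw_contract\<close> applies.\<close>
    also have "\<dots> = sw VH (\<lambda>x y. ?G x \<one>\<^bsub>H\<^esub> y) (comult H h)"
      by (rule sw_contract) simp_all
    also have "\<dots> = sw VH (\<lambda>x h4. sw VH (\<lambda>h1 y. sw VH (\<lambda>h2 h3. sw VH (\<lambda>m0 m1. sw VH (\<lambda>n0 n1.
        ?E h1 h2 \<one>\<^bsub>H\<^esub> h3 h4 m0 m1 n0 n1) (coaction N n)) (coaction M m)) (comult H y)) (comult H x))
          (comult H h)"
      by (rule sw_coassoc4) simp_all
    also have "\<dots> = ?R (vpure k M N m n)"
    proof -
      have push: "pure_tensor k V H (sw V f (comult H x)) z = sw VH (\<lambda>a b. pure_tensor k V H (f a b)
        z) (comult H x)"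
        if "z \<in> carrier H" "x \<in> carrier H" "\<And>a b. a \<in> carrier H \<Longrightarrow> b \<in> carrier H \<Longrightarrow> f a b \<in> carrier V"
          for z x f
        by (rule comult_push[where g = "\<lambda>v. pure_tensor k V H v z"]) (use that in simp_all)
      \<comment> \<open>The right-hand side is expanded separately and brought to the same order of
        summation. Here the inner coproduct comes from the action of the middle leg on
        \<open>m\<^sub>0 \<otimes> n\<^sub>0\<close>.\<close>
      have "?R (vpure k M N m n) = sw VH (\<lambda>h12 h4. sw VH (\<lambda>h1 y. sw VH (\<lambda>m0 m1. sw VH (\<lambda>n0 n1. sw VH
        (\<lambda>h2 h3.
          ?E h1 h2 \<one>\<^bsub>H\<^esub> h3 h4 m0 m1 n0 n1) (comult H y)) (coaction N n)) (coaction M m)) (comult H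
            h12)) (comult H h)"
        by (simp add: sw_coaction_tens push) (simp add: assoc_H)
      also have "\<dots> = sw VH (\<lambda>h12 h4. sw VH (\<lambda>h1 y. sw VH (\<lambda>m0 m1. sw VH (\<lambda>h2 h3. sw VH (\<lambda>n0 n1.
          ?E h1 h2 \<one>\<^bsub>H\<^esub> h3 h4 m0 m1 n0 n1) (coaction N n)) (comult H y)) (coaction M m)) (comult H
            h12)) (comult H h)"
        by (rule sw_comult_cong, simp, rule sw_comult_cong, simp, rule sw_coact_cong[OF MC], simp,
            rule sw_swap[of k H H N H VH]) simp_all
      also have "\<dots> = sw VH (\<lambda>h12 h4. sw VH (\<lambda>h1 y. sw VH (\<lambda>h2 h3. sw VH (\<lambda>m0 m1. sw VH (\<lambda>n0 n1.
          ?E h1 h2 \<one>\<^bsub>H\<^esub> h3 h4 m0 m1 n0 n1) (coaction N n)) (coaction M m)) (comult H y)) (comult H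
            h12)) (comult H h)"
        by (rule sw_comult_cong, simp, rule sw_comult_cong, simp,
            rule sw_swap[of k H H M H VH]) simp_all
      finally show ?thesis by simp
    qed
    finally show "coaction W (action W h (vpure k M N m n)) = ?R (vpure k M N m n)" .
  qed (use t in simp_all)
  then show "coaction W (action W h t) = tensor_lift (tensor_module k W H)
      (\<lambda>h12 h3. tensor_lift (tensor_module k W H) (\<lambda>h1 h2. tensor_lift (tensor_module k W H)
        (\<lambda>m0 m1. pure_tensor k W H (action W h2 m0)
          (\<beta>' h3 \<otimes>\<^bsub>H\<^esub> m1 \<otimes>\<^bsub>H\<^esub> \<alpha>' (inv_into (carrier H) (antipode H) h1)))
        (coaction W t)) (comult H h12)) (comult H h)"
    using t by (simp add: \<alpha>' \<beta>' flip: sinv_def)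
qed

end

section \<open>Conjugation and the unit object\<close>

definition yd_twist ::
  "('k, 'x) ring_scheme \<Rightarrow> ('k, 'h, 'y) hopf_scheme \<Rightarrow> ('h \<Rightarrow> 'h) \<Rightarrow> ('h \<Rightarrow> 'h)
    \<Rightarrow> ('k, 'h, 'v) yd_module \<Rightarrow> ('k, 'h, 'v) yd_module" where
  "yd_twist k H \<theta> \<eta> N = N\<lparr>action := (\<lambda>h\<in>carrier H. \<lambda>n\<in>carrier N. action N (\<theta> h) n),
     coaction := (\<lambda>n\<in>carrier N. tensor_map k N H (\<lambda>x. x) \<eta> (coaction N n))\<rparr>"

lemma truncate_yd_twist: "module.truncate (yd_twist k H \<theta> \<eta> N) = module.truncate N"
  by (simp add: yd_twist_def module.defs)

lemmas yd_twist_trunc [simp] = trunc_rules[OF truncate_yd_twist]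
lemmas yd_twist_vtrunc [simp] =
  trunc_vtensor[OF truncate_yd_twist] trunc_vpure[OF truncate_yd_twist] trunc_vlift[OF
    truncate_yd_twist]
  trunc_vlift_target[OF truncate_yd_twist]

lemma yd_conj_ob_eq:
  "yd_conj_ob k H (\<alpha>, \<beta>) ((\<gamma>, \<delta>), N) =
    ((\<alpha>, \<beta>) \<otimes>\<^bsub>yd_group k H\<^esub> (\<gamma>, \<delta>) \<otimes>\<^bsub>yd_group k H\<^esub> inv\<^bsub>yd_group k H\<^esub> (\<alpha>, \<beta>),
     yd_twist k H (inv\<^bsub>Aut_Hopf k H\<^esub> \<gamma> \<otimes>\<^bsub>Aut_Hopf k H\<^esub> \<beta> \<otimes>\<^bsub>Aut_Hopf k H\<^esub> \<gamma> \<otimes>\<^bsub>Aut_Hopf k H\<^esub>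
       inv\<^bsub>Aut_Hopf k H\<^esub> \<alpha>)
       (\<alpha> \<otimes>\<^bsub>Aut_Hopf k H\<^esub> inv\<^bsub>Aut_Hopf k H\<^esub> \<beta>) N)"
  by (simp add: yd_conj_ob_def yd_twist_def Let_def)

context hopf_algebra_bij
begin

context
  fixes N :: "('k, 'h, 'v) yd_module" and \<theta> \<eta>
  assumes \<theta>: "\<theta> \<in> hopf_auto k H" and \<eta>: "\<eta> \<in> hopf_auto k H"
begin

lemma action_twist [simp]:
  "h \<in> carrier H \<Longrightarrow> n \<in> carrier N \<Longrightarrow> action (yd_twist k H \<theta> \<eta> N) h n = action N (\<theta> h) n"
  by (simp add: yd_twist_def)

lemma coaction_twist:
  "n \<in> carrier N \<Longrightarrow> coaction (yd_twist k H \<theta> \<eta> N) n = tensor_map k N H (\<lambda>x. x) \<eta> (coaction N n)"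
  by (simp add: yd_twist_def)

lemma left_action_twist:
  assumes N: "left_action k H N"
  shows "left_action k H (yd_twist k H \<theta> \<eta> N)"
proof (intro left_action.intro left_action_axioms.intro)
  note [simp] = auto_rules[OF \<theta>] N
  show "field k" "module k (yd_twist k H \<theta> \<eta> N)" by (simp_all add: act_module[OF N])
  show "action (yd_twist k H \<theta> \<eta> N) \<in> carrier H \<rightarrow>\<^sub>E carrier (yd_twist k H \<theta> \<eta> N) \<rightarrow>\<^sub>E carrier
    (yd_twist k H \<theta> \<eta> N)"
    by (auto simp: yd_twist_def PiE_def extensional_def Pi_def)
  show "action (yd_twist k H \<theta> \<eta> N) h \<in> linear_maps k (yd_twist k H \<theta> \<eta> N) (yd_twist k H \<theta> \<eta> N)"
    if h: "h \<in> carrier H" for h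
  proof -
    have "lin k N N (action (yd_twist k H \<theta> \<eta> N) h)"
      by (subst lin_cong[where g = "\<lambda>n. action N (\<theta> h) n"]) (use h in \<open>simp_all add: act_module[OF
        N]\<close>)
    then show ?thesis by (simp flip: lin_def)
  qed
qed (simp_all add: \<theta> auto_rules[OF \<theta>] act_mult[OF N] act_one[OF N] N
      left_action.action_add[OF N] left_action.action_smult[OF N]
      lin_add[OF lin_auto_self[OF \<theta>]] lin_smult[OF lin_auto_self[OF \<theta>]])

context
  assumes N: "right_coaction k H N"
begin

lemma lin_coaction_twist: "lin k N (tensor_module k N H) (coaction (yd_twist k H \<theta> \<eta> N))"
  by (subst lin_cong[OF coaction_twist])
    (simp_all add: coact_module[OF N] N
      lin_comp[OF lin_tensor_map[OF coact_module[OF N] mod_H coact_module[OF N] mod_H lin_ident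
        lin_auto_self[OF \<eta>]]])

lemma sw_coaction_twist:
  assumes "module k P" "n \<in> carrier N" "bilin k N H P F"
  shows "sw P F (coaction (yd_twist k H \<theta> \<eta> N) n) = sw P (\<lambda>n0 n1. F n0 (\<eta> n1)) (coaction N n)"
  unfolding coaction_twist[OF assms(2)]
  by (rule sw_tensor_map[of k N H]) (use assms N in \<open>simp_all add: coact_module[OF N]
    lin_auto_self[OF \<eta>]\<close>)

text \<open>Changing the coefficients by \<open>\<eta>\<close> preserves the comodule axioms because
  \<open>\<eta>\<close> is a coalgebra map: it respects the counit, and
  \<open>\<Delta>\<eta> = (\<eta> \<otimes> \<eta>)\<Delta>\<close>.\<close>

lemma right_coaction_twist: "right_coaction k H (yd_twist k H \<theta> \<eta> N)"
proof (intro right_coaction.intro right_coaction_axioms.intro)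
  let ?N = "yd_twist k H \<theta> \<eta> N"
  note [simp] = auto_rules[OF \<eta>] N coact_module[OF N]
  show "field k" "module k ?N" by simp_all
  show "coaction ?N \<in> extensional (carrier ?N)" by (simp add: yd_twist_def)
  show "coaction ?N \<in> linear_maps k ?N (tensor_module k ?N H)"
    using lin_coaction_twist by (simp flip: lin_def)
  have cl [simp]: "coaction ?N n \<in> carrier (tensor_module k N H)" if "n \<in> carrier N" for n
    using lin_closed[OF lin_coaction_twist that] .
  have occ [simp]: "occurs (coaction ?N t) x y \<longleftrightarrow> x \<in> carrier N \<and> y \<in> carrier H \<and> occurring (coaction
    ?N t) x y"
    "occurs_lift (coaction ?N t) x y \<longleftrightarrow> x \<in> carrier N \<and> y \<in> carrier H \<and> occurring_lift (coaction ?N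
      t) x y"
    if "t \<in> carrier N" for t x y
    using that by (simp_all add: occurs_iff[of k N H] occurs_lift_iff[of k N H])
  show "tensor_lift ?N (\<lambda>m0 m1. counit H m1 \<odot>\<^bsub>?N\<^esub> m0) (coaction ?N n) = n" if "n \<in> carrier ?N" for n
    using that coact_counit[OF N, of N n "\<lambda>x. x"]
    by (simp add: tensor_lift_eq_sw[of k N H] sw_coaction_twist)
  show "tensor_lift (tensor_module k ?N HH) (\<lambda>m0 m1. tensor_lift (tensor_module k ?N HH)
      (\<lambda>m00 m01. pure_tensor k ?N HH m00 (pure_tensor k H H m01 m1)) (coaction ?N m0)) (coaction ?N
        n) =
    tensor_map k ?N HH (\<lambda>x. x) (comult H) (coaction ?N n)" if "n \<in> carrier ?N" for n
  proof -
    from that have n [simp]: "n \<in> carrier N" by simp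
    let ?Q = "tensor_module k N HH"
    let ?p = "\<lambda>m a b. pure_tensor k N HH m (pure_tensor k H H a b)"
    have lift: "tensor_lift ?Q F (coaction ?N t) = sw ?Q F (coaction ?N t)" if "t \<in> carrier N"
      "bilin k N H ?Q F" for F t
      using that by (intro tensor_lift_eq_sw[of k N H]) simp_all
    have body: "lin k L ?Q (\<lambda>w. sw ?Q (F w) (coaction ?N t))"
      if "module k L" "t \<in> carrier N" "\<And>u v. u \<in> carrier N \<Longrightarrow> v \<in> carrier H
        \<Longrightarrow> lin k L ?Q (\<lambda>w. F w u v)"
      for L :: "('k, 'h, 'y) hopf_scheme" and F t
      by (rule lin_sw_body[of k N H]) (use that in simp_all)
    have arg: "lin k N ?Q (\<lambda>x. sw ?Q f (coaction ?N x))" if "bilin k N H ?Q f" for f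
      by (rule lin_comp[OF lin_sw_self lin_coaction_twist]) (use that in simp_all)
    have push: "pure_tensor k N HH v (sw HH f (comult H x)) = sw ?Q (\<lambda>a b. pure_tensor k N HH v (f a
      b)) (comult H x)"
      if "v \<in> carrier N" "x \<in> carrier H" "\<And>a b. a \<in> carrier H \<Longrightarrow> b \<in> carrier H \<Longrightarrow> f a b \<in> carrier HH"
        for v x f
      by (rule comult_push[where g = "pure_tensor k N HH v"]) (use that in simp_all)
    have \<Delta>: "comult H (\<eta> x) = sw HH (\<lambda>a b. pure_tensor k H H (\<eta> a) (\<eta> b)) (comult H x)" if
      "x \<in> carrier H" for x
      using that by (simp add: auto_comult[OF \<eta>] tensor_map_eq_sw[of k H H] lin_auto_self[OF \<eta>])
    have "sw ?Q (\<lambda>m0 m1. sw ?Q (\<lambda>m00 m01. ?p m00 m01 m1) (coaction ?N m0)) (coaction ?N n)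
      = sw ?Q (\<lambda>m0 m1. sw ?Q (\<lambda>m00 m01. ?p m00 (\<eta> m01) (\<eta> m1)) (coaction N m0)) (coaction N n)"
      by (simp add: sw_coaction_twist arg body)
    also have "\<dots> = sw ?Q (\<lambda>m0 m1. sw ?Q (\<lambda>a b. ?p m0 (\<eta> a) (\<eta> b)) (comult H m1)) (coaction N n)"
      by (rule coact_coassoc[OF N]) simp_all
    also have "\<dots> = sw ?Q (\<lambda>m0 m1. pure_tensor k N HH m0 (comult H m1)) (coaction ?N n)"
      by (simp add: sw_coaction_twist lin_comult \<Delta> push)
    finally show ?thesis
      by (simp add: lift arg body tensor_map_eq_sw[of k N H] lin_comult)
  qed
qed

end

text \<open>\<open>\<theta>\<close> is a coalgebra map and commutes with splitting \<open>h\<close>;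
  \<open>\<eta>\<close> is an algebra map and distributes over the three factors of the coefficient.
  Moving \<open>\<theta>\<close> past the inverse antipode produces the words
  \<open>\<eta>\<gamma>\<theta>\<close> and \<open>\<eta>\<delta>\<theta>\<close>.\<close>

lemma yetter_drinfeld_twist:
  assumes N: "yetter_drinfeld k H \<gamma> \<delta> N" and \<gamma>: "\<gamma> \<in> hopf_auto k H" and \<delta>: "\<delta> \<in> hopf_auto k H"
    and \<alpha>': "\<And>h. h \<in> carrier H \<Longrightarrow> \<alpha>' h = \<eta> (\<gamma> (\<theta> h))"
    and \<beta>': "\<And>h. h \<in> carrier H \<Longrightarrow> \<beta>' h = \<eta> (\<delta> (\<theta> h))"
  shows "yetter_drinfeld k H \<alpha>' \<beta>' (yd_twist k H \<theta> \<eta> N)"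
proof (intro yetter_drinfeld.intro yetter_drinfeld_axioms.intro)
  let ?N = "yd_twist k H \<theta> \<eta> N" and ?T = "tensor_module k N H"
  note NA [simp] = yd_left_action[OF N \<gamma> \<delta>] and NC [simp] = yd_right_coaction[OF N \<gamma> \<delta>]
  note [simp] = act_module[OF NA] auto_rules[OF \<eta>] auto_rules[OF \<theta>] auto_rules[OF \<gamma>] auto_rules[OF
    \<delta>]
  show "left_action k H ?N" by (rule left_action_twist[OF NA])
  show "right_coaction k H ?N" by (rule right_coaction_twist[OF NC])
  fix h n assume h [simp]: "h \<in> carrier H" and "n \<in> carrier ?N"
  then have n [simp]: "n \<in> carrier N" by simp
  have cl [simp]: "coaction ?N n \<in> carrier ?T" if "n \<in> carrier N" for n
    using lin_closed[OF lin_coaction_twist[OF NC] that] .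
  have occ [simp]: "occurs (coaction ?N t) x y \<longleftrightarrow> x \<in> carrier N \<and> y \<in> carrier H \<and> occurring (coaction
    ?N t) x y"
    "occurs_lift (coaction ?N t) x y \<longleftrightarrow> x \<in> carrier N \<and> y \<in> carrier H \<and> occurring_lift (coaction ?N
      t) x y"
    if "t \<in> carrier N" for t x y
    using that by (simp_all add: occurs_iff[of k N H] occurs_lift_iff[of k N H])
  have lift: "tensor_lift ?T F (coaction ?N t) = sw ?T F (coaction ?N t)" if "t \<in> carrier N"
    "bilin k N H ?T F" for F t
    using that by (intro tensor_lift_eq_sw[of k N H]) simp_all
  have "coaction ?N (action ?N h n) = sw ?T (\<lambda>n0 n1. pure_tensor k N H n0 (\<eta> n1)) (coaction N
    (action N (\<theta> h) n))"
    by (simp add: coaction_twist tensor_map_eq_sw[of k N H] lin_auto_self[OF \<eta>])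
  also have "\<dots> = sw ?T (\<lambda>h12 h3. sw ?T (\<lambda>h1 h2. sw ?T (\<lambda>n0 n1. pure_tensor k N H (action N (\<theta> h2)
    n0)
      (\<eta> (\<delta> (\<theta> h3)) \<otimes>\<^bsub>H\<^esub> \<eta> n1 \<otimes>\<^bsub>H\<^esub> \<eta> (\<gamma> (\<theta> (sinv h1))))) (coaction N n)) (comult H h12)) (comult H
        h)"
    by (subst coact_act_left_nested[OF N \<gamma> \<delta>]) simp_all
  finally show "coaction ?N (action ?N h n) = tensor_lift (tensor_module k ?N H)
      (\<lambda>h12 h3. tensor_lift (tensor_module k ?N H) (\<lambda>h1 h2. tensor_lift (tensor_module k ?N H)
        (\<lambda>m0 m1. pure_tensor k ?N H (action ?N h2 m0)
          (\<beta>' h3 \<otimes>\<^bsub>H\<^esub> m1 \<otimes>\<^bsub>H\<^esub> \<alpha>' (inv_into (carrier H) (antipode H) h1)))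
        (coaction ?N n)) (comult H h12)) (comult H h)"
    by (simp add: \<alpha>' \<beta>' lift sw_coaction_twist[OF NC] cong: conj_cong flip: sinv_def)
qed

end

section \<open>The unit object\<close>

definition unit_module :: "('k, 'h, ('k, 'a) vec) yd_module" where
  "unit_module = (let I = transport Scalar (base_module k) in
     \<lparr>carrier = carrier I, mult = mult I, one = one I, zero = zero I, add = add I, smult = smult I,
      action = (\<lambda>h\<in>carrier H. \<lambda>x\<in>carrier I. counit H h \<odot>\<^bsub>I\<^esub> x),
      coaction = (\<lambda>x\<in>carrier I. pure_tensor k I H x \<one>\<^bsub>H\<^esub>)\<rparr>)"

lemma yd_unit_eq: "yd_unit k H = (\<one>\<^bsub>G\<^esub>, unit_module)"
  by (simp add: yd_unit_def unit_module_def Let_def)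

text \<open>The bare vector space to which linear constructions on the unit object are rewritten, as
  \<open>vtensor\<close> is for tensor products.\<close>

definition unit_space :: "('k, ('k, 'a) vec) module" where
  "unit_space = transport Scalar (base_module k)"

lemma truncate_unit: "module.truncate unit_module = module.truncate unit_space"
  by (simp add: unit_module_def unit_space_def Let_def module.defs)

lemmas unit_trunc [simp] = vtrunc_rules[OF truncate_unit]

lemma inj_Scalar: "inj_on Scalar X"
  by (auto simp: inj_on_def)

lemma module_unit_space [simp]: "module k unit_space"
  unfolding unit_space_def by (rule module_transport[OF module_base inj_Scalar]) simp

lemma action_unit [simp]: "h \<in> carrier H \<Longrightarrow> x \<in> carrier unit_space \<Longrightarrow> action unit_module h x
  = counit H h \<odot>\<^bsub>unit_space\<^esub> x"
  by (simp add: unit_module_def unit_space_def Let_def)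

lemma coaction_unit [simp]: "x \<in> carrier unit_space \<Longrightarrow> coaction unit_module x
  = pure_tensor k unit_space H x \<one>\<^bsub>H\<^esub>"
  by (simp add: unit_module_def unit_space_def Let_def)

lemma left_action_unit: "left_action k H (unit_module :: ('k, 'h, ('k, 'a) vec) yd_module)"
proof -
  interpret I: module k "unit_space :: ('k, ('k, 'a) vec) module" by simp
  let ?U = "unit_module :: ('k, 'h, ('k, 'a) vec) yd_module"
  show ?thesis
  proof (intro left_action.intro left_action_axioms.intro)
    show "action ?U \<in> carrier H \<rightarrow>\<^sub>E carrier ?U \<rightarrow>\<^sub>E carrier ?U"
      using I.smult_closed
      by (auto simp: unit_module_def unit_space_def Let_def PiE_def extensional_def Pi_def simp del:
        transport_simps)
    show "action ?U h \<in> linear_maps k ?U ?U" if h: "h \<in> carrier H" for h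
    proof -
      have "lin k unit_space unit_space (action ?U h)"
        by (subst lin_cong[OF action_unit[OF h]]) (use h in simp_all)
      then show ?thesis by (simp flip: lin_def)
    qed
    show "action ?U (g \<oplus>\<^bsub>H\<^esub> h) x = action ?U g x \<oplus>\<^bsub>?U\<^esub> action ?U h x"
      if "g \<in> carrier H" "h \<in> carrier H" "x \<in> carrier ?U" for g h x
      using that lin_add[OF lin_counit_smult[OF module_unit_space lin_ident], of x g h] by simp
    show "action ?U (c \<odot>\<^bsub>H\<^esub> h) x = c \<odot>\<^bsub>?U\<^esub> action ?U h x"
      if "c \<in> carrier k" "h \<in> carrier H" "x \<in> carrier ?U" for c h x
      using that lin_smult[OF lin_counit_smult[OF module_unit_space lin_ident], of x c h] by simp
  qed (simp_all add: I.smult_assoc1)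
qed

lemma right_coaction_unit: "right_coaction k H unit_module"
proof (intro right_coaction.intro right_coaction_axioms.intro)
  interpret I: module k unit_space by simp
  show "field k" "module k unit_module" by simp_all
  show "coaction unit_module \<in> extensional (carrier unit_module)"
    by (simp add: unit_module_def Let_def)
  show "coaction unit_module \<in> linear_maps k unit_module (tensor_module k unit_module H)"
  proof -
    have "lin k unit_space (tensor_module k unit_space H) (coaction unit_module)"
      by (subst lin_cong[OF coaction_unit]) simp_all
    then show ?thesis by (simp flip: lin_def)
  qed
  fix x :: "('k, 'a) vec" assume "x \<in> carrier unit_module"
  then have x [simp]: "x \<in> carrier unit_space" by simp
  show "tensor_lift unit_module (\<lambda>m0 m1. counit H m1 \<odot>\<^bsub>unit_module\<^esub> m0) (coaction unit_module x)
    = x"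
    by simp
  show "tensor_lift (tensor_module k unit_module HH) (\<lambda>m0 m1. tensor_lift (tensor_module k
    unit_module HH)
      (\<lambda>m00 m01. pure_tensor k unit_module HH m00 (pure_tensor k H H m01 m1)) (coaction unit_module
        m0)) (coaction unit_module x) =
    tensor_map k unit_module HH (\<lambda>x. x) (comult H) (coaction unit_module x)"
  proof -
    let ?Q = "tensor_module k unit_space HH"
    have inner: "tensor_lift ?Q (\<lambda>m00 m01. pure_tensor k unit_space HH m00 (pure_tensor k H H m01
      m1)) (coaction unit_module m0)
      = pure_tensor k unit_space HH m0 (pure_tensor k H H \<one>\<^bsub>H\<^esub> m1)" if "m0 \<in> carrier
        unit_space" "m1 \<in> carrier H" for m0 m1
      using that by simp
    have "tensor_lift ?Q (\<lambda>m0 m1. tensor_lift ?Q (\<lambda>m00 m01. pure_tensor k unit_space HH m00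
      (pure_tensor k H H m01 m1))
        (coaction unit_module m0)) (coaction unit_module x)
      = tensor_lift ?Q (\<lambda>m0 m1. pure_tensor k unit_space HH m0 (pure_tensor k H H \<one>\<^bsub>H\<^esub> m1))
        (pure_tensor k unit_space H x \<one>\<^bsub>H\<^esub>)"
      by (simp only: coaction_unit[OF x], rule tensor_lift_cong[of k unit_space H]) (simp_all add:
        inner)
    also have "\<dots> = pure_tensor k unit_space HH x (comult H \<one>\<^bsub>H\<^esub>)"
      using sw_comult_one[of HH "pure_tensor k H H"] by (simp add: sw_pures)
    also have "\<dots> = tensor_map k unit_space HH (\<lambda>x. x) (comult H) (pure_tensor k unit_space H x
      \<one>\<^bsub>H\<^esub>)"
      by (simp add: tensor_map_pure[of k unit_space H] lin_comult)
    finally show ?thesis by simp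
  qed
qed

text \<open>The middle leg of \<open>h\<close> acts through the counit and disappears. The
  coefficient that remains is \<open>h\<^sub>2 S\<^sup>-\<^sup>1(h\<^sub>1)\<close>, which is
  \<open>\<epsilon>(h) 1\<close> by \<open>sw_sinv_right\<close>.\<close>

lemma yetter_drinfeld_unit: "yetter_drinfeld k H \<one>\<^bsub>A\<^esub> \<one>\<^bsub>A\<^esub> unit_module"
proof (intro yetter_drinfeld.intro yetter_drinfeld_axioms.intro)
  show "left_action k H unit_module" "right_coaction k H unit_module"
    by (rule left_action_unit right_coaction_unit)+
  interpret I: module k unit_space by simp
  fix h and x :: "('k, 'a) vec" assume h [simp]: "h \<in> carrier H" and "x \<in> carrier unit_module"
  then have x [simp]: "x \<in> carrier unit_space" by simp
  let ?T = "tensor_module k unit_space H"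
  have [simp]: "lin k L unit_space (\<lambda>x. action unit_module h (f x))" if "h \<in> carrier H"
    "lin k L unit_space f"
    for h f and L :: "('k, ('k, 'a) vec) module"
    using lin_act_right[OF left_action_unit] that by simp
  have "sw ?T (\<lambda>h12 h3. sw ?T (\<lambda>h1 h2. pure_tensor k unit_space H (counit H h2 \<odot>\<^bsub>unit_space\<^esub> x) (h3
    \<otimes>\<^bsub>H\<^esub> sinv h1)) (comult H h12)) (comult H h)
    = sw ?T (\<lambda>h12 h3. sw ?T (\<lambda>h1 h2. counit H h2 \<odot>\<^bsub>?T\<^esub> pure_tensor k unit_space H x (h3 \<otimes>\<^bsub>H\<^esub> sinv
      h1)) (comult H h12)) (comult H h)"
    by (simp add: pure_tensor_smult_left)
  also have "\<dots> = sw ?T (\<lambda>h12 h3. pure_tensor k unit_space H x (h3 \<otimes>\<^bsub>H\<^esub> sinv h12)) (comult H h)"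
    by (rule sw_comult_cong, simp, rule sw_counit_right) simp_all
  also have "\<dots> = counit H h \<odot>\<^bsub>?T\<^esub> pure_tensor k unit_space H x \<one>\<^bsub>H\<^esub>"
    by (rule sw_sinv_right) simp_all
  finally show "coaction unit_module (action unit_module h x)
    = tensor_lift (tensor_module k unit_module H)
      (\<lambda>h12 h3. tensor_lift (tensor_module k unit_module H) (\<lambda>h1 h2. tensor_lift (tensor_module k
        unit_module H)
        (\<lambda>m0 m1. pure_tensor k unit_module H (action unit_module h2 m0)
          (\<one>\<^bsub>A\<^esub> h3 \<otimes>\<^bsub>H\<^esub> m1 \<otimes>\<^bsub>H\<^esub> \<one>\<^bsub>A\<^esub> (inv_into (carrier H) (antipode H) h1)))
        (coaction unit_module x)) (comult H h12)) (comult H h)"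
    by (simp add: pure_tensor_smult_left flip: sinv_def)
qed

end

section \<open>Morphisms of Yetter--Drinfeld modules\<close>

lemma vtensor_ext_left:
  assumes "module k L" "module k M" "module k N" "module k P"
    "lin k (vtensor k (vtensor k L M) N) P f" "lin k (vtensor k (vtensor k L M) N) P g"
    "\<And>l m n. l \<in> carrier L \<Longrightarrow> m \<in> carrier M \<Longrightarrow> n \<in> carrier N \<Longrightarrow>
      f (vpure k (vtensor k L M) N (vpure k L M l m) n) = g (vpure k (vtensor k L M) N (vpure k L M
        l m) n)"
    "t \<in> carrier (vtensor k (vtensor k L M) N)"
  shows "f t = g t"
proof (rule vtensor_ext[OF _ assms(3,4,5,6) _ assms(8)])
  fix s n assume s: "s \<in> carrier (vtensor k L M)" and n: "n \<in> carrier N"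
  show "f (vpure k (vtensor k L M) N s n) = g (vpure k (vtensor k L M) N s n)"
    by (rule vtensor_ext[OF assms(1,2,4) _ _ _ s]) (use assms n in \<open>auto intro: lin_comp\<close>)
qed (use assms in simp)

lemma vtensor_ext_right:
  assumes "module k L" "module k M" "module k N" "module k P"
    "lin k (vtensor k L (vtensor k M N)) P f" "lin k (vtensor k L (vtensor k M N)) P g"
    "\<And>l m n. l \<in> carrier L \<Longrightarrow> m \<in> carrier M \<Longrightarrow> n \<in> carrier N \<Longrightarrow>
      f (vpure k L (vtensor k M N) l (vpure k M N m n)) = g (vpure k L (vtensor k M N) l (vpure k M
        N m n))"
    "t \<in> carrier (vtensor k L (vtensor k M N))"
  shows "f t = g t"
proof (rule vtensor_ext[OF assms(1) _ assms(4,5,6) _ assms(8)])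
  fix l s assume s: "s \<in> carrier (vtensor k M N)" and l: "l \<in> carrier L"
  show "f (vpure k L (vtensor k M N) l s) = g (vpure k L (vtensor k M N) l s)"
    by (rule vtensor_ext[OF assms(2,3,4) _ _ _ s]) (use assms l in \<open>auto intro: lin_comp\<close>)
qed (use assms in simp)

section \<open>The linear maps underlying the associativity constraint and tensor products of
  arrows\<close>

definition vassoc where
  "vassoc k L M N = vlift k (vtensor k L M) N (vtensor k L (vtensor k M N))
     (\<lambda>t n. vlift k L M (vtensor k L (vtensor k M N)) (\<lambda>l m. vpure k L (vtensor k M N) l (vpure k M
       N m n)) t)"

definition vassoc_inv where
  "vassoc_inv k L M N = vlift k L (vtensor k M N) (vtensor k (vtensor k L M) N)
     (\<lambda>l t. vlift k M N (vtensor k (vtensor k L M) N) (\<lambda>m n. vpure k (vtensor k L M) N (vpure k L M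
       l m) n) t)"

definition vmap where
  "vmap k M N M' N' f g = vlift k M N (vtensor k M' N') (\<lambda>m n. vpure k M' N' (f m) (g n))"

context
  fixes k :: "('k, 'x) ring_scheme" and L :: "('k, ('k, 'a) vec, 'y1) module_scheme"
    and M :: "('k, ('k, 'a) vec, 'y2) module_scheme"
    and N :: "('k, ('k, 'a) vec, 'y3) module_scheme"
  assumes [simp]: "module k L" "module k M" "module k N"
begin

lemma lin_vassoc: "lin k (vtensor k (vtensor k L M) N) (vtensor k L (vtensor k M N)) (vassoc k L M
  N)"
  unfolding vassoc_def by simp

lemma vassoc_pure: "l \<in> carrier L \<Longrightarrow> m \<in> carrier M \<Longrightarrow> n \<in> carrier N \<Longrightarrow>
    vassoc k L M N (vpure k (vtensor k L M) N (vpure k L M l m) n) = vpure k L (vtensor k M N) l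
      (vpure k M N m n)"
  unfolding vassoc_def by simp

lemma lin_vassoc_inv: "lin k (vtensor k L (vtensor k M N)) (vtensor k (vtensor k L M) N) (vassoc_inv
  k L M N)"
  unfolding vassoc_inv_def by simp

lemma vassoc_inv_pure: "l \<in> carrier L \<Longrightarrow> m \<in> carrier M \<Longrightarrow> n \<in> carrier N \<Longrightarrow>
    vassoc_inv k L M N (vpure k L (vtensor k M N) l (vpure k M N m n)) = vpure k (vtensor k L M) N
      (vpure k L M l m) n"
  unfolding vassoc_inv_def by simp

lemma vassoc_inv_vassoc:
  assumes "t \<in> carrier (vtensor k (vtensor k L M) N)"
  shows "vassoc_inv k L M N (vassoc k L M N t) = t"
  by (rule vtensor_ext_left[where k = k and L = L and M = M and N = N
    and P = "vtensor k (vtensor k L M) N"])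
    (use assms lin_comp[OF lin_vassoc_inv lin_vassoc] in \<open>simp_all add: vassoc_pure
      vassoc_inv_pure\<close>)

lemma vassoc_vassoc_inv:
  assumes "t \<in> carrier (vtensor k L (vtensor k M N))"
  shows "vassoc k L M N (vassoc_inv k L M N t) = t"
  by (rule vtensor_ext_right[where k = k and L = L and M = M and N = N
    and P = "vtensor k L (vtensor k M N)"])
    (use assms lin_comp[OF lin_vassoc lin_vassoc_inv] in \<open>simp_all add: vassoc_pure
      vassoc_inv_pure\<close>)

end

lemma
  fixes k :: "('k, 'x) ring_scheme" and M :: "('k, ('k, 'a) vec, 'y1) module_scheme"
    and N :: "('k, ('k, 'a) vec, 'y2) module_scheme"
    and M' :: "('k, ('k, 'a) vec, 'y3) module_scheme"
    and N' :: "('k, ('k, 'a) vec, 'y4) module_scheme"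
  assumes [simp]: "module k M" "module k N" "module k M'" "module k N'"
    and f: "lin k M M' f" and g: "lin k N N' g"
  shows lin_vmap: "lin k (vtensor k M N) (vtensor k M' N') (vmap k M N M' N' f g)"
    and vmap_pure: "m \<in> carrier M \<Longrightarrow> n \<in> carrier N \<Longrightarrow> vmap k M N M' N' f g (vpure k M N m n)
      = vpure k M' N' (f m) (g n)"
proof -
  have "bilin k M N (vtensor k M' N') (\<lambda>m n. vpure k M' N' (f m) (g n))"
    using f g by (intro bilinI lin_vpure_left lin_vpure_right lin_closed[OF f] lin_closed[OF g])
      simp_all
  then show "lin k (vtensor k M N) (vtensor k M' N') (vmap k M N M' N' f g)"
    "m \<in> carrier M \<Longrightarrow> n \<in> carrier N \<Longrightarrow> vmap k M N M' N' f g (vpure k M N m n)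
      = vpure k M' N' (f m) (g n)"
    unfolding vmap_def by (simp_all del: bilinI)
qed

section \<open>Criteria for morphisms\<close>

context hopf_algebra_bij
begin

lemma yd_mapsI:
  assumes "module k N" "right_coaction k H M" "lin k M N f" "f \<in> extensional (carrier M)"
    and "\<And>h m. h \<in> carrier H \<Longrightarrow> m \<in> carrier M \<Longrightarrow> f (action M h m) = action N h (f m)"
    and "\<And>m. m \<in> carrier M \<Longrightarrow> coaction N (f m) = sw (tensor_module k N H) (\<lambda>x y. pure_tensor k N H (f
      x) y) (coaction M m)"
  shows "f \<in> yd_maps k H M N"
  using assms by (auto simp: yd_maps_def lin_def[symmetric] tensor_map_eq_sw[of k M H])

context
  fixes M :: "('k, 'h, 'v) yd_module" and N :: "('k, 'h, 'w) yd_module" and f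
  assumes f: "f \<in> yd_maps k H M N"
begin

lemma yd_map_lin: "lin k M N f"
  using f by (simp add: yd_maps_def lin_def)

lemma yd_map_extensional: "f \<in> extensional (carrier M)"
  using f by (simp add: yd_maps_def)

lemma yd_map_closed: "m \<in> carrier M \<Longrightarrow> f m \<in> carrier N"
  by (rule lin_closed[OF yd_map_lin])

lemma yd_map_action: "h \<in> carrier H \<Longrightarrow> m \<in> carrier M \<Longrightarrow> f (action M h m) = action N h (f m)"
  using f by (simp add: yd_maps_def)

lemma yd_map_coaction: "m \<in> carrier M \<Longrightarrow> coaction N (f m) = tensor_map k N H f (\<lambda>x. x) (coaction M
  m)"
  using f by (simp add: yd_maps_def)

lemma yd_map_sw:
  assumes "right_coaction k H M" "module k N" "module k P" "m \<in> carrier M" "bilin k N H P F"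
  shows "sw P F (coaction N (f m)) = sw P (\<lambda>x y. F (f x) y) (coaction M m)"
  unfolding yd_map_coaction[OF assms(4)]
  by (rule sw_tensor_map[of k M H]) (use assms yd_map_lin in \<open>simp_all del: bilinI\<close>)

end

text \<open>Linearity over \<open>H\<close> is transferred by applying \<open>g\<close> to that of
  \<open>f\<close> at \<open>g y\<close>, colinearity by applying \<open>g \<otimes> id\<close> to
  that of \<open>f\<close> at \<open>g y\<close>. So for each constraint and for the braiding a
  linear inverse is enough.\<close>

lemma yd_maps_inverse:
  assumes f: "f \<in> yd_maps k H M N" and M: "left_action k H M" "right_coaction k H M"
    and N: "left_action k H N" "right_coaction k H N"
    and g: "lin k N M g" "g \<in> extensional (carrier N)"
    and gf: "\<And>x. x \<in> carrier M \<Longrightarrow> g (f x) = x" and fg: "\<And>y. y \<in> carrier N \<Longrightarrow> f (g y) = y"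
  shows "g \<in> yd_maps k H N M"
proof (rule yd_mapsI)
  note [simp] = M N gf fg lin_closed[OF g(1)] yd_map_closed[OF f] lin_comp[OF g(1)]
  show "module k M" using act_module[OF M(1)] .
  note [simp] = this act_module[OF N(1)]
  show "g (action N h y) = action M h (g y)" if [simp]: "h \<in> carrier H" "y \<in> carrier N" for h y
    using yd_map_action[OF f, of h "g y"] gf[of "action M h (g y)"] by simp
  show "coaction M (g y) = sw (tensor_module k M H) (\<lambda>x y. pure_tensor k M H (g x) y) (coaction N
    y)"
    if [simp]: "y \<in> carrier N" for y
  proof -
    have "sw (tensor_module k M H) (\<lambda>x y. pure_tensor k M H (g x) y) (coaction N (f (g y)))
      = sw (tensor_module k M H) (\<lambda>x y. pure_tensor k M H (g (f x)) y) (coaction M (g y))"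
      by (rule yd_map_sw[OF f]) simp_all
    then show ?thesis by (simp add: sw_pures)
  qed
qed (use g N in auto)

end

context action_coaction_pair
begin

lemmas tens_facts = left_action_tens right_coaction_tens action_tens_pure sw_coaction_tens
  coaction_tens_pure

text \<open>Both conditions are linear in the tensor and may be checked on pure ones. The second is
  stated with the coaction of the tensor product already expanded, the form in which calculations
  deliver it.\<close>

lemma yd_mapsI_tens:
  assumes X: "left_action k H X" "right_coaction k H X"
    and f: "lin k V X f" "f \<in> extensional (carrier V)"
    and act: "\<And>h m n. h \<in> carrier H \<Longrightarrow> m \<in> carrier M \<Longrightarrow> n \<in> carrier N \<Longrightarrow>
      f (action W h (vpure k M N m n)) = action X h (f (vpure k M N m n))"
    and coact: "\<And>m n. m \<in> carrier M \<Longrightarrow> n \<in> carrier N \<Longrightarrow>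
      coaction X (f (vpure k M N m n)) = sw (tensor_module k X H) (\<lambda>m0 m1. sw (tensor_module k X H)
        (\<lambda>n0 n1. pure_tensor k X H (f (vpure k M N m0 n0)) (n1 \<otimes>\<^bsub>H\<^esub> m1)) (coaction N n)) (coaction M
          m)"
  shows "f \<in> yd_maps k H W X"
proof (rule yd_mapsI)
  note [simp] = X lin_comp[OF f(1)] lin_closed[OF f(1)]
  show "module k X" by (rule act_module[OF X(1)])
  note [simp] = this
  let ?T = "tensor_module k X H"
  show "right_coaction k H W" by simp
  show "lin k W X f" "f \<in> extensional (carrier W)" using f by simp_all
  show "f (action W h t) = action X h (f t)" if h: "h \<in> carrier H" and t: "t \<in> carrier W" for h t
    by (rule vtensor_ext[where t = t and P = X and M = M and N = N and k = k])
      (use h t act in \<open>simp_all add: lin_action_tens del: action_tens_pure\<close>)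
  have lp: "lin k L ?T (\<lambda>x. pure_tensor k X H (f (g x)) y)" if "lin k L V g" "y \<in> carrier H"
    for g y and L :: "('k, ('k, 'a) vec) module" using that by simp
  show "coaction X (f t) = sw ?T (\<lambda>x y. pure_tensor k X H (f x) y) (coaction W t)" if t:
    "t \<in> carrier W" for t
  proof (rule vtensor_ext[where t = t and P = ?T and M = M and N = N and k = k])
    show "lin k V ?T (\<lambda>t. sw ?T (\<lambda>x y. pure_tensor k X H (f x) y) (coaction W t))"
      by (rule lin_comp[OF lin_sw_self lin_coaction_tens]) simp_all
    show "coaction X (f (vpure k M N m n)) = sw ?T (\<lambda>x y. pure_tensor k X H (f x) y) (coaction W
      (vpure k M N m n))"
      if "m \<in> carrier M" "n \<in> carrier N" for m n
      using that by (simp add: coact sw_coaction_tens)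
  qed (use t in simp_all)
qed

end

context hopf_algebra_bij
begin

lemma vmap_yd:
  fixes M N M' N' :: "('k, 'h, ('k, 'a) vec) yd_module"
  assumes f: "f \<in> yd_maps k H M M'" and g: "g \<in> yd_maps k H N N'"
    and "left_action k H M" "right_coaction k H M" "left_action k H N" "right_coaction k H N"
    and "left_action k H M'" "right_coaction k H M'" "left_action k H N'" "right_coaction k H N'"
    and "\<gamma> \<in> hopf_auto k H" "\<theta> \<in> hopf_auto k H"
  shows "vmap k M N M' N' f g \<in> yd_maps k H (yd_tens k H \<gamma> \<theta> M N) (yd_tens k H \<gamma> \<theta> M' N')"
proof -
  interpret S: action_coaction_pair k H M N \<gamma> \<theta> by (intro action_coaction_pair.intro
    action_coaction_pair_axioms.intro hopf_algebra_bij_axioms assms)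
  interpret S': action_coaction_pair k H M' N' \<gamma> \<theta> by (intro action_coaction_pair.intro
    action_coaction_pair_axioms.intro hopf_algebra_bij_axioms assms)
  note lf = yd_map_lin[OF f] and lg = yd_map_lin[OF g]
  note [simp] = yd_map_closed[OF f] yd_map_closed[OF g] vmap_pure[OF _ _ _ _ lf lg] lin_comp[OF lf]
    lin_comp[OF lg]
  have lv: "lin k S.V S'.V (vmap k M N M' N' f g)"
    by (rule lin_vmap[OF _ _ _ _ lf lg]) simp_all
  show ?thesis
  proof (rule S.yd_mapsI_tens)
    show "vmap k M N M' N' f g (action S.W h (vpure k M N m n)) = action S'.W h (vmap k M N M' N' f
      g (vpure k M N m n))"
      if "h \<in> carrier H" "m \<in> carrier M" "n \<in> carrier N" for h m n
      using that by (simp add: comult_push[OF _ _ _ lv] yd_map_action[OF f] yd_map_action[OF g])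
    show "coaction S'.W (vmap k M N M' N' f g (vpure k M N m n)) =
      sw (tensor_module k S'.W H) (\<lambda>m0 m1. sw (tensor_module k S'.W H)
        (\<lambda>n0 n1. pure_tensor k S'.W H (vmap k M N M' N' f g (vpure k M N m0 n0)) (n1 \<otimes>\<^bsub>H\<^esub> m1))
          (coaction N n)) (coaction M m)"
      if "m \<in> carrier M" "n \<in> carrier N" for m n
      using that by (simp add: S'.coaction_tens_pure yd_map_sw[OF f] yd_map_sw[OF g])
  qed (use lv in \<open>simp_all add: vmap_def\<close>)
qed

text \<open>The conditions \<open>e\<close> compare the automorphisms through which \<open>h\<close>
  reaches \<open>L\<close>, \<open>M\<close> and \<open>N\<close> under the two bracketings. The
  rest of linearity is coassociativity of \<open>H\<close>; colinearity is associativity of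
  \<open>H\<close> applied to the coefficient of the three factors.\<close>

lemma vassoc_yd:
  fixes L M N :: "('k, 'h, ('k, 'a) vec) yd_module"
  assumes "left_action k H L" "right_coaction k H L" "left_action k H M" "right_coaction k H M"
    and "left_action k H N" "right_coaction k H N"
    and \<gamma>: "\<gamma>2 \<in> hopf_auto k H" "\<theta>2 \<in> hopf_auto k H" "\<gamma>3 \<in> hopf_auto k H" "\<theta>3 \<in> hopf_auto k H"
      "\<gamma>' \<in> hopf_auto k H" "\<theta>' \<in> hopf_auto k H" "\<theta>'' \<in> hopf_auto k H"
    and e: "\<And>h. h \<in> carrier H \<Longrightarrow> \<gamma>' h = \<gamma>2 (\<gamma>3 h)" "\<And>h. h \<in> carrier H \<Longrightarrow> \<gamma>3 (\<theta>' h) = \<theta>2 (\<gamma>3 h)"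
      "\<And>h. h \<in> carrier H \<Longrightarrow> \<theta>'' (\<theta>' h) = \<theta>3 h"
  shows "vassoc k L M N \<in> yd_maps k H (yd_tens k H \<gamma>3 \<theta>3 (yd_tens k H \<gamma>2 \<theta>2 L M) N)
    (yd_tens k H \<gamma>' \<theta>' L (yd_tens k H \<gamma>3 \<theta>'' M N))"
proof -
  interpret LM: action_coaction_pair k H L M \<gamma>2 \<theta>2 by (intro action_coaction_pair.intro
    action_coaction_pair_axioms.intro hopf_algebra_bij_axioms assms)
  interpret S: action_coaction_pair k H LM.W N \<gamma>3 \<theta>3 by (intro action_coaction_pair.intro
    action_coaction_pair_axioms.intro hopf_algebra_bij_axioms
        LM.left_action_tens LM.right_coaction_tens assms)
  interpret MN: action_coaction_pair k H M N \<gamma>3 \<theta>'' by (intro action_coaction_pair.intro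
    action_coaction_pair_axioms.intro hopf_algebra_bij_axioms assms)
  interpret S': action_coaction_pair k H L MN.W \<gamma>' \<theta>' by (intro action_coaction_pair.intro
    action_coaction_pair_axioms.intro hopf_algebra_bij_axioms
        MN.left_action_tens MN.right_coaction_tens assms)
  note [simp] = S.tens_facts(1,2,3)[unfolded yd_tens_trunc] S'.tens_facts(1,2,3)[unfolded
    yd_tens_trunc]
    vassoc_pure e
  have lv: "lin k (vtensor k LM.V N) (vtensor k L MN.V) (vassoc k L M N)"
    by (rule lin_vassoc) simp_all
  note [simp] = lin_comp[OF lv] lin_closed[OF lv]
  let ?T = "tensor_module k (vtensor k L MN.V) H"
  show ?thesis
  proof (rule yd_mapsI)
    show "lin k S.W S'.W (vassoc k L M N)" using lv by simp
    show "vassoc k L M N \<in> extensional (carrier S.W)" by (simp add: vassoc_def)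
    show "vassoc k L M N (action S.W h t) = action S'.W h (vassoc k L M N t)"
      if h [simp]: "h \<in> carrier H" and t: "t \<in> carrier S.W" for h t
    proof (rule vtensor_ext_left[where t = t and k = k and L = L and M = M and N = N
      and P = "vtensor k L MN.V"])
      show "lin k (vtensor k LM.V N) (vtensor k L MN.V) (\<lambda>t. vassoc k L M N (action S.W h t))"
        "lin k (vtensor k LM.V N) (vtensor k L MN.V) (\<lambda>t. action S'.W h (vassoc k L M N t))"
        using lin_comp[OF lv S.lin_action_tens[unfolded yd_tens_trunc]]
          lin_comp[OF S'.lin_action_tens[unfolded yd_tens_trunc] lv] by simp_all
      fix l m n assume [simp]: "l \<in> carrier L" "m \<in> carrier M" "n \<in> carrier N"
      let ?p = "\<lambda>l m n. vpure k (vtensor k L M) N (vpure k L M l m) n"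
      let ?q = "\<lambda>l m n. vpure k L MN.V l (vpure k M N m n)"
      have push: "vpure k LM.V N (sw LM.V f (comult H x)) n = sw (vtensor k LM.V N) (\<lambda>a b. vpure k
        LM.V N (f a b) n) (comult H x)"
        if "x \<in> carrier H" "n \<in> carrier N" "\<And>a b. a \<in> carrier H \<Longrightarrow> b \<in> carrier H
          \<Longrightarrow> f a b \<in> carrier LM.V" for x f n
        by (rule comult_push[where g = "\<lambda>v. vpure k LM.V N v n"]) (use that in simp_all)
      have push': "vpure k L MN.V l (sw MN.V f (comult H x)) = sw (vtensor k L MN.V) (\<lambda>a b. vpure k
        L MN.V l (f a b)) (comult H x)"
        if "x \<in> carrier H" "l \<in> carrier L" "\<And>a b. a \<in> carrier H \<Longrightarrow> b \<in> carrier H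
          \<Longrightarrow> f a b \<in> carrier MN.V" for x f l
        by (rule comult_push[where g = "vpure k L MN.V l"]) (use that in simp_all)
      have "vassoc k L M N (action S.W h (?p l m n)) = sw (vtensor k L MN.V) (\<lambda>x y. sw (vtensor k L
        MN.V) (\<lambda>x1 x2.
          ?q (action L (\<gamma>2 (\<gamma>3 x1)) l) (action M (\<theta>2 (\<gamma>3 x2)) m) (action N (\<theta>3 y) n)) (comult H x))
            (comult H h)"
        by (simp add: push comult_push[OF _ _ _ lv])
      also have "\<dots> = sw (vtensor k L MN.V) (\<lambda>x y. sw (vtensor k L MN.V) (\<lambda>y1 y2.
          ?q (action L (\<gamma>2 (\<gamma>3 x)) l) (action M (\<theta>2 (\<gamma>3 y1)) m) (action N (\<theta>3 y2) n)) (comult H y))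
            (comult H h)"
        by (rule sw_coassoc) simp_all
      also have "\<dots> = action S'.W h (vassoc k L M N (?p l m n))"
        by (simp add: push')
      finally show "vassoc k L M N (action S.W h (?p l m n)) = action S'.W h (vassoc k L M N (?p l m
        n))" .
    qed (use t in simp_all)
    show "coaction S'.W (vassoc k L M N t) = sw (tensor_module k S'.W H) (\<lambda>x y. pure_tensor k S'.W H
      (vassoc k L M N x) y) (coaction S.W t)"
      if t: "t \<in> carrier S.W" for t
    proof -
      have "coaction S'.W (vassoc k L M N t) = sw ?T (\<lambda>x y. pure_tensor k (vtensor k L MN.V) H
        (vassoc k L M N x) y) (coaction S.W t)"
      proof (rule vtensor_ext_left[where t = t and k = k and L = L and M = M and N = N and P = ?T])
        show "lin k (vtensor k LM.V N) ?T (\<lambda>t. coaction S'.W (vassoc k L M N t))"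
          using lin_comp[OF S'.lin_coaction_tens[unfolded yd_tens_trunc] lv] by simp
        show "lin k (vtensor k LM.V N) ?T (\<lambda>t. sw ?T (\<lambda>x y. pure_tensor k (vtensor k L MN.V) H
          (vassoc k L M N x) y) (coaction S.W t))"
          by (rule lin_comp[OF lin_sw_self S.lin_coaction_tens[unfolded yd_tens_trunc]]) simp_all
        fix l m n assume [simp]: "l \<in> carrier L" "m \<in> carrier M" "n \<in> carrier N"
        have "coaction S'.W (vpure k L MN.V l (vpure k M N m n)) = sw ?T (\<lambda>l0 l1. sw ?T (\<lambda>m0 m1. sw
          ?T (\<lambda>n0 n1.
            pure_tensor k (vtensor k L MN.V) H (vpure k L MN.V l0 (vpure k M N m0 n0)) (n1 \<otimes>\<^bsub>H\<^esub> m1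
              \<otimes>\<^bsub>H\<^esub> l1))
            (coaction N n)) (coaction M m)) (coaction L l)"
          by (simp add: S'.coaction_tens_pure[unfolded yd_tens_trunc] MN.sw_coaction_tens)
        moreover have "sw ?T (\<lambda>x y. pure_tensor k (vtensor k L MN.V) H (vassoc k L M N x) y)
            (coaction S.W (vpure k LM.V N (vpure k L M l m) n)) = sw ?T (\<lambda>l0 l1. sw ?T (\<lambda>m0 m1. sw
              ?T (\<lambda>n0 n1.
            pure_tensor k (vtensor k L MN.V) H (vpure k L MN.V l0 (vpure k M N m0 n0)) (n1 \<otimes>\<^bsub>H\<^esub> (m1
              \<otimes>\<^bsub>H\<^esub> l1)))
            (coaction N n)) (coaction M m)) (coaction L l)"
          by (simp add: S.sw_coaction_tens[unfolded yd_tens_trunc] LM.sw_coaction_tens)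
        ultimately show "coaction S'.W (vassoc k L M N (vpure k LM.V N (vpure k L M l m) n))
          = sw ?T (\<lambda>x y. pure_tensor k (vtensor k L MN.V) H (vassoc k L M N x) y) (coaction S.W
            (vpure k LM.V N (vpure k L M l m) n))"
          by (simp add: assoc_H)
      qed (use t in simp_all)
      then show ?thesis by simp
    qed
  qed simp_all
qed

section \<open>The unit constraints\<close>

lemma base_simps [simp]:
  "carrier (base_module k) = carrier k" "c \<odot>\<^bsub>base_module k\<^esub> x = c \<otimes>\<^bsub>k\<^esub> x"
  "x \<oplus>\<^bsub>base_module k\<^esub> y = x \<oplus>\<^bsub>k\<^esub> y"
  by (simp_all add: base_module_def)

lemma lin_unscalar: "lin k unit_space (base_module k) (inv_into (carrier k) Scalar)"
  using lin_inv_transport[OF module_base[OF field_k] inj_Scalar] by (simp only: unit_space_def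
    base_simps)

lemma unscalar_closed [simp]: "r \<in> carrier unit_space \<Longrightarrow> inv_into (carrier k) Scalar r \<in> carrier k"
  using lin_closed[OF lin_unscalar] by (simp add: base_module_def)

lemma unscalar_smult [simp]: "c \<in> carrier k \<Longrightarrow> r \<in> carrier unit_space \<Longrightarrow>
    inv_into (carrier k) Scalar (c \<odot>\<^bsub>unit_space\<^esub> r) = c \<otimes>\<^bsub>k\<^esub> inv_into (carrier k) Scalar r"
  using lin_smult[OF lin_unscalar] by (simp add: base_module_def)

lemma lin_unscalar_smult [simp]:
  assumes "module k P" "p \<in> carrier P" "lin k L unit_space f"
  shows "lin k L P (\<lambda>x. inv_into (carrier k) Scalar (f x) \<odot>\<^bsub>P\<^esub> p)"
proof -
  interpret P: module k P by fact
  have "lin k unit_space P (\<lambda>r. inv_into (carrier k) Scalar r \<odot>\<^bsub>P\<^esub> p)"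
    using assms(2)
    by (intro linI) (simp_all add: lin_add[OF lin_unscalar] P.smult_l_distr P.smult_assoc1)
  then show ?thesis using assms(3) by (rule lin_comp)
qed

lemma scalar_one_closed [simp]: "Scalar \<one>\<^bsub>k\<^esub> \<in> carrier unit_space"
  by (simp add: unit_space_def base_module_def)

lemma unscalar_Scalar [simp]: "c \<in> carrier k \<Longrightarrow> inv_into (carrier k) Scalar (Scalar c) = c"
  by (simp add: inv_into_f_f[OF inj_Scalar])

lemma Scalar_unscalar:
  "r \<in> carrier unit_space \<Longrightarrow> inv_into (carrier k) Scalar r \<odot>\<^bsub>unit_space\<^esub> Scalar \<one>\<^bsub>k\<^esub> = r"
proof -
  assume "r \<in> carrier unit_space"
  then obtain c where "c \<in> carrier k" "r = Scalar c" by (auto simp: unit_space_def base_module_def)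
  then show ?thesis
    using inv_into_f_f[OF inj_Scalar, of _ "carrier k"] by (simp add: unit_space_def
      base_module_def)
qed

definition vlunit :: "('k, 'h, ('k, 'a) vec) yd_module \<Rightarrow> ('k, 'a) vec \<Rightarrow> ('k, 'a) vec" where
  "vlunit X = vlift k unit_space X X (\<lambda>r m. inv_into (carrier k) Scalar r \<odot>\<^bsub>X\<^esub> m)"

definition vrunit :: "('k, 'h, ('k, 'a) vec) yd_module \<Rightarrow> ('k, 'a) vec \<Rightarrow> ('k, 'a) vec" where
  "vrunit X = vlift k X unit_space X (\<lambda>m r. inv_into (carrier k) Scalar r \<odot>\<^bsub>X\<^esub> m)"

context
  fixes X :: "('k, 'h, ('k, 'a) vec) yd_module"
  assumes XA [simp]: "left_action k H X" and XC [simp]: "right_coaction k H X"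
begin

lemma module_X [simp]: "module k X" by (rule act_module[OF XA])

lemma lin_vlunit: "lin k (vtensor k unit_space X) X (vlunit X)"
  and lin_vrunit: "lin k (vtensor k X unit_space) X (vrunit X)"
  by (simp_all only: vlunit_def vrunit_def) simp_all

lemma vlunit_pure: "r \<in> carrier unit_space \<Longrightarrow> m \<in> carrier X \<Longrightarrow>
    vlunit X (vpure k unit_space X r m) = inv_into (carrier k) Scalar r \<odot>\<^bsub>X\<^esub> m"
  and vrunit_pure: "r \<in> carrier unit_space \<Longrightarrow> m \<in> carrier X \<Longrightarrow>
    vrunit X (vpure k X unit_space m r) = inv_into (carrier k) Scalar r \<odot>\<^bsub>X\<^esub> m"
  by (simp_all add: vlunit_def vrunit_def)

lemma vlunit_inverse:
  "m \<in> carrier X \<Longrightarrow> vlunit X (vpure k unit_space X (Scalar \<one>\<^bsub>k\<^esub>) m) = m"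
  "t \<in> carrier (vtensor k unit_space X) \<Longrightarrow> vpure k unit_space X (Scalar \<one>\<^bsub>k\<^esub>) (vlunit X t) = t"
proof -
  interpret X: module k X by simp
  show "m \<in> carrier X \<Longrightarrow> vlunit X (vpure k unit_space X (Scalar \<one>\<^bsub>k\<^esub>) m) = m"
    by (simp add: vlunit_pure)
  assume t: "t \<in> carrier (vtensor k unit_space X)"
  show "vpure k unit_space X (Scalar \<one>\<^bsub>k\<^esub>) (vlunit X t) = t"
  proof (rule vtensor_ext[where t = t and k = k and M = unit_space and N = X
    and P = "vtensor k unit_space X"])
    show "vpure k unit_space X (Scalar \<one>\<^bsub>k\<^esub>) (vlunit X (vpure k unit_space X r m))
      = vpure k unit_space X r m"
      if [simp]: "r \<in> carrier unit_space" "m \<in> carrier X" for r m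
    proof -
      let ?c = "inv_into (carrier k) Scalar r"
      \<comment> \<open>The inverse sends \<open>m\<close> to \<open>1 \<otimes> m\<close>: the
        scalar \<open>?c\<close> is carried across the tensor sign, where it turns \<open>1\<close>
        back into \<open>r\<close>.\<close>
      have "vpure k unit_space X (Scalar \<one>\<^bsub>k\<^esub>) (?c \<odot>\<^bsub>X\<^esub> m) = ?c \<odot>\<^bsub>vtensor k unit_space X\<^esub> vpure k
        unit_space X (Scalar \<one>\<^bsub>k\<^esub>) m"
        by (rule lin_smult[OF bilinD2[OF bilin_vpure]]) simp_all
      also have "\<dots> = vpure k unit_space X (?c \<odot>\<^bsub>unit_space\<^esub> Scalar \<one>\<^bsub>k\<^esub>) m"
        by (rule lin_smult[OF bilinD1[OF bilin_vpure], symmetric]) simp_all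
      finally show ?thesis by (simp add: vlunit_pure Scalar_unscalar)
    qed
  qed (use t lin_vlunit in simp_all)
qed

lemma vrunit_inverse:
  "m \<in> carrier X \<Longrightarrow> vrunit X (vpure k X unit_space m (Scalar \<one>\<^bsub>k\<^esub>)) = m"
  "t \<in> carrier (vtensor k X unit_space) \<Longrightarrow> vpure k X unit_space (vrunit X t) (Scalar \<one>\<^bsub>k\<^esub>) = t"
proof -
  interpret X: module k X by simp
  show "m \<in> carrier X \<Longrightarrow> vrunit X (vpure k X unit_space m (Scalar \<one>\<^bsub>k\<^esub>)) = m"
    by (simp add: vrunit_pure)
  assume t: "t \<in> carrier (vtensor k X unit_space)"
  show "vpure k X unit_space (vrunit X t) (Scalar \<one>\<^bsub>k\<^esub>) = t"
  proof (rule vtensor_ext[where t = t and k = k and N = unit_space and M = X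
    and P = "vtensor k X unit_space"])
    show "vpure k X unit_space (vrunit X (vpure k X unit_space m r)) (Scalar \<one>\<^bsub>k\<^esub>)
      = vpure k X unit_space m r"
      if [simp]: "r \<in> carrier unit_space" "m \<in> carrier X" for r m
    proof -
      let ?c = "inv_into (carrier k) Scalar r"
      have "vpure k X unit_space (?c \<odot>\<^bsub>X\<^esub> m) (Scalar \<one>\<^bsub>k\<^esub>) = ?c \<odot>\<^bsub>vtensor k X unit_space\<^esub> vpure k X
        unit_space m (Scalar \<one>\<^bsub>k\<^esub>)"
        by (rule lin_smult[OF bilinD1[OF bilin_vpure]]) simp_all
      also have "\<dots> = vpure k X unit_space m (?c \<odot>\<^bsub>unit_space\<^esub> Scalar \<one>\<^bsub>k\<^esub>)"
        by (rule lin_smult[OF bilinD2[OF bilin_vpure], symmetric]) simp_all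
      finally show ?thesis by (simp add: vrunit_pure Scalar_unscalar)
    qed
  qed (use t lin_vrunit in simp_all)
qed

text \<open>Places the scalar inside the Sweedler sum, where the coaction of the tensor product with
  the unit object leaves it.\<close>

lemma coaction_smult:
  assumes [simp]: "c \<in> carrier k" "m \<in> carrier X"
  shows "coaction X (c \<odot>\<^bsub>X\<^esub> m) = sw (tensor_module k X H) (\<lambda>n0 n1. pure_tensor k X H (c \<odot>\<^bsub>X\<^esub> n0) n1)
    (coaction X m)"
proof -
  interpret X: module k X by simp
  have "coaction X (c \<odot>\<^bsub>X\<^esub> m) = c \<odot>\<^bsub>tensor_module k X H\<^esub> sw (tensor_module k X H) (\<lambda>n0 n1.
    pure_tensor k X H n0 n1) (coaction X m)"
    using lin_smult[OF lin_coact_self[OF XC]] by (simp add: sw_pures)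
  also have "\<dots> = sw (tensor_module k X H) (\<lambda>n0 n1. pure_tensor k X H (c \<odot>\<^bsub>X\<^esub> n0) n1) (coaction X m)"
    by (subst coact_push[OF XC, where g = "\<lambda>x. c \<odot>\<^bsub>tensor_module k X H\<^esub> x"])
      (simp_all add: pure_tensor_smult_left)
  finally show ?thesis .
qed

text \<open>The unit object has second index \<open>1\<close>, so
  \<open>\<theta> = \<gamma>\<^sup>-\<^sup>1 1 \<gamma>\<close> is the identity;
  \<open>\<gamma>\<close> acts on the unit object and is absorbed by the counit.\<close>

lemma vlunit_yd:
  assumes \<gamma>: "\<gamma> \<in> hopf_auto k H" and \<theta>: "\<theta> \<in> hopf_auto k H" and ident: "\<And>h. h \<in> carrier H \<Longrightarrow> \<theta> h = h"
  shows "vlunit X \<in> yd_maps k H (yd_tens k H \<gamma> \<theta> unit_module X) X"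
proof -
  interpret S: action_coaction_pair k H unit_module X \<gamma> \<theta>
    by (intro action_coaction_pair.intro action_coaction_pair_axioms.intro hopf_algebra_bij_axioms
        left_action_unit right_coaction_unit XA XC \<gamma> \<theta>)
  interpret X: module k X by simp
  interpret I: module k "unit_space :: ('k, ('k, 'a) vec) module" by simp
  note [simp] = S.tens_facts(1,2,3)[unfolded unit_trunc] ident vlunit_pure
  show ?thesis
  proof (rule S.yd_mapsI_tens)
    fix h m and r :: "('k, 'a) vec" assume [simp]: "h \<in> carrier H" "m \<in> carrier X"
    assume "r \<in> carrier unit_module" then have r [simp]: "r \<in> carrier unit_space" by simp
    have "vlunit X (action S.W h (vpure k unit_space X r m)) = sw X (\<lambda>x y. counit H x \<odot>\<^bsub>X\<^esub> (inv_into
      (carrier k) Scalar r \<odot>\<^bsub>X\<^esub> action X y m)) (comult H h)"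
      by (simp add: comult_push[OF _ _ _ lin_vlunit] X.smult_assoc1)
    also have "\<dots> = inv_into (carrier k) Scalar r \<odot>\<^bsub>X\<^esub> action X h m"
      by (rule sw_counit_left) simp_all
    finally show "vlunit X (action S.W h (vpure k unit_module X r m))
      = action X h (vlunit X (vpure k unit_module X r m))"
      using lin_smult[OF lin_act_right[OF XA, of h X "\<lambda>x. x"]] by simp
  next
    fix m and r :: "('k, 'a) vec" assume [simp]: "m \<in> carrier X"
    assume "r \<in> carrier unit_module" then have r [simp]: "r \<in> carrier unit_space" by simp
    show "coaction X (vlunit X (vpure k unit_module X r m)) = sw (tensor_module k X H) (\<lambda>m0 m1. sw
      (tensor_module k X H)
        (\<lambda>n0 n1. pure_tensor k X H (vlunit X (vpure k unit_module X m0 n0)) (n1 \<otimes>\<^bsub>H\<^esub> m1)) (coaction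
          X m)) (coaction unit_module r)"
      by (simp add: sw_pure[of k unit_space H] lin_comp[OF lin_vlunit] coaction_smult)
  qed (use lin_vlunit in \<open>simp_all add: vlunit_def\<close>)
qed

text \<open>The mirror image: \<open>\<gamma>\<close> is the first index of the unit object and
  hence the identity, while \<open>\<theta>\<close> is absorbed by the counit.\<close>

lemma vrunit_yd:
  assumes \<gamma>: "\<gamma> \<in> hopf_auto k H" and \<theta>: "\<theta> \<in> hopf_auto k H" and ident: "\<And>h. h \<in> carrier H \<Longrightarrow> \<gamma> h = h"
  shows "vrunit X \<in> yd_maps k H (yd_tens k H \<gamma> \<theta> X unit_module) X"
proof -
  interpret S: action_coaction_pair k H X unit_module \<gamma> \<theta>
    by (intro action_coaction_pair.intro action_coaction_pair_axioms.intro hopf_algebra_bij_axioms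
        XA XC left_action_unit right_coaction_unit \<gamma> \<theta>)
  interpret X: module k X by simp
  interpret I: module k "unit_space :: ('k, ('k, 'a) vec) module" by simp
  note [simp] = S.tens_facts(1,2,3)[unfolded unit_trunc] ident vrunit_pure
  show ?thesis
  proof (rule S.yd_mapsI_tens)
    fix h m and r :: "('k, 'a) vec" assume [simp]: "h \<in> carrier H" "m \<in> carrier X"
    assume "r \<in> carrier unit_module" then have r [simp]: "r \<in> carrier unit_space" by simp
    have "vrunit X (action S.W h (vpure k X unit_space m r)) = sw X (\<lambda>x y. counit H y \<odot>\<^bsub>X\<^esub> (inv_into
      (carrier k) Scalar r \<odot>\<^bsub>X\<^esub> action X x m)) (comult H h)"
      by (simp add: comult_push[OF _ _ _ lin_vrunit] X.smult_assoc1)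
    also have "\<dots> = inv_into (carrier k) Scalar r \<odot>\<^bsub>X\<^esub> action X h m"
      by (rule sw_counit_right) simp_all
    finally show "vrunit X (action S.W h (vpure k X unit_module m r))
      = action X h (vrunit X (vpure k X unit_module m r))"
      using lin_smult[OF lin_act_right[OF XA, of h X "\<lambda>x. x"]] by simp
  next
    fix m and r :: "('k, 'a) vec" assume [simp]: "m \<in> carrier X"
    assume "r \<in> carrier unit_module" then have r [simp]: "r \<in> carrier unit_space" by simp
    show "coaction X (vrunit X (vpure k X unit_module m r)) = sw (tensor_module k X H) (\<lambda>m0 m1. sw
      (tensor_module k X H)
        (\<lambda>n0 n1. pure_tensor k X H (vrunit X (vpure k X unit_module m0 n0)) (n1 \<otimes>\<^bsub>H\<^esub> m1)) (coaction
          unit_module r)) (coaction X m)"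
      by (simp add: sw_pure[of k unit_space H] lin_comp[OF lin_vrunit] coaction_smult)
  qed (use lin_vrunit in \<open>simp_all add: vrunit_def\<close>)
qed

end

end

section \<open>The braiding\<close>

text \<open>The map \<open>b\<close> stands for \<open>\<beta>\<^sup>-\<^sup>1\<close>. Conjugation
  leaves the vector space of \<open>N\<close> unchanged, so \<open>N\<close> itself can replace its
  conjugate in the body taken from \<open>yd_braiding\<close>.\<close>

definition (in hopf_algebra_bij) vbraid where
  "vbraid b M N = vlift k M N (vtensor k N M)
     (\<lambda>m n. tensor_lift (vtensor k N M) (\<lambda>n0 n1. vpure k N M n0 (action M (b n1) m)) (coaction N
       n))"

definition (in hopf_algebra_bij) vbraid_inv where
  "vbraid_inv b M N = vlift k N M (vtensor k M N)
     (\<lambda>n m. sw (vtensor k M N) (\<lambda>n0 n1. vpure k M N (action M (b (antipode H n1)) m) n0) (coaction N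
       n))"

context hopf_algebra_bij
begin

text \<open>The contraction \<open>S\<^sup>-\<^sup>1(h\<^sub>2) h\<^sub>1 \<otimes> h\<^sub>3 = 1 \<otimes> h\<close>.\<close>

lemma sw_contract_left:
  assumes P [simp]: "module k P" and h [simp]: "h \<in> carrier H"
    and G1: "\<And>z. z \<in> carrier H \<Longrightarrow> lin k H P (\<lambda>y. E y z)"
    and G2: "\<And>y. y \<in> carrier H \<Longrightarrow> lin k H P (\<lambda>z. E y z)"
  shows "sw P (\<lambda>x y. sw P (\<lambda>y1 y2. E (sinv y1 \<otimes>\<^bsub>H\<^esub> x) y2) (comult H y)) (comult H h) = E \<one>\<^bsub>H\<^esub> h"
proof -
  note [simp] = lin_comp[OF G1] G2 lin_closed[OF G1]
  have "sw P (\<lambda>x y. sw P (\<lambda>y1 y2. E (sinv y1 \<otimes>\<^bsub>H\<^esub> x) y2) (comult H y)) (comult H h)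
    = sw P (\<lambda>w y2. sw P (\<lambda>x y1. E (sinv y1 \<otimes>\<^bsub>H\<^esub> x) y2) (comult H w)) (comult H h)"
    by (rule sw_coassoc[symmetric]) simp_all
  also have "\<dots> = sw P (\<lambda>w y2. counit H w \<odot>\<^bsub>P\<^esub> E \<one>\<^bsub>H\<^esub> y2) (comult H h)"
    by (simp add: sw_sinv[where f = "\<lambda>z. E z _"])
  also have "\<dots> = E \<one>\<^bsub>H\<^esub> h"
    by (rule sw_counit_left) simp_all
  finally show ?thesis .
qed

context
  fixes M N :: "('k, 'h, ('k, 'a) vec) yd_module" and b
  assumes MA [simp]: "left_action k H M" and NC [simp]: "right_coaction k H N"
    and b: "b \<in> hopf_auto k H"
begin

lemma module_braid [simp]: "module k M" "module k N"
  using act_module[OF MA] coact_module[OF NC] by simp_all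

lemma lin_vbraid: "lin k (vtensor k M N) (vtensor k N M) (vbraid b M N)"
  and vbraid_pure: "m \<in> carrier M \<Longrightarrow> n \<in> carrier N \<Longrightarrow> vbraid b M N (vpure k M N m n) =
    sw (vtensor k N M) (\<lambda>n0 n1. vpure k N M n0 (action M (b n1) m)) (coaction N n)"
proof -
  note [simp] = auto_rules[OF b]
  have eq: "vbraid b M N = vlift k M N (vtensor k N M)
     (\<lambda>m n. sw (vtensor k N M) (\<lambda>n0 n1. vpure k N M n0 (action M (b n1) m)) (coaction N n))"
    unfolding vbraid_def by (rule vlift_cong) simp_all
  show "lin k (vtensor k M N) (vtensor k N M) (vbraid b M N)"
    unfolding eq by simp
  show "m \<in> carrier M \<Longrightarrow> n \<in> carrier N \<Longrightarrow> vbraid b M N (vpure k M N m n) =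
    sw (vtensor k N M) (\<lambda>n0 n1. vpure k N M n0 (action M (b n1) m)) (coaction N n)"
    unfolding eq by simp
qed

lemma lin_vbraid_inv: "lin k (vtensor k N M) (vtensor k M N) (vbraid_inv b M N)"
  and vbraid_inv_pure: "m \<in> carrier M \<Longrightarrow> n \<in> carrier N \<Longrightarrow> vbraid_inv b M N (vpure k N M n m) =
    sw (vtensor k M N) (\<lambda>n0 n1. vpure k M N (action M (b (antipode H n1)) m) n0) (coaction N n)"
proof -
  note [simp] = auto_rules[OF b]
  show "lin k (vtensor k N M) (vtensor k M N) (vbraid_inv b M N)"
    unfolding vbraid_inv_def by simp
  show "m \<in> carrier M \<Longrightarrow> n \<in> carrier N \<Longrightarrow> vbraid_inv b M N (vpure k N M n m) =
    sw (vtensor k M N) (\<lambda>n0 n1. vpure k M N (action M (b (antipode H n1)) m) n0) (coaction N n)"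
    unfolding vbraid_inv_def by simp
qed

text \<open>By coassociativity of the coaction the two coefficients are the legs of one coproduct,
  acting in the order \<open>S(x) y\<close>. The antipode axiom and then the counit of
  \<open>N\<close> remove them.\<close>

lemma vbraid_inv_vbraid:
  assumes t: "t \<in> carrier (vtensor k M N)"
  shows "vbraid_inv b M N (vbraid b M N t) = t"
proof (rule vtensor_ext[where t = t and k = k and M = M and N = N and P = "vtensor k M N"])
  let ?P = "vtensor k M N"
  note [simp] = auto_rules[OF b]
  fix m n assume [simp]: "m \<in> carrier M" "n \<in> carrier N"
  have "vbraid_inv b M N (vbraid b M N (vpure k M N m n))
    = sw ?P (\<lambda>n0 n1. sw ?P (\<lambda>n00 n01. vpure k M N (action M (b (antipode H n01)) (action M (b n1)
      m)) n00) (coaction N n0)) (coaction N n)"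
    by (simp add: vbraid_pure coact_push[OF _ _ _ _ lin_vbraid_inv] vbraid_inv_pure)
  also have "\<dots> = sw ?P (\<lambda>n0 n1. sw ?P (\<lambda>x y. vpure k M N (action M (b (antipode H x)) (action M (b
    y) m)) n0) (comult H n1)) (coaction N n)"
    by (rule coact_coassoc[OF NC]) simp_all
  also have "\<dots> = sw ?P (\<lambda>n0 n1. counit H n1 \<odot>\<^bsub>?P\<^esub> vpure k M N m n0) (coaction N n)"
  proof (rule sw_coact_cong[OF NC])
    fix n0 n1 assume [simp]: "n0 \<in> carrier N" "n1 \<in> carrier H"
    have "sw ?P (\<lambda>x y. vpure k M N (action M (b (antipode H x \<otimes>\<^bsub>H\<^esub> y)) m) n0) (comult H n1)
      = counit H n1 \<odot>\<^bsub>?P\<^esub> vpure k M N (action M (b \<one>\<^bsub>H\<^esub>) m) n0"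
      by (rule sw_antipode_left) simp_all
    then show "sw ?P (\<lambda>x y. vpure k M N (action M (b (antipode H x)) (action M (b y) m)) n0) (comult
      H n1)
      = counit H n1 \<odot>\<^bsub>?P\<^esub> vpure k M N m n0"
      by (simp add: act_mult)
  qed simp
  also have "\<dots> = vpure k M N m n" by (rule coact_counit[OF NC]) simp_all
  finally show "vbraid_inv b M N (vbraid b M N (vpure k M N m n)) = vpure k M N m n" .
qed (use t lin_comp[OF lin_vbraid_inv lin_vbraid] in simp_all)

text \<open>As before, but the legs now act in the order \<open>x S(y)\<close>, so the right
  antipode axiom is the one needed.\<close>

lemma vbraid_vbraid_inv:
  assumes t: "t \<in> carrier (vtensor k N M)"
  shows "vbraid b M N (vbraid_inv b M N t) = t"
proof (rule vtensor_ext[where t = t and k = k and M = N and N = M and P = "vtensor k N M"])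
  let ?P = "vtensor k N M"
  note [simp] = auto_rules[OF b]
  fix m n assume [simp]: "m \<in> carrier M" "n \<in> carrier N"
  have "vbraid b M N (vbraid_inv b M N (vpure k N M n m))
    = sw ?P (\<lambda>n0 n1. sw ?P (\<lambda>n00 n01. vpure k N M n00 (action M (b n01) (action M (b (antipode H
      n1)) m))) (coaction N n0)) (coaction N n)"
    by (simp add: vbraid_pure coact_push[OF _ _ _ _ lin_vbraid] vbraid_inv_pure)
  also have "\<dots> = sw ?P (\<lambda>n0 n1. sw ?P (\<lambda>x y. vpure k N M n0 (action M (b x) (action M (b (antipode H
    y)) m))) (comult H n1)) (coaction N n)"
    by (rule coact_coassoc[OF NC]) simp_all
  also have "\<dots> = sw ?P (\<lambda>n0 n1. counit H n1 \<odot>\<^bsub>?P\<^esub> vpure k N M n0 m) (coaction N n)"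
  proof (rule sw_coact_cong[OF NC])
    fix n0 n1 assume [simp]: "n0 \<in> carrier N" "n1 \<in> carrier H"
    have "sw ?P (\<lambda>x y. vpure k N M n0 (action M (b (x \<otimes>\<^bsub>H\<^esub> antipode H y)) m)) (comult H n1)
      = counit H n1 \<odot>\<^bsub>?P\<^esub> vpure k N M n0 (action M (b \<one>\<^bsub>H\<^esub>) m)"
      by (rule sw_antipode_right) simp_all
    then show "sw ?P (\<lambda>x y. vpure k N M n0 (action M (b x) (action M (b (antipode H y)) m))) (comult
      H n1)
      = counit H n1 \<odot>\<^bsub>?P\<^esub> vpure k N M n0 m"
      by (simp add: act_mult)
  qed simp
  also have "\<dots> = vpure k N M n m" by (rule coact_counit[OF NC]) simp_all
  finally show "vbraid b M N (vbraid_inv b M N (vpure k N M n m)) = vpure k N M n m" .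
qed (use t lin_comp[OF lin_vbraid lin_vbraid_inv] in simp_all)

end

text \<open>In the linearity part, \<open>\<gamma>\<theta> = \<beta>\<gamma>\<close> turns
  \<open>b\<gamma>\<theta>\<close> into \<open>\<gamma>\<close>, so the first leg from
  \<open>N\<close> meets \<open>\<gamma>(x)\<close> on \<open>M\<close>. In the colinearity part,
  \<open>\<eta> = \<alpha>b\<close> makes the last factor from \<open>M\<close> and the coefficient
  from the conjugate of \<open>N\<close> images under one map. Both times
  \<open>S\<^sup>-\<^sup>1(h\<^sub>2) h\<^sub>1\<close> appears and cancels. The conditions on
  \<open>\<theta>''\<close> and \<open>\<theta>'\<close> say that the remaining legs act as on the
  target.\<close>

lemma vbraid_yd:
  fixes M N :: "('k, 'h, ('k, 'a) vec) yd_module"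
  assumes M: "yetter_drinfeld k H \<alpha> \<beta> M" and N: "yetter_drinfeld k H \<gamma> \<delta> N"
    and a: "\<alpha> \<in> hopf_auto k H" "\<beta> \<in> hopf_auto k H" "\<gamma> \<in> hopf_auto k H" "\<delta> \<in> hopf_auto k H"
      "\<theta> \<in> hopf_auto k H" "\<theta>' \<in> hopf_auto k H" "\<theta>'' \<in> hopf_auto k H" "\<eta> \<in> hopf_auto k H"
        "b \<in> hopf_auto k H"
    and b: "\<And>h. h \<in> carrier H \<Longrightarrow> b (\<beta> h) = h" "\<And>h. h \<in> carrier H \<Longrightarrow> \<beta> (b h) = h"
    and e: "\<And>h. h \<in> carrier H \<Longrightarrow> \<gamma> (\<theta> h) = \<beta> (\<gamma> h)" "\<And>h. h \<in> carrier H \<Longrightarrow> \<eta> h = \<alpha> (b h)"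
      "\<And>h. h \<in> carrier H \<Longrightarrow> \<theta>'' (\<alpha> h) = \<theta> h" "\<And>h. h \<in> carrier H \<Longrightarrow> \<theta>' h = b (\<delta> (\<theta> h))"
  shows "vbraid b M N \<in> yd_maps k H (yd_tens k H \<gamma> \<theta> M N) (yd_tens k H \<alpha> \<theta>' (yd_twist k H \<theta>'' \<eta> N)
    M)"
proof -
  note MA [simp] = yd_left_action[OF M a(1,2)] and MC [simp] = yd_right_coaction[OF M a(1,2)]
  note NA [simp] = yd_left_action[OF N a(3,4)] and NC [simp] = yd_right_coaction[OF N a(3,4)]
  let ?N = "yd_twist k H \<theta>'' \<eta> N"
  interpret S: action_coaction_pair k H M N \<gamma> \<theta>
    by (intro action_coaction_pair.intro action_coaction_pair_axioms.intro hopf_algebra_bij_axioms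
      MA MC NA NC a)
  interpret S': action_coaction_pair k H ?N M \<alpha> \<theta>'
    by (intro action_coaction_pair.intro action_coaction_pair_axioms.intro hopf_algebra_bij_axioms
      MA MC
        left_action_twist[OF a(7,8) NA] right_coaction_twist[OF a(7,8) NC] a)
  note [simp] = auto_rules[OF a(1)] auto_rules[OF a(2)] auto_rules[OF a(4)] auto_rules[OF a(9)]
    vbraid_pure[OF MA NC a(9)] b e(1) action_twist[OF a(7,8)]
  note S'_facts = S'.tens_facts[unfolded yd_twist_trunc yd_twist_vtrunc]
  note [simp] = S'_facts(1,2,3)
  note lv = lin_vbraid[OF MA NC a(9)]
  let ?V' = "vtensor k N M" let ?T = "tensor_module k ?V' H"
  show ?thesis
  proof (rule S.yd_mapsI_tens)
    show "vbraid b M N \<in> extensional (carrier S.V)" by (simp add: vbraid_def)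
    show "lin k S.V S'.W (vbraid b M N)" using lv by simp
    fix h m n assume h [simp]: "h \<in> carrier H" and m [simp]: "m \<in> carrier M"
      and n [simp]: "n \<in> carrier N"
    \<comment> \<open>\<open>z\<close> holds \<open>S\<^sup>-\<^sup>1(y\<^sub>1) x\<close> before
      the cancellation and \<open>1\<close> after it; applying \<open>b\<close> to the coefficient
      of \<open>N\<close> has already removed \<open>\<beta>\<close> from this factor.\<close>
    let ?G = "\<lambda>z y. sw ?V' (\<lambda>y2 y3. sw ?V' (\<lambda>n0 n1. vpure k N M (action N (\<theta> y2) n0)
        (action M (b (\<delta> (\<theta> y3)) \<otimes>\<^bsub>H\<^esub> (b n1 \<otimes>\<^bsub>H\<^esub> \<gamma> z)) m)) (coaction N n)) (comult H y)"
    have inner: "sw ?V' (\<lambda>n0 n1. vpure k N M n0 (action M (b n1) (action M (\<gamma> x) m))) (coaction N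
      (action N (\<theta> y) n))
        = sw ?V' (\<lambda>y1 y23. ?G (sinv y1 \<otimes>\<^bsub>H\<^esub> x) y23) (comult H y)" if [simp]: "x \<in> carrier H" "y \<in>
          carrier H" for x y
      by (subst coact_act[OF N a(3,4)]) (simp_all add: act_mult)
    have "vbraid b M N (action S.W h (vpure k M N m n)) = sw ?V' (\<lambda>x y. sw ?V' (\<lambda>y1 y23. ?G (sinv y1
      \<otimes>\<^bsub>H\<^esub> x) y23) (comult H y)) (comult H h)"
      by (simp add: comult_push[OF _ _ _ lv] inner)
    also have "\<dots> = ?G \<one>\<^bsub>H\<^esub> h"
      by (rule sw_contract_left) simp_all
    also have "\<dots> = sw ?V' (\<lambda>n0 n1. sw ?V' (\<lambda>y2 y3. vpure k N M (action N (\<theta> y2) n0)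
        (action M (b (\<delta> (\<theta> y3)) \<otimes>\<^bsub>H\<^esub> (b n1 \<otimes>\<^bsub>H\<^esub> \<gamma> \<one>\<^bsub>H\<^esub>)) m)) (comult H h)) (coaction N n)"
      by (rule sw_swap[of k N H H H ?V']) simp_all
    also have "\<dots> = action S'.W h (vbraid b M N (vpure k M N m n))"
      by (simp add: coact_push[OF NC _ _ _ S'.lin_action_tens[unfolded yd_twist_trunc
        yd_twist_vtrunc]] act_mult e(3,4))
    finally show "vbraid b M N (action S.W h (vpure k M N m n)) = action S'.W h (vbraid b M N (vpure
      k M N m n))" .
  next
    fix m n assume m [simp]: "m \<in> carrier M" and n [simp]: "n \<in> carrier N"
    let ?p = "\<lambda>x y z. pure_tensor k ?V' H (vpure k N M x y) z"
    let ?G = "\<lambda>n0 z y. sw ?T (\<lambda>h2 h3. sw ?T (\<lambda>m0 m1. ?p n0 (action M (b h2) m0) (h3 \<otimes>\<^bsub>H\<^esub> (m1 \<otimes>\<^bsub>H\<^esub> \<alpha>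
      (b z)))) (coaction M m)) (comult H y)"
    have inner: "sw ?T (\<lambda>q0 q1. ?p x q0 (q1 \<otimes>\<^bsub>H\<^esub> y)) (coaction M (action M (b z) m))
      = sw ?T (\<lambda>h1 h23. sw ?T (\<lambda>h2 h3. sw ?T (\<lambda>m0 m1. ?p x (action M (b h2) m0) (h3 \<otimes>\<^bsub>H\<^esub> m1 \<otimes>\<^bsub>H\<^esub> \<alpha>
        (b (sinv h1)) \<otimes>\<^bsub>H\<^esub> y))
        (coaction M m)) (comult H h23)) (comult H z)" if [simp]: "x \<in> carrier N" "y \<in> carrier
          H" "z \<in> carrier H" for x y z
      by (subst coact_act[OF M a(1,2)]) simp_all
    have "coaction S'.W (vbraid b M N (vpure k M N m n))
      = sw ?T (\<lambda>n0 n1. coaction S'.W (vpure k N M n0 (action M (b n1) m))) (coaction N n)"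
      by (simp add: coact_push[OF NC _ _ _ S'.lin_coaction_tens[unfolded yd_twist_trunc
        yd_twist_vtrunc]])
    \<comment> \<open>The coaction of \<open>b(n\<^sub>1)\<cdot>m\<close> ends in
      \<open>\<alpha>b(S\<^sup>-\<^sup>1(h\<^sub>1))\<close>, the twisted coaction of
      \<open>n\<^sub>0\<close> begins with \<open>\<alpha>b(n\<^sub>0\<^sub>1)\<close>, and they
      merge in the argument \<open>z\<close> of the local \<open>?G\<close>.\<close>
    also have "\<dots> = sw ?T (\<lambda>n0 n1. sw ?T (\<lambda>n00 n01. sw ?T (\<lambda>h1 h23. ?G n00 (sinv h1 \<otimes>\<^bsub>H\<^esub> n01) h23)
      (comult H n1)) (coaction N n0)) (coaction N n)"
      by (simp add: S'_facts(5) sw_coaction_twist[OF a(7,8) NC] inner e(2)) (simp add: assoc_H)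
    also have "\<dots> = sw ?T (\<lambda>n0 w. sw ?T (\<lambda>x y. sw ?T (\<lambda>h1 h23. ?G n0 (sinv h1 \<otimes>\<^bsub>H\<^esub> x) h23) (comult H
      y)) (comult H w)) (coaction N n)"
      by (rule coact_coassoc[OF NC]) simp_all
    \<comment> \<open>Coassociativity has made \<open>x\<close> and \<open>h1\<close> consecutive
      legs of \<open>w\<close>, so the pair contracts.\<close>
    also have "\<dots> = sw ?T (\<lambda>n0 w. ?G n0 \<one>\<^bsub>H\<^esub> w) (coaction N n)"
      by (rule sw_coact_cong[OF NC], simp, rule sw_contract_left) simp_all
    also have "\<dots> = sw ?T (\<lambda>n0 w. sw ?T (\<lambda>m0 m1. sw ?T (\<lambda>h2 h3. ?p n0 (action M (b h2) m0) (h3 \<otimes>\<^bsub>H\<^esub>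
      m1)) (comult H w)) (coaction M m)) (coaction N n)"
    proof (rule sw_coact_cong[OF NC])
      fix n0 w assume [simp]: "n0 \<in> carrier N" "w \<in> carrier H"
      have "?G n0 \<one>\<^bsub>H\<^esub> w = sw ?T (\<lambda>h2 h3. sw ?T (\<lambda>m0 m1. ?p n0 (action M (b h2) m0) (h3 \<otimes>\<^bsub>H\<^esub> m1))
        (coaction M m)) (comult H w)"
        by simp
      also have "\<dots> = sw ?T (\<lambda>m0 m1. sw ?T (\<lambda>h2 h3. ?p n0 (action M (b h2) m0) (h3 \<otimes>\<^bsub>H\<^esub> m1)) (comult
        H w)) (coaction M m)"
        by (rule sw_swap[of k M H H H ?T]) simp_all
      finally show "?G n0 \<one>\<^bsub>H\<^esub> w = sw ?T (\<lambda>m0 m1. sw ?T (\<lambda>h2 h3. ?p n0 (action M (b h2) m0) (h3 \<otimes>\<^bsub>H\<^esub>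
        m1)) (comult H w)) (coaction M m)" .
    qed simp
    also have "\<dots> = sw ?T (\<lambda>m0 m1. sw ?T (\<lambda>n0 w. sw ?T (\<lambda>h2 h3. ?p n0 (action M (b h2) m0) (h3 \<otimes>\<^bsub>H\<^esub>
      m1)) (comult H w)) (coaction N n)) (coaction M m)"
      by (rule sw_swap[of k M H N H ?T]) simp_all
    \<comment> \<open>Coassociativity of \<open>N\<close> read backwards: the legs of
      \<open>w\<close> become an iterated coaction, in which the braiding of
      \<open>m\<^sub>0\<close> and \<open>n\<^sub>0\<close> is visible again.\<close>
    also have "\<dots> = sw ?T (\<lambda>m0 m1. sw ?T (\<lambda>n0 n1. sw ?T (\<lambda>n00 n01. ?p n00 (action M (b n01) m0) (n1
      \<otimes>\<^bsub>H\<^esub> m1)) (coaction N n0)) (coaction N n)) (coaction M m)"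
      by (rule sw_coact_cong[OF MC], simp, rule coact_coassoc[OF NC, symmetric]) simp_all
    also have "\<dots> = sw ?T (\<lambda>m0 m1. sw ?T (\<lambda>n0 n1. pure_tensor k ?V' H (vbraid b M N (vpure k M N m0
      n0)) (n1 \<otimes>\<^bsub>H\<^esub> m1)) (coaction N n)) (coaction M m)"
    proof -
      have push: "pure_tensor k ?V' H (sw ?V' f (coaction N x)) z = sw ?T (\<lambda>a b. pure_tensor k ?V' H
        (f a b) z) (coaction N x)"
        if "z \<in> carrier H" "x \<in> carrier N" "\<And>a b. a \<in> carrier N \<Longrightarrow> b \<in> carrier H
          \<Longrightarrow> f a b \<in> carrier ?V'" for z x f
        by (rule coact_push[OF NC, where g = "\<lambda>v. pure_tensor k ?V' H v z"]) (use that in simp_all)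
      show ?thesis by (simp add: push)
    qed
    finally show "coaction S'.W (vbraid b M N (vpure k M N m n)) = sw (tensor_module k S'.W H) (\<lambda>m0
      m1. sw (tensor_module k S'.W H)
        (\<lambda>n0 n1. pure_tensor k S'.W H (vbraid b M N (vpure k M N m0 n0)) (n1 \<otimes>\<^bsub>H\<^esub> m1)) (coaction N
          n)) (coaction M m)"
      by simp
  qed simp_all
qed

end

section \<open>Coherence on elements\<close>

lemmas vmaps_defs = vassoc_def vassoc_inv_def vmap_def

context
  fixes R :: "('k, ('k, 'a) vec, 'y) module_scheme" and V :: "('k, ('k, 'a) vec, 'v) module_scheme"
  assumes RV: "module.truncate R = module.truncate V"
begin

lemma trunc_vmaps:
  "vassoc k R M N = vassoc k V M N" "vassoc k M R N = vassoc k M V N"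
    "vassoc k M N R = vassoc k M N V"
  "vassoc_inv k R M N = vassoc_inv k V M N" "vassoc_inv k M R N = vassoc_inv k M V N"
    "vassoc_inv k M N R = vassoc_inv k M N V"
  "vmap k R N M' N' f g = vmap k V N M' N' f g" "vmap k M R M' N' f g = vmap k M V M' N' f g"
  "vmap k M N R N' f g = vmap k M N V N' f g" "vmap k M N M' R f g = vmap k M N M' V f g"
  by (simp_all add: vmaps_defs trunc_vtensor[OF RV] trunc_vpure[OF RV] trunc_vlift[OF RV])

end

lemmas (in hopf_algebra_bij) unit_vmaps [simp] = trunc_vmaps[OF truncate_unit]

declare vassoc_pure [simp] vassoc_inv_pure [simp] vmap_pure [simp] lin_vassoc [simp] lin_vassoc_inv
  [simp] lin_vmap [simp]

context
  fixes k :: "('k, 'x) ring_scheme" and L :: "('k, ('k, 'a) vec, 'y1) module_scheme"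
    and M :: "('k, ('k, 'a) vec, 'y2) module_scheme"
    and N :: "('k, ('k, 'a) vec, 'y3) module_scheme"
  assumes [simp]: "module k L" "module k M" "module k N"
begin

lemma lin_vassoc_comp [simp]:
  "lin k A (vtensor k (vtensor k L M) N) f \<Longrightarrow> lin k A (vtensor k L (vtensor k M N)) (\<lambda>x. vassoc k L M
    N (f x))"
  by (rule lin_comp[OF lin_vassoc]) simp_all

lemma lin_vassoc_inv_comp [simp]:
  "lin k A (vtensor k L (vtensor k M N)) f \<Longrightarrow> lin k A (vtensor k (vtensor k L M) N) (\<lambda>x. vassoc_inv k
    L M N (f x))"
  by (rule lin_comp[OF lin_vassoc_inv]) simp_all

end

context
  fixes k :: "('k, 'x) ring_scheme" and M :: "('k, ('k, 'a) vec, 'y1) module_scheme"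
    and N :: "('k, ('k, 'a) vec, 'y2) module_scheme"
    and M' :: "('k, ('k, 'a) vec, 'y3) module_scheme"
    and N' :: "('k, ('k, 'a) vec, 'y4) module_scheme"
  assumes [simp]: "module k M" "module k N" "module k M'" "module k N'"
begin

lemma lin_vmap_comp [simp]:
  "lin k M M' f \<Longrightarrow> lin k N N' g \<Longrightarrow> lin k A (vtensor k M N) h
    \<Longrightarrow> lin k A (vtensor k M' N') (\<lambda>x. vmap k M N M' N' f g (h x))"
  by (rule lin_comp[OF lin_vmap]) simp_all

end

lemma lin_restrict_ident [simp]: "module k M \<Longrightarrow> lin k M M (\<lambda>m\<in>carrier M. m)"
  by (subst lin_cong[where g = "\<lambda>x. x"]) simp_all

text \<open>\<open>i\<close> and \<open>j\<close> are linear maps fixing the elements of the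
  carriers, so the lemma covers the restricted identities that serve as identity arrows.\<close>

lemma vmap_ident:
  fixes M :: "('k, ('k, 'a) vec, 'y1) module_scheme"
    and N :: "('k, ('k, 'a) vec, 'y2) module_scheme"
  assumes [simp]: "module k M" "module k N" and t: "t \<in> carrier (vtensor k M N)"
    and i: "\<And>x. x \<in> carrier M \<Longrightarrow> i x = x" "lin k M M i" and j: "\<And>x. x \<in> carrier N \<Longrightarrow> j x = x"
      "lin k N N j"
  shows "vmap k M N M N i j t = t"
  by (rule vtensor_ext[where k = k and M = M and N = N and P = "vtensor k M N"
    and t = t]) (use t i j in simp_all)

text \<open>The composites are given by their values on the carriers, which is how composition of
  arrows with its restriction enters.\<close>

lemma vmap_vmap:
  fixes M :: "('k, ('k, 'a) vec, 'y1) module_scheme"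
    and N :: "('k, ('k, 'a) vec, 'y2) module_scheme"
    and M' :: "('k, ('k, 'a) vec, 'y3) module_scheme"
    and N' :: "('k, ('k, 'a) vec, 'y4) module_scheme"
    and M'' :: "('k, ('k, 'a) vec, 'y5) module_scheme"
    and N'' :: "('k, ('k, 'a) vec, 'y6) module_scheme"
  assumes [simp]: "module k M" "module k N" "module k M'" "module k N'" "module k M''"
    "module k N''"
    and f: "lin k M M' f" "lin k M' M'' f'" and g: "lin k N N' g" "lin k N' N'' g'"
    and ff: "lin k M M'' f''" "\<And>m. m \<in> carrier M \<Longrightarrow> f'' m = f' (f m)"
    and gg: "lin k N N'' g''" "\<And>n. n \<in> carrier N \<Longrightarrow> g'' n = g' (g n)"
    and t: "t \<in> carrier (vtensor k M N)"
  shows "vmap k M N M'' N'' f'' g'' t = vmap k M' N' M'' N'' f' g' (vmap k M N M' N' f g t)"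
  by (rule vtensor_ext[where k = k and M = M and N = N and P = "vtensor k M'' N''" and t = t])
    (use t f g ff gg in \<open>simp_all add: lin_closed[OF f(1)] lin_closed[OF g(1)]\<close>)

lemma vassoc_vmap:
  fixes L :: "('k, ('k, 'a) vec, 'y1) module_scheme"
    and M :: "('k, ('k, 'a) vec, 'y2) module_scheme"
    and N :: "('k, ('k, 'a) vec, 'y3) module_scheme"
    and L' :: "('k, ('k, 'a) vec, 'y4) module_scheme"
    and M' :: "('k, ('k, 'a) vec, 'y5) module_scheme"
    and N' :: "('k, ('k, 'a) vec, 'y6) module_scheme"
  assumes [simp]: "module k L" "module k M" "module k N" "module k L'" "module k M'" "module k N'"
    and f: "lin k L L' f" and g: "lin k M M' g" and h: "lin k N N' h"
    and t: "t \<in> carrier (vtensor k (vtensor k L M) N)"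
  shows "vassoc k L' M' N' (vmap k (vtensor k L M) N (vtensor k L' M') N' (vmap k L M L' M' f g) h
    t)
    = vmap k L (vtensor k M N) L' (vtensor k M' N') f (vmap k M N M' N' g h) (vassoc k L M N t)"
  by (rule vtensor_ext_left[where k = k and L = L and M = M and N = N
    and P = "vtensor k L' (vtensor k M' N')" and t = t])
    (use t f g h in \<open>simp_all add: lin_closed[OF f] lin_closed[OF g] lin_closed[OF h]\<close>)

text \<open>On pure tensors both sides merely move brackets; the fourfold tensor is decomposed by
  splitting off \<open>X\<close> and then treating the threefold part.\<close>

lemma vassoc_pentagon:
  fixes U :: "('k, ('k, 'a) vec, 'y1) module_scheme"
    and V :: "('k, ('k, 'a) vec, 'y2) module_scheme"
    and W :: "('k, ('k, 'a) vec, 'y3) module_scheme"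
      and X :: "('k, ('k, 'a) vec, 'y4) module_scheme"
  assumes [simp]: "module k U" "module k V" "module k W" "module k X"
    and t: "t \<in> carrier (vtensor k (vtensor k (vtensor k U V) W) X)"
    and i: "\<And>x. x \<in> carrier U \<Longrightarrow> i x = x" "lin k U U i" and j: "\<And>x. x \<in> carrier X \<Longrightarrow> j x = x"
      "lin k X X j"
  shows "vassoc k U V (vtensor k W X) (vassoc k (vtensor k U V) W X t) =
    vmap k U (vtensor k (vtensor k V W) X) U (vtensor k V (vtensor k W X)) i (vassoc k V W X)
      (vassoc k U (vtensor k V W) X (vmap k (vtensor k (vtensor k U V) W) X (vtensor k U (vtensor k
        V W)) X (vassoc k U V W) j t))"
proof -
  note [simp] = i j
  let ?P = "vtensor k U (vtensor k V (vtensor k W X))"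
  let ?f = "\<lambda>t. vassoc k U V (vtensor k W X) (vassoc k (vtensor k U V) W X t)"
  let ?g = "\<lambda>t. vmap k U (vtensor k (vtensor k V W) X) U (vtensor k V (vtensor k W X)) i (vassoc k V
    W X)
      (vassoc k U (vtensor k V W) X (vmap k (vtensor k (vtensor k U V) W) X (vtensor k U (vtensor k
        V W)) X (vassoc k U V W) j t))"
  show ?thesis
  proof (rule vtensor_ext[where t = t and k = k and M = "vtensor k (vtensor k U V) W" and N = X
    and P = ?P])
    fix s x assume s: "s \<in> carrier (vtensor k (vtensor k U V) W)" and x [simp]: "x \<in> carrier X"
    show "?f (vpure k (vtensor k (vtensor k U V) W) X s x) = ?g (vpure k (vtensor k (vtensor k U V)
      W) X s x)"
      by (rule vtensor_ext_left[where t = s and k = k and L = U and M = V and N = W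
        and P = ?P]) (use s in simp_all)
  qed (use t in simp_all)
qed

lemma vpure_smult:
  fixes M :: "('k, ('k, 'a) vec, 'y1) module_scheme"
    and N :: "('k, ('k, 'a) vec, 'y2) module_scheme"
  assumes "module k M" "module k N" "c \<in> carrier k" "m \<in> carrier M" "n \<in> carrier N"
  shows "vpure k M N (c \<odot>\<^bsub>M\<^esub> m) n = vpure k M N m (c \<odot>\<^bsub>N\<^esub> n)"
  using lin_smult[OF bilinD1[OF bilin_vpure[OF assms(1,2)] assms(5)] assms(3,4)]
    lin_smult[OF bilinD2[OF bilin_vpure[OF assms(1,2)] assms(4)] assms(3,5)] by simp

context hopf_algebra_bij
begin

text \<open>On pure tensors this says that the scalar from the middle factor may be absorbed on
  either side of the tensor sign.\<close>

lemma vunit_triangle: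
  fixes U V :: "('k, 'h, ('k, 'a) vec) yd_module"
  assumes [simp]: "left_action k H U" "right_coaction k H U" "left_action k H V"
    "right_coaction k H V"
    and t: "t \<in> carrier (vtensor k (vtensor k U unit_space) V)"
    and i: "\<And>x. x \<in> carrier U \<Longrightarrow> i x = x" "lin k U U i" and j: "\<And>x. x \<in> carrier V \<Longrightarrow> j x = x"
      "lin k V V j"
  shows "vmap k U (vtensor k unit_space V) U V i (vlunit V) (vassoc k U unit_space V t)
    = vmap k (vtensor k U unit_space) V U V (vrunit U) j t"
proof -
  have [simp]: "module k U" "module k V" using act_module assms by auto
  interpret U: module k U by simp
  interpret V: module k V by simp
  note [simp] = i j lin_vlunit lin_vrunit vlunit_pure vrunit_pure
  show ?thesis
    by (rule vtensor_ext_left[where t = t and k = k and L = U and M = unit_space and N = V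
      and P = "vtensor k U V"])
      (use t in \<open>simp_all add: vpure_smult\<close>)
qed

lemma vlunit_vmap:
  fixes X Y :: "('k, 'h, ('k, 'a) vec) yd_module"
  assumes [simp]: "left_action k H X" "right_coaction k H X" "left_action k H Y"
    "right_coaction k H Y"
    and f: "lin k X Y f" and i: "\<And>x. x \<in> carrier unit_space \<Longrightarrow> i x = x"
      "lin k unit_space unit_space i"
    and t: "t \<in> carrier (vtensor k unit_space X)"
  shows "vlunit Y (vmap k unit_space X unit_space Y i f t) = f (vlunit X t)"
proof -
  have [simp]: "module k X" "module k Y" using act_module assms by auto
  interpret X: module k X by simp
  note [simp] = i f vlunit_pure lin_comp[OF lin_vlunit] lin_comp[OF f] lin_closed[OF f] lin_smult[OF
    f] lin_vlunit
  show ?thesis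
    by (rule vtensor_ext[where t = t and k = k and M = unit_space and N = X
      and P = Y]) (use t in simp_all)
qed

lemma vrunit_vmap:
  fixes X Y :: "('k, 'h, ('k, 'a) vec) yd_module"
  assumes [simp]: "left_action k H X" "right_coaction k H X" "left_action k H Y"
    "right_coaction k H Y"
    and f: "lin k X Y f" and i: "\<And>x. x \<in> carrier unit_space \<Longrightarrow> i x = x"
      "lin k unit_space unit_space i"
    and t: "t \<in> carrier (vtensor k X unit_space)"
  shows "vrunit Y (vmap k X unit_space Y unit_space f i t) = f (vrunit X t)"
proof -
  have [simp]: "module k X" "module k Y" using act_module assms by auto
  interpret X: module k X by simp
  note [simp] = i f vrunit_pure lin_comp[OF lin_vrunit] lin_comp[OF f] lin_closed[OF f] lin_smult[OF
    f] lin_vrunit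
  show ?thesis
    by (rule vtensor_ext[where t = t and k = k and M = X and N = unit_space
      and P = Y]) (use t in simp_all)
qed

text \<open>Colinearity of \<open>g\<close> moves it inside the coaction of \<open>n\<close>, and
  linearity of \<open>f\<close> over \<open>H\<close> moves it past the action on
  \<open>m\<close>.\<close>

lemma vbraid_vmap:
  fixes M N M' N' :: "('k, 'h, ('k, 'a) vec) yd_module"
  assumes [simp]: "left_action k H M" "right_coaction k H N" "left_action k H M'"
    "right_coaction k H N'"
    and f: "f \<in> yd_maps k H M M'" and g: "g \<in> yd_maps k H N N'" and b: "b \<in> hopf_auto k H"
    and t: "t \<in> carrier (vtensor k M N)"
  shows "vmap k N M N' M' g f (vbraid b M N t) = vbraid b M' N' (vmap k M N M' N' f g t)"
proof -
  have [simp]: "module k M" "module k N" "module k M'" "module k N'"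
    using act_module coact_module assms by auto
  note lf = yd_map_lin[OF f] and lg = yd_map_lin[OF g]
  note [simp] = auto_rules[OF b] lf lg lin_comp[OF lf] lin_comp[OF lg] lin_closed[OF lf]
    lin_closed[OF lg]
    yd_map_action[OF f] yd_map_sw[OF g] lin_vbraid[OF _ _ b] vbraid_pure[OF _ _ b] lin_comp[OF
      lin_vbraid[OF _ _ b]]
  have lv: "lin k (vtensor k N M) (vtensor k N' M') (vmap k N M N' M' g f)" by simp
  show ?thesis
  proof (rule vtensor_ext[where t = t and k = k and M = M and N = N and P = "vtensor k N' M'"])
    show "vmap k N M N' M' g f (vbraid b M N (vpure k M N m n)) = vbraid b M' N' (vmap k M N M' N' f
      g (vpure k M N m n))"
      if "m \<in> carrier M" "n \<in> carrier N" for m n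
      using that by (simp add: coact_push[OF _ _ _ _ lv])
  qed (use t in simp_all)
qed

text \<open>The coefficient of \<open>n\<close> acts on \<open>l \<otimes> m\<close> through
  \<open>\<Delta>\<close>. Coassociativity of \<open>N\<close> converts this into braiding past
  \<open>M\<close> and then past \<open>L\<close>. The conditions \<open>e\<close> match the
  automorphisms on the two legs; \<open>\<eta>\<close> is the twist of the coaction that
  \<open>N\<close> picks up when it passes \<open>M\<close>.\<close>

lemma vbraid_tens_left:
  fixes L M N :: "('k, 'h, ('k, 'a) vec) yd_module"
  assumes L: "left_action k H L" "right_coaction k H L" and M: "left_action k H M"
    "right_coaction k H M"
    and N: "right_coaction k H N"
    and a: "\<gamma> \<in> hopf_auto k H" "\<theta> \<in> hopf_auto k H" "b' \<in> hopf_auto k H" "b1 \<in> hopf_auto k H"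
      "b2 \<in> hopf_auto k H"
      "\<theta>'' \<in> hopf_auto k H" "\<eta> \<in> hopf_auto k H"
    and e: "\<And>h. h \<in> carrier H \<Longrightarrow> \<gamma> (b' h) = b1 (\<eta> h)" "\<And>h. h \<in> carrier H \<Longrightarrow> \<theta> (b' h) = b2 h"
    and i: "\<And>x. x \<in> carrier L \<Longrightarrow> i x = x" "lin k L L i" and j: "\<And>x. x \<in> carrier M \<Longrightarrow> j x = x"
      "lin k M M j"
    and t: "t \<in> carrier (vtensor k (vtensor k L M) N)"
  shows "vbraid b' (yd_tens k H \<gamma> \<theta> L M) N t =
    vassoc k N L M (vmap k (vtensor k L N) M (vtensor k N L) M (vbraid b1 L (yd_twist k H \<theta>'' \<eta> N))
      j
      (vassoc_inv k L N M (vmap k L (vtensor k M N) L (vtensor k N M) i (vbraid b2 M N) (vassoc k L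
        M N t))))"
proof -
  let ?N = "yd_twist k H \<theta>'' \<eta> N"
  note [simp] = L M N i j auto_rules[OF a(3)] auto_rules[OF a(4)] auto_rules[OF a(5)] auto_rules[OF
    a(7)]
  have tc [simp]: "right_coaction k H ?N" by (rule right_coaction_twist[OF a(6,7) N])
  interpret LM: action_coaction_pair k H L M \<gamma> \<theta>
    by (intro action_coaction_pair.intro action_coaction_pair_axioms.intro hopf_algebra_bij_axioms L
      M a)
  have modules [simp]: "module k L" "module k M" "module k N" using act_module coact_module L M N
    by auto
  have [simp]: "lin k (vtensor k M N) (vtensor k N M) (vbraid b2 M N)" by (rule lin_vbraid[OF _ _
    a(5)]) simp_all
  have lb1 [simp]: "lin k (vtensor k L N) (vtensor k N L) (vbraid b1 L ?N)"
    using lin_vbraid[OF L(1) tc a(4)] by simp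
  have lb' [simp]: "lin k (vtensor k LM.V N) (vtensor k N LM.V) (vbraid b' LM.W N)"
    using lin_vbraid[OF LM.left_action_tens N a(3)] by simp
  let ?P = "vtensor k N LM.V"
  show ?thesis
  proof (rule vtensor_ext_left[where t = t and k = k and L = L and M = M and N = N and P = ?P])
    fix l m n assume [simp]: "l \<in> carrier L" "m \<in> carrier M" "n \<in> carrier N"
    let ?q = "\<lambda>n0 x y. vpure k N LM.V n0 (vpure k L M (action L (b1 (\<eta> x)) l) (action M (b2 y) m))"
    \<comment> \<open>The last three maps of the composite, taken as one linear map, so that the sum
      produced by the first braiding can be pushed through it at once.\<close>
    let ?D = "\<lambda>t. vassoc k N L M (vmap k (vtensor k L N) M (vtensor k N L) M (vbraid b1 L ?N) j
      (vassoc_inv k L N M t))"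
    have lD: "lin k (vtensor k L (vtensor k N M)) ?P ?D" by simp
    have D: "?D (vpure k L (vtensor k N M) l (sw (vtensor k N M) f (coaction N n)))
        = sw ?P (\<lambda>x y. ?D (vpure k L (vtensor k N M) l (f x y))) (coaction N n)"
      if "\<And>x y. x \<in> carrier N \<Longrightarrow> y \<in> carrier H \<Longrightarrow> f x y \<in> carrier (vtensor k N M)" for f
      by (rule coact_push[OF N, where g = "\<lambda>u. ?D (vpure k L (vtensor k N M) l u)"]) (use that in
        simp_all)
    have E: "?D (vpure k L (vtensor k N M) l (vpure k N M n0 m'))
      = sw ?P (\<lambda>x y. vpure k N LM.V x (vpure k L M (action L (b1 (\<eta> y)) l) m')) (coaction N n0)"
      if [simp]: "n0 \<in> carrier N" "m' \<in> carrier M" for n0 m'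
    proof -
      have "vbraid b1 L ?N (vpure k L N l n0) = sw (vtensor k N L) (\<lambda>x y. vpure k N L x (action L
        (b1 (\<eta> y)) l)) (coaction N n0)"
        using vbraid_pure[OF L(1) tc a(4), of l n0] by (simp add: sw_coaction_twist[OF a(6,7) N])
      moreover have "vassoc k N L M (vpure k (vtensor k N L) M (sw (vtensor k N L) f (coaction N
        n0)) m')
          = sw ?P (\<lambda>x y. vassoc k N L M (vpure k (vtensor k N L) M (f x y) m')) (coaction N n0)"
        if "\<And>x y. x \<in> carrier N \<Longrightarrow> y \<in> carrier H \<Longrightarrow> f x y \<in> carrier (vtensor k N L)" for f
        by (rule coact_push[OF N, where g = "\<lambda>u. vassoc k N L M (vpure k (vtensor k N L) M u m')"])
          (use that in simp_all)
      ultimately show ?thesis by simp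
    qed
    have push: "vpure k N LM.V v (sw LM.V f (comult H x)) = sw ?P (\<lambda>a b. vpure k N LM.V v (f a b))
      (comult H x)"
      if "v \<in> carrier N" "x \<in> carrier H" "\<And>a b. a \<in> carrier H \<Longrightarrow> b \<in> carrier H
        \<Longrightarrow> f a b \<in> carrier LM.V" for v x f
      by (rule comult_push[where g = "vpure k N LM.V v"]) (use that in simp_all)
    have "vbraid b' LM.W N (vpure k LM.V N (vpure k L M l m) n) = sw ?P (\<lambda>n0 n1. sw ?P (\<lambda>x y. ?q n0
      x y) (comult H n1)) (coaction N n)"
      using vbraid_pure[OF LM.left_action_tens N a(3), of "vpure k L M l m" n] by (simp add: push e)
    also have "\<dots> = sw ?P (\<lambda>n0 n1. sw ?P (\<lambda>x y. ?q x y n1) (coaction N n0)) (coaction N n)"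
      by (rule coact_coassoc[OF N, symmetric]) simp_all
    also have "\<dots> = sw ?P (\<lambda>n0 n1. ?D (vpure k L (vtensor k N M) l (vpure k N M n0 (action M (b2 n1)
      m)))) (coaction N n)"
      by (rule sw_coact_cong[OF N], simp, rule E[symmetric]) simp_all
    also have "\<dots> = ?D (vpure k L (vtensor k N M) l (sw (vtensor k N M) (\<lambda>n0 n1. vpure k N M n0
      (action M (b2 n1) m)) (coaction N n)))"
      by (rule D[symmetric]) simp
    also have "\<dots> = ?D (vmap k L (vtensor k M N) L (vtensor k N M) i (vbraid b2 M N) (vassoc k L M N
      (vpure k LM.V N (vpure k L M l m) n)))"
      by (simp add: vbraid_pure[OF M(1) N a(5)])
    finally show "vbraid b' LM.W N (vpure k LM.V N (vpure k L M l m) n) =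
      ?D (vmap k L (vtensor k M N) L (vtensor k N M) i (vbraid b2 M N) (vassoc k L M N (vpure k LM.V
        N (vpure k L M l m) n)))" .
  qed (use t in simp_all)
qed

text \<open>The coefficient \<open>n\<^sub>1 m\<^sub>1\<close> acts as \<open>m\<^sub>1\<close>
  followed by \<open>n\<^sub>1\<close>, which is braiding past \<open>M\<close> and then past
  \<open>N\<close>.\<close>

lemma vbraid_tens_right:
  fixes L M N :: "('k, 'h, ('k, 'a) vec) yd_module"
  assumes L: "left_action k H L" and M: "left_action k H M" "right_coaction k H M"
    and N: "left_action k H N" "right_coaction k H N"
    and a: "\<gamma> \<in> hopf_auto k H" "\<theta> \<in> hopf_auto k H" "b \<in> hopf_auto k H"
    and i: "\<And>x. x \<in> carrier M \<Longrightarrow> i x = x" "lin k M M i" and j: "\<And>x. x \<in> carrier N \<Longrightarrow> j x = x"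
      "lin k N N j"
    and t: "t \<in> carrier (vtensor k L (vtensor k M N))"
  shows "vbraid b L (yd_tens k H \<gamma> \<theta> M N) t =
    vassoc_inv k M N L (vmap k M (vtensor k L N) M (vtensor k N L) i (vbraid b L N)
      (vassoc k M L N (vmap k (vtensor k L M) N (vtensor k M L) N (vbraid b L M) j (vassoc_inv k L M
        N t))))"
proof -
  note [simp] = L M N i j auto_rules[OF a(3)]
  interpret MN: action_coaction_pair k H M N \<gamma> \<theta>
    by (intro action_coaction_pair.intro action_coaction_pair_axioms.intro hopf_algebra_bij_axioms M
      N a)
  have modules [simp]: "module k L" "module k M" "module k N" using act_module coact_module L M N
    by auto
  have [simp]: "lin k (vtensor k L N) (vtensor k N L) (vbraid b L N)"
    "lin k (vtensor k L M) (vtensor k M L) (vbraid b L M)"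
    by (rule lin_vbraid[OF _ _ a(3)]; simp)+
  have lb' [simp]: "lin k (vtensor k L MN.V) (vtensor k MN.V L) (vbraid b L MN.W)"
    using lin_vbraid[OF L MN.right_coaction_tens a(3)] by simp
  note [simp] = vbraid_pure[OF L M(2) a(3)] vbraid_pure[OF L N(2) a(3)]
  let ?P = "vtensor k MN.V L"
  show ?thesis
  proof (rule vtensor_ext_right[where t = t and k = k and L = L and M = M and N = N and P = ?P])
    fix l m n assume [simp]: "l \<in> carrier L" "m \<in> carrier M" "n \<in> carrier N"
    let ?D = "\<lambda>t. vassoc_inv k M N L (vmap k M (vtensor k L N) M (vtensor k N L) i (vbraid b L N)
      (vassoc k M L N t))"
    have D: "?D (vpure k (vtensor k M L) N (sw (vtensor k M L) f (coaction M m)) n)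
        = sw ?P (\<lambda>x y. ?D (vpure k (vtensor k M L) N (f x y) n)) (coaction M m)"
      if "\<And>x y. x \<in> carrier M \<Longrightarrow> y \<in> carrier H \<Longrightarrow> f x y \<in> carrier (vtensor k M L)" for f
      by (rule coact_push[OF M(2), where g = "\<lambda>u. ?D (vpure k (vtensor k M L) N u n)"]) (use that in
        simp_all)
    have E: "vassoc_inv k M N L (vpure k M (vtensor k N L) m' (sw (vtensor k N L) f (coaction N n)))
        = sw ?P (\<lambda>x y. vassoc_inv k M N L (vpure k M (vtensor k N L) m' (f x y))) (coaction N n)"
      if "m' \<in> carrier M" "\<And>x y. x \<in> carrier N \<Longrightarrow> y \<in> carrier H \<Longrightarrow> f x y \<in> carrier (vtensor k N L)"
        for f m'
      by (rule coact_push[OF N(2), where g =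
        "\<lambda>u. vassoc_inv k M N L (vpure k M (vtensor k N L) m' u)"]) (use that in simp_all)
    have "vbraid b L MN.W (vpure k L MN.V l (vpure k M N m n)) = sw ?P (\<lambda>m0 m1. sw ?P (\<lambda>n0 n1.
        vpure k MN.V L (vpure k M N m0 n0) (action L (b n1) (action L (b m1) l))) (coaction N n))
          (coaction M m)"
      using vbraid_pure[OF L MN.right_coaction_tens a(3), of l "vpure k M N m n"]
        by (simp add: MN.sw_coaction_tens act_mult)
    also have "\<dots> = ?D (vmap k (vtensor k L M) N (vtensor k M L) N (vbraid b L M) j (vassoc_inv k L M
      N (vpure k L MN.V l (vpure k M N m n))))"
      by (simp add: D) (simp add: E)
    finally show "vbraid b L MN.W (vpure k L MN.V l (vpure k M N m n)) =
      ?D (vmap k (vtensor k L M) N (vtensor k M L) N (vbraid b L M) j (vassoc_inv k L M N (vpure k L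
        MN.V l (vpure k M N m n))))" .
  qed (use t in simp_all)
qed

text \<open>The twisted coaction of \<open>N\<close> contributes \<open>\<eta>'\<close>, the new
  index contributes \<open>b'\<close>, and the twisted action on \<open>M\<close> contributes
  \<open>\<theta>\<close>. If these compose to \<open>b\<close>, the two braidings are the same
  function, since twisting changes no vector space.\<close>

lemma vbraid_twist:
  fixes M N :: "('k, 'h, ('k, 'a) vec) yd_module"
  assumes M: "left_action k H M" and N: "right_coaction k H N"
    and a: "b \<in> hopf_auto k H" "b' \<in> hopf_auto k H" "\<theta> \<in> hopf_auto k H" "\<theta>' \<in> hopf_auto k H"
      "\<eta> \<in> hopf_auto k H" "\<eta>' \<in> hopf_auto k H"
    and e: "\<And>h. h \<in> carrier H \<Longrightarrow> \<theta> (b' (\<eta>' h)) = b h"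
  shows "vbraid b' (yd_twist k H \<theta> \<eta> M) (yd_twist k H \<theta>' \<eta>' N) = vbraid b M N"
proof (rule extensionalityI[where A = "carrier (vtensor k M N)"])
  let ?M = "yd_twist k H \<theta> \<eta> M" and ?N = "yd_twist k H \<theta>' \<eta>' N"
  note [simp] = M N action_twist[OF a(3,5)] sw_coaction_twist[OF a(4,6) N]
    auto_rules[OF a(1)] auto_rules[OF a(2)] auto_rules[OF a(3)] auto_rules[OF a(6)]
  have [simp]: "module k M" "module k N" using act_module coact_module M N by auto
  show "vbraid b' ?M ?N \<in> extensional (carrier (vtensor k M N))"
    "vbraid b M N \<in> extensional (carrier (vtensor k M N))"
    by (simp_all add: vbraid_def)
  have M' [simp]: "left_action k H ?M" and N' [simp]: "right_coaction k H ?N"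
    by (rule left_action_twist[OF a(3,5) M], rule right_coaction_twist[OF a(4,6) N])
  show "vbraid b' ?M ?N t = vbraid b M N t" if t: "t \<in> carrier (vtensor k M N)" for t
  proof (rule vtensor_ext[where t = t and k = k and M = M and N = N and P = "vtensor k N M"])
    show "lin k (vtensor k M N) (vtensor k N M) (vbraid b' ?M ?N)"
      using lin_vbraid[OF M' N' a(2)] by simp
    show "lin k (vtensor k M N) (vtensor k N M) (vbraid b M N)" by (rule lin_vbraid[OF M N a(1)])
    show "vbraid b' ?M ?N (vpure k M N m n) = vbraid b M N (vpure k M N m n)"
      if [simp]: "m \<in> carrier M" "n \<in> carrier N" for m n
      using vbraid_pure[OF M' N' a(2), of m n] by (simp add: vbraid_pure[OF M N a(1)] e)
  qed (use t in simp_all)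
qed

end

section \<open>The monoidal category of Yetter--Drinfeld modules\<close>

text \<open>\<open>arr_inv\<close> is a definite description, so a known inverse can replace it only
  after uniqueness.\<close>

lemma (in category) inverse_unique:
  assumes "inverse_arrows C f g" "inverse_arrows C f g'"
  shows "g = g'"
proof -
  from assms have f: "f \<in> Hom C (Dom C f) (Cod C f)" and g: "g \<in> Hom C (Cod C f) (Dom C f)"
    and g': "g' \<in> Hom C (Cod C f) (Dom C f)"
    by (auto simp: inverse_arrows_def Hom_def)
  have "g = Ident C (Dom C f) \<cdot> g" using Ident_Comp[OF g] by simp
  also have "\<dots> = (g' \<cdot> f) \<cdot> g" using assms by (simp add: inverse_arrows_def)
  also have "\<dots> = g' \<cdot> (f \<cdot> g)" by (rule Comp_assoc[OF g f g'])
  also have "\<dots> = g'" using assms Comp_Ident[OF g'] by (simp add: inverse_arrows_def)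
  finally show ?thesis .
qed

lemma (in category) arr_inv_eqI: "inverse_arrows C f g \<Longrightarrow> arr_inv C f = g"
  unfolding arr_inv_def using inverse_unique by (intro the_equality) auto

lemma YD_simps [simp]:
  "Ob (YD k H) = yd_obs k H" "Arr (YD k H) = yd_arrs k H"
  "Dom (YD k H) (X, Y, f) = X" "Cod (YD k H) (X, Y, f) = Y"
  "Ident (YD k H) X = (X, X, \<lambda>m\<in>carrier (snd X). m)"
  "(Y, Z, g) \<cdot>\<^bsub>YD k H\<^esub> (X, Y', f) = (X, Z, compose (carrier (snd X)) g f)"
  "tens_ob (YD k H) = yd_tensor k H" "unit_ob (YD k H) = yd_unit k H"
  "assoc (YD k H) X1 X2 X3 = (yd_tensor k H (yd_tensor k H X1 X2) X3, yd_tensor k H X1 (yd_tensor k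
    H X2 X3),
     vassoc k (snd X1) (snd X2) (snd X3))"
  "tens_arr (YD k H) (X, X', f) (Y, Y', g) = (yd_tensor k H X Y, yd_tensor k H X' Y',
     vmap k (snd X) (snd Y) (snd X') (snd Y') f g)"
  by (simp_all add: YD_def yd_assoc_def vassoc_def yd_tensor_arr_def vmap_def Let_def)

lemma lin_restrict: "lin k M N f \<Longrightarrow> module k M \<Longrightarrow> lin k M N (\<lambda>x\<in>carrier M. f x)"
  by (subst lin_cong[where g = f]) simp_all

context hopf_algebra_bij
begin

lemma YD_lunit [simp]: "lunit (YD k H) X = (yd_tensor k H (yd_unit k H) X, X, vlunit (snd X))"
  and YD_runit [simp]: "runit (YD k H) X = (yd_tensor k H X (yd_unit k H), X, vrunit (snd X))"
  by (simp_all add: YD_def yd_lunit_def yd_runit_def yd_unit_eq vlunit_def vrunit_def)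

lemma ob_iff: "((\<alpha>, \<beta>), M) \<in> yd_obs k H \<longleftrightarrow> \<alpha> \<in> hopf_auto k H \<and> \<beta> \<in> hopf_auto k H \<and> yetter_drinfeld k
  H \<alpha> \<beta> M"
  by (auto simp: yd_obs_def yd_component_def)

lemma ob_cases:
  assumes "X \<in> yd_obs k H"
  obtains \<alpha> \<beta> M where "X = ((\<alpha>, \<beta>), M)" "\<alpha> \<in> hopf_auto k H" "\<beta> \<in> hopf_auto k H"
    "yetter_drinfeld k H \<alpha> \<beta> M"
  using assms by (cases X, cases "fst X") (auto simp: ob_iff)

lemma ob_rules [simp]:
  assumes "X \<in> yd_obs k H"
  shows "left_action k H (snd X)" "right_coaction k H (snd X)" "module k (snd X)"
  using assms yd_left_action yd_right_coaction act_module by (auto elim!: ob_cases)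

lemma ob_rules_pair:
  assumes "(a, M) \<in> yd_obs k H"
  shows "left_action k H M" "right_coaction k H M" "module k M"
  using ob_rules[OF assms] by simp_all

lemma Hom_iff: "F \<in> Hom (YD k H) X Y \<longleftrightarrow>
    (\<exists>f. F = (X, Y, f) \<and> X \<in> yd_obs k H \<and> Y \<in> yd_obs k H \<and> fst X = fst Y \<and> f \<in> yd_maps k H (snd X)
      (snd Y))"
  by (cases F; cases X; cases Y) (auto simp: Hom_def yd_arrs_def)

lemma HomI: "X \<in> yd_obs k H \<Longrightarrow> Y \<in> yd_obs k H \<Longrightarrow> fst X = fst Y \<Longrightarrow> f \<in> yd_maps k H (snd X) (snd Y)
    \<Longrightarrow> (X, Y, f) \<in> Hom (YD k H) X Y"
  by (simp add: Hom_iff)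

lemma HomE:
  assumes "F \<in> Hom (YD k H) X Y"
  obtains f where "F = (X, Y, f)" "X \<in> yd_obs k H" "Y \<in> yd_obs k H" "fst X = fst Y"
    "f \<in> yd_maps k H (snd X) (snd Y)"
    "lin k (snd X) (snd Y) f" "f \<in> extensional (carrier (snd X))"
proof -
  obtain f where f: "F = (X, Y, f)" "X \<in> yd_obs k H" "Y \<in> yd_obs k H" "fst X = fst Y"
    "f \<in> yd_maps k H (snd X) (snd Y)"
    using assms by (auto simp: Hom_iff)
  show thesis by (rule that[OF f yd_map_lin[OF f(5)] yd_map_extensional[OF f(5)]])
qed

lemma Arr_iff: "F \<in> yd_arrs k H \<longleftrightarrow> (\<exists>X Y. F \<in> Hom (YD k H) X Y)"
  by (auto simp: Hom_def)

lemma yd_map_coaction_sw: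
  assumes "f \<in> yd_maps k H M N" "right_coaction k H M" "right_coaction k H N" "m \<in> carrier M"
  shows "coaction N (f m) = sw (tensor_module k N H) (\<lambda>x y. pure_tensor k N H (f x) y) (coaction M
    m)"
proof -
  have [simp]: "module k N" "module k M" using assms coact_module by auto
  show ?thesis
    using assms yd_map_coaction[OF assms(1,4)] by (simp add: tensor_map_eq_sw[of k M H] yd_map_lin)
qed

lemma ident_yd:
  assumes "left_action k H M" "right_coaction k H M"
  shows "(\<lambda>m\<in>carrier M. m) \<in> yd_maps k H M M"
proof (rule yd_mapsI)
  have [simp]: "module k M" using assms act_module by auto
  show "module k M" "lin k M M (\<lambda>m\<in>carrier M. m)" by simp_all
qed (use assms in \<open>simp_all add: sw_pures[of k M H]\<close>)

lemma compose_yd: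
  assumes f: "f \<in> yd_maps k H L M" and g: "g \<in> yd_maps k H M N"
    and [simp]: "left_action k H L" "right_coaction k H L" "left_action k H M"
      "right_coaction k H M"
      "left_action k H N" "right_coaction k H N"
  shows "compose (carrier L) g f \<in> yd_maps k H L N"
proof (rule yd_mapsI)
  have [simp]: "module k L" "module k M" "module k N" using act_module by auto
  note lf = yd_map_lin[OF f] and lg = yd_map_lin[OF g]
  note [simp] = lin_closed[OF lf] lin_closed[OF lg] lin_comp[OF lf] lin_comp[OF lg] lf lg compose_eq
    yd_map_action[OF f] yd_map_action[OF g]
  show "module k N" "right_coaction k H L" by simp_all
  show "lin k L N (compose (carrier L) g f)"
    by (subst lin_cong[where g = "\<lambda>x. g (f x)"]) simp_all
  show "coaction N (compose (carrier L) g f m) =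
      sw (tensor_module k N H) (\<lambda>x y. pure_tensor k N H (compose (carrier L) g f x) y) (coaction L
        m)"
    if "m \<in> carrier L" for m
    using that by (simp add: yd_map_coaction_sw[OF g] yd_map_sw[OF f])
  show "compose (carrier L) g f (action L h m) = action N h (compose (carrier L) g f m)"
    if "h \<in> carrier H" "m \<in> carrier L" for h m
    using that by simp
qed simp_all

lemma category_YD: "category (YD k H)"
proof
  fix F X Y assume "F \<in> Hom (YD k H) X Y"
  then show "F \<cdot>\<^bsub>YD k H\<^esub> Ident (YD k H) X = F" "Ident (YD k H) Y \<cdot>\<^bsub>YD k H\<^esub> F = F"
    by (auto elim!: HomE simp: lin_closed compose_eq intro!: extensionalityI[where A =
      "carrier (snd X)"])
next
  fix F G E X Y Z W assume "F \<in> Hom (YD k H) X Y" "G \<in> Hom (YD k H) Y Z" "E \<in> Hom (YD k H) Z W"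
  then show "(E \<cdot>\<^bsub>YD k H\<^esub> G) \<cdot>\<^bsub>YD k H\<^esub> F = E \<cdot>\<^bsub>YD k H\<^esub> (G \<cdot>\<^bsub>YD k H\<^esub> F)"
    by (auto elim!: HomE simp: lin_closed compose_eq intro!: extensionalityI[where A =
      "carrier (snd X)"])
next
  fix F G X Y Z assume "F \<in> Hom (YD k H) X Y" "G \<in> Hom (YD k H) Y Z"
  then show "G \<cdot>\<^bsub>YD k H\<^esub> F \<in> Hom (YD k H) X Z"
    by (elim HomE) (simp, rule HomI, simp_all, rule compose_yd, simp_all, simp_all)
qed (auto simp: Arr_iff intro!: HomI ident_yd elim!: HomE intro: ob_rules_pair)

section \<open>The tensor product and its constraints in the category\<close>

lemma tensor_Ob:
  assumes "X \<in> yd_obs k H" "Y \<in> yd_obs k H"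
  shows "yd_tensor k H X Y \<in> yd_obs k H"
proof -
  obtain \<alpha> \<beta> M where X: "X = ((\<alpha>, \<beta>), M)" and a [simp]: "\<alpha> \<in> hopf_auto k H" "\<beta> \<in> hopf_auto k H"
    and M: "yetter_drinfeld k H \<alpha> \<beta> M" using assms(1) by (rule ob_cases)
  obtain \<gamma> \<delta> N where Y: "Y = ((\<gamma>, \<delta>), N)" and b [simp]: "\<gamma> \<in> hopf_auto k H" "\<delta> \<in> hopf_auto k H"
    and N: "yetter_drinfeld k H \<gamma> \<delta> N" using assms(2) by (rule ob_cases)
  interpret action_coaction_pair k H M N \<gamma> "inv\<^bsub>A\<^esub> \<gamma> \<otimes>\<^bsub>A\<^esub> \<beta> \<otimes>\<^bsub>A\<^esub> \<gamma>"
    by (intro action_coaction_pair.intro action_coaction_pair_axioms.intro hopf_algebra_bij_axioms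
        yd_left_action[OF M a] yd_right_coaction[OF M a] yd_left_action[OF N b] yd_right_coaction[OF
          N b] A_closed a b)
  show ?thesis
    by (simp add: X Y yd_tensor_eq ob_iff)
      (rule yetter_drinfeld_tens[OF M N], simp_all add: auto_rules[OF a(2)] auto_rules[OF b(1)])
qed

lemma unit_Ob: "yd_unit k H \<in> yd_obs k H"
  by (simp add: yd_unit_eq ob_iff yetter_drinfeld_unit)

lemma fst_tensor: "X \<in> yd_obs k H \<Longrightarrow> Y \<in> yd_obs k H \<Longrightarrow> fst (yd_tensor k H X Y) = fst X \<otimes>\<^bsub>G\<^esub> fst Y"
  by (auto elim!: ob_cases simp: yd_tensor_eq)

lemma fst_Ob: "X \<in> yd_obs k H \<Longrightarrow> fst X \<in> carrier G"
  by (auto elim!: ob_cases)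

lemma truncate_snd_tensor: "X \<in> yd_obs k H \<Longrightarrow> Y \<in> yd_obs k H \<Longrightarrow>
    module.truncate (snd (yd_tensor k H X Y)) = module.truncate (vtensor k (snd X) (snd Y))"
  by (auto elim!: ob_cases simp: yd_tensor_eq truncate_yd_tens)

lemmas snd_tensor_trunc [simp] = vtrunc_rules[OF truncate_snd_tensor] trunc_vmaps[OF
  truncate_snd_tensor]

lemma snd_unit [simp]: "snd (yd_unit k H) = unit_module"
  by (simp add: yd_unit_eq)

declare tensor_Ob [simp] unit_Ob [simp]

lemma assoc_Hom:
  assumes "X \<in> yd_obs k H" "Y \<in> yd_obs k H" "Z \<in> yd_obs k H"
  shows "assoc (YD k H) X Y Z \<in> Hom (YD k H) (yd_tensor k H (yd_tensor k H X Y) Z) (yd_tensor k H X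
    (yd_tensor k H Y Z))"
proof -
  obtain \<alpha> \<beta> L where X: "X = ((\<alpha>, \<beta>), L)" and a [simp]: "\<alpha> \<in> hopf_auto k H" "\<beta> \<in> hopf_auto k H"
    and L: "yetter_drinfeld k H \<alpha> \<beta> L" using assms(1) by (rule ob_cases)
  obtain \<gamma> \<delta> M where Y: "Y = ((\<gamma>, \<delta>), M)" and b [simp]: "\<gamma> \<in> hopf_auto k H" "\<delta> \<in> hopf_auto k H"
    and M: "yetter_drinfeld k H \<gamma> \<delta> M" using assms(2) by (rule ob_cases)
  obtain \<epsilon> \<zeta> N where Z: "Z = ((\<epsilon>, \<zeta>), N)" and c [simp]: "\<epsilon> \<in> hopf_auto k H" "\<zeta> \<in> hopf_auto k H"
    and N: "yetter_drinfeld k H \<epsilon> \<zeta> N" using assms(3) by (rule ob_cases)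
  note [simp] = auto_rules[OF a(2)] auto_rules[OF b(1)] auto_rules[OF b(2)] auto_rules[OF c(1)]
    auto_rules[OF A_closed(2)[OF b(1)]] auto_rules[OF A_closed(2)[OF c(1)]]
  have "vassoc k (snd X) (snd Y) (snd Z) \<in> yd_maps k H (snd (yd_tensor k H (yd_tensor k H X Y) Z))
    (snd (yd_tensor k H X (yd_tensor k H Y Z)))"
    by (simp only: X Y Z yd_tensor_eq G_simps snd_conv, rule vassoc_yd)
      (simp_all add: yd_left_action[OF L a] yd_right_coaction[OF L a] yd_left_action[OF M b]
        yd_right_coaction[OF M b]
        yd_left_action[OF N c] yd_right_coaction[OF N c] A.inv_mult_group)
  \<comment> \<open>The indices of domain and codomain agree by associativity in \<open>G\<close>;
    \<open>G_simps\<close> is withheld so that indices stay opaque group elements.\<close>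
  then show ?thesis
    using assms by (simp add: HomI fst_tensor G.m_assoc fst_Ob del: G_simps)
qed

lemma inverse_arrowsI:
  assumes F: "(X, Y, f) \<in> Hom (YD k H) X Y"
    and g: "lin k (snd Y) (snd X) g" "g \<in> extensional (carrier (snd Y))"
    and gf: "\<And>x. x \<in> carrier (snd X) \<Longrightarrow> g (f x) = x" and fg: "\<And>y. y \<in> carrier (snd Y) \<Longrightarrow> f (g y) = y"
  shows "inverse_arrows (YD k H) (X, Y, f) (Y, X, g)"
proof -
  from F have [simp]: "X \<in> yd_obs k H" "Y \<in> yd_obs k H" and i: "fst X = fst Y"
    and f: "f \<in> yd_maps k H (snd X) (snd Y)"
    by (auto simp: Hom_iff)
  have "g \<in> yd_maps k H (snd Y) (snd X)"
    by (rule yd_maps_inverse[OF f _ _ _ _ g gf fg]) simp_all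
  then have "(Y, X, g) \<in> Hom (YD k H) Y X" using i by (simp add: HomI)
  moreover have "compose (carrier (snd X)) g f = (\<lambda>m\<in>carrier (snd X). m)"
    "compose (carrier (snd Y)) f g = (\<lambda>m\<in>carrier (snd Y). m)"
    using gf fg by (auto simp: compose_def)
  ultimately show ?thesis
    using F by (auto simp: inverse_arrows_def Hom_def)
qed

lemma isosI: "F \<in> Hom (YD k H) X Y \<Longrightarrow> inverse_arrows (YD k H) F F' \<Longrightarrow> F \<in> isos (YD k H) X Y"
  unfolding isos_def by blast

lemma inverse_assoc:
  assumes [simp]: "X \<in> yd_obs k H" "Y \<in> yd_obs k H" "Z \<in> yd_obs k H"
  shows "inverse_arrows (YD k H) (assoc (YD k H) X Y Z)
    (yd_tensor k H X (yd_tensor k H Y Z), yd_tensor k H (yd_tensor k H X Y) Z, vassoc_inv k (snd X)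
      (snd Y) (snd Z))"
  using assoc_Hom[OF assms] by simp
    (rule inverse_arrowsI, simp_all add: vassoc_inv_vassoc vassoc_vassoc_inv, simp add:
      vassoc_inv_def)

lemma arr_inv_assoc:
  assumes "X \<in> yd_obs k H" "Y \<in> yd_obs k H" "Z \<in> yd_obs k H"
  shows "arr_inv (YD k H) (assoc (YD k H) X Y Z) =
    (yd_tensor k H X (yd_tensor k H Y Z), yd_tensor k H (yd_tensor k H X Y) Z, vassoc_inv k (snd X)
      (snd Y) (snd Z))"
  by (rule category.arr_inv_eqI[OF category_YD inverse_assoc[OF assms]])

lemma lunit_Hom:
  assumes "X \<in> yd_obs k H"
  shows "lunit (YD k H) X \<in> Hom (YD k H) (yd_tensor k H (yd_unit k H) X) X"
proof -
  obtain \<gamma> \<delta> M where X: "X = ((\<gamma>, \<delta>), M)" and b [simp]: "\<gamma> \<in> hopf_auto k H" "\<delta> \<in> hopf_auto k H"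
    and M: "yetter_drinfeld k H \<gamma> \<delta> M" using assms by (rule ob_cases)
  note [simp] = auto_rules[OF b(1)]
  have "vlunit (snd X) \<in> yd_maps k H (snd (yd_tensor k H (yd_unit k H) X)) (snd X)"
    by (simp only: X yd_unit_eq G_simps yd_tensor_eq snd_conv, rule vlunit_yd)
      (simp_all add: yd_left_action[OF M b] yd_right_coaction[OF M b])
  moreover have "fst (yd_tensor k H (yd_unit k H) X) = fst X"
    unfolding fst_tensor[OF unit_Ob assms] using G.l_one[OF fst_Ob[OF assms]]
      by (simp add: yd_unit_eq del: G_simps)
  ultimately show ?thesis using assms by (simp add: HomI)
qed

lemma runit_Hom:
  assumes "X \<in> yd_obs k H"
  shows "runit (YD k H) X \<in> Hom (YD k H) (yd_tensor k H X (yd_unit k H)) X"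
proof -
  obtain \<gamma> \<delta> M where X: "X = ((\<gamma>, \<delta>), M)" and b [simp]: "\<gamma> \<in> hopf_auto k H" "\<delta> \<in> hopf_auto k H"
    and M: "yetter_drinfeld k H \<gamma> \<delta> M" using assms by (rule ob_cases)
  note [simp] = auto_rules[OF b(1)]
  have "vrunit (snd X) \<in> yd_maps k H (snd (yd_tensor k H X (yd_unit k H))) (snd X)"
    by (simp only: X yd_unit_eq G_simps yd_tensor_eq snd_conv, rule vrunit_yd)
      (simp_all add: yd_left_action[OF M b] yd_right_coaction[OF M b])
  moreover have "fst (yd_tensor k H X (yd_unit k H)) = fst X"
    unfolding fst_tensor[OF assms unit_Ob] using G.r_one[OF fst_Ob[OF assms]]
      by (simp add: yd_unit_eq del: G_simps)
  ultimately show ?thesis using assms by (simp add: HomI)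
qed

lemma tens_arr_Hom:
  assumes "F \<in> Hom (YD k H) X X'" "F' \<in> Hom (YD k H) Y Y'"
  shows "tens_arr (YD k H) F F' \<in> Hom (YD k H) (yd_tensor k H X Y) (yd_tensor k H X' Y')"
proof -
  obtain f where F: "F = (X, X', f)" "X \<in> yd_obs k H" "X' \<in> yd_obs k H" "fst X = fst X'"
    "f \<in> yd_maps k H (snd X) (snd X')" using assms(1) by (rule HomE)
  obtain g where F': "F' = (Y, Y', g)" "Y \<in> yd_obs k H" "Y' \<in> yd_obs k H" "fst Y = fst Y'"
    "g \<in> yd_maps k H (snd Y) (snd Y')" using assms(2) by (rule HomE)
  obtain \<alpha> \<beta> M where X: "X = ((\<alpha>, \<beta>), M)" and a [simp]: "\<alpha> \<in> hopf_auto k H" "\<beta> \<in> hopf_auto k H"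
    using F(2) by (rule ob_cases)
  obtain M' where X': "X' = ((\<alpha>, \<beta>), M')" using F(4) X by (cases X') auto
  obtain \<gamma> \<delta> N where Y: "Y = ((\<gamma>, \<delta>), N)" and b [simp]: "\<gamma> \<in> hopf_auto k H" "\<delta> \<in> hopf_auto k H"
    using F'(2) by (rule ob_cases)
  obtain N' where Y': "Y' = ((\<gamma>, \<delta>), N')" using F'(4) Y by (cases Y') auto
  have "vmap k (snd X) (snd Y) (snd X') (snd Y') f g \<in> yd_maps k H (snd (yd_tensor k H X Y)) (snd
    (yd_tensor k H X' Y'))"
    using ob_rules[OF F(2)] ob_rules[OF F(3)] ob_rules[OF F'(2)] ob_rules[OF F'(3)] F(5) F'(5)
    by (simp only: X X' Y Y' yd_tensor_eq snd_conv, intro vmap_yd) simp_all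
  then show ?thesis
    using F F' by (simp add: HomI fst_tensor)
qed

text \<open>Each coherence law equates arrows with the same end points, so only the underlying maps
  need comparison. These are extensional on a common carrier, which leaves the elementwise
  identities of the preceding section.\<close>

lemma monoidal_category_YD: "monoidal_category (YD k H :: (('k, 'h, 'a) yd_ob, ('k, 'h, 'a) yd_arr)
  moncat)"
proof (intro monoidal_category.intro category_YD monoidal_category_axioms.intro)
  fix X Y :: "('k, 'h, 'a) yd_ob" assume [simp]: "X \<in> Ob (YD k H)" "Y \<in> Ob (YD k H)"
  then have [simp]: "X \<in> yd_obs k H" "Y \<in> yd_obs k H" by simp_all
  show "X \<otimes>o\<^bsub>YD k H\<^esub> Y \<in> Ob (YD k H)" by simp
  show "Ident (YD k H) X \<otimes>a\<^bsub>YD k H\<^esub> Ident (YD k H) Y = Ident (YD k H) (X \<otimes>o\<^bsub>YD k H\<^esub> Y)"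
    by simp (rule extensionalityI[where A = "carrier (vtensor k (snd X) (snd Y))"], simp_all add:
      vmap_ident, simp add: vmap_def)
  show "(Ident (YD k H) X \<otimes>a\<^bsub>YD k H\<^esub> lunit (YD k H) Y) \<cdot>\<^bsub>YD k H\<^esub> assoc (YD k H) X (unit_ob (YD k H))
    Y =
      runit (YD k H) X \<otimes>a\<^bsub>YD k H\<^esub> Ident (YD k H) Y"
    by simp (rule extensionalityI[where A =
      "carrier (vtensor k (vtensor k (snd X) unit_space) (snd Y))"],
      simp_all add: compose_eq, simp add: vmap_def, rule vunit_triangle, simp_all)
next
  fix X :: "('k, 'h, 'a) yd_ob" assume "X \<in> Ob (YD k H)"
  then have [simp]: "X \<in> yd_obs k H" by simp
  have "inverse_arrows (YD k H) (lunit (YD k H) X) (X, yd_tensor k H (yd_unit k H) X,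
    \<lambda>m\<in>carrier (snd X). vpure k unit_space (snd X) (Scalar \<one>\<^bsub>k\<^esub>) m)"
    using lunit_Hom[of X] unfolding YD_lunit
    by (rule_tac inverse_arrowsI) (simp_all add: vlunit_inverse lin_closed[OF lin_vlunit], simp_all
      add: lin_restrict)
  then show "lunit (YD k H) X \<in> isos (YD k H) (unit_ob (YD k H) \<otimes>o\<^bsub>YD k H\<^esub> X) X"
    using lunit_Hom[of X] by (intro isosI) simp_all
  have "inverse_arrows (YD k H) (runit (YD k H) X) (X, yd_tensor k H X (yd_unit k H),
    \<lambda>m\<in>carrier (snd X). vpure k (snd X) unit_space m (Scalar \<one>\<^bsub>k\<^esub>))"
    using runit_Hom[of X] unfolding YD_runit
    by (rule_tac inverse_arrowsI) (simp_all add: vrunit_inverse lin_closed[OF lin_vrunit], simp_all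
      add: lin_restrict)
  then show "runit (YD k H) X \<in> isos (YD k H) (X \<otimes>o\<^bsub>YD k H\<^esub> unit_ob (YD k H)) X"
    using runit_Hom[of X] by (intro isosI) simp_all
next
  fix X Y Z :: "('k, 'h, 'a) yd_ob" assume "X \<in> Ob (YD k H)" "Y \<in> Ob (YD k H)" "Z \<in> Ob (YD k H)"
  then have [simp]: "X \<in> yd_obs k H" "Y \<in> yd_obs k H" "Z \<in> yd_obs k H" by simp_all
  have "assoc (YD k H) X Y Z \<in> isos (YD k H) (yd_tensor k H (yd_tensor k H X Y) Z) (yd_tensor k H X
    (yd_tensor k H Y Z))"
    by (rule isosI[OF assoc_Hom inverse_assoc]) simp_all
  then show "assoc (YD k H) X Y Z \<in> isos (YD k H) ((X \<otimes>o\<^bsub>YD k H\<^esub> Y) \<otimes>o\<^bsub>YD k H\<^esub> Z) (X \<otimes>o\<^bsub>YD k H\<^esub> Y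
    \<otimes>o\<^bsub>YD k H\<^esub> Z)"
    by simp
  fix W :: "('k, 'h, 'a) yd_ob" assume "W \<in> Ob (YD k H)"
  then have [simp]: "W \<in> yd_obs k H" by simp
  show "assoc (YD k H) X Y (Z \<otimes>o\<^bsub>YD k H\<^esub> W) \<cdot>\<^bsub>YD k H\<^esub> assoc (YD k H) (X \<otimes>o\<^bsub>YD k H\<^esub> Y) Z W =
      (Ident (YD k H) X \<otimes>a\<^bsub>YD k H\<^esub> assoc (YD k H) Y Z W) \<cdot>\<^bsub>YD k H\<^esub> assoc (YD k H) X (Y \<otimes>o\<^bsub>YD k H\<^esub> Z)
        W \<cdot>\<^bsub>YD k H\<^esub>
        (assoc (YD k H) X Y Z \<otimes>a\<^bsub>YD k H\<^esub> Ident (YD k H) W)"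
    by simp (rule extensionalityI[where A =
      "carrier (vtensor k (vtensor k (vtensor k (snd X) (snd Y)) (snd Z)) (snd W))"],
      simp_all add: compose_eq, rule vassoc_pentagon, simp_all)
next
  fix X X' Y Y' :: "('k, 'h, 'a) yd_ob" and f g :: "('k, 'h, 'a) yd_arr" assume f:
    "f \<in> Hom (YD k H) X X'" and g: "g \<in> Hom (YD k H) Y Y'"
  then show "f \<otimes>a\<^bsub>YD k H\<^esub> g \<in> Hom (YD k H) (X \<otimes>o\<^bsub>YD k H\<^esub> Y) (X' \<otimes>o\<^bsub>YD k H\<^esub> Y')"
    using tens_arr_Hom by simp
  fix X'' Y'' :: "('k, 'h, 'a) yd_ob" and f' g' :: "('k, 'h, 'a) yd_arr" assume f':
    "f' \<in> Hom (YD k H) X' X''" and g': "g' \<in> Hom (YD k H) Y' Y''"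
  from f obtain f0 where F: "f = (X, X', f0)" "X \<in> yd_obs k H" "X' \<in> yd_obs k H"
    "lin k (snd X) (snd X') f0" by (rule HomE)
  from g obtain g0 where G: "g = (Y, Y', g0)" "Y \<in> yd_obs k H" "Y' \<in> yd_obs k H"
    "lin k (snd Y) (snd Y') g0" by (rule HomE)
  from f' obtain f1 where F': "f' = (X', X'', f1)" "X'' \<in> yd_obs k H" "lin k (snd X') (snd X'') f1"
    by (rule HomE)
  from g' obtain g1 where G': "g' = (Y', Y'', g1)" "Y'' \<in> yd_obs k H" "lin k (snd Y') (snd Y'') g1"
    by (rule HomE)
  have c: "lin k (snd X) (snd X'') (compose (carrier (snd X)) f1 f0)"
    "lin k (snd Y) (snd Y'') (compose (carrier (snd Y)) g1 g0)"
    unfolding compose_def by (rule lin_restrict[OF lin_comp[OF F'(3) F(4)]], simp add: F, rule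
      lin_restrict[OF lin_comp[OF G'(3) G(4)]], simp add: G)
  show "(f' \<cdot>\<^bsub>YD k H\<^esub> f) \<otimes>a\<^bsub>YD k H\<^esub> (g' \<cdot>\<^bsub>YD k H\<^esub> g) = (f' \<otimes>a\<^bsub>YD k H\<^esub> g') \<cdot>\<^bsub>YD k H\<^esub> (f \<otimes>a\<^bsub>YD k H\<^esub>
    g)"
    using F G F' G' by simp (rule extensionalityI[where A = "carrier (vtensor k (snd X) (snd Y))"],
      simp add: vmap_def, simp, subst compose_eq, simp, rule vmap_vmap, simp_all add: c compose_eq)
next
  fix X X' Y Y' Z Z' :: "('k, 'h, 'a) yd_ob" and f g h :: "('k, 'h, 'a) yd_arr" assume f:
    "f \<in> Hom (YD k H) X X'" and g: "g \<in> Hom (YD k H) Y Y'" and h: "h \<in> Hom (YD k H) Z Z'"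
  from f obtain f0 where F: "f = (X, X', f0)" "X \<in> yd_obs k H" "X' \<in> yd_obs k H"
    "lin k (snd X) (snd X') f0" by (rule HomE)
  from g obtain g0 where G: "g = (Y, Y', g0)" "Y \<in> yd_obs k H" "Y' \<in> yd_obs k H"
    "lin k (snd Y) (snd Y') g0" by (rule HomE)
  from h obtain h0 where H: "h = (Z, Z', h0)" "Z \<in> yd_obs k H" "Z' \<in> yd_obs k H"
    "lin k (snd Z) (snd Z') h0" by (rule HomE)
  show "assoc (YD k H) X' Y' Z' \<cdot>\<^bsub>YD k H\<^esub> ((f \<otimes>a\<^bsub>YD k H\<^esub> g) \<otimes>a\<^bsub>YD k H\<^esub> h)
    = (f \<otimes>a\<^bsub>YD k H\<^esub> (g \<otimes>a\<^bsub>YD k H\<^esub> h)) \<cdot>\<^bsub>YD k H\<^esub> assoc (YD k H) X Y Z"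
    using F G H by simp (rule extensionalityI[where A =
      "carrier (vtensor k (vtensor k (snd X) (snd Y)) (snd Z))"],
      simp_all add: compose_eq, rule vassoc_vmap, simp_all)
next
  fix X X' :: "('k, 'h, 'a) yd_ob" and f :: "('k, 'h, 'a) yd_arr" assume f: "f \<in> Hom (YD k H) X X'"
  from f obtain f0 where F: "f = (X, X', f0)" "X \<in> yd_obs k H" "X' \<in> yd_obs k H"
    "lin k (snd X) (snd X') f0" by (rule HomE)
  show "lunit (YD k H) X' \<cdot>\<^bsub>YD k H\<^esub> (Ident (YD k H) (unit_ob (YD k H)) \<otimes>a\<^bsub>YD k H\<^esub> f)
    = f \<cdot>\<^bsub>YD k H\<^esub> lunit (YD k H) X"
    using F by simp (rule extensionalityI[where A = "carrier (vtensor k unit_space (snd X))"],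
      simp_all add: compose_eq, rule vlunit_vmap, simp_all)
  show "runit (YD k H) X' \<cdot>\<^bsub>YD k H\<^esub> (f \<otimes>a\<^bsub>YD k H\<^esub> Ident (YD k H) (unit_ob (YD k H)))
    = f \<cdot>\<^bsub>YD k H\<^esub> runit (YD k H) X"
    using F by simp (rule extensionalityI[where A = "carrier (vtensor k (snd X) unit_space)"],
      simp_all add: compose_eq, rule vrunit_vmap, simp_all)
qed simp

end

section \<open>Conjugation functors\<close>

text \<open>Strict functors must preserve objects up to equality of records. Extensionality of
  actions and coactions reduces this to equal vector spaces and equal values on the
  carriers.\<close>

lemma yd_module_eqI:
  fixes M N :: "('k, 'h, 'v) yd_module"
  assumes MN: "module.truncate M = module.truncate N"
    and M: "left_action k H M" "right_coaction k H M" and N: "left_action k H N"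
      "right_coaction k H N"
    and act: "\<And>h m. h \<in> carrier H \<Longrightarrow> m \<in> carrier M \<Longrightarrow> action M h m = action N h m"
    and coact: "\<And>m. m \<in> carrier M \<Longrightarrow> coaction M m = coaction N m"
  shows "M = N"
proof (rule yd_module.equality)
  have c: "carrier M = carrier N" using MN by (simp add: module.defs)
  show "action M = action N"
  proof (rule extensionalityI[where A = "carrier H"])
    show "action M \<in> extensional (carrier H)" "action N \<in> extensional (carrier H)"
      using left_action.action_ext[OF M(1)] left_action.action_ext[OF N(1)] unfolding PiE_def
        by blast+
    fix h assume h: "h \<in> carrier H"
    show "action M h = action N h"
    proof (rule extensionalityI[where A = "carrier M"])
      have "action M h \<in> carrier M \<rightarrow>\<^sub>E carrier M" "action N h \<in> carrier N \<rightarrow>\<^sub>E carrier N"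
        using left_action.action_ext[OF M(1)] left_action.action_ext[OF N(1)] h by auto
      then show "action M h \<in> extensional (carrier M)" "action N h \<in> extensional (carrier M)"
        unfolding c by (auto simp: PiE_iff)
    qed (rule act[OF h])
  qed
  show "coaction M = coaction N"
    using right_coaction.coaction_ext[OF M(2)] right_coaction.coaction_ext[OF N(2)] coact
    by (intro extensionalityI[where A = "carrier M"]) (simp_all add: c)
qed (use MN in \<open>simp_all add: module.defs\<close>)

context hopf_algebra_bij
begin

lemma coaction_twist_sw:
  assumes "\<eta> \<in> hopf_auto k H" "right_coaction k H N" "n \<in> carrier N"
  shows "coaction (yd_twist k H \<theta> \<eta> N) n = sw (tensor_module k N H) (\<lambda>n0 n1. pure_tensor k N H n0 (\<eta>
    n1)) (coaction N n)"
  using assms by (simp add: yd_twist_def tensor_map_eq_sw[of k N H] lin_auto_self)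

text \<open>The two parameters compose in opposite orders: \<open>\<theta>\<close> is applied to
  \<open>h\<close> before the action, so the outer one comes first, while \<open>\<eta>\<close> is
  applied to the coefficient after the coaction, so the outer one comes last.\<close>

lemma yd_twist_eqI:
  assumes N: "left_action k H N" "right_coaction k H N"
    and a: "\<theta> \<in> hopf_auto k H" "\<eta> \<in> hopf_auto k H" "\<theta>1 \<in> hopf_auto k H" "\<eta>1 \<in> hopf_auto k H"
      "\<theta>2 \<in> hopf_auto k H" "\<eta>2 \<in> hopf_auto k H"
    and e: "\<And>h. h \<in> carrier H \<Longrightarrow> \<theta> h = \<theta>2 (\<theta>1 h)" "\<And>h. h \<in> carrier H \<Longrightarrow> \<eta> h = \<eta>1 (\<eta>2 h)"
  shows "yd_twist k H \<theta> \<eta> N = yd_twist k H \<theta>1 \<eta>1 (yd_twist k H \<theta>2 \<eta>2 N)"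
proof -
  note [simp] = N a auto_rules[OF a(2)] auto_rules[OF a(3)] auto_rules[OF a(4)] auto_rules[OF a(6)]
    left_action_twist right_coaction_twist
  show ?thesis
    by (rule yd_module_eqI[where k = k and H = H])
      (simp_all add: truncate_yd_twist e coaction_twist_sw[OF a(2) N(2)] coaction_twist_sw[OF a(4)
        right_coaction_twist] sw_coaction_twist)
qed

lemma yd_twist_ident:
  assumes N: "left_action k H N" "right_coaction k H N"
    and a: "\<theta> \<in> hopf_auto k H" "\<eta> \<in> hopf_auto k H"
    and e: "\<And>h. h \<in> carrier H \<Longrightarrow> \<theta> h = h" "\<And>h. h \<in> carrier H \<Longrightarrow> \<eta> h = h"
  shows "yd_twist k H \<theta> \<eta> N = N"
proof -
  note [simp] = N a left_action_twist right_coaction_twist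
  show ?thesis
    by (rule yd_module_eqI[where k = k and H = H])
      (simp_all add: truncate_yd_twist e coaction_twist_sw sw_pures[of k N H])
qed

text \<open>The coefficient \<open>n\<^sub>1 m\<^sub>1\<close> is a product and
  \<open>\<eta>\<close> is multiplicative, so both factors receive the same \<open>\<eta>\<close>.
  The conditions \<open>e\<close> compare the two ways in which each leg of \<open>h\<close> reaches
  its factor.\<close>

lemma twist_tens:
  fixes M N :: "('k, 'h, ('k, 'a) vec) yd_module"
  assumes M: "left_action k H M" "right_coaction k H M" and N: "left_action k H N"
    "right_coaction k H N"
    and a: "\<gamma> \<in> hopf_auto k H" "\<delta> \<in> hopf_auto k H" "\<theta> \<in> hopf_auto k H" "\<eta> \<in> hopf_auto k H"
      "\<gamma>' \<in> hopf_auto k H" "\<delta>' \<in> hopf_auto k H" "\<theta>1 \<in> hopf_auto k H" "\<theta>2 \<in> hopf_auto k H"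
    and e: "\<And>h. h \<in> carrier H \<Longrightarrow> \<gamma> (\<theta> h) = \<theta>1 (\<gamma>' h)" "\<And>h. h \<in> carrier H \<Longrightarrow> \<delta> (\<theta> h) = \<theta>2 (\<delta>' h)"
  shows "yd_twist k H \<theta> \<eta> (yd_tens k H \<gamma> \<delta> M N) = yd_tens k H \<gamma>' \<delta>' (yd_twist k H \<theta>1 \<eta> M) (yd_twist
    k H \<theta>2 \<eta> N)"
proof -
  interpret S: action_coaction_pair k H M N \<gamma> \<delta>
    by (intro action_coaction_pair.intro action_coaction_pair_axioms.intro hopf_algebra_bij_axioms M
      N a)
  interpret S': action_coaction_pair k H "yd_twist k H \<theta>1 \<eta> M" "yd_twist k H \<theta>2 \<eta> N" \<gamma>' \<delta>'
    by (intro action_coaction_pair.intro action_coaction_pair_axioms.intro hopf_algebra_bij_axioms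
      left_action_twist right_coaction_twist M N a)
  note [simp] = a auto_rules[OF a(3)] auto_rules[OF a(4)] auto_rules[OF a(7)] auto_rules[OF a(8)]
    S'.action_tens_pure[unfolded yd_twist_trunc yd_twist_vtrunc]
  have lS: "lin k S.V S.V (action S'.W h)" if "h \<in> carrier H" for h
    using S'.lin_action_tens[OF that] by simp
  have lT: "lin k S.V S.VH (coaction S'.W)"
    using S'.lin_coaction_tens by simp
  have lS2: "lin k S.V S.V (\<lambda>t. action S.W (\<theta> h) t)" if "h \<in> carrier H" for h
    using S.lin_action_tens[of "\<theta> h"] that by simp
  have lT2: "lin k S.V S.VH (coaction (yd_twist k H \<theta> \<eta> S.W))"
    using lin_coaction_twist[OF a(3,4) S.right_coaction_tens] by simp
  show ?thesis
  proof (rule yd_module_eqI[where k = k and H = H])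
    show "module.truncate (yd_twist k H \<theta> \<eta> S.W) = module.truncate S'.W"
      by (simp add: truncate_yd_twist truncate_yd_tens)
    fix t assume "t \<in> carrier (yd_twist k H \<theta> \<eta> S.W)"
    then have t [simp]: "t \<in> carrier S.V" by simp
    show "action (yd_twist k H \<theta> \<eta> S.W) h t = action S'.W h t" if h [simp]: "h \<in> carrier H" for h
    proof -
      have "action S.W (\<theta> h) t = action S'.W h t"
        by (rule vtensor_ext[where t = t and k = k and M = M and N = N and P = S.V, OF _ _ _ lS2
          lS])
          (simp_all add: e)
      then show ?thesis by simp
    qed
    show "coaction (yd_twist k H \<theta> \<eta> S.W) t = coaction S'.W t"
      by (rule vtensor_ext[where t = t and k = k and M = M and N = N and P = S.VH, OF _ _ _ lT2 lT])
        (simp_all add: coaction_twist_sw[OF a(4) S.right_coaction_tens] S.sw_coaction_tens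
          S'.coaction_tens_pure[unfolded yd_twist_trunc yd_twist_vtrunc] sw_coaction_twist)
  qed (simp_all add: left_action_twist right_coaction_twist)
qed

lemma yd_maps_twist:
  assumes f: "f \<in> yd_maps k H M N" and M: "left_action k H M" "right_coaction k H M"
    and N: "left_action k H N" "right_coaction k H N"
    and a: "\<theta> \<in> hopf_auto k H" "\<eta> \<in> hopf_auto k H"
  shows "f \<in> yd_maps k H (yd_twist k H \<theta> \<eta> M) (yd_twist k H \<theta> \<eta> N)"
proof -
  note [simp] = M N a auto_rules[OF a(1)] auto_rules[OF a(2)] yd_map_closed[OF f] lin_comp[OF
    yd_map_lin[OF f]]
  show ?thesis
    by (rule yd_mapsI)
      (simp_all add: yd_map_lin[OF f] yd_map_extensional[OF f] right_coaction_twist yd_map_action[OF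
        f]
        coaction_twist_sw[OF a(2) N(2)] sw_coaction_twist yd_map_sw[OF f])
qed

text \<open>Automorphisms fix the counit and the unit of \<open>H\<close>, which are all that the
  action and the coaction of the unit object use.\<close>

lemma twist_unit:
  assumes a: "\<theta> \<in> hopf_auto k H" "\<eta> \<in> hopf_auto k H"
  shows "yd_twist k H \<theta> \<eta> unit_module = unit_module"
proof -
  note [simp] = a auto_rules[OF a(1)] auto_rules[OF a(2)] left_action_unit right_coaction_unit
  show ?thesis
    by (rule yd_module_eqI[where k = k and H = H])
      (simp_all add: truncate_yd_twist left_action_twist right_coaction_twist coaction_twist_sw[OF
        a(2)] sw_pure[of k unit_space H])
qed

lemma conj_Ob:
  assumes "a \<in> carrier G" "X \<in> yd_obs k H"
  shows "yd_conj_ob k H a X \<in> yd_obs k H"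
proof -
  obtain \<alpha> \<beta> where a: "a = (\<alpha>, \<beta>)" "\<alpha> \<in> hopf_auto k H" "\<beta> \<in> hopf_auto k H" using assms(1) by auto
  obtain \<gamma> \<delta> N where X: "X = ((\<gamma>, \<delta>), N)" and b: "\<gamma> \<in> hopf_auto k H" "\<delta> \<in> hopf_auto k H"
    and N: "yetter_drinfeld k H \<gamma> \<delta> N" using assms(2) by (rule ob_cases)
  note [simp] = a b auto_rules[OF b(1)] auto_rules[OF b(2)] auto_rules[OF a(2)] auto_rules[OF a(3)]
    auto_rules[OF A_closed(2)[OF b(1)]] auto_rules[OF A_closed(2)[OF a(2)]] auto_rules[OF
      A_closed(2)[OF a(3)]]
  show ?thesis
    by (simp add: X yd_conj_ob_eq ob_iff) (rule yetter_drinfeld_twist[OF _ _ N b], simp_all)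
qed

lemma fst_conj: "a \<in> carrier G \<Longrightarrow> X \<in> yd_obs k H \<Longrightarrow> fst (yd_conj_ob k H a X)
  = a \<otimes>\<^bsub>G\<^esub> fst X \<otimes>\<^bsub>G\<^esub> inv\<^bsub>G\<^esub> a"
  by (cases a) (auto elim!: ob_cases simp: yd_conj_ob_eq simp del: G_simps G_inv)

lemma truncate_snd_conj: "X \<in> yd_obs k H \<Longrightarrow> module.truncate (snd (yd_conj_ob k H a X))
  = module.truncate (snd X)"
  by (cases a) (auto elim!: ob_cases simp: yd_conj_ob_eq truncate_yd_twist)

lemmas snd_conj_trunc [simp] = vtrunc_rules[OF truncate_snd_conj] trunc_vmaps[OF truncate_snd_conj]

lemma conj_yd_maps:
  assumes "a \<in> carrier G" "X \<in> yd_obs k H" "Y \<in> yd_obs k H" "fst X = fst Y"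
    "f \<in> yd_maps k H (snd X) (snd Y)"
  shows "f \<in> yd_maps k H (snd (yd_conj_ob k H a X)) (snd (yd_conj_ob k H a Y))"
proof -
  obtain \<alpha> \<beta> where a: "a = (\<alpha>, \<beta>)" "\<alpha> \<in> hopf_auto k H" "\<beta> \<in> hopf_auto k H" using assms(1) by auto
  obtain \<gamma> \<delta> N where X: "X = ((\<gamma>, \<delta>), N)" and b: "\<gamma> \<in> hopf_auto k H" "\<delta> \<in> hopf_auto k H"
    using assms(2) by (rule ob_cases)
  obtain N' where Y: "Y = ((\<gamma>, \<delta>), N')" using assms(4) X by (cases Y) auto
  show ?thesis
    using a b assms(5) ob_rules[OF assms(2)] ob_rules[OF assms(3)]
    by (simp only: X Y yd_conj_ob_eq snd_conv, intro yd_maps_twist) (simp_all add: X Y)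
qed

lemma conj_tensor:
  assumes "a \<in> carrier G" "X \<in> yd_obs k H" "Y \<in> yd_obs k H"
  shows "yd_conj_ob k H a (yd_tensor k H X Y) = yd_tensor k H (yd_conj_ob k H a X) (yd_conj_ob k H a
    Y)"
proof (rule prod_eqI)
  note g = fst_Ob[OF assms(2)] fst_Ob[OF assms(3)] assms(1)
  \<comment> \<open>Conjugation by \<open>a\<close> is an endomorphism of \<open>G\<close>; this
    settles the indices, leaving a separate comparison of the modules.\<close>
  have "a \<otimes>\<^bsub>G\<^esub> (fst X \<otimes>\<^bsub>G\<^esub> fst Y) \<otimes>\<^bsub>G\<^esub> inv\<^bsub>G\<^esub> a = (a \<otimes>\<^bsub>G\<^esub> fst X \<otimes>\<^bsub>G\<^esub> inv\<^bsub>G\<^esub> a) \<otimes>\<^bsub>G\<^esub> (a \<otimes>\<^bsub>G\<^esub> fst Y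
    \<otimes>\<^bsub>G\<^esub> inv\<^bsub>G\<^esub> a)"
    using g by (simp add: G.m_assoc G.inv_solve_left' G.r_cancel_one' del: G_simps G_inv) 
  then show "fst (yd_conj_ob k H a (yd_tensor k H X Y)) = fst (yd_tensor k H (yd_conj_ob k H a X)
    (yd_conj_ob k H a Y))"
    using assms by (simp add: fst_conj fst_tensor conj_Ob del: G_simps G_inv)
  obtain \<alpha> \<beta> where a: "a = (\<alpha>, \<beta>)" "\<alpha> \<in> hopf_auto k H" "\<beta> \<in> hopf_auto k H" using assms(1) by auto
  obtain \<gamma> \<delta> M where X: "X = ((\<gamma>, \<delta>), M)" and b: "\<gamma> \<in> hopf_auto k H" "\<delta> \<in> hopf_auto k H"
    using assms(2) by (rule ob_cases)
  obtain \<epsilon> \<zeta> N where Y: "Y = ((\<epsilon>, \<zeta>), N)" and c: "\<epsilon> \<in> hopf_auto k H" "\<zeta> \<in> hopf_auto k H"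
    using assms(3) by (rule ob_cases)
  note [simp] = a(2,3) b c auto_rules[OF b(1)] auto_rules[OF b(2)] auto_rules[OF a(2)] auto_rules[OF
    a(3)]
    auto_rules[OF c(1)] auto_rules[OF c(2)] auto_rules[OF A_closed(2)[OF c(1)]]
    auto_rules[OF A_closed(2)[OF b(1)]] auto_rules[OF A_closed(2)[OF a(2)]] auto_rules[OF
      A_closed(2)[OF a(3)]]
  show "snd (yd_conj_ob k H a (yd_tensor k H X Y)) = snd (yd_tensor k H (yd_conj_ob k H a X)
    (yd_conj_ob k H a Y))"
    unfolding a(1) X Y
    using ob_rules[OF assms(2)] ob_rules[OF assms(3)]
    by (simp add: X Y yd_tensor_eq yd_conj_ob_eq, intro twist_tens) (simp_all add: A.inv_mult_group)
qed

lemma conj_unit: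
  assumes "a \<in> carrier G"
  shows "yd_conj_ob k H a (yd_unit k H) = yd_unit k H"
proof (rule prod_eqI)
  have "fst (yd_unit k H :: ('k, 'h, 'a) yd_ob) = \<one>\<^bsub>G\<^esub>" by (simp only: yd_unit_eq fst_conv)
  then show "fst (yd_conj_ob k H a (yd_unit k H :: ('k, 'h, 'a) yd_ob)) = fst (yd_unit k H :: ('k,
    'h, 'a) yd_ob)"
    using assms by (simp add: fst_conj del: G_simps G_inv)
  show "snd (yd_conj_ob k H a (yd_unit k H :: ('k, 'h, 'a) yd_ob)) = snd (yd_unit k H :: ('k, 'h,
    'a) yd_ob)"
    using assms by (cases a) (simp add: yd_unit_eq yd_conj_ob_eq twist_unit)
qed

text \<open>The automorphisms of the second conjugation are computed from the index that the first
  one has already changed; the resulting words nevertheless compose to those of the product.\<close>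

lemma conj_mult:
  assumes "a \<in> carrier G" "b \<in> carrier G" "X \<in> yd_obs k H"
  shows "yd_conj_ob k H (a \<otimes>\<^bsub>G\<^esub> b) X = yd_conj_ob k H a (yd_conj_ob k H b X)"
proof (rule prod_eqI)
  show "fst (yd_conj_ob k H (a \<otimes>\<^bsub>G\<^esub> b) X) = fst (yd_conj_ob k H a (yd_conj_ob k H b X))"
    using assms fst_Ob[OF assms(3)] by (simp add: fst_conj conj_Ob G.m_assoc G.inv_mult_group del:
      G_simps G_inv)
  obtain \<alpha> \<beta> where a: "a = (\<alpha>, \<beta>)" "\<alpha> \<in> hopf_auto k H" "\<beta> \<in> hopf_auto k H" using assms(1) by auto
  obtain \<gamma> \<delta> where b: "b = (\<gamma>, \<delta>)" "\<gamma> \<in> hopf_auto k H" "\<delta> \<in> hopf_auto k H" using assms(2) by auto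
  obtain \<epsilon> \<zeta> N where X: "X = ((\<epsilon>, \<zeta>), N)" and c: "\<epsilon> \<in> hopf_auto k H" "\<zeta> \<in> hopf_auto k H"
    using assms(3) by (rule ob_cases)
  note [simp] = a(2,3) b(2,3) c auto_rules[OF b(2)] auto_rules[OF b(3)] auto_rules[OF a(2)]
    auto_rules[OF a(3)]
    auto_rules[OF c(1)] auto_rules[OF c(2)] auto_rules[OF A_closed(2)[OF c(1)]] auto_rules[OF
      A_closed(2)[OF b(3)]]
    auto_rules[OF A_closed(2)[OF b(2)]] auto_rules[OF A_closed(2)[OF a(2)]] auto_rules[OF
      A_closed(2)[OF a(3)]]
  show "snd (yd_conj_ob k H (a \<otimes>\<^bsub>G\<^esub> b) X) = snd (yd_conj_ob k H a (yd_conj_ob k H b X))"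
    unfolding a(1) b(1) X
    using ob_rules[OF assms(3)]
    by (simp add: X yd_conj_ob_eq, intro yd_twist_eqI) (simp_all add: A.inv_mult_group)
qed

lemma conj_one:
  assumes "X \<in> yd_obs k H"
  shows "yd_conj_ob k H \<one>\<^bsub>G\<^esub> X = X"
proof (rule prod_eqI)
  show "fst (yd_conj_ob k H \<one>\<^bsub>G\<^esub> X) = fst X"
    using assms fst_Ob[OF assms] by (simp add: fst_conj del: G_simps G_inv)
  obtain \<epsilon> \<zeta> N where X: "X = ((\<epsilon>, \<zeta>), N)" and c: "\<epsilon> \<in> hopf_auto k H" "\<zeta> \<in> hopf_auto k H"
    using assms by (rule ob_cases)
  note [simp] = c auto_rules[OF c(1)]
  show "snd (yd_conj_ob k H \<one>\<^bsub>G\<^esub> X) = snd X"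
    using ob_rules[OF assms]
    by (simp add: X yd_conj_ob_eq, intro yd_twist_ident) simp_all
qed

section \<open>Conjugation as a strict monoidal functor\<close>

lemma arr_cases:
  assumes "F \<in> yd_arrs k H"
  obtains X Y f where "F = (X, Y, f)" "X \<in> yd_obs k H" "Y \<in> yd_obs k H" "fst X = fst Y"
    "f \<in> yd_maps k H (snd X) (snd Y)"
    "lin k (snd X) (snd Y) f"
proof -
  obtain X Y where F: "F \<in> Hom (YD k H) X Y" using assms by (auto simp: Arr_iff)
  then obtain f where f: "F = (X, Y, f)" "X \<in> yd_obs k H" "Y \<in> yd_obs k H" "fst X = fst Y"
    "f \<in> yd_maps k H (snd X) (snd Y)"
    "lin k (snd X) (snd Y) f" by (rule HomE)
  show thesis by (rule that[OF f])
qed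

lemma arr_iff [simp]: "(X, Y, f) \<in> yd_arrs k H \<longleftrightarrow>
    X \<in> yd_obs k H \<and> Y \<in> yd_obs k H \<and> fst X = fst Y \<and> f \<in> yd_maps k H (snd X) (snd Y)"
  by (auto simp: Arr_iff Hom_iff)

lemma yd_conj_ob_app [simp]: "X \<in> yd_obs k H \<Longrightarrow> fst (yd_conj k H a) X = yd_conj_ob k H a X"
  by (simp add: yd_conj_def)

lemma yd_conj_arr_app [simp]:
  "(X, Y, f) \<in> yd_arrs k H \<Longrightarrow> snd (yd_conj k H a) (X, Y, f) = (yd_conj_ob k H a X, yd_conj_ob k H a
    Y, f)"
  by (simp add: yd_conj_def)

lemma vlunit_conj [simp]: "X \<in> yd_obs k H \<Longrightarrow> vlunit (snd (yd_conj_ob k H a X)) = vlunit (snd X)"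
  and vrunit_conj [simp]: "X \<in> yd_obs k H \<Longrightarrow> vrunit (snd (yd_conj_ob k H a X)) = vrunit (snd X)"
  by (simp_all add: vlunit_def vrunit_def)

lemma Hom_arr: "F \<in> Hom (YD k H) X Y \<Longrightarrow> F \<in> yd_arrs k H"
  by (auto simp: Hom_def)

lemma isos_arr: "F \<in> isos (YD k H) X Y \<Longrightarrow> F \<in> yd_arrs k H"
  by (auto simp: isos_def Hom_def)

text \<open>On an arrow only domain and codomain change. As conjugates have the same vector spaces,
  the constraints of conjugated objects are given by the same functions, and equality of objects is
  the content of \<open>conj_tensor\<close> and \<open>conj_unit\<close>.\<close>

lemma yd_conj_strict:
  assumes a [simp]: "a \<in> carrier G"
  shows "yd_conj k H a \<in> strict_endofunctors (YD k H :: (('k, 'h, 'a) yd_ob, ('k, 'h, 'a) yd_arr)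
    moncat)"
proof -
  interpret T: monoidal_category "YD k H :: (('k, 'h, 'a) yd_ob, ('k, 'h, 'a) yd_arr) moncat"
    by (rule monoidal_category_YD)
  let ?F = "fst (yd_conj k H a) :: ('k, 'h, 'a) yd_ob \<Rightarrow> _"
    and ?F' = "snd (yd_conj k H a) :: ('k, 'h, 'a) yd_arr \<Rightarrow> _"
  let ?T = "YD k H :: (('k, 'h, 'a) yd_ob, ('k, 'h, 'a) yd_arr) moncat"
  note [simp del] = G_simps G_inv
  note [simp] = conj_Ob conj_tensor conj_unit
  have ident: "(X, X, \<lambda>m\<in>carrier (snd X). m) \<in> yd_arrs k H" if "X \<in> yd_obs k H" for X ::
    "('k, 'h, 'a) yd_ob"
    using Hom_arr[OF T.Ident_Hom] that by simp
  have f1: "?F \<in> Ob ?T \<rightarrow>\<^sub>E Ob ?T" "?F' \<in> Arr ?T \<rightarrow>\<^sub>E Arr ?T"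
    by (auto simp: PiE_iff yd_conj_def fst_conj conj_yd_maps)
  have f2: "Dom ?T (?F' f) = ?F (Dom ?T f)" "Cod ?T (?F' f) = ?F (Cod ?T f)" if "f \<in> Arr ?T" for f
    using that by (auto elim!: arr_cases)
  have f3: "?F' (Ident ?T X) = Ident ?T (?F X)" if "X \<in> Ob ?T" for X
    using that by (simp add: ident_yd)
  have f4: "?F' (g \<cdot>\<^bsub>?T\<^esub> f) = ?F' g \<cdot>\<^bsub>?T\<^esub> ?F' f" if "f \<in> Arr ?T" "g \<in> Arr ?T" "Dom ?T g = Cod ?T f"
    for f g
  proof -
    have "g \<cdot>\<^bsub>?T\<^esub> f \<in> yd_arrs k H"
      by (rule Hom_arr, rule T.Comp_Hom) (use that in \<open>auto simp: Hom_def\<close>)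
    then show ?thesis using that by (auto elim!: arr_cases)
  qed
  have f5: "?F (X \<otimes>o\<^bsub>?T\<^esub> Y) = ?F X \<otimes>o\<^bsub>?T\<^esub> ?F Y" if "X \<in> Ob ?T" "Y \<in> Ob ?T" for X Y
    using that by simp
  have f6: "?F' (f \<otimes>a\<^bsub>?T\<^esub> g) = ?F' f \<otimes>a\<^bsub>?T\<^esub> ?F' g" if "f \<in> Arr ?T" "g \<in> Arr ?T" for f g
  proof -
    \<comment> \<open>The arrow part of \<open>yd_conj\<close> is a restricted function, so it can
      be evaluated only at something known to be an arrow.\<close>
    have fg: "f \<otimes>a\<^bsub>?T\<^esub> g \<in> yd_arrs k H"
      by (rule Hom_arr, rule T.tens_Hom) (use that in \<open>auto simp: Hom_def\<close>)
    from that obtain X X' f0 Y Y' g0 where "f = (X, X', f0)" "X \<in> yd_obs k H" "X' \<in> yd_obs k H"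
      "f \<in> yd_arrs k H"
      "g = (Y, Y', g0)" "Y \<in> yd_obs k H" "Y' \<in> yd_obs k H" "g \<in> yd_arrs k H"
      by simp (metis arr_cases)
    then show ?thesis using fg by simp
  qed
  have f7: "?F (unit_ob ?T) = unit_ob ?T" by simp
  have f8: "?F' (assoc ?T X Y Z) = assoc ?T (?F X) (?F Y) (?F Z)" if "X \<in> Ob ?T" "Y \<in> Ob ?T"
    "Z \<in> Ob ?T" for X Y Z
    using isos_arr[OF T.assoc_iso[OF that]] that by simp
  have f9: "?F' (lunit ?T X) = lunit ?T (?F X)" "?F' (runit ?T X) = runit ?T (?F X)" if "X \<in> Ob ?T"
    for X
    using isos_arr[OF T.lunit_iso[OF that]] isos_arr[OF T.runit_iso[OF that]] that by simp_all
  show ?thesis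
    unfolding strict_endofunctors_def mem_Collect_eq case_prod_beta
    by (intro conjI ballI impI) (assumption | rule f1 f2 f3 f4 f5 f6 f7 f8 f9)+
qed

lemma yd_conj_mult:
  assumes a: "a \<in> carrier G" and b: "b \<in> carrier G"
  shows "yd_conj k H (a \<otimes>\<^bsub>G\<^esub> b) =
    yd_conj k H a \<otimes>\<^bsub>strict_End (YD k H :: (('k, 'h, 'a) yd_ob, ('k, 'h, 'a) yd_arr) moncat)\<^esub> yd_conj
      k H b"
proof -
  note [simp del] = G_simps G_inv
  have 1: "fst (yd_conj k H (a \<otimes>\<^bsub>G\<^esub> b)) = compose (yd_obs k H) (fst (yd_conj k H a)) (fst (yd_conj k
    H b :: (('k, 'h, 'a) yd_ob \<Rightarrow> _) \<times> _))"
    by (rule extensionalityI[where A = "yd_obs k H"])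
      (simp_all add: compose_eq conj_mult[OF a b] conj_Ob[OF b], simp add: yd_conj_def)
  have 2: "snd (yd_conj k H (a \<otimes>\<^bsub>G\<^esub> b)) = compose (yd_arrs k H) (snd (yd_conj k H a)) (snd (yd_conj
    k H b :: _ \<times> (('k, 'h, 'a) yd_arr \<Rightarrow> _)))"
  proof (rule extensionalityI[where A = "yd_arrs k H"])
    fix F :: "('k, 'h, 'a) yd_arr" assume "F \<in> yd_arrs k H"
    then show "snd (yd_conj k H (a \<otimes>\<^bsub>G\<^esub> b)) F = compose (yd_arrs k H) (snd (yd_conj k H a)) (snd
      (yd_conj k H b)) F"
      by (auto elim!: arr_cases simp: compose_eq conj_mult[OF a b] conj_Ob[OF b] fst_conj[OF b]
        conj_yd_maps[OF b])
  qed (simp_all, simp add: yd_conj_def)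
  show ?thesis
    by (rule prod_eqI) (simp_all add: strict_End_def 1 2 split_beta)
qed

lemma yd_conj_one:
  "yd_conj k H \<one>\<^bsub>G\<^esub> = \<one>\<^bsub>strict_End (YD k H :: (('k, 'h, 'a) yd_ob, ('k, 'h, 'a) yd_arr) moncat)\<^esub>"
proof -
  note [simp del] = G_simps G_inv
  have 1: "fst (yd_conj k H \<one>\<^bsub>G\<^esub>) = (\<lambda>X\<in>yd_obs k H. X :: ('k, 'h, 'a) yd_ob)"
    by (rule extensionalityI[where A = "yd_obs k H"]) (simp_all add: conj_one, simp add:
      yd_conj_def)
  have 2: "snd (yd_conj k H \<one>\<^bsub>G\<^esub>) = (\<lambda>X\<in>yd_arrs k H. X :: ('k, 'h, 'a) yd_arr)"
  proof (rule extensionalityI[where A = "yd_arrs k H"])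
    fix F :: "('k, 'h, 'a) yd_arr" assume "F \<in> yd_arrs k H"
    then show "snd (yd_conj k H \<one>\<^bsub>G\<^esub>) F = (\<lambda>X\<in>yd_arrs k H. X) F"
      by (auto elim!: arr_cases simp: conj_one)
  qed (simp_all, simp add: yd_conj_def)
  show ?thesis
    by (rule prod_eqI) (simp_all add: strict_End_def 1 2 split_beta)
qed

lemma component_iff: "a \<in> carrier G \<Longrightarrow> X \<in> yd_component k H a \<longleftrightarrow> X \<in> yd_obs k H \<and> fst X = a"
  by (cases X; cases a) (auto simp: yd_obs_def yd_component_def)

lemma T_category_YD:
  "T_category G (YD k H :: (('k, 'h, 'a) yd_ob, ('k, 'h, 'a) yd_arr) moncat) (yd_component k H)
    (yd_conj k H)"
proof (intro T_category.intro T_category_axioms.intro G.is_group monoidal_category_YD)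
  let ?T = "YD k H :: (('k, 'h, 'a) yd_ob, ('k, 'h, 'a) yd_arr) moncat"
  note [simp del] = G_simps G_inv
  note [simp] = component_iff
  show "(\<Union>a\<in>carrier G. yd_component k H a) = Ob ?T" by (simp add: yd_obs_def)
  fix a assume a [simp]: "a \<in> carrier G"
  show "Cod ?T f \<in> yd_component k H a" if "f \<in> Arr ?T" "Dom ?T f \<in> yd_component k H a" for f
    using that by (auto elim!: arr_cases)
  fix b assume b [simp]: "b \<in> carrier G"
  show "yd_component k H a \<inter> yd_component k H b = {}" if "a \<noteq> b"
    using that by auto
  show "U \<otimes>o\<^bsub>?T\<^esub> V \<in> yd_component k H (a \<otimes>\<^bsub>G\<^esub> b)" if "U \<in> yd_component k H a"
    "V \<in> yd_component k H b" for U V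
    using that by (simp add: fst_tensor)
  have c: "yd_conj_ob k H c X \<in> yd_component k H (c \<otimes>\<^bsub>G\<^esub> d \<otimes>\<^bsub>G\<^esub> inv\<^bsub>G\<^esub> c)"
    if "c \<in> carrier G" "d \<in> carrier G" "X \<in> yd_component k H d" for c d
      and X :: "('k, 'h, 'a) yd_ob"
    using that by (simp add: conj_Ob fst_conj)
  show "fst (yd_conj k H b) ` (yd_component k H a :: ('k, 'h, 'a) yd_ob set)
    = yd_component k H (b \<otimes>\<^bsub>G\<^esub> a \<otimes>\<^bsub>G\<^esub> inv\<^bsub>G\<^esub> b)"
  proof (intro equalityI subsetI)
    fix X :: "('k, 'h, 'a) yd_ob" assume "X \<in> fst (yd_conj k H b) ` yd_component k H a"
    then obtain Y where Y: "Y \<in> yd_component k H a" "X = fst (yd_conj k H b) Y" by blast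
    show "X \<in> yd_component k H (b \<otimes>\<^bsub>G\<^esub> a \<otimes>\<^bsub>G\<^esub> inv\<^bsub>G\<^esub> b)"
      using c[OF b a Y(1)] Y by simp
  next
    fix X :: "('k, 'h, 'a) yd_ob" assume X: "X \<in> yd_component k H (b \<otimes>\<^bsub>G\<^esub> a \<otimes>\<^bsub>G\<^esub> inv\<^bsub>G\<^esub> b)"
    \<comment> \<open>Surjectivity onto the conjugate component: the preimage is obtained by
      conjugating back.\<close>
    let ?X = "yd_conj_ob k H (inv\<^bsub>G\<^esub> b) X"
    have ob: "X \<in> yd_obs k H" using X by simp
    have "inv\<^bsub>G\<^esub> b \<otimes>\<^bsub>G\<^esub> (b \<otimes>\<^bsub>G\<^esub> a \<otimes>\<^bsub>G\<^esub> inv\<^bsub>G\<^esub> b) \<otimes>\<^bsub>G\<^esub> inv\<^bsub>G\<^esub> (inv\<^bsub>G\<^esub> b) = a"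
      by (simp add: G.m_assoc)
    with c[of "inv\<^bsub>G\<^esub> b", OF _ _ X] have "?X \<in> yd_component k H a" by simp
    moreover have "fst (yd_conj k H b) ?X = X"
      using conj_mult[of b "inv\<^bsub>G\<^esub> b" X] conj_one[OF ob] ob by (simp add: conj_Ob)
    ultimately show "X \<in> fst (yd_conj k H b) ` yd_component k H a" by (metis imageI)
  qed
next
  let ?T = "YD k H :: (('k, 'h, 'a) yd_ob, ('k, 'h, 'a) yd_arr) moncat"
  show "unit_ob ?T \<in> yd_component k H \<one>\<^bsub>G\<^esub>"
    using G.one_closed by (simp add: component_iff yd_unit_eq[symmetric] del: G_simps) (simp add:
      yd_unit_eq)
  \<comment> \<open>The target of the homomorphism is a group of units, so invertibility is shown by
    exhibiting conjugation by the inverse of \<open>a\<close>.\<close>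
  have "yd_conj k H a \<in> Units (strict_End ?T)" if a: "a \<in> carrier G" for a
  proof -
    have "yd_conj k H (inv\<^bsub>G\<^esub> a) \<in> carrier (strict_End ?T)"
      "yd_conj k H a \<in> carrier (strict_End ?T)"
      using yd_conj_strict[OF G.inv_closed[OF a]] yd_conj_strict[OF a]
      by (simp_all add: strict_End_def del: G_simps G_inv)
    moreover have "yd_conj k H (inv\<^bsub>G\<^esub> a) \<otimes>\<^bsub>strict_End ?T\<^esub> yd_conj k H a = \<one>\<^bsub>strict_End ?T\<^esub>"
      "yd_conj k H a \<otimes>\<^bsub>strict_End ?T\<^esub> yd_conj k H (inv\<^bsub>G\<^esub> a) = \<one>\<^bsub>strict_End ?T\<^esub>"
      using a by (simp_all add: yd_conj_one yd_conj_mult[symmetric] del: G_simps G_inv)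
    ultimately show ?thesis by (auto simp: Units_def)
  qed
  then show "yd_conj k H \<in> hom G (strict_Aut ?T)"
    by (simp add: hom_def units_of_def yd_conj_mult del: G_simps)
qed

section \<open>The braided T-category\<close>

lemma yd_braiding_eq:
  assumes "X \<in> yd_obs k H" "Y \<in> yd_obs k H"
  shows "yd_braiding k H X Y = (yd_tensor k H X Y, yd_tensor k H (yd_conj_ob k H (fst X) Y) X,
    vbraid (inv\<^bsub>A\<^esub> (snd (fst X))) (snd X) (snd Y))"
proof -
  obtain \<alpha> \<beta> M where X: "X = ((\<alpha>, \<beta>), M)" using assms(1) by (rule ob_cases)
  show ?thesis using assms by (simp add: X yd_braiding_def Let_def vbraid_def)
qed

lemma vbraid_Hom:
  assumes "X \<in> yd_obs k H" "Y \<in> yd_obs k H"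
  shows "(yd_tensor k H X Y, yd_tensor k H (yd_conj_ob k H (fst X) Y) X, vbraid (inv\<^bsub>A\<^esub> (snd (fst
    X))) (snd X) (snd Y))
    \<in> Hom (YD k H) (yd_tensor k H X Y) (yd_tensor k H (yd_conj_ob k H (fst X) Y) X)"
proof (rule HomI)
  note g = fst_Ob[OF assms(1)] fst_Ob[OF assms(2)]
  show "yd_tensor k H X Y \<in> yd_obs k H" "yd_tensor k H (yd_conj_ob k H (fst X) Y) X \<in> yd_obs k H"
    using assms g by (simp_all add: conj_Ob del: G_simps)
  \<comment> \<open>For indices \<open>a\<close> of \<open>X\<close> and \<open>c\<close> of
    \<open>Y\<close> this is the identity \<open>a c = (a c a\<^sup>-\<^sup>1) a\<close>.\<close>
  show "fst (yd_tensor k H X Y) = fst (yd_tensor k H (yd_conj_ob k H (fst X) Y) X)"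
    using assms g by (simp add: fst_tensor conj_Ob fst_conj G.m_assoc del: G_simps G_inv)
  obtain \<alpha> \<beta> M where X: "X = ((\<alpha>, \<beta>), M)" and a: "\<alpha> \<in> hopf_auto k H" "\<beta> \<in> hopf_auto k H"
    and M: "yetter_drinfeld k H \<alpha> \<beta> M" using assms(1) by (rule ob_cases)
  obtain \<gamma> \<delta> N where Y: "Y = ((\<gamma>, \<delta>), N)" and b: "\<gamma> \<in> hopf_auto k H" "\<delta> \<in> hopf_auto k H"
    and N: "yetter_drinfeld k H \<gamma> \<delta> N" using assms(2) by (rule ob_cases)
  note [simp] = a b auto_rules[OF b(1)] auto_rules[OF b(2)] auto_rules[OF a(1)] auto_rules[OF a(2)]
    auto_rules[OF A_closed(2)[OF b(1)]] auto_rules[OF A_closed(2)[OF a(1)]] auto_rules[OF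
      A_closed(2)[OF a(2)]]
  show "vbraid (inv\<^bsub>A\<^esub> (snd (fst X))) (snd X) (snd Y)
      \<in> yd_maps k H (snd (yd_tensor k H X Y)) (snd (yd_tensor k H (yd_conj_ob k H (fst X) Y) X))"
    by (simp add: X Y yd_tensor_eq yd_conj_ob_eq, rule vbraid_yd[OF M N a b]) simp_all
qed

lemma inverse_vbraid:
  assumes "X \<in> yd_obs k H" "Y \<in> yd_obs k H"
  shows "inverse_arrows (YD k H)
    (yd_tensor k H X Y, yd_tensor k H (yd_conj_ob k H (fst X) Y) X, vbraid (inv\<^bsub>A\<^esub> (snd (fst X)))
      (snd X) (snd Y))
    (yd_tensor k H (yd_conj_ob k H (fst X) Y) X, yd_tensor k H X Y, vbraid_inv (inv\<^bsub>A\<^esub> (snd (fst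
      X))) (snd X) (snd Y))"
proof -
  have [simp]: "inv\<^bsub>A\<^esub> (snd (fst X)) \<in> hopf_auto k H" "yd_conj_ob k H (fst X) Y \<in> yd_obs k H"
    using fst_Ob[OF assms(1)] assms by (auto simp: conj_Ob mem_Times_iff)
  show ?thesis
    by (rule inverse_arrowsI[OF vbraid_Hom[OF assms]])
      (use assms in \<open>simp_all add: lin_vbraid_inv vbraid_inv_vbraid vbraid_vbraid_inv\<close>, simp add:
        vbraid_inv_def)
qed

lemma braided_T_category_YD:
  "braided_T_category G (YD k H :: (('k, 'h, 'a) yd_ob, ('k, 'h, 'a) yd_arr) moncat)
    (yd_component k H) (yd_conj k H) (yd_braiding k H)"
proof (intro braided_T_category.intro braided_T_category_axioms.intro T_category_YD)
  let ?T = "YD k H :: (('k, 'h, 'a) yd_ob, ('k, 'h, 'a) yd_arr) moncat"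
  fix a U V
  assume a: "a \<in> carrier G" and "U \<in> (yd_component k H a :: ('k, 'h, 'a) yd_ob set)" and "V \<in> Ob ?T"
  then have U: "U \<in> yd_obs k H" "fst U = a" and V: "V \<in> yd_obs k H" by (simp_all add: component_iff
    del: G_simps)
  show "yd_braiding k H U V \<in> isos ?T (U \<otimes>o\<^bsub>?T\<^esub> V) (fst (yd_conj k H a) V \<otimes>o\<^bsub>?T\<^esub> U)"
    using isosI[OF vbraid_Hom[OF U(1) V] inverse_vbraid[OF U(1) V]]
      by (simp add: U V yd_braiding_eq)
next
  let ?T = "YD k H :: (('k, 'h, 'a) yd_ob, ('k, 'h, 'a) yd_arr) moncat"
  fix a f g U U' V V'
  assume a: "a \<in> carrier G" and "U \<in> (yd_component k H a :: ('k, 'h, 'a) yd_ob set)"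
    "U' \<in> yd_component k H a"
    and f: "f \<in> Hom ?T U U'" and g: "g \<in> Hom ?T V V'"
  then have U: "U \<in> yd_obs k H" "fst U = a" "U' \<in> yd_obs k H" "fst U' = a"
    by (simp_all add: component_iff del: G_simps)
  from f obtain f0 where F: "f = (U, U', f0)" "f0 \<in> yd_maps k H (snd U) (snd U')"
    "lin k (snd U) (snd U') f0"
    by (rule HomE)
  from g obtain g0 where G: "g = (V, V', g0)" "V \<in> yd_obs k H" "V' \<in> yd_obs k H" "fst V = fst V'"
    "g0 \<in> yd_maps k H (snd V) (snd V')" "lin k (snd V) (snd V') g0" by (rule HomE)
  have [simp]: "inv\<^bsub>A\<^esub> (snd a) \<in> hopf_auto k H" "yd_conj_ob k H a V \<in> yd_obs k H"
    "yd_conj_ob k H a V' \<in> yd_obs k H"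
    using a G by (auto simp: conj_Ob)
  show "(snd (yd_conj k H a) g \<otimes>a\<^bsub>?T\<^esub> f) \<cdot>\<^bsub>?T\<^esub> yd_braiding k H U V
    = yd_braiding k H U' V' \<cdot>\<^bsub>?T\<^esub> (f \<otimes>a\<^bsub>?T\<^esub> g)"
    using U G F(3)
    by (simp add: F G yd_braiding_eq)
      (rule extensionalityI[where A = "carrier (vtensor k (snd U) (snd V))"], simp, simp, simp add:
        compose_eq, rule vbraid_vmap, simp_all add: F G(2,3,5))
next
  let ?T = "YD k H :: (('k, 'h, 'a) yd_ob, ('k, 'h, 'a) yd_arr) moncat"
  fix a b U V W
  assume a: "a \<in> carrier G" and b: "b \<in> carrier G"
    and "U \<in> (yd_component k H a :: ('k, 'h, 'a) yd_ob set)"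
    "V \<in> (yd_component k H b :: ('k, 'h, 'a) yd_ob set)" and "W \<in> Ob ?T"
  then have U: "U \<in> yd_obs k H" "fst U = a" and V: "V \<in> yd_obs k H" "fst V = b"
    and W: "W \<in> yd_obs k H"
    by (simp_all add: component_iff del: G_simps)
  have bW: "yd_conj_ob k H b W \<in> yd_obs k H" "yd_conj_ob k H a (yd_conj_ob k H b W) \<in> yd_obs k H"
    using a b W by (simp_all add: conj_Ob del: G_simps)
  obtain \<alpha> \<beta> L where UL: "U = ((\<alpha>, \<beta>), L)" and \<alpha>: "\<alpha> \<in> hopf_auto k H" "\<beta> \<in> hopf_auto k H"
    using U(1) by (rule ob_cases)
  obtain \<gamma> \<delta> M where VM: "V = ((\<gamma>, \<delta>), M)" and \<gamma>: "\<gamma> \<in> hopf_auto k H" "\<delta> \<in> hopf_auto k H"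
    using V(1) by (rule ob_cases)
  obtain \<epsilon> \<zeta> N where WN: "W = ((\<epsilon>, \<zeta>), N)" and \<epsilon>: "\<epsilon> \<in> hopf_auto k H" "\<zeta> \<in> hopf_auto k H"
    using W(1) by (rule ob_cases)
  have ab: "a = (\<alpha>, \<beta>)" "b = (\<gamma>, \<delta>)" using U V UL VM by auto
  note [simp] = \<alpha> \<gamma> \<epsilon> auto_rules[OF \<alpha>(1)] auto_rules[OF \<alpha>(2)] auto_rules[OF \<gamma>(1)] auto_rules[OF
    \<gamma>(2)]
    auto_rules[OF A_closed(2)[OF \<alpha>(2)]] auto_rules[OF A_closed(2)[OF \<gamma>(1)]] auto_rules[OF
      A_closed(2)[OF \<gamma>(2)]]
  \<comment> \<open>Here \<open>b'\<close> is the inverse of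
    \<open>\<delta>\<gamma>\<^sup>-\<^sup>1\<beta>\<gamma>\<close> and
    \<open>\<eta> = \<gamma>\<delta>\<^sup>-\<^sup>1\<close>. Then \<open>\<gamma>b'\<close> and
    \<open>\<beta>\<^sup>-\<^sup>1\<eta>\<close> are both
    \<open>\<beta>\<^sup>-\<^sup>1\<gamma>\<delta>\<^sup>-\<^sup>1\<close>, while
    \<open>\<theta>b'\<close> with \<open>\<theta> = \<gamma>\<^sup>-\<^sup>1\<beta>\<gamma>\<close>
    is \<open>\<delta>\<^sup>-\<^sup>1\<close>.\<close>
  have key: "vbraid (inv\<^bsub>A\<^esub> (snd (fst (yd_tensor k H U V)))) (snd (yd_tensor k H U V)) (snd W) t =
    vassoc k (snd W) (snd U) (snd V) (vmap k (vtensor k (snd U) (snd W)) (snd V) (vtensor k (snd W)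
      (snd U)) (snd V)
      (vbraid (inv\<^bsub>A\<^esub> (snd a)) (snd U) (snd (yd_conj_ob k H b W))) (\<lambda>m\<in>carrier (snd V). m)
      (vassoc_inv k (snd U) (snd W) (snd V) (vmap k (snd U) (vtensor k (snd V) (snd W)) (snd U)
        (vtensor k (snd W) (snd V))
        (\<lambda>m\<in>carrier (snd U). m) (vbraid (inv\<^bsub>A\<^esub> (snd b)) (snd V) (snd W)) (vassoc k (snd U) (snd V)
          (snd W) t))))"
    if "t \<in> carrier (vtensor k (vtensor k (snd U) (snd V)) (snd W))" for t
    using that ob_rules[OF U(1)] ob_rules[OF V(1)] ob_rules[OF W]
    by (simp add: UL VM WN ab yd_tensor_eq yd_conj_ob_eq, intro vbraid_tens_left) (simp_all add:
      A.inv_mult_group)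
  have lb: "lin k (vtensor k (snd U) (snd W)) (vtensor k (snd W) (snd U)) (vbraid (inv\<^bsub>A\<^esub> (snd a))
    (snd U) (snd (yd_conj_ob k H b W)))"
    using lin_vbraid[of "snd U" "snd (yd_conj_ob k H b W)" "inv\<^bsub>A\<^esub> (snd a)"] U(1) W bW(1) ab by simp
  have lb': "lin k (vtensor k (snd V) (snd W)) (vtensor k (snd W) (snd V)) (vbraid (inv\<^bsub>A\<^esub> (snd b))
    (snd V) (snd W))"
    using V W by (intro lin_vbraid) (simp_all add: ab)
  show "yd_braiding k H (U \<otimes>o\<^bsub>?T\<^esub> V) W =
      assoc ?T (fst (yd_conj k H a) (fst (yd_conj k H b) W)) U V \<cdot>\<^bsub>?T\<^esub>
      (yd_braiding k H U (fst (yd_conj k H b) W) \<otimes>a\<^bsub>?T\<^esub> Ident ?T V) \<cdot>\<^bsub>?T\<^esub>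
      arr_inv ?T (assoc ?T U (fst (yd_conj k H b) W) V) \<cdot>\<^bsub>?T\<^esub>
      (Ident ?T U \<otimes>a\<^bsub>?T\<^esub> yd_braiding k H V W) \<cdot>\<^bsub>?T\<^esub> assoc ?T U V W"
    unfolding yd_conj_ob_app[OF W] yd_conj_ob_app[OF bW(1)] arr_inv_assoc[OF U(1) bW(1) V(1)]
    using U V W bW
    by (simp add: yd_braiding_eq fst_tensor conj_mult[OF a b] del: G_simps)
      (rule extensionalityI[where A = "carrier (vtensor k (vtensor k (snd U) (snd V)) (snd W))"],
        simp add: vbraid_def, simp, simp add: compose_eq lb lb' key[unfolded fst_tensor[OF U(1)
          V(1)] U V] del: G_simps)
next
  let ?T = "YD k H :: (('k, 'h, 'a) yd_ob, ('k, 'h, 'a) yd_arr) moncat"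
  fix a U V W
  assume a: "a \<in> carrier G" and "U \<in> (yd_component k H a :: ('k, 'h, 'a) yd_ob set)" and "V \<in> Ob ?T"
    and "W \<in> Ob ?T"
  then have U: "U \<in> yd_obs k H" "fst U = a" and V: "V \<in> yd_obs k H" and W: "W \<in> yd_obs k H"
    by (simp_all add: component_iff del: G_simps)
  have aV: "yd_conj_ob k H a V \<in> yd_obs k H" "yd_conj_ob k H a W \<in> yd_obs k H"
    using a W V by (simp_all add: conj_Ob del: G_simps)
  have [simp]: "inv\<^bsub>A\<^esub> (snd a) \<in> hopf_auto k H" using a by auto
  obtain \<gamma> \<delta> M where VM: "V = ((\<gamma>, \<delta>), M)" and [simp]: "\<gamma> \<in> hopf_auto k H" "\<delta> \<in> hopf_auto k H"
    using V by (rule ob_cases)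
  obtain \<epsilon> \<zeta> N where WN: "W = ((\<epsilon>, \<zeta>), N)" and [simp]: "\<epsilon> \<in> hopf_auto k H" "\<zeta> \<in> hopf_auto k H"
    using W by (rule ob_cases)
  have key: "vbraid (inv\<^bsub>A\<^esub> (snd a)) (snd U) (snd (yd_tensor k H V W)) t =
    vassoc_inv k (snd V) (snd W) (snd U) (vmap k (snd V) (vtensor k (snd U) (snd W)) (snd V)
      (vtensor k (snd W) (snd U))
      (\<lambda>m\<in>carrier (snd V). m) (vbraid (inv\<^bsub>A\<^esub> (snd a)) (snd U) (snd W))
      (vassoc k (snd V) (snd U) (snd W) (vmap k (vtensor k (snd U) (snd V)) (snd W) (vtensor k (snd
        V) (snd U)) (snd W)
        (vbraid (inv\<^bsub>A\<^esub> (snd a)) (snd U) (snd V)) (\<lambda>m\<in>carrier (snd W). m) (vassoc_inv k (snd U) (snd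
          V) (snd W) t))))"
    if "t \<in> carrier (vtensor k (snd U) (vtensor k (snd V) (snd W)))" for t
    using that ob_rules[OF U(1)] ob_rules[OF V] ob_rules[OF W]
    by (simp add: VM WN yd_tensor_eq, intro vbraid_tens_right) simp_all
  have lb: "lin k (vtensor k (snd U) (snd V')) (vtensor k (snd V') (snd U)) (vbraid (inv\<^bsub>A\<^esub> (snd a))
    (snd U) (snd V'))"
    if "V' \<in> yd_obs k H" for V' :: "('k, 'h, 'a) yd_ob"
    using U that by (intro lin_vbraid) simp_all
  show "yd_braiding k H U (V \<otimes>o\<^bsub>?T\<^esub> W) =
      arr_inv ?T (assoc ?T (fst (yd_conj k H a) V) (fst (yd_conj k H a) W) U) \<cdot>\<^bsub>?T\<^esub>
      (Ident ?T (fst (yd_conj k H a) V) \<otimes>a\<^bsub>?T\<^esub> yd_braiding k H U W) \<cdot>\<^bsub>?T\<^esub>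
      assoc ?T (fst (yd_conj k H a) V) U W \<cdot>\<^bsub>?T\<^esub>
      (yd_braiding k H U V \<otimes>a\<^bsub>?T\<^esub> Ident ?T W) \<cdot>\<^bsub>?T\<^esub> arr_inv ?T (assoc ?T U V W)"
    unfolding yd_conj_ob_app[OF W] yd_conj_ob_app[OF V] arr_inv_assoc[OF aV U(1)] arr_inv_assoc[OF
      U(1) V W]
    using U V W aV
    by (simp add: yd_braiding_eq conj_tensor[OF a] del: G_simps)
      (rule extensionalityI[where A = "carrier (vtensor k (snd U) (vtensor k (snd V) (snd W)))"],
        simp add: vbraid_def, simp, simp add: compose_eq lb key)
next
  let ?T = "YD k H :: (('k, 'h, 'a) yd_ob, ('k, 'h, 'a) yd_arr) moncat"
  fix b U V assume b: "b \<in> carrier G" and "U \<in> Ob ?T" "V \<in> Ob ?T"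
  then have U: "U \<in> yd_obs k H" and V: "V \<in> yd_obs k H" by simp_all
  have bU: "yd_conj_ob k H b U \<in> yd_obs k H" "yd_conj_ob k H b V \<in> yd_obs k H"
    using b U V by (simp_all add: conj_Ob del: G_simps)
  obtain \<alpha> \<beta> where ab: "b = (\<alpha>, \<beta>)" and \<alpha>: "\<alpha> \<in> hopf_auto k H" "\<beta> \<in> hopf_auto k H" using b by auto
  obtain \<gamma> \<delta> M where UM: "U = ((\<gamma>, \<delta>), M)" and \<gamma>: "\<gamma> \<in> hopf_auto k H" "\<delta> \<in> hopf_auto k H"
    using U by (rule ob_cases)
  obtain \<epsilon> \<zeta> N where VN: "V = ((\<epsilon>, \<zeta>), N)" and \<epsilon>: "\<epsilon> \<in> hopf_auto k H" "\<zeta> \<in> hopf_auto k H"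
    using V by (rule ob_cases)
  note [simp] = \<alpha> \<gamma> \<epsilon> auto_rules[OF \<alpha>(1)] auto_rules[OF \<alpha>(2)] auto_rules[OF \<gamma>(1)] auto_rules[OF
    \<gamma>(2)]
    auto_rules[OF A_closed(2)[OF \<alpha>(2)]] auto_rules[OF A_closed(2)[OF \<alpha>(1)]]
    auto_rules[OF A_closed(2)[OF \<gamma>(1)]] auto_rules[OF A_closed(2)[OF \<gamma>(2)]]
  \<comment> \<open>The word to check is \<open>\<theta> b' \<eta>'\<close> with \<open>\<theta> =
    \<gamma>\<^sup>-\<^sup>1\<beta>\<gamma>\<alpha>\<^sup>-\<^sup>1\<close>, \<open>b' =
    \<alpha>\<gamma>\<^sup>-\<^sup>1\<beta>\<^sup>-\<^sup>1\<gamma>\<delta>\<^sup>-\<^sup>1\<beta>\<alpha>\<^sup>-\<^sup>1\<close>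
    and \<open>\<eta>' = \<alpha>\<beta>\<^sup>-\<^sup>1\<close>; it collapses to
    \<open>\<delta>\<^sup>-\<^sup>1\<close>.\<close>
  have key: "vbraid (inv\<^bsub>A\<^esub> (snd (fst (yd_conj_ob k H b U)))) (snd (yd_conj_ob k H b U)) (snd
    (yd_conj_ob k H b V))
      = vbraid (inv\<^bsub>A\<^esub> (snd (fst U))) (snd U) (snd V)"
    using ob_rules[OF U] ob_rules[OF V]
    by (simp add: UM VN ab yd_conj_ob_eq, intro vbraid_twist) (simp_all add: A.inv_mult_group)
  \<comment> \<open>The two codomains agree because conjugating by the index \<open>a\<close> of
    \<open>U\<close> and then by \<open>b\<close> is the same as conjugating by \<open>b\<close> and
    then by \<open>b a b\<^sup>-\<^sup>1\<close>.\<close>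
  have "yd_conj_ob k H b (yd_conj_ob k H (fst U) V) = yd_conj_ob k H (fst (yd_conj_ob k H b U))
    (yd_conj_ob k H b V)"
    using b U V fst_Ob[OF U] by (simp add: fst_conj conj_mult[symmetric] G.m_assoc del: G_simps
      G_inv)
  then show "snd (yd_conj k H b) (yd_braiding k H U V) = yd_braiding k H (fst (yd_conj k H b) U)
    (fst (yd_conj k H b) V)"
    using vbraid_Hom[OF U V] b U V bU fst_Ob[OF U] key
    by (simp add: yd_braiding_eq Hom_iff conj_tensor conj_Ob del: G_simps G_inv)
qed

end

theorem theorem3p5:
  fixes k :: "('k, 'x) ring_scheme" and H :: "('k, 'h, 'y) hopf_scheme"
  assumes "field k"
    and "hopf_algebra k H"
    and "bij_betw (antipode H) (carrier H) (carrier H)"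
  shows "braided_T_category (yd_group k H)
    (YD k H :: (('k, 'h, 'a) yd_ob, ('k, 'h, 'a) yd_arr) moncat)
    (yd_component k H) (yd_conj k H) (yd_braiding k H)"
proof -
  interpret hopf_algebra_bij k H
    using assms by (intro hopf_algebra_bij.intro hopf_algebra_bij_axioms.intro)
  show ?thesis by (rule braided_T_category_YD)
qed

end
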